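(* Let $(M,\omega_g)$ be a compact connected Hermitian manifold of complex dimension $n\ge 2$ and let $\omega_E$ be the $n$-conformal extremal metric (unique up to scaling) in the conformal class $\{e^f\omega_g: f\in C^\infty(M,\mathbb R)\}$ of $\omega_g$. (1) If $\omega_E$ is Gauduchon, then $\omega_E$ has constant Chern scalar curvature. (2) If $\omega_E$ has constant nonzero Chern scalar curvature, then $\omega_E$ is Gauduchon.
   Context: For a Hermitian metric $\omega=\sqrt{-1}\,g_{i\bar j}\,dz^i\wedge d\bar z^j$ on a complex manifold $M$ of dimension $n$, the Chern scalar curvature is $s=g^{i\bar j}g^{k\bar\ell}\Theta_{i\bar jk\bar\ell}$, where $\Theta$ is the curvature tensor of the Chern connection; equivalently $s=\mathrm{tr}_{\omega}\left(-\sqrt{-1}\,\partial\bar\partial\log\det(g_{i\bar j})\right)$. The metric $\omega$ is Gauduchon if $\partial\bar\partial\omega^{n-1}=0$. The $n$-Calabi functional is $C_n(\omega)=\int_M|s|^n\frac{\omega^n}{n!}$. The metric $\omega$ is called $n$-conformal extremal if $\left.\frac{d}{dt}\right|_{t=0}C_n(e^{tf}\omega)=0$ for every $f\in C^\infty(M,\mathbb R)$; equivalently, $\square^*(s|s|^{n-2})=0$ in the sense of distributions, where $\square f=\mathrm{tr}_{\omega}(\sqrt{-1}\,\partial\bar\partial f)$ and $\square^*$ is its formal adjoint with respect to the $L^2$ inner product defined by $\omega^n/n!$. On a compact connected Hermitian manifold of complex dimension $n\geq 2$ such a metric exists in every conformal class and is unique up to scaling. *)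

theory Defs
  imports "HOL-Analysis.Analysis"
begin

section \<open>Differential calculus on open subsets of complex coordinate space\<close>

primrec Ck_on :: "nat \<Rightarrow> 'v::real_normed_vector set \<Rightarrow> ('v \<Rightarrow> 'w::real_normed_vector) \<Rightarrow> bool" where
  "Ck_on 0 S f \<longleftrightarrow> continuous_on S f"
| "Ck_on (Suc k) S f \<longleftrightarrow> (\<forall>x\<in>S. f differentiable (at x)) \<and>
     (\<forall>v. Ck_on k S (\<lambda>x. frechet_derivative f (at x) v))"

text \<open>All sets \<open>S\<close> below on which smoothness or holomorphy is considered are open.\<close>

definition smooth_on :: "'v::real_normed_vector set \<Rightarrow> ('v \<Rightarrow> 'w::real_normed_vector) \<Rightarrow> bool" where
  "smooth_on S f \<longleftrightarrow> (\<forall>k. Ck_on k S f)"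

definition holomorphic_map_on :: "(complex^'n) set \<Rightarrow> (complex^'n \<Rightarrow> complex^'m) \<Rightarrow> bool" where
  "holomorphic_map_on S f \<longleftrightarrow>
     (\<forall>z\<in>S. \<exists>D. (f has_derivative D) (at z) \<and> (\<forall>c v. D (c *s v) = c *s D v))"

text \<open>
  The \<open>(1,0)\<close> and \<open>(0,1)\<close> parts of the differential of \<open>h\<close>, applied to the real tangent vector \<open>u\<close>:
  \<open>\<partial>h(u) = \<Sum>\<^sub>i u\<^sub>i \<partial>h/\<partial>z\<^sup>i\<close> and the conjugate expression for the second one.  On the coordinate
  vector \<open>axis i 1\<close> they are the Wirtinger derivatives of \<open>h\<close>.
\<close>

definition del_fun :: "(complex^'n \<Rightarrow> complex) \<Rightarrow> complex^'n \<Rightarrow> complex^'n \<Rightarrow> complex" where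
  "del_fun h z u =
     (frechet_derivative h (at z) u - \<i> * frechet_derivative h (at z) (\<i> *s u)) / 2"

definition delbar_fun :: "(complex^'n \<Rightarrow> complex) \<Rightarrow> complex^'n \<Rightarrow> complex^'n \<Rightarrow> complex" where
  "delbar_fun h z u =
     (frechet_derivative h (at z) u + \<i> * frechet_derivative h (at z) (\<i> *s u)) / 2"

definition wirtinger :: "'n::finite \<Rightarrow> (complex^'n \<Rightarrow> complex) \<Rightarrow> complex^'n \<Rightarrow> complex" where
  "wirtinger i h z = del_fun h z (axis i 1)"

definition wirtinger_bar :: "'n::finite \<Rightarrow> (complex^'n \<Rightarrow> complex) \<Rightarrow> complex^'n \<Rightarrow> complex" where
  "wirtinger_bar i h z = delbar_fun h z (axis i 1)"

section \<open>Complex differential forms in coordinates\<close>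

text \<open>
  A \<open>k\<close>-form assigns to a point and to a sequence \<open>v\<close> of real tangent vectors a complex number that
  depends on \<open>v 0, \<dots>, v (k - 1)\<close> only and is alternating and real-multilinear in these.
  The degrees are passed as explicit arguments.
\<close>

type_synonym 'n form = "complex^'n \<Rightarrow> (nat \<Rightarrow> complex^'n) \<Rightarrow> complex"

definition wedge :: "nat \<Rightarrow> nat \<Rightarrow> 'n::finite form \<Rightarrow> 'n form \<Rightarrow> 'n form" where
  "wedge p q \<alpha> \<beta> = (\<lambda>z v.
     (\<Sum>\<sigma> | \<sigma> permutes {..<p + q}.
        of_int (sign \<sigma>) * \<alpha> z (\<lambda>i. v (\<sigma> i)) * \<beta> z (\<lambda>i. v (\<sigma> (p + i))))
     / (fact p * fact q))"

text \<open>The \<open>k\<close>-th exterior power of a \<open>2\<close>-form.\<close>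

primrec form_power :: "'n::finite form \<Rightarrow> nat \<Rightarrow> 'n form" where
  "form_power \<omega> 0 = (\<lambda>z v. 1)"
| "form_power \<omega> (Suc k) = wedge 2 (2 * k) \<omega> (form_power \<omega> k)"

definition dz :: "'n::finite \<Rightarrow> 'n form" where
  "dz i = (\<lambda>z v. v 0 $ i)"

definition dzbar :: "'n::finite \<Rightarrow> 'n form" where
  "dzbar i = (\<lambda>z v. cnj (v 0 $ i))"

definition omit :: "nat \<Rightarrow> (nat \<Rightarrow> 'v) \<Rightarrow> nat \<Rightarrow> 'v" where
  "omit i v = (\<lambda>j. if j < i then v j else v (Suc j))"

text \<open>
  The operators \<open>\<partial>\<close> and \<open>\<partial>\<close>-bar on \<open>k\<close>-forms: \<open>\<partial>\<alpha> = \<Sum>\<^sub>i dz\<^sup>i \<and> \<partial>\<alpha>/\<partial>z\<^sup>i\<close>, where the coefficients of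
  \<open>\<alpha>\<close> are differentiated, evaluated on \<open>k + 1\<close> vectors (considered as constant vector fields).
\<close>

definition del_form :: "nat \<Rightarrow> 'n::finite form \<Rightarrow> 'n form" where
  "del_form k \<alpha> = (\<lambda>z v. \<Sum>i\<le>k. (- 1) ^ i * del_fun (\<lambda>w. \<alpha> w (omit i v)) z (v i))"

definition delbar_form :: "nat \<Rightarrow> 'n::finite form \<Rightarrow> 'n form" where
  "delbar_form k \<alpha> = (\<lambda>z v. \<Sum>i\<le>k. (- 1) ^ i * delbar_fun (\<lambda>w. \<alpha> w (omit i v)) z (v i))"

text \<open>
  The positively oriented real frame \<open>\<partial>/\<partial>x\<^sup>1, \<partial>/\<partial>y\<^sup>1, \<dots>, \<partial>/\<partial>x\<^sup>n, \<partial>/\<partial>y\<^sup>n\<close>.  The index type is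
  enumerated in an arbitrary way; reordering the pairs does not affect the orientation.
\<close>

definition real_frame :: "nat \<Rightarrow> complex^'n::finite" where
  "real_frame k =
     (let e = (SOME e :: nat \<Rightarrow> 'n. bij_betw e {..<CARD('n)} UNIV)
      in axis (e (k div 2)) (if even k then 1 else \<i>))"

section \<open>Complex manifolds and Hermitian metrics\<close>

text \<open>
  A chart is a pair of its domain and its coordinate map.  The manifold is the whole type \<open>'a\<close>, and
  its complex dimension is \<open>CARD('n)\<close>.  Atlases need not be maximal.
\<close>

type_synonym ('a, 'n) chart = "'a set \<times> ('a \<Rightarrow> complex^'n)"

definition inv_chart :: "('a, 'n::finite) chart \<Rightarrow> complex^'n \<Rightarrow> 'a" where
  "inv_chart c = the_inv_into (fst c) (snd c)"

definition chart_image :: "('a, 'n::finite) chart \<Rightarrow> (complex^'n) set" where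
  "chart_image c = snd c ` fst c"

definition transition :: "('a, 'n::finite) chart \<Rightarrow> ('a, 'n) chart \<Rightarrow> complex^'n \<Rightarrow> complex^'n" where
  "transition c c' = snd c' \<circ> inv_chart c"

definition complex_atlas :: "('a::topological_space, 'n::finite) chart set \<Rightarrow> bool" where
  "complex_atlas \<A> \<longleftrightarrow>
     (\<Union>c\<in>\<A>. fst c) = UNIV \<and>
     (\<forall>c\<in>\<A>. open (fst c) \<and> open (chart_image c) \<and>
        homeomorphism (fst c) (chart_image c) (snd c) (inv_chart c)) \<and>
     (\<forall>c\<in>\<A>. \<forall>c'\<in>\<A>. holomorphic_map_on (snd c ` (fst c \<inter> fst c')) (transition c c'))"

definition smooth_function :: "('a::topological_space, 'n::finite) chart set \<Rightarrow> ('a \<Rightarrow> real) \<Rightarrow> bool" where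
  "smooth_function \<A> f \<longleftrightarrow> (\<forall>c\<in>\<A>. smooth_on (chart_image c) (f \<circ> inv_chart c))"

text \<open>
  A Hermitian metric is given by its components: \<open>g c z $ i $ j\<close> is the component with holomorphic
  index \<open>i\<close> and antiholomorphic index \<open>j\<close> in the chart \<open>c\<close> at the coordinate point \<open>z\<close>.
  On overlaps of charts the components satisfy the transformation law of a tensor.
  Only the values for \<open>c\<close> in the atlas and \<open>z \<in> chart_image c\<close> are relevant.
\<close>

type_synonym ('a, 'n) metric_components = "('a, 'n) chart \<Rightarrow> complex^'n \<Rightarrow> complex^'n^'n"

definition hermitian_metric ::
    "('a::topological_space, 'n::finite) chart set \<Rightarrow> ('a, 'n) metric_components \<Rightarrow> bool" where
  "hermitian_metric \<A> g \<longleftrightarrow>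
     (\<forall>c\<in>\<A>. \<forall>i j. smooth_on (chart_image c) (\<lambda>z. g c z $ i $ j)) \<and>
     (\<forall>c\<in>\<A>. \<forall>z\<in>chart_image c. \<forall>i j. g c z $ j $ i = cnj (g c z $ i $ j)) \<and>
     (\<forall>c\<in>\<A>. \<forall>z\<in>chart_image c. \<forall>v. v \<noteq> 0 \<longrightarrow>
        0 < Re (\<Sum>i\<in>UNIV. \<Sum>j\<in>UNIV. g c z $ i $ j * v $ i * cnj (v $ j))) \<and>
     (\<forall>c\<in>\<A>. \<forall>c'\<in>\<A>. \<forall>z\<in>snd c ` (fst c \<inter> fst c'). \<forall>i j.
        g c z $ i $ j =
          (\<Sum>k\<in>UNIV. \<Sum>l\<in>UNIV. g c' (transition c c' z) $ k $ l *
             wirtinger i (\<lambda>w. transition c c' w $ k) z *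
             cnj (wirtinger j (\<lambda>w. transition c c' w $ l) z)))"

definition conformal_change ::
    "('a \<Rightarrow> real) \<Rightarrow> ('a, 'n::finite) metric_components \<Rightarrow> ('a, 'n) metric_components" where
  "conformal_change f g = (\<lambda>c z. exp (f (inv_chart c z)) *\<^sub>R g c z)"

definition conformal_class ::
    "('a::topological_space, 'n::finite) chart set \<Rightarrow> ('a, 'n) metric_components
      \<Rightarrow> ('a, 'n) metric_components set" where
  "conformal_class \<A> g = {conformal_change f g | f. smooth_function \<A> f}"

definition fundamental_form :: "(complex^'n \<Rightarrow> complex^'n^'n) \<Rightarrow> 'n::finite form" where
  "fundamental_form h = (\<lambda>z v. \<i> * (\<Sum>i\<in>UNIV. \<Sum>j\<in>UNIV. h z $ i $ j * wedge 1 1 (dz i) (dzbar j) z v))"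

definition gauduchon ::
    "('a::topological_space, 'n::finite) chart set \<Rightarrow> ('a, 'n) metric_components \<Rightarrow> bool" where
  "gauduchon \<A> g \<longleftrightarrow>
     (\<forall>c\<in>\<A>. \<forall>z\<in>chart_image c. \<forall>v.
        del_form (2 * CARD('n) - 1) (delbar_form (2 * CARD('n) - 2)
          (form_power (fundamental_form (g c)) (CARD('n) - 1))) z v = 0)"

section \<open>Chern curvature\<close>

text \<open>
  \<open>inverse_metric h z i j\<close> has holomorphic index \<open>i\<close> and antiholomorphic index \<open>j\<close>; it satisfies
  \<open>\<Sum>\<^sub>j inverse_metric h z i j * h z $ k $ j = \<delta>\<^sub>i\<^sub>k\<close>, whence the transposition.
\<close>

definition inverse_metric :: "(complex^'n \<Rightarrow> complex^'n^'n) \<Rightarrow> complex^'n \<Rightarrow> 'n::finite \<Rightarrow> 'n \<Rightarrow> complex" where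
  "inverse_metric h z i j = matrix_inv (h z) $ j $ i"

text \<open>
  The Chern connection is the connection whose \<open>(0,1)\<close>-part is the \<open>\<partial>\<close>-bar operator and which is
  compatible with the metric, i.e. \<open>\<partial>\<^sub>i h\<^sub>k\<^sub>q = \<Sum>\<^sub>p \<Gamma>\<^sup>p\<^sub>i\<^sub>k h\<^sub>p\<^sub>q\<close> in the holomorphic coordinate frame
  (the index \<open>q\<close> being antiholomorphic).  \<open>chern_connection h p i k\<close> is \<open>\<Gamma>\<^sup>p\<^sub>i\<^sub>k\<close>.
\<close>

definition chern_connection ::
    "(complex^'n \<Rightarrow> complex^'n^'n) \<Rightarrow> 'n::finite \<Rightarrow> 'n \<Rightarrow> 'n \<Rightarrow> complex^'n \<Rightarrow> complex" where
  "chern_connection h p i k z =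
     (\<Sum>q\<in>UNIV. inverse_metric h z p q * wirtinger i (\<lambda>w. h w $ k $ q) z)"

text \<open>The component with holomorphic indices \<open>i\<close>, \<open>k\<close> and antiholomorphic indices \<open>j\<close>, \<open>l\<close>.\<close>

definition chern_curvature ::
    "(complex^'n \<Rightarrow> complex^'n^'n) \<Rightarrow> complex^'n \<Rightarrow> 'n::finite \<Rightarrow> 'n \<Rightarrow> 'n \<Rightarrow> 'n \<Rightarrow> complex" where
  "chern_curvature h z i j k l =
     - (\<Sum>p\<in>UNIV. wirtinger_bar j (chern_connection h p i k) z * h z $ p $ l)"

definition local_chern_scalar :: "(complex^'n::finite \<Rightarrow> complex^'n^'n) \<Rightarrow> complex^'n \<Rightarrow> complex" where
  "local_chern_scalar h z =
     (\<Sum>i\<in>UNIV. \<Sum>j\<in>UNIV. \<Sum>k\<in>UNIV. \<Sum>l\<in>UNIV.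
        inverse_metric h z i j * inverse_metric h z k l * chern_curvature h z i j k l)"

text \<open>
  The Chern scalar curvature as a function on the manifold, computed in any chart around the point.
  It is complex-valued here; for a Hermitian metric the values are real.
\<close>

definition chern_scalar ::
    "('a::topological_space, 'n::finite) chart set \<Rightarrow> ('a, 'n) metric_components \<Rightarrow> 'a \<Rightarrow> complex" where
  "chern_scalar \<A> g x =
     (let c = (SOME c. c \<in> \<A> \<and> x \<in> fst c) in local_chern_scalar (g c) (snd c x))"

section \<open>The volume measure and the Calabi functional\<close>

text \<open>The density of \<open>\<omega>\<^sup>n / n!\<close> with respect to \<open>dx\<^sup>1 \<and> dy\<^sup>1 \<and> \<dots> \<and> dx\<^sup>n \<and> dy\<^sup>n\<close>.\<close>

definition volume_density :: "(complex^'n::finite \<Rightarrow> complex^'n^'n) \<Rightarrow> complex^'n \<Rightarrow> real" where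
  "volume_density h z =
     Re (form_power (fundamental_form h) (CARD('n)) z real_frame) / fact CARD('n)"

text \<open>
  The Borel measure on the manifold induced by \<open>\<omega>\<^sup>n / n!\<close>; it is uniquely determined by its values on
  the Borel subsets of chart domains when the manifold is compact.
\<close>

definition volume_measure ::
    "('a::topological_space, 'n::finite) chart set \<Rightarrow> ('a, 'n) metric_components \<Rightarrow> 'a measure" where
  "volume_measure \<A> g =
     (THE \<mu>. sets \<mu> = sets borel \<and>
        (\<forall>c\<in>\<A>. \<forall>B\<in>sets borel. B \<subseteq> fst c \<longrightarrow>
           emeasure \<mu> B = (\<integral>\<^sup>+ z\<in>snd c ` B. ennreal (volume_density (g c) z) \<partial>lborel)))"

definition calabi_functional ::
    "('a::topological_space, 'n::finite) chart set \<Rightarrow> ('a, 'n) metric_components \<Rightarrow> real" where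
  "calabi_functional \<A> g =
     (LINT x|volume_measure \<A> g. norm (chern_scalar \<A> g x) ^ CARD('n))"

definition n_conformal_extremal ::
    "('a::topological_space, 'n::finite) chart set \<Rightarrow> ('a, 'n) metric_components \<Rightarrow> bool" where
  "n_conformal_extremal \<A> g \<longleftrightarrow>
     (\<forall>f. smooth_function \<A> f \<longrightarrow>
        ((\<lambda>t. calabi_functional \<A> (conformal_change (\<lambda>x. t * f x) g))
           has_real_derivative 0) (at 0))"

end

theory Submission
  imports Defs "HOL-Complex_Analysis.Cauchy_Integral_Formula"
begin

text \<open>
  Write \<open>\<box>u = \<Sum>\<^sub>k\<^sub>l h\<^sup>k\<^sup>l \<partial>\<^sub>k\<partial>\<^sub>l u\<close> (the second derivative being conjugate) and \<open>d\<mu> = \<omega>\<^sup>n / n!\<close>.  Since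
  \<open>s = - \<box> log det h\<close>, the metric \<open>exp f \<cdot> \<omega>\<close> has scalar curvature \<open>exp (- f) (s - n \<box>f)\<close> and volume
  \<open>exp (n f) d\<mu>\<close>, so the functional at \<open>exp (t f) \<cdot> \<omega>\<close> is \<open>\<integral> \<bar>s - n t \<box>f\<bar>\<^sup>n d\<mu>\<close>, and \<open>\<omega>\<close> is extremal iff
  \<open>\<integral> s \<bar>s\<bar>\<^sup>n\<^sup>-\<^sup>2 \<box>f d\<mu> = 0\<close> for all \<open>f\<close>.  In coordinates \<open>\<partial>\<partial>\<close>-bar of \<open>\<omega>\<^sup>n\<^sup>-\<^sup>1\<close> is a nonzero multiple of
  \<open>\<Sum>\<^sub>k\<^sub>l \<partial>\<^sub>k\<partial>\<^sub>l (det h \<cdot> h\<^sup>k\<^sup>l)\<close>, so integrating by parts twice shows that \<open>\<omega>\<close> is Gauduchon iff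
  \<open>\<integral> \<box>f d\<mu> = 0\<close> for all \<open>f\<close>; one direction tests against bump functions, the other decomposes by a
  partition of unity.  For constant \<open>s \<noteq> 0\<close> extremality is therefore the Gauduchon condition.
  Conversely, if \<open>\<omega>\<close> is Gauduchon and extremal, integrating
  \<open>\<box>\<bar>s\<bar>\<^sup>n = n s \<bar>s\<bar>\<^sup>n\<^sup>-\<^sup>2 \<box>s + n (n - 1) \<bar>s\<bar>\<^sup>n\<^sup>-\<^sup>2 \<bar>\<partial>s\<bar>\<^sup>2\<close> makes the last, nonnegative term vanish
  identically, so \<open>\<bar>s\<bar>\<^sup>n\<close>, hence \<open>\<bar>s\<bar>\<close>, hence \<open>s\<close> is constant.
\<close>

section \<open>Alternating sums\<close>

text \<open>Two questions of regularity shape the proof. Extremality offers only smooth test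
  functions, so the extremal equation is tested on s itself, which is smooth. The vanishing of the
  integral of \<box>u, on the other hand, is applied to u = \<bar>s\<bar>^n, which for odd n is in
  general only C^(n-1) across the zeros of s, hence only C^2 when n = 3; the facts about the
  Laplacian are therefore stated for C^2 functions. Secondly, charts are required to change by maps
  with a complex linear derivative at each point and nothing more. Their smoothness is derived from
  Cauchy's formula on complex lines, and it makes \<box>, s and the volume independent of the chart.
  The exponent is written n = m + 2, so that s \<bar>s\<bar>^(n-2) becomes s \<bar>s\<bar>^m, with
  \<bar>0\<bar>^0 = 1 when n = 2. The power in the functional equals the dimension: this is what
  makes the conformal factors of curvature and volume cancel, leaving \<box>f as the only trace of
  f.\<close>

definition alt_sum :: "nat \<Rightarrow> ((nat \<Rightarrow> 'v) \<Rightarrow> complex) \<Rightarrow> (nat \<Rightarrow> 'v) \<Rightarrow> complex" where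
  "alt_sum k B v = (\<Sum>\<sigma> | \<sigma> permutes {..<k}. of_int (sign \<sigma>) * B (\<lambda>i. v (\<sigma> i)))"

lemma alt_sum_cong: "(\<And>u. B u = C u) \<Longrightarrow> alt_sum k B v = alt_sum k C v"
  by (simp add: alt_sum_def)

lemma alt_sum_sum: "alt_sum k (\<lambda>u. \<Sum>i\<in>I. B i u) v = (\<Sum>i\<in>I. alt_sum k (B i) v)"
  unfolding alt_sum_def by (subst sum.swap) (simp add: sum_distrib_left)

lemma alt_sum_cmult: "alt_sum k (\<lambda>u. c * B u) v = c * alt_sum k B v"
  by (simp add: alt_sum_def sum_distrib_left algebra_simps)

lemma permutation_lessThan: "\<sigma> permutes {..<k::nat} \<Longrightarrow> permutation \<sigma>"
  using permutation_permutes by blast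

text \<open>A permutation of the last q of p + q slots that leaves the first p alone. It is the
  substitution used to regroup iterated alternating sums.\<close>

lemma shift_permutation:
  fixes p :: nat
  assumes "\<pi> permutes {..<q}"
  defines "\<rho> \<equiv> map_permutation {..<q} ((+) p) \<pi>"
  shows "\<rho> permutes {..<p + q}" "sign \<rho> = sign \<pi>" "\<rho> (p + i) = p + \<pi> i" "i < p \<Longrightarrow> \<rho> i = i"
proof -
  have inj: "inj_on ((+) p) {..<q}" by simp
  have 1: "\<rho> permutes ((+) p ` {..<q})"
    unfolding \<rho>_def by (rule map_permutation_permutes[OF _ assms(1)]) (simp add: bij_betw_def)
  then show "\<rho> permutes {..<p + q}"
    by (rule permutes_subset) auto
  show "sign \<rho> = sign \<pi>"
    unfolding \<rho>_def by (rule sign_map_permutation[OF inj assms(1)]) simp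
  show "\<rho> (p + i) = p + \<pi> i"
  proof (cases "i < q")
    case True
    then show ?thesis using map_permutation_apply[OF inj, of i \<pi>] by (simp add: \<rho>_def)
  next
    case False
    then have "\<pi> i = i" using assms(1) by (simp add: permutes_not_in)
    moreover have "p + i \<notin> (+) p ` {..<q}" using False by auto
    ultimately show ?thesis using 1 by (simp add: permutes_not_in)
  qed
  show "\<rho> i = i" if "i < p"
    by (rule permutes_not_in[OF 1]) (use that in auto)
qed

text \<open>For an inner permutation \<pi>, let \<rho> be its shift to the last q slots.
  Substituting \<sigma> \<circ> \<rho> for \<sigma> does not affect A and produces exactly the
  summand of \<pi>, sign included. The q! inner permutations thus contribute equal sums; this factor
  cancels the \<open>fact q\<close> in \<open>wedge\<close>.\<close>

lemma alt_sum_absorb: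
  assumes loc: "\<And>u w. (\<And>i. i < p \<Longrightarrow> u i = w i) \<Longrightarrow> A u = A w"
  shows "(\<Sum>\<sigma> | \<sigma> permutes {..<p + q}. of_int (sign \<sigma>) * A (\<lambda>i. v (\<sigma> i)) * alt_sum q B (\<lambda>i. v (\<sigma> (p + i))))
    = fact q * alt_sum (p + q) (\<lambda>u. A u * B (\<lambda>i. u (p + i))) v"
proof -
  let ?P = "{\<sigma>. \<sigma> permutes {..<p + q}}"
  let ?f = "\<lambda>\<sigma>. of_int (sign \<sigma>) * (A (\<lambda>i. v (\<sigma> i)) * B (\<lambda>i. v (\<sigma> (p + i))))"
  have "(\<Sum>\<sigma>\<in>?P. of_int (sign \<sigma>) * A (\<lambda>i. v (\<sigma> i)) * (of_int (sign \<pi>) * B (\<lambda>i. v (\<sigma> (p + \<pi> i)))))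
      = sum ?f ?P" if \<pi>: "\<pi> permutes {..<q}" for \<pi>
  proof -
    define \<rho> where "\<rho> = map_permutation {..<q} ((+) p) \<pi>"
    note r = shift_permutation[OF \<pi>, where p = p, folded \<rho>_def]
    have "sum ?f ?P = (\<Sum>\<sigma>\<in>?P. ?f (\<sigma> \<circ> \<rho>))"
      by (rule sum_permutations_compose_right[OF r(1)])
    also have "\<dots> = (\<Sum>\<sigma>\<in>?P. of_int (sign \<sigma>) * A (\<lambda>i. v (\<sigma> i)) * (of_int (sign \<pi>) * B (\<lambda>i. v (\<sigma> (p + \<pi> i)))))"
    proof (rule sum.cong[OF refl])
      fix \<sigma> assume "\<sigma> \<in> ?P"
      then have s: "sign (\<sigma> \<circ> \<rho>) = sign \<sigma> * sign \<pi>"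
        using r(1,2) by (simp add: sign_compose permutation_lessThan)
      have "A (\<lambda>i. v ((\<sigma> \<circ> \<rho>) i)) = A (\<lambda>i. v (\<sigma> i))"
        by (rule loc) (simp add: r(4))
      then show "?f (\<sigma> \<circ> \<rho>) = of_int (sign \<sigma>) * A (\<lambda>i. v (\<sigma> i)) * (of_int (sign \<pi>) * B (\<lambda>i. v (\<sigma> (p + \<pi> i))))"
        by (simp add: s r(3))
    qed
    finally show ?thesis ..
  qed
  note key = this
  have "(\<Sum>\<pi> | \<pi> permutes {..<q}. \<Sum>\<sigma>\<in>?P. of_int (sign \<sigma>) * A (\<lambda>i. v (\<sigma> i)) * (of_int (sign \<pi>) * B (\<lambda>i. v (\<sigma> (p + \<pi> i)))))
      = (\<Sum>\<pi> | \<pi> permutes {..<q}. sum ?f ?P)"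
    by (rule sum.cong[OF refl], rule key) simp
  also have "\<dots> = fact q * sum ?f ?P"
    by (simp add: card_permutations)
  finally show ?thesis
    unfolding alt_sum_def by (subst (asm) sum.swap) (simp add: sum_distrib_left)
qed

text \<open>The cycle (0 i i-1 ... 1). These cycles represent the cosets of the permutations that
  fix 0: the entry i is placed in front and the remaining entries keep their order, as in
  \<open>omit\<close>.\<close>

definition cycle_to :: "nat \<Rightarrow> nat \<Rightarrow> nat" where
  "cycle_to i j = (if j = 0 then i else if j \<le> i then j - 1 else j)"

lemma cycle_to_Suc: "cycle_to (Suc i) = Transposition.transpose i (Suc i) \<circ> cycle_to i"
  by (auto simp: cycle_to_def fun_eq_iff Transposition.transpose_def)

lemma cycle_to_permutes: "i \<le> k \<Longrightarrow> cycle_to i permutes {..<Suc k} \<and> sign (cycle_to i) = (-1) ^ i"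
proof (induction i)
  case 0
  have "cycle_to 0 = id" by (auto simp: cycle_to_def fun_eq_iff)
  then show ?case by (metis permutes_id power_0 sign_id)
next
  case (Suc i)
  then have "cycle_to i permutes {..<Suc k}" "sign (cycle_to i) = (-1) ^ i" by auto
  moreover have "Transposition.transpose i (Suc i) permutes {..<Suc k}"
    using Suc.prems by (intro permutes_swap_id) auto
  ultimately show ?case
    unfolding cycle_to_Suc
    by (subst sign_compose) (auto intro: permutes_compose permutation_lessThan simp: sign_swap_id)
qed

text \<open>Every permutation \<tau> of k + 1 slots is uniquely the cycle with i = \<tau> 0 composed
  with a permutation of the slots 1, ..., k; existence follows from uniqueness by counting. The sign
  is (-1)^i times that of the second factor. This is the analogue of expanding a determinant along
  its first row and matches the formula that defines \<open>del_form\<close> and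
  \<open>delbar_form\<close>.\<close>

lemma alt_sum_Suc:
  "(\<Sum>i\<le>k. (-1) ^ i * alt_sum k (B (v i)) (omit i v)) = alt_sum (Suc k) (\<lambda>u. B (u 0) (\<lambda>i. u (Suc i))) v"
proof -
  let ?D = "{..k} \<times> {\<pi>. \<pi> permutes {..<k}}"
  let ?E = "{\<tau>. \<tau> permutes {..<Suc k}}"
  define F where "F = (\<lambda>(i, \<pi>). cycle_to i \<circ> map_permutation {..<k} ((+) 1) \<pi>)"
  have F0: "F (i, \<pi>) 0 = i" and FS: "F (i, \<pi>) (Suc j) = (if \<pi> j < i then \<pi> j else Suc (\<pi> j))"
    and FP: "i \<le> k \<Longrightarrow> F (i, \<pi>) \<in> ?E" and Fs: "i \<le> k \<Longrightarrow> sign (F (i, \<pi>)) = (-1) ^ i * sign \<pi>"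
    if "\<pi> permutes {..<k}" for i \<pi> j
  proof -
    note r = shift_permutation[OF that, where p = 1]
    show "F (i, \<pi>) 0 = i" using r(4)[of 0] by (simp add: F_def cycle_to_def del: One_nat_def)
    show "F (i, \<pi>) (Suc j) = (if \<pi> j < i then \<pi> j else Suc (\<pi> j))"
      using r(3)[of j] by (auto simp add: F_def cycle_to_def)
    assume "i \<le> k"
    note c = cycle_to_permutes[OF this, THEN conjunct1] cycle_to_permutes[OF this, THEN conjunct2]
    have r1: "map_permutation {..<k} ((+) 1) \<pi> permutes {..<Suc k}" using r(1) by simp
    show "F (i, \<pi>) \<in> ?E"
      using permutes_compose[OF r1 c(1)] by (simp add: F_def)
    show "sign (F (i, \<pi>)) = (-1) ^ i * sign \<pi>"
      using sign_compose[OF permutation_lessThan[OF c(1)] permutation_lessThan[OF r1]] c(2) r(2)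
      by (simp add: F_def)
  qed
  have inj: "inj_on F ?D"
  proof (rule inj_onI)
    fix x y assume x: "x \<in> ?D" and y: "y \<in> ?D" and eq: "F x = F y"
    obtain i \<pi> where xx: "x = (i, \<pi>)" "\<pi> permutes {..<k}" using x by auto
    obtain i' \<pi>' where yy: "y = (i', \<pi>')" "\<pi>' permutes {..<k}" using y by auto
    have "i = i'" using F0[OF xx(2)] F0[OF yy(2)] eq xx(1) yy(1) by metis
    moreover have "\<pi> j = \<pi>' j" for j
      using FS[OF xx(2), of i j] FS[OF yy(2), of i' j] eq xx(1) yy(1) \<open>i = i'\<close>
      by (auto split: if_splits)
    ultimately show "x = y" by (simp add: xx yy fun_eq_iff)
  qed
  have "F ` ?D \<subseteq> ?E" using FP by auto
  moreover have "card (F ` ?D) = card ?E"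
    by (simp add: card_image[OF inj] card_cartesian_product card_permutations)
  ultimately have img: "F ` ?D = ?E"
    by (intro card_subset_eq) (auto simp: finite_permutations)
  have "alt_sum (Suc k) (\<lambda>u. B (u 0) (\<lambda>i. u (Suc i))) v
      = (\<Sum>x\<in>?D. of_int (sign (F x)) * B (v (F x 0)) (\<lambda>j. v (F x (Suc j))))"
    unfolding alt_sum_def img[symmetric] by (subst sum.reindex[OF inj]) simp
  also have "\<dots> = (\<Sum>(i, \<pi>)\<in>?D. (-1) ^ i * (of_int (sign \<pi>) * B (v i) (\<lambda>j. omit i v (\<pi> j))))"
  proof -
    have "of_int (sign (F (i, \<pi>))) * B (v (F (i, \<pi>) 0)) (\<lambda>j. v (F (i, \<pi>) (Suc j)))
        = (-1) ^ i * (of_int (sign \<pi>) * B (v i) (\<lambda>j. omit i v (\<pi> j)))"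
      if "i \<le> k" and \<pi>: "\<pi> permutes {..<k}" for i \<pi>
    proof -
      have e: "(\<lambda>j. v (F (i, \<pi>) (Suc j))) = (\<lambda>j. omit i v (\<pi> j))"
        by (auto simp: FS[OF \<pi>] omit_def)
      show ?thesis
        using Fs[OF \<pi>, of i] F0[OF \<pi>, of i] \<open>i \<le> k\<close> by (simp add: e)
    qed
    then show ?thesis by (intro sum.cong) auto
  qed
  also have "\<dots> = (\<Sum>i\<le>k. (-1) ^ i * alt_sum k (B (v i)) (omit i v))"
    by (subst sum.cartesian_product[symmetric]) (simp add: alt_sum_def sum_distrib_left)
  finally show ?thesis by simp
qed

section \<open>Powers of the fundamental form\<close>

definition herm_form :: "complex^'n^'n \<Rightarrow> complex^'n \<Rightarrow> complex^'n::finite \<Rightarrow> complex" where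
  "herm_form h x y = (\<Sum>i\<in>UNIV. \<Sum>j\<in>UNIV. h $ i $ j * x $ i * cnj (y $ j))"

lemma permutes_lessThan_2: "{\<sigma>. \<sigma> permutes {..<2::nat}} = {id, Transposition.transpose 0 1}"
proof -
  have "{..<2::nat} = {0, 1}" by auto
  then show ?thesis by (simp add: permutes_doubleton_iff Collect_conv_if Collect_disj_eq insert_commute)
qed

lemma fundamental_form_eq:
  "fundamental_form h z v = \<i> * (herm_form (h z) (v 0) (v 1) - herm_form (h z) (v 1) (v 0))"
proof -
  have 1: "wedge 1 1 (dz i) (dzbar j) z v = v 0 $ i * cnj (v 1 $ j) - v 1 $ i * cnj (v 0 $ j)" for i j
  proof -
    have "(1::nat) + 1 = 2" by simp
    moreover have "id \<noteq> (Transposition.transpose 0 1 :: nat \<Rightarrow> nat)" by (metis id_apply transpose_apply_first zero_neq_one)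
    ultimately show ?thesis
      unfolding wedge_def dz_def dzbar_def by (simp only: permutes_lessThan_2) (simp add: sign_swap_id)
  qed
  show ?thesis
    unfolding fundamental_form_def herm_form_def 1
    by (simp add: algebra_simps sum_subtractf)
qed

text \<open>The factorials in \<open>wedge\<close> leave no constant behind: (2k)! is absorbed by
  merging the two alternations, and 2! by the two summands of the fundamental form, which differ by
  a sign and a swap of the first two arguments and so have the same alternating sum.\<close>

lemma form_power_eq_alt_sum:
  "form_power (fundamental_form h) k z v =
     alt_sum (2 * k) (\<lambda>u. \<Prod>m<k. \<i> * herm_form (h z) (u (2 * m)) (u (2 * m + 1))) v"
proof (induction k arbitrary: v)
  case 0
  then show ?case by (simp add: alt_sum_def)
next
  case (Suc k)
  let ?H = "\<lambda>x y. \<i> * herm_form (h z) x y"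
  let ?B = "\<lambda>u. \<Prod>m<k. ?H (u (2 * m)) (u (2 * m + 1))"
  let ?C = "\<lambda>u. ?B (\<lambda>i. u (2 + i))"
  have IH: "form_power (fundamental_form h) k z = alt_sum (2 * k) ?B"
    using Suc.IH by auto
  have "form_power (fundamental_form h) (Suc k) z v
     = (\<Sum>\<sigma> | \<sigma> permutes {..<2 + 2 * k}. of_int (sign \<sigma>) * fundamental_form h z (\<lambda>i. v (\<sigma> i)) *
         alt_sum (2 * k) ?B (\<lambda>i. v (\<sigma> (2 + i)))) / (fact 2 * fact (2 * k))"
    by (simp add: wedge_def IH)
  also have "\<dots> = alt_sum (2 + 2 * k) (\<lambda>u. fundamental_form h z u * ?C u) v / 2"
    by (subst alt_sum_absorb) (auto simp: fundamental_form_eq)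
  also have "\<dots> = alt_sum (2 + 2 * k) (\<lambda>u. ?H (u 0) (u 1) * ?C u) v"
  proof -
    let ?P = "{\<sigma>. \<sigma> permutes {..<2 + 2 * k}}"
    let ?t = "Transposition.transpose 0 1 :: nat \<Rightarrow> nat"
    let ?f = "\<lambda>\<sigma>. of_int (sign \<sigma>) * (?H (v (\<sigma> 1)) (v (\<sigma> 0)) * ?C (\<lambda>i. v (\<sigma> i)))"
    have t: "?t permutes {..<2 + 2 * k}" by (intro permutes_swap_id) auto
    have "sum ?f ?P = (\<Sum>\<sigma>\<in>?P. ?f (\<sigma> \<circ> ?t))"
      by (rule sum_permutations_compose_right[OF t])
    also have "\<dots> = - alt_sum (2 + 2 * k) (\<lambda>u. ?H (u 0) (u 1) * ?C u) v"
      unfolding alt_sum_def sum_negf[symmetric]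
    proof (rule sum.cong[OF refl])
      fix \<sigma> assume "\<sigma> \<in> ?P"
      then have "sign (\<sigma> \<circ> ?t) = - sign \<sigma>"
        using t by (simp add: sign_compose permutation_lessThan sign_swap_id)
      then show "?f (\<sigma> \<circ> ?t) = - (of_int (sign \<sigma>) * (?H (v (\<sigma> 0)) (v (\<sigma> 1)) * ?C (\<lambda>i. v (\<sigma> i))))"
        by (simp add: transpose_def)
    qed
    finally have eq: "sum ?f ?P = - alt_sum (2 + 2 * k) (\<lambda>u. ?H (u 0) (u 1) * ?C u) v" .
    have "alt_sum (2 + 2 * k) (\<lambda>u. fundamental_form h z u * ?C u) v
       = alt_sum (2 + 2 * k) (\<lambda>u. ?H (u 0) (u 1) * ?C u) v - sum ?f ?P"
      unfolding alt_sum_def sum_subtractf[symmetric]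
      by (intro sum.cong) (auto simp: fundamental_form_eq algebra_simps)
    then show ?thesis using eq by simp
  qed
  also have "\<dots> = alt_sum (2 * Suc k) (\<lambda>u. \<Prod>m<Suc k. ?H (u (2 * m)) (u (2 * m + 1))) v"
    unfolding prod.lessThan_Suc_shift by simp
  finally show ?case .
qed

section \<open>Determinants of block matrices\<close>

definition block_matrix :: "'a^'n^'n \<Rightarrow> 'a^'m^'n \<Rightarrow> 'a^'n^'m \<Rightarrow> 'a^'m^'m \<Rightarrow> 'a^('n::finite + 'm::finite)^('n + 'm)" where
  "block_matrix A B C D = (\<chi> i j. case i of
      Inl i' \<Rightarrow> (case j of Inl j' \<Rightarrow> A $ i' $ j' | Inr j' \<Rightarrow> B $ i' $ j')
    | Inr i' \<Rightarrow> (case j of Inl j' \<Rightarrow> C $ i' $ j' | Inr j' \<Rightarrow> D $ i' $ j'))"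

lemma block_matrix_nth [simp]:
  "block_matrix A B C D $ Inl i $ Inl j = A $ i $ j"
  "block_matrix A B C D $ Inl i $ Inr l = B $ i $ l"
  "block_matrix A B C D $ Inr k $ Inl j = C $ k $ j"
  "block_matrix A B C D $ Inr k $ Inr l = D $ k $ l"
  by (simp_all add: block_matrix_def)

lemma sum_UNIV_Plus:
  "(\<Sum>x\<in>UNIV. f x) = (\<Sum>i\<in>UNIV. f (Inl i)) + (\<Sum>j\<in>UNIV. f (Inr j))"
  for f :: "'n::finite + 'm::finite \<Rightarrow> 'a::comm_monoid_add"
  using sum.Plus[of "UNIV :: 'n set" "UNIV :: 'm set" f] by (simp add: o_def)

lemma prod_UNIV_Plus:
  "(\<Prod>x\<in>UNIV. f x) = (\<Prod>i\<in>UNIV. f (Inl i)) * (\<Prod>j\<in>UNIV. f (Inr j))"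
  for f :: "'n::finite + 'm::finite \<Rightarrow> 'a::comm_monoid_mult"
  using prod.Plus[of "UNIV :: 'n set" "UNIV :: 'm set" f] by (simp add: o_def)

lemma block_matrix_mult:
  "block_matrix A B C D ** block_matrix A' B' C' D' =
   block_matrix (A ** A' + B ** C') (A ** B' + B ** D') (C ** A' + D ** C') (C ** B' + D ** D')"
  by (simp add: vec_eq_iff matrix_matrix_mult_def sum_UNIV_Plus split_sum_all)

lemma permutation_UNIV: "p permutes (UNIV :: 'n::finite set) \<Longrightarrow> permutation p"
  unfolding permutation_permutes by (rule exI[of _ UNIV]) simp

text \<open>Each factor is extended by the identity on the other summand, where its sign is
  inherited along an injection; the permutation is the composite of the two extensions.\<close>

lemma map_sum_permutes:
  fixes p :: "'n::finite \<Rightarrow> 'n" and q :: "'m::finite \<Rightarrow> 'm"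
  assumes p: "p permutes UNIV" and q: "q permutes UNIV"
  shows "map_sum p q permutes UNIV" "sign (map_sum p q) = sign p * sign q"
proof -
  have l: "map_sum p (id :: 'm \<Rightarrow> 'm) = map_permutation UNIV Inl p"
  proof
    fix x :: "'n + 'm" show "map_sum p id x = map_permutation UNIV Inl p x"
      by (cases x) (auto simp: map_permutation_apply map_permutation_def restrict_id_def)
  qed
  have r: "map_sum (id :: 'n \<Rightarrow> 'n) q = map_permutation UNIV Inr q"
  proof
    fix x :: "'n + 'm" show "map_sum id q x = map_permutation UNIV Inr q x"
      by (cases x) (auto simp: map_permutation_apply map_permutation_def restrict_id_def)
  qed
  have lp: "map_sum p (id :: 'm \<Rightarrow> 'm) permutes UNIV"
    unfolding l by (rule permutes_subset[OF map_permutation_permutes[OF _ p, of _ "range Inl"]]) (auto simp: bij_betw_def)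
  have rp: "map_sum (id :: 'n \<Rightarrow> 'n) q permutes UNIV"
    unfolding r by (rule permutes_subset[OF map_permutation_permutes[OF _ q, of _ "range Inr"]]) (auto simp: bij_betw_def)
  have c: "map_sum p q = map_sum p id \<circ> map_sum id q"
    by (simp add: map_sum.comp)
  show "map_sum p q permutes UNIV"
    unfolding c by (rule permutes_compose[OF rp lp])
  have "sign (map_sum p (id :: 'm \<Rightarrow> 'm)) = sign p" "sign (map_sum (id :: 'n \<Rightarrow> 'n) q) = sign q"
    unfolding l r using sign_map_permutation[OF _ p, of Inl] sign_map_permutation[OF _ q, of Inr] by simp_all
  then show "sign (map_sum p q) = sign p * sign q"
    unfolding c by (simp add: sign_compose[OF permutation_UNIV[OF lp] permutation_UNIV[OF rp]])
qed

lemma permutes_UNIV_iff: "p permutes (UNIV :: 'n::finite set) \<longleftrightarrow> inj p"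
proof
  assume "inj p"
  then have "bij p" by (simp add: bij_def finite_UNIV_inj_surj)
  then show "p permutes UNIV" using bij_imp_permutes[of p UNIV] by simp
qed (rule permutes_inj)

lemma det_block_upper_triangular:
  fixes A :: "'a::comm_ring_1^'n^'n" and D :: "'a^'m^'m"
  shows "det (block_matrix A B 0 D) = det A * det D"
proof -
  let ?M = "block_matrix A B 0 D"
  let ?PQ = "{p :: 'n \<Rightarrow> 'n. p permutes UNIV} \<times> {q :: 'm \<Rightarrow> 'm. q permutes UNIV}"
  let ?f = "\<lambda>s. of_int (sign s) * (\<Prod>i\<in>UNIV. ?M $ i $ s i)"
  let ?S = "(\<lambda>(p, q). map_sum p q) ` ?PQ"
  have inj: "inj_on (\<lambda>(p, q). map_sum p q) ?PQ"
  proof (rule inj_onI, clarify)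
    fix p p' :: "'n \<Rightarrow> 'n" and q q' :: "'m \<Rightarrow> 'm"
    assume eq: "map_sum p q = map_sum p' q'"
    have "p i = p' i" for i using fun_cong[OF eq, of "Inl i"] by simp
    moreover have "q i = q' i" for i using fun_cong[OF eq, of "Inr i"] by simp
    ultimately show "p = p' \<and> q = q'" by auto
  qed
  \<comment> \<open>A summand without zero factor sends \<open>Inr\<close> indices to
    \<open>Inr\<close> indices. By finiteness it permutes them, which leaves only \<open>Inl\<close>
    indices as images of \<open>Inl\<close> indices, so the permutation splits.\<close>
  have "?f s = 0" if s: "s permutes UNIV" and nS: "s \<notin> ?S" for s
  proof (rule ccontr)
    assume "?f s \<noteq> 0"
    then have nz: "(\<Prod>i\<in>UNIV. ?M $ i $ s i) \<noteq> 0" by auto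
    have "?M $ i $ s i \<noteq> 0" for i
      using nz prod_zero[of UNIV "\<lambda>i. ?M $ i $ s i"] by auto
    then have "\<exists>k. s (Inr j) = Inr k" for j
      by (metis block_matrix_nth(3) old.sum.exhaust zero_index)
    then obtain q where q: "\<And>j. s (Inr j) = Inr (q j)" by metis
    have injs: "inj s" using s permutes_inj by blast
    then have iq: "inj q" by (metis injD injI q sum.inject(2))
    then have "surj q" by (simp add: finite_UNIV_inj_surj)
    have "\<exists>k. s (Inl j) = Inl k" for j
    proof (cases "s (Inl j)")
      case (Inr m)
      then obtain k where "m = q k" using \<open>surj q\<close> by auto
      then have "s (Inl j) = s (Inr k)" using Inr q by simp
      then show ?thesis using injs by (metis Inl_Inr_False injD)
    qed auto
    then obtain p where p: "\<And>j. s (Inl j) = Inl (p j)" by metis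
    have ip: "inj p" using injs by (metis injD injI p sum.inject(1))
    have "s = map_sum p q"
    proof
      fix x show "s x = map_sum p q x" by (cases x) (auto simp: p q)
    qed
    with ip iq nS show False by (auto simp: permutes_UNIV_iff)
  qed
  then have "det ?M = sum ?f ?S"
    unfolding det_def
    by (intro sum.mono_neutral_right) (auto simp: finite_permutations map_sum_permutes)
  also have "\<dots> = (\<Sum>(p, q)\<in>?PQ. (of_int (sign p) * (\<Prod>i\<in>UNIV. A $ i $ p i)) * (of_int (sign q) * (\<Prod>i\<in>UNIV. D $ i $ q i)))"
    by (subst sum.reindex[OF inj]) (auto intro!: sum.cong simp: map_sum_permutes prod_UNIV_Plus)
  also have "\<dots> = det A * det D"
    unfolding det_def sum_product by (simp add: sum.cartesian_product)
  finally show ?thesis .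
qed

lemma transpose_block_matrix:
  "transpose (block_matrix A B C D) = block_matrix (transpose A) (transpose C) (transpose B) (transpose D)"
  by (simp add: vec_eq_iff transpose_def split_sum_all)

lemma det_block_lower_triangular:
  fixes A :: "'a::comm_ring_1^'n^'n" and D :: "'a^'m^'m"
  shows "det (block_matrix A 0 C D) = det A * det D"
proof -
  have "transpose (0 :: 'a^'m^'n) = 0" by (simp add: transpose_def vec_eq_iff)
  then show ?thesis
    using det_block_upper_triangular[of "transpose A" "transpose C" "transpose D"]
    by (metis det_transpose transpose_block_matrix)
qed

text \<open>Conjugation by q matches the permutations of the two index types and preserves signs.
  The types may differ, which is what the passage to real coordinates requires.\<close>

lemma det_reindex:
  fixes A :: "'a::comm_ring_1^'n^'n" and q :: "'m::finite \<Rightarrow> 'n::finite"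
  assumes "bij q"
  shows "det (\<chi> i j. A $ q i $ q j) = det A"
proof -
  let ?F = "map_permutation UNIV q"
  have bij: "bij_betw ?F {\<pi>. \<pi> permutes UNIV} {\<pi>. \<pi> permutes UNIV}"
  proof -
    have "?F = (\<lambda>\<pi> x. if x \<in> UNIV then q (\<pi> (inv_into UNIV q x)) else x)"
      using bij_is_surj[OF assms] by (intro ext) (simp add: map_permutation_def restrict_id_def)
    then show ?thesis using bij_betw_permutations[of q UNIV UNIV] assms by simp
  qed
  have inj: "inj_on q UNIV" using assms bij_is_inj by blast
  have "det A = (\<Sum>\<pi> | \<pi> permutes (UNIV :: 'm set). of_int (sign (?F \<pi>)) * (\<Prod>i\<in>UNIV. A $ i $ ?F \<pi> i))"
    unfolding det_def by (rule sum.reindex_bij_betw[OF bij, symmetric])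
  also have "\<dots> = det (\<chi> i j. A $ q i $ q j)"
    unfolding det_def
  proof (rule sum.cong[OF refl])
    fix \<pi> assume "\<pi> \<in> {\<pi>. \<pi> permutes (UNIV :: 'm set)}"
    then have "sign (?F \<pi>) = sign \<pi>" by (intro sign_map_permutation[OF inj]) auto
    moreover have "(\<Prod>i\<in>UNIV. A $ i $ ?F \<pi> i) = (\<Prod>i\<in>UNIV. A $ q i $ ?F \<pi> (q i))"
      by (rule prod.reindex_bij_betw[OF assms, symmetric])
    ultimately show "of_int (sign (?F \<pi>)) * (\<Prod>i\<in>UNIV. A $ i $ ?F \<pi> i)
        = of_int (sign \<pi>) * (\<Prod>i\<in>UNIV. (\<chi> i j. A $ q i $ q j) $ i $ \<pi> i)"
      by (simp add: map_permutation_apply[OF inj])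
  qed
  finally show ?thesis ..
qed

lemma det_of_real: "det (\<chi> i j. complex_of_real (A $ i $ j)) = of_real (det (A :: real^'n::finite^'n))"
  by (simp add: det_def)

lemma det_cnj: "det (\<chi> i j. cnj (A $ i $ j)) = cnj (det (A :: complex^'n::finite^'n))"
  by (simp add: det_def)

lemma smult_mat_mult [simp]: "mat c ** A = (\<chi> i j. c * A $ i $ j)" "A ** mat c = (\<chi> i j. c * A $ i $ j)"
  for A :: "'a::comm_ring_1^'n::finite^'n"
  by (simp_all add: vec_eq_iff matrix_matrix_mult_def mat_def if_distrib if_distribR sum.delta sum.delta' mult.commute cong: if_cong)

text \<open>Over the complex numbers, adding \<i> times the lower block row to the upper one and
  then subtracting \<i> times the left block column from the right one makes the matrix block lower
  triangular, with L and its conjugate on the diagonal. Hence holomorphic maps preserve orientation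
  and scale volume by |det L|^2.\<close>

lemma det_realification:
  fixes L :: "complex^'n::finite^'n"
  shows "of_real (det (block_matrix (\<chi> i j. Re (L $ i $ j)) (\<chi> i j. - Im (L $ i $ j)) (\<chi> i j. Im (L $ i $ j)) (\<chi> i j. Re (L $ i $ j))))
    = det L * cnj (det L)"
proof -
  let ?A = "\<chi> i j. complex_of_real (Re (L $ i $ j))" and ?B = "\<chi> i j. complex_of_real (Im (L $ i $ j))"
  let ?mB = "\<chi> i j. - complex_of_real (Im (L $ i $ j))"
  let ?R = "block_matrix ?A ?mB ?B ?A :: complex^('n + 'n)^('n + 'n)"
  have 1: "of_real (det (block_matrix (\<chi> i j. Re (L $ i $ j)) (\<chi> i j. - Im (L $ i $ j)) (\<chi> i j. Im (L $ i $ j)) (\<chi> i j. Re (L $ i $ j)))) = det ?R"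
    unfolding det_of_real[symmetric]
    by (rule arg_cong[where f = det]) (simp add: vec_eq_iff split_sum_all)
  have 2: "block_matrix (mat 1) (mat \<i>) 0 (mat 1) ** ?R ** block_matrix (mat 1) (mat (-\<i>)) 0 (mat 1)
     = block_matrix L 0 ?B (\<chi> i j. cnj (L $ i $ j))"
    unfolding block_matrix_mult
    by (simp add: vec_eq_iff split_sum_all complex_eq_iff)
  have "det (block_matrix (mat 1) (mat \<i>) 0 (mat 1) ** ?R ** block_matrix (mat 1) (mat (-\<i>)) 0 (mat 1)) = det ?R"
    unfolding det_mul det_block_upper_triangular by simp
  then show ?thesis
    unfolding 1 2 det_block_lower_triangular det_cnj by simp
qed

lemma matrix_inv_mult:
  assumes "invertible A"
  shows "A ** matrix_inv A = mat 1" "matrix_inv A ** A = mat 1"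
  using someI_ex[OF assms[unfolded invertible_def]] by (simp_all add: matrix_inv_def)

lemma matrix_vector_mult_axis: "(A *v axis k 1) $ l = A $ l $ k"
  for A :: "'a::comm_semiring_1^'n::finite^'m"
  by (simp add: matrix_vector_mult_def axis_def if_distrib if_distribR cong: if_cong)

section \<open>Top-degree forms\<close>

text \<open>The same choice expression as in the definition of \<open>real_frame\<close>, so that
  the two enumerations coincide.\<close>

definition enum_index :: "nat \<Rightarrow> 'n::finite" where
  "enum_index = (SOME e. bij_betw e {..<CARD('n)} UNIV)"

lemma bij_betw_enum_index: "bij_betw (enum_index :: nat \<Rightarrow> 'n::finite) {..<CARD('n)} UNIV"
proof -
  have "\<exists>e :: nat \<Rightarrow> 'n. bij_betw e {..<CARD('n)} UNIV"
    by (rule finite_same_card_bij) auto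
  then show ?thesis unfolding enum_index_def by (rule someI_ex)
qed

text \<open>The slots 2m and 2m + 1 are the two arguments of the m-th factor in a product of
  (1,1)-forms, and they are also the x and y directions of the m-th coordinate in
  \<open>real_frame\<close>.\<close>

definition pair_index :: "nat \<Rightarrow> 'n::finite + 'n" where
  "pair_index k = (if even k then Inl (enum_index (k div 2)) else Inr (enum_index (k div 2)))"

lemma bij_betw_pair_index: "bij_betw (pair_index :: nat \<Rightarrow> 'n::finite + 'n) {..<2 * CARD('n)} UNIV"
proof (rule bij_betw_imageI)
  let ?e = "enum_index :: nat \<Rightarrow> 'n"
  have inj: "inj_on ?e {..<CARD('n)}" and im: "?e ` {..<CARD('n)} = UNIV"
    using bij_betw_enum_index by (auto simp: bij_betw_def)
  show "inj_on (pair_index :: nat \<Rightarrow> 'n + 'n) {..<2 * CARD('n)}"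
  proof (rule inj_onI)
    fix k l assume k: "k \<in> {..<2 * CARD('n)}" and l: "l \<in> {..<2 * CARD('n)}"
      and eq: "(pair_index k :: 'n + 'n) = pair_index l"
    have "?e (k div 2) = ?e (l div 2)" "even k = even l"
      using eq by (auto simp: pair_index_def split: if_splits)
    then have "k div 2 = l div 2" using inj_onD[OF inj] k l by auto
    with \<open>even k = even l\<close> show "k = l"
      by (metis even_two_times_div_two odd_two_times_div_two_succ)
  qed
  show "(pair_index :: nat \<Rightarrow> 'n + 'n) ` {..<2 * CARD('n)} = UNIV"
  proof -
    have "y \<in> (pair_index :: nat \<Rightarrow> 'n + 'n) ` {..<2 * CARD('n)}" for y :: "'n + 'n"
    proof (cases y)
      case (Inl i)
      obtain m where "m < CARD('n)" "?e m = i" using im by (metis UNIV_I imageE lessThan_iff)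
      then show ?thesis using Inl by (intro image_eqI[of _ _ "2 * m"]) (auto simp: pair_index_def)
    next
      case (Inr i)
      obtain m where "m < CARD('n)" "?e m = i" using im by (metis UNIV_I imageE lessThan_iff)
      then show ?thesis using Inr by (intro image_eqI[of _ _ "2 * m + 1"]) (auto simp: pair_index_def)
    qed
    then show ?thesis by auto
  qed
qed

definition frame_of :: "(nat \<Rightarrow> 'v) \<Rightarrow> 'n::finite + 'n \<Rightarrow> 'v" where
  "frame_of v y = v (inv_into {..<2 * CARD('n)} pair_index y)"

lemma frame_of_pair_index: "k < 2 * CARD('n) \<Longrightarrow> frame_of v (pair_index k :: 'n::finite + 'n) = v k"
  using bij_betw_pair_index[where 'n = 'n] by (simp add: frame_of_def bij_betw_def)

text \<open>Transport of the alternating sum along \<open>pair_index\<close>. The factor K may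
  depend on the index, so that one of the n Hermitian forms can be exchanged for another, as in dz^k
  \<and> dzbar^l \<and> \<omega>^(n-1).\<close>

lemma alt_sum_eq_sum_UNIV:
  fixes K :: "'n::finite \<Rightarrow> 'v \<Rightarrow> 'v \<Rightarrow> complex" and v :: "nat \<Rightarrow> 'v"
  shows "alt_sum (2 * CARD('n)) (\<lambda>u. \<Prod>m<CARD('n). K (enum_index m) (u (2 * m)) (u (2 * m + 1))) v =
    (\<Sum>\<sigma> | \<sigma> permutes (UNIV :: ('n + 'n) set). of_int (sign \<sigma>) *
       (\<Prod>i\<in>UNIV. K i (frame_of v (\<sigma> (Inl i))) (frame_of v (\<sigma> (Inr i)))))"
proof -
  let ?q = "pair_index :: nat \<Rightarrow> 'n + 'n" and ?N = "{..<2 * CARD('n)}"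
  let ?F = "map_permutation ?N ?q"
  have q: "bij_betw ?q ?N UNIV" by (rule bij_betw_pair_index)
  then have inj: "inj_on ?q ?N" and im: "?q ` ?N = UNIV" by (auto simp: bij_betw_def)
  have bij: "bij_betw ?F {\<pi>. \<pi> permutes ?N} {\<pi>. \<pi> permutes UNIV}"
  proof -
    have "?F = (\<lambda>\<pi> x. if x \<in> UNIV then ?q (\<pi> (inv_into ?N ?q x)) else x)"
      using im by (intro ext) (simp add: map_permutation_def restrict_id_def)
    then show ?thesis using bij_betw_permutations[OF q] by simp
  qed
  have ap: "frame_of v (?F \<pi> (?q k)) = v (\<pi> k)" if "\<pi> permutes ?N" "k \<in> ?N" for \<pi> k
  proof -
    have "\<pi> k \<in> ?N" using that permutes_in_image by metis
    then show ?thesis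
      unfolding map_permutation_apply[OF inj that(2)] by (simp add: frame_of_pair_index)
  qed
  have "(\<Sum>\<sigma> | \<sigma> permutes (UNIV :: ('n + 'n) set). of_int (sign \<sigma>) *
       (\<Prod>i\<in>UNIV. K i (frame_of v (\<sigma> (Inl i))) (frame_of v (\<sigma> (Inr i)))))
     = (\<Sum>\<pi> | \<pi> permutes ?N. of_int (sign (?F \<pi>)) *
       (\<Prod>i\<in>UNIV. K i (frame_of v (?F \<pi> (Inl i))) (frame_of v (?F \<pi> (Inr i)))))"
    by (rule sum.reindex_bij_betw[OF bij, symmetric])
  also have "\<dots> = (\<Sum>\<pi> | \<pi> permutes ?N. of_int (sign \<pi>) *
       (\<Prod>m<CARD('n). K (enum_index m) (v (\<pi> (2 * m))) (v (\<pi> (2 * m + 1)))))"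
  proof (rule sum.cong[OF refl])
    fix \<pi> assume "\<pi> \<in> {\<pi>. \<pi> permutes ?N}"
    then have \<pi>: "\<pi> permutes ?N" by simp
    have "(\<Prod>i\<in>UNIV. K i (frame_of v (?F \<pi> (Inl i))) (frame_of v (?F \<pi> (Inr i))))
        = (\<Prod>m<CARD('n). K (enum_index m) (frame_of v (?F \<pi> (Inl (enum_index m)))) (frame_of v (?F \<pi> (Inr (enum_index m)))))"
      by (rule prod.reindex_bij_betw[OF bij_betw_enum_index, symmetric])
    also have "\<dots> = (\<Prod>m<CARD('n). K (enum_index m) (v (\<pi> (2 * m))) (v (\<pi> (2 * m + 1))))"
    proof (rule prod.cong[OF refl])
      fix m assume m: "m \<in> {..<CARD('n)}"
      have "Inl (enum_index m) = ?q (2 * m)" "Inr (enum_index m) = ?q (2 * m + 1)"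
        by (auto simp: pair_index_def)
      moreover have "2 * m \<in> ?N" "2 * m + 1 \<in> ?N" using m by auto
      ultimately show "K (enum_index m) (frame_of v (?F \<pi> (Inl (enum_index m)))) (frame_of v (?F \<pi> (Inr (enum_index m))))
          = K (enum_index m) (v (\<pi> (2 * m))) (v (\<pi> (2 * m + 1)))"
        using ap[OF \<pi>] by metis
    qed
    finally show "of_int (sign (?F \<pi>)) * (\<Prod>i\<in>UNIV. K i (frame_of v (?F \<pi> (Inl i))) (frame_of v (?F \<pi> (Inr i))))
        = of_int (sign \<pi>) * (\<Prod>m<CARD('n). K (enum_index m) (v (\<pi> (2 * m))) (v (\<pi> (2 * m + 1))))"
      using sign_map_permutation[OF inj \<pi>] by simp
  qed
  finally show ?thesis unfolding alt_sum_def by simp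
qed

text \<open>The determinant of this matrix is the value of dz^1 \<and> ... \<and> dz^n \<and>
  dzbar^1 \<and> ... \<and> dzbar^n on the vectors x, for matching orders of the indices.\<close>

definition frame_matrix :: "('n::finite + 'n \<Rightarrow> complex^'n) \<Rightarrow> complex^('n + 'n)^('n + 'n)" where
  "frame_matrix x = (\<chi> r y. case r of Inl a \<Rightarrow> x y $ a | Inr a \<Rightarrow> cnj (x y $ a))"

lemma det_permutation_matrix:
  fixes b :: "'n::finite \<Rightarrow> 'n"
  shows "det (\<chi> i j. if j = b i then 1 else 0 :: 'a::{comm_ring_1}^'n^'n) = (if b permutes UNIV then of_int (sign b) else 0)"
proof (cases "b permutes UNIV")
  case True
  have "(\<chi> i j. if j = b i then 1 else 0 :: 'a^'n^'n) = (\<chi> i. mat 1 $ b i)"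
    by (simp add: vec_eq_iff mat_def)
  then show ?thesis using det_permute_rows[OF True, of "mat 1 :: 'a^'n^'n"] True by simp
next
  case False
  then obtain i j where "i \<noteq> j" "b i = b j" unfolding permutes_UNIV_iff inj_def by blast
  then show ?thesis
    using False by (auto intro!: det_identical_rows[of i j] simp: row_def)
qed

text \<open>
  Expanding the forms in the antiholomorphic index only turns the alternating sum into determinants
  of products of a block diagonal matrix with the frame matrix.
\<close>

lemma sum_permutations_herm_form:
  fixes h :: "'n::finite \<Rightarrow> complex^'n^'n" and x :: "'n + 'n \<Rightarrow> complex^'n"
  shows "(\<Sum>\<sigma> | \<sigma> permutes (UNIV :: ('n + 'n) set). of_int (sign \<sigma>) *
       (\<Prod>i\<in>UNIV. herm_form (h i) (x (\<sigma> (Inl i))) (x (\<sigma> (Inr i)))))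
    = (\<Sum>b | b permutes UNIV. of_int (sign b) * det (\<chi> i a. h i $ a $ b i)) * det (frame_matrix x)"
proof -
  let ?P = "{\<sigma>. \<sigma> permutes (UNIV :: ('n + 'n) set)}"
  let ?N = "\<lambda>b :: 'n \<Rightarrow> 'n. \<chi> i a. h i $ a $ b i"
  let ?Q = "\<lambda>b :: 'n \<Rightarrow> 'n. \<chi> i j. if j = b i then 1 else 0 :: complex^'n^'n"
  have entries: "(block_matrix (?N b) 0 0 (?Q b) ** frame_matrix x) $ Inl i $ y = (\<Sum>a\<in>UNIV. h i $ a $ b i * x y $ a)"
    "(block_matrix (?N b) 0 0 (?Q b) ** frame_matrix x) $ Inr i $ y = cnj (x y $ b i)" for b i y
    by (simp_all add: matrix_matrix_mult_def sum_UNIV_Plus frame_matrix_def if_distrib if_distribR sum.delta cong: if_cong)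
  have "(\<Prod>i\<in>UNIV. herm_form (h i) (x (\<sigma> (Inl i))) (x (\<sigma> (Inr i))))
      = (\<Sum>b\<in>UNIV. \<Prod>r\<in>UNIV. (block_matrix (?N b) 0 0 (?Q b) ** frame_matrix x) $ r $ \<sigma> r)" for \<sigma>
  proof -
    have "herm_form (h i) (x (\<sigma> (Inl i))) (x (\<sigma> (Inr i)))
      = (\<Sum>j\<in>UNIV. (\<Sum>a\<in>UNIV. h i $ a $ j * x (\<sigma> (Inl i)) $ a) * cnj (x (\<sigma> (Inr i)) $ j))" for i
      unfolding herm_form_def by (subst sum.swap) (simp add: sum_distrib_right)
    then have "(\<Prod>i\<in>UNIV. herm_form (h i) (x (\<sigma> (Inl i))) (x (\<sigma> (Inr i))))
      = (\<Sum>b\<in>UNIV. \<Prod>i\<in>UNIV. (\<Sum>a\<in>UNIV. h i $ a $ b i * x (\<sigma> (Inl i)) $ a) * cnj (x (\<sigma> (Inr i)) $ b i))"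
      by (simp add: prod_sum_PiE PiE_UNIV_domain)
    then show ?thesis by (simp add: prod_UNIV_Plus entries prod.distrib)
  qed
  then have "(\<Sum>\<sigma>\<in>?P. of_int (sign \<sigma>) * (\<Prod>i\<in>UNIV. herm_form (h i) (x (\<sigma> (Inl i))) (x (\<sigma> (Inr i)))))
      = (\<Sum>b\<in>UNIV. det (block_matrix (?N b) 0 0 (?Q b) ** frame_matrix x))"
    unfolding det_def by (subst sum.swap) (simp add: sum_distrib_left)
  \<comment> \<open>A choice b of antiholomorphic indices that repeats one gives \<open>?Q b\<close>
    two equal rows, and the determinant vanishes.\<close>
  also have "\<dots> = (\<Sum>b\<in>UNIV. if b permutes UNIV then of_int (sign b) * det (?N b) * det (frame_matrix x) else 0)"
    by (intro sum.cong) (auto simp: det_mul det_block_upper_triangular det_permutation_matrix)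
  also have "\<dots> = (\<Sum>b | b permutes UNIV. of_int (sign b) * det (?N b)) * det (frame_matrix x)"
    by (simp add: sum.If_cases sum_distrib_right)
  finally show ?thesis .
qed

text \<open>Every permutation b contributes det h: its sign occurs once in the sum and once from
  permuting the rows of the transpose, and the two cancel. This accounts for the n!.\<close>

lemma form_power_top:
  fixes h :: "complex^'n::finite \<Rightarrow> complex^'n^'n"
  shows "form_power (fundamental_form h) CARD('n) z v
    = \<i> ^ CARD('n) * fact CARD('n) * det (h z) * det (frame_matrix (frame_of v))"
proof -
  have "form_power (fundamental_form h) CARD('n) z v
     = alt_sum (2 * CARD('n)) (\<lambda>u. \<i> ^ CARD('n) * (\<Prod>m<CARD('n). herm_form (h z) (u (2 * m)) (u (2 * m + 1)))) v"
    unfolding form_power_eq_alt_sum by (simp add: prod.distrib)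
  also have "\<dots> = \<i> ^ CARD('n) * (\<Sum>\<sigma> | \<sigma> permutes (UNIV :: ('n + 'n) set). of_int (sign \<sigma>) *
       (\<Prod>i\<in>UNIV. herm_form (h z) (frame_of v (\<sigma> (Inl i))) (frame_of v (\<sigma> (Inr i)))))"
    unfolding alt_sum_cmult alt_sum_eq_sum_UNIV[where K = "\<lambda>i :: 'n. herm_form (h z)"] ..
  also have "\<dots> = \<i> ^ CARD('n) * ((\<Sum>b :: 'n \<Rightarrow> 'n | b permutes UNIV. of_int (sign b) * det (\<chi> i a. h z $ a $ b i)) * det (frame_matrix (frame_of v)))"
    by (simp only: sum_permutations_herm_form[of "\<lambda>i. h z" "frame_of v"])
  also have "(\<Sum>b :: 'n \<Rightarrow> 'n | b permutes UNIV. of_int (sign b) * det (\<chi> i a. h z $ a $ b i)) = (\<Sum>b :: 'n \<Rightarrow> 'n | b permutes UNIV. det (h z))"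
  proof (rule sum.cong[OF refl])
    fix b :: "'n \<Rightarrow> 'n" assume "b \<in> {b. b permutes UNIV}"
    then have b: "b permutes UNIV" by simp
    have "(\<chi> i a. h z $ a $ b i) = (\<chi> i. Finite_Cartesian_Product.transpose (h z) $ b i)"
      by (simp add: vec_eq_iff Finite_Cartesian_Product.transpose_def)
    then have "det (\<chi> i a. h z $ a $ b i) = of_int (sign b) * det (h z)"
      using det_permute_rows[OF b, of "Finite_Cartesian_Product.transpose (h z)"] by simp
    moreover have "of_int (sign b) * (of_int (sign b) * c) = c" for c :: complex
      unfolding mult.assoc[symmetric] of_int_mult[symmetric] by simp
    ultimately show "of_int (sign b) * det (\<chi> i a. h z $ a $ b i) = det (h z)" by simp
  qed
  finally show ?thesis by (simp add: card_permutations)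
qed

text \<open>The number (n - 1)!, the combinatorial constant in dz^k \<and> dzbar^l \<and>
  \<omega>^(n-1).\<close>

definition card_fix :: "'n::finite itself \<Rightarrow> nat" where
  "card_fix _ = card {b :: 'n \<Rightarrow> 'n. b permutes UNIV \<and> b (enum_index 0) = enum_index 0}"

lemma card_fix_pos: "card_fix TYPE('n::finite) > 0"
proof -
  have "id \<in> {b :: 'n \<Rightarrow> 'n. b permutes UNIV \<and> b (enum_index 0) = enum_index 0}"
    using permutes_id[of "UNIV :: 'n set"] by (simp add: id_def)
  then have "{b :: 'n \<Rightarrow> 'n. b permutes UNIV \<and> b (enum_index 0) = enum_index 0} \<noteq> {}" by blast
  then show ?thesis unfolding card_fix_def by (subst card_gt_0_iff) (simp add: finite_permutations)
qed

lemma card_permutes_to: "card {b :: 'n::finite \<Rightarrow> 'n. b permutes UNIV \<and> b (enum_index 0) = l} = card_fix TYPE('n)"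
proof -
  let ?t = "Transposition.transpose l (enum_index 0)"
  have t: "?t permutes UNIV" by (rule permutes_swap_id) auto
  have "bij_betw (\<lambda>b. ?t \<circ> b) {b :: 'n \<Rightarrow> 'n. b permutes UNIV \<and> b (enum_index 0) = l}
     {b :: 'n \<Rightarrow> 'n. b permutes UNIV \<and> b (enum_index 0) = enum_index 0}"
    by (rule bij_betwI[where g = "\<lambda>b. ?t \<circ> b"]) (use permutes_compose[OF _ t] in \<open>auto simp: o_def\<close>)
  then show ?thesis unfolding card_fix_def by (rule bij_betw_same_card)
qed

text \<open>This computes dz^k \<and> dzbar^l \<and> \<omega>^(n-1): the first of the n Hermitian
  forms is the one whose matrix has its only nonzero entry, 1, at (k, l). In the resulting sum only
  permutations with \<open>b (enum_index 0) = l\<close> survive, and each contributes the (k, l)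
  cofactor of h, that is, det h times an entry of the inverse.\<close>

lemma alt_sum_wedge_form_power:
  fixes h :: "complex^'n::finite^'n"
  assumes inv: "invertible h"
  shows "alt_sum (2 * CARD('n)) (\<lambda>u. u 0 $ k * cnj (u 1 $ l) *
       (\<Prod>m<CARD('n) - 1. \<i> * herm_form h (u (2 + 2 * m)) (u (2 + (2 * m + 1))))) v
    = \<i> ^ (CARD('n) - 1) * of_nat (card_fix TYPE('n)) * (det h * matrix_inv h $ l $ k) * det (frame_matrix (frame_of v))"
proof -
  let ?e = "enum_index :: nat \<Rightarrow> 'n"
  let ?E = "\<chi> a b. if a = k \<and> b = l then 1 else 0 :: complex^'n^'n"
  define H where "H = (\<lambda>i. if i = ?e 0 then ?E else h)"
  have e0: "?e (Suc m) \<noteq> ?e 0" if "m < CARD('n) - 1" for m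
  proof
    assume "?e (Suc m) = ?e 0"
    moreover have "inj_on ?e {..<CARD('n)}" using bij_betw_enum_index[where 'n = 'n] by (simp add: bij_betw_def)
    ultimately have "Suc m = 0" using that by (auto dest!: inj_onD)
    then show False by simp
  qed
  have E: "herm_form ?E x y = x $ k * cnj (y $ l)" for x y
  proof -
    have "herm_form ?E x y = (\<Sum>i\<in>UNIV. if i = k then (\<Sum>j\<in>UNIV. if j = l then x $ i * cnj (y $ j) else 0) else 0)"
      unfolding herm_form_def by (intro sum.cong refl) (simp add: sum.neutral if_distrib if_distribR cong: if_cong)
    then show ?thesis by simp
  qed
  have split: "(\<Prod>m<CARD('n). f m) = f 0 * (\<Prod>m<CARD('n) - 1. f (Suc m))" for f :: "nat \<Rightarrow> complex"
    using prod.lessThan_Suc_shift[of f "CARD('n) - 1"] by simp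
  have "u 0 $ k * cnj (u 1 $ l) * (\<Prod>m<CARD('n) - 1. \<i> * herm_form h (u (2 + 2 * m)) (u (2 + (2 * m + 1))))
      = \<i> ^ (CARD('n) - 1) * (\<Prod>m<CARD('n). herm_form (H (?e m)) (u (2 * m)) (u (2 * m + 1)))" for u :: "nat \<Rightarrow> complex^'n"
    unfolding split by (simp add: H_def E e0 prod.distrib)
  then have "alt_sum (2 * CARD('n)) (\<lambda>u. u 0 $ k * cnj (u 1 $ l) *
       (\<Prod>m<CARD('n) - 1. \<i> * herm_form h (u (2 + 2 * m)) (u (2 + (2 * m + 1))))) v
    = \<i> ^ (CARD('n) - 1) * alt_sum (2 * CARD('n)) (\<lambda>u. \<Prod>m<CARD('n). herm_form (H (?e m)) (u (2 * m)) (u (2 * m + 1))) v"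
    by (simp add: alt_sum_cmult)
  also have "\<dots> = \<i> ^ (CARD('n) - 1) * ((\<Sum>b | b permutes UNIV. of_int (sign b) * det (\<chi> i a. H i $ a $ b i)) * det (frame_matrix (frame_of v)))"
    by (simp only: alt_sum_eq_sum_UNIV[where K = "\<lambda>i :: 'n. herm_form (H i)"] sum_permutations_herm_form[of H "frame_of v"])
  also have "(\<Sum>b | b permutes UNIV. of_int (sign b) * det (\<chi> i a. H i $ a $ b i))
     = (\<Sum>b | b permutes UNIV. if b (?e 0) = l then det h * matrix_inv h $ l $ k else 0)"
  proof (rule sum.cong[OF refl])
    fix b :: "'n \<Rightarrow> 'n" assume "b \<in> {b. b permutes UNIV}"
    then have b: "b permutes UNIV" by simp
    show "of_int (sign b) * det (\<chi> i a. H i $ a $ b i) = (if b (?e 0) = l then det h * matrix_inv h $ l $ k else 0)"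
    proof (cases "b (?e 0) = l")
      case True
      \<comment> \<open>The matrix h with column l replaced by e_k, where e_k is written as h
        applied to a vector so that Cramer's rule evaluates the determinant.\<close>
      define P where "P = (\<chi> a j. if j = l then (h *v (matrix_inv h *v axis k 1)) $ a else h $ a $ j)"
      have ax: "h *v (matrix_inv h *v axis k 1) = axis k 1"
        using inv by (simp add: matrix_vector_mul_assoc matrix_inv_mult)
      have "det P = (matrix_inv h *v axis k 1) $ l * det h"
        unfolding P_def by (rule cramer_lemma)
      moreover have "(matrix_inv h *v axis k 1) $ l = matrix_inv h $ l $ k"
        by (rule matrix_vector_mult_axis)
      moreover have "(\<chi> i a. H i $ a $ b i) = (\<chi> i. Finite_Cartesian_Product.transpose P $ b i)"
      proof -
        have "b i = l \<longleftrightarrow> i = ?e 0" for i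
          using True permutes_inj[OF b] by (metis injD)
        then show ?thesis
          by (auto simp add: vec_eq_iff Finite_Cartesian_Product.transpose_def P_def ax H_def) (auto simp: axis_def)
      qed
      ultimately have "det (\<chi> i a. H i $ a $ b i) = of_int (sign b) * (matrix_inv h $ l $ k * det h)"
        using det_permute_rows[OF b, of "Finite_Cartesian_Product.transpose P"] by simp
      moreover have "of_int (sign b) * (of_int (sign b) * c) = c" for c :: complex
        unfolding mult.assoc[symmetric] of_int_mult[symmetric] by simp
      ultimately show ?thesis using True by simp
    next
      case False
      then have "row (?e 0) (\<chi> i a. H i $ a $ b i) = 0"
        by (simp add: row_def vec_eq_iff H_def)
      then have "det (\<chi> i a. H i $ a $ b i) = 0" by (rule det_zero_row(2))
      then show ?thesis using False by simp
    qed
  qed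
  also have "\<dots> = of_nat (card_fix TYPE('n)) * (det h * matrix_inv h $ l $ k)"
    by (simp add: sum.If_cases Int_def card_permutes_to)
  finally show ?thesis by simp
qed

lemma frame_of_real_frame:
  fixes i :: "'n::finite"
  shows "frame_of real_frame (Inl i) = axis i 1" "frame_of real_frame (Inr i) = axis i \<i>"
proof -
  have rf: "(real_frame :: nat \<Rightarrow> complex^'n) k = axis (enum_index (k div 2)) (if even k then 1 else \<i>)" for k
    by (simp add: real_frame_def enum_index_def Let_def)
  have "i \<in> enum_index ` {..<CARD('n)}"
    using bij_betw_enum_index[where 'n = 'n] by (simp add: bij_betw_def)
  then obtain m where m: "m < CARD('n)" "i = enum_index m" by auto
  have p: "Inl i = (pair_index (2 * m) :: 'n + 'n)" "Inr i = (pair_index (2 * m + 1) :: 'n + 'n)"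
    unfolding m(2) by (simp_all add: pair_index_def)
  have l: "2 * m < 2 * CARD('n)" "2 * m + 1 < 2 * CARD('n)" using m(1) by auto
  show "frame_of real_frame (Inl i) = axis i 1"
    unfolding p frame_of_pair_index[OF l(1)] rf by (simp add: m(2))
  show "frame_of real_frame (Inr i) = axis i \<i>"
    unfolding p frame_of_pair_index[OF l(2)] rf by (simp add: m(2))
qed

lemma det_mat: "det (mat c :: 'a::comm_ring_1^'n::finite^'n) = c ^ CARD('n)"
  by (subst det_diagonal) (auto simp: mat_def)

text \<open>On the x directions dz and dzbar agree with the coordinate vectors, on the y directions
  they are \<i> and -\<i> times these. The factorisation is one step of block elimination.\<close>

lemma det_real_frame: "det (frame_matrix (frame_of real_frame :: 'n::finite + 'n \<Rightarrow> complex^'n)) = (- 2 * \<i>) ^ CARD('n)"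
proof -
  have "frame_matrix (frame_of real_frame :: 'n + 'n \<Rightarrow> complex^'n)
    = block_matrix (mat 1) 0 (mat 1) (mat 1) ** block_matrix (mat 1) (mat \<i>) 0 (mat (- 2 * \<i>))"
    unfolding block_matrix_mult smult_mat_mult(1)
    by (auto simp add: vec_eq_iff split_sum_all frame_matrix_def frame_of_real_frame axis_def mat_def)
  then show ?thesis
    by (simp add: det_mul det_block_lower_triangular det_block_upper_triangular det_mat)
qed

text \<open>The factor \<i>^n from the power of the fundamental form and (-2\<i>)^n from the real
  frame multiply to 2^n.\<close>

lemma volume_density_eq:
  fixes h :: "complex^'n::finite \<Rightarrow> complex^'n^'n"
  shows "volume_density h z = 2 ^ CARD('n) * Re (det (h z))"
proof -
  have "\<i> ^ CARD('n) * (- 2 * \<i>) ^ CARD('n) = (2 ^ CARD('n) :: complex)"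
    unfolding power_mult_distrib[symmetric] by (rule arg_cong[where f = "\<lambda>x. x ^ CARD('n)"]) (simp add: complex_eq_iff)
  then have "form_power (fundamental_form h) CARD('n) z real_frame = of_real (fact CARD('n) * 2 ^ CARD('n)) * det (h z)"
    unfolding form_power_top det_real_frame by (simp add: algebra_simps)
  then show ?thesis
    unfolding volume_density_def by (simp only: Re_complex_of_real times_complex.sel Im_complex_of_real) simp
qed

section \<open>Continuously differentiable functions\<close>

lemma Ck_on_cong:
  assumes "open S" "\<And>x. x \<in> S \<Longrightarrow> f x = g x"
  shows "Ck_on k S f \<longleftrightarrow> Ck_on k S g"
proof -
  have "Ck_on k S f \<Longrightarrow> Ck_on k S g" if "\<And>x. x \<in> S \<Longrightarrow> f x = g x" for f g
    using that
  proof (induction k arbitrary: f g)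
    case 0
    then show ?case by (metis Ck_on.simps(1) continuous_on_cong)
  next
    case (Suc k)
    have D: "(f has_derivative D) (at x) \<longleftrightarrow> (g has_derivative D) (at x)" if "x \<in> S" for x D
      using Suc.prems(2) that \<open>open S\<close>
      by (metis has_derivative_transform_within_open)
    then have "f differentiable at x \<longleftrightarrow> g differentiable at x"
      "frechet_derivative f (at x) = frechet_derivative g (at x)" if "x \<in> S" for x
      using that by (auto simp: differentiable_def frechet_derivative_def)
    moreover have "Ck_on k S (\<lambda>x. frechet_derivative g (at x) v)" for v
    proof (rule Suc.IH)
      show "Ck_on k S (\<lambda>x. frechet_derivative f (at x) v)" using Suc.prems(1) by simp
    qed (simp add: calculation(2))
    ultimately show ?case using Suc.prems(1) by simp
  qed
  then show ?thesis using assms(2) by (metis (full_types))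
qed

text \<open>Any known formula for the derivative may take the place of
  \<open>frechet_derivative\<close>, which is given by a choice operator.\<close>

lemma Ck_on_SucI:
  assumes "open S" "\<And>x. x \<in> S \<Longrightarrow> (f has_derivative f' x) (at x)" "\<And>v. Ck_on k S (\<lambda>x. f' x v)"
  shows "Ck_on (Suc k) S f"
proof -
  have "frechet_derivative f (at x) = f' x" if "x \<in> S" for x
    using assms(2)[OF that] frechet_derivative_at by metis
  then have "Ck_on k S (\<lambda>x. frechet_derivative f (at x) v)" for v
    using assms(3)[of v] Ck_on_cong[OF assms(1), of "\<lambda>x. frechet_derivative f (at x) v" "\<lambda>x. f' x v"] by simp
  then show ?thesis using assms(2) by (auto simp: differentiable_def)
qed

lemma Ck_on_SucD:
  assumes "Ck_on (Suc k) S f"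
  shows "x \<in> S \<Longrightarrow> (f has_derivative frechet_derivative f (at x)) (at x)"
    and "Ck_on k S (\<lambda>x. frechet_derivative f (at x) v)"
  using assms by (auto simp: frechet_derivative_works)

lemma Ck_on_Suc_imp: "Ck_on (Suc k) S f \<Longrightarrow> Ck_on k S f"
proof (induction k arbitrary: f)
  case 0
  then show ?case
    by (metis Ck_on.simps continuous_at_imp_continuous_on differentiable_imp_continuous_within)
next
  case (Suc k)
  then show ?case by (metis Ck_on.simps(2))
qed

lemma Ck_on_le: "Ck_on m S f \<Longrightarrow> k \<le> m \<Longrightarrow> Ck_on k S f"
  by (induction m) (auto simp: le_Suc_eq simp del: Ck_on.simps(2) intro: Ck_on_Suc_imp)

lemma Ck_on_imp_continuous_on: "Ck_on k S f \<Longrightarrow> continuous_on S f"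
  using Ck_on_le[of k S f 0] by simp

lemma Ck_on_subset: "Ck_on k S f \<Longrightarrow> T \<subseteq> S \<Longrightarrow> Ck_on k T f"
  by (induction k arbitrary: f) (auto intro: continuous_on_subset)

lemma Ck_on_Union:
  assumes "\<And>S. S \<in> \<S> \<Longrightarrow> open S" "\<And>S. S \<in> \<S> \<Longrightarrow> Ck_on k S f"
  shows "Ck_on k (\<Union>\<S>) f"
  using assms(2)
proof (induction k arbitrary: f)
  case 0
  then show ?case using continuous_on_open_Union[of \<S> f] assms(1) by simp
next
  case (Suc k)
  then show ?case by auto
qed

lemma Ck_on_Un: "open S \<Longrightarrow> open T \<Longrightarrow> Ck_on k S f \<Longrightarrow> Ck_on k T f \<Longrightarrow> Ck_on k (S \<union> T) f"
  using Ck_on_Union[of "{S, T}" k f] by auto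

lemma Ck_on_const: "Ck_on k S (\<lambda>x. c)"
  by (induction k arbitrary: c) auto

lemma Ck_on_bounded_linear:
  assumes "bounded_linear L" "open S" "Ck_on k S f"
  shows "Ck_on k S (\<lambda>x. L (f x))"
  using assms(3)
proof (induction k arbitrary: f)
  case 0
  then show ?case using bounded_linear.continuous_on[OF assms(1)] by auto
next
  case (Suc k)
  show ?case
    by (rule Ck_on_SucI[OF assms(2) bounded_linear.has_derivative[OF assms(1) Ck_on_SucD(1)[OF Suc.prems]]])
      (auto intro: Suc.IH Ck_on_SucD(2)[OF Suc.prems])
qed

lemma Ck_on_linear: "bounded_linear L \<Longrightarrow> open S \<Longrightarrow> Ck_on k S L"
proof (cases k)
  case (Suc m)
  assume "bounded_linear L" "open S"
  then show ?thesis
    unfolding Suc by (intro Ck_on_SucI[where f' = "\<lambda>_. L"]) (auto intro: bounded_linear_imp_has_derivative Ck_on_const)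
qed (simp add: linear_continuous_on)

lemma Ck_on_add:
  assumes "open S" "Ck_on k S f" "Ck_on k S g"
  shows "Ck_on k S (\<lambda>x. f x + g x)"
  using assms(2,3)
proof (induction k arbitrary: f g)
  case 0
  then show ?case by (auto intro: continuous_on_add)
next
  case (Suc k)
  show ?case
    by (rule Ck_on_SucI[OF assms(1) has_derivative_add[OF Ck_on_SucD(1)[OF Suc.prems(1)] Ck_on_SucD(1)[OF Suc.prems(2)]]])
      (auto intro!: Suc.IH Ck_on_SucD(2)[OF Suc.prems(1)] Ck_on_SucD(2)[OF Suc.prems(2)])
qed

lemma Ck_on_sum: "open S \<Longrightarrow> (\<And>i. i \<in> I \<Longrightarrow> Ck_on k S (f i)) \<Longrightarrow> Ck_on k S (\<lambda>x. \<Sum>i\<in>I. f i x)"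
  by (induction I rule: infinite_finite_induct) (auto intro: Ck_on_const Ck_on_add)

lemma Ck_on_bilinear:
  assumes "bounded_bilinear B" "open S" "Ck_on k S f" "Ck_on k S g"
  shows "Ck_on k S (\<lambda>x. B (f x) (g x))"
  using assms(3,4)
proof (induction k arbitrary: f g)
  case 0
  then show ?case using bounded_bilinear.continuous_on[OF assms(1)] by auto
next
  case (Suc k)
  show ?case
  proof (rule Ck_on_SucI[OF assms(2) bounded_bilinear.FDERIV[OF assms(1) Ck_on_SucD(1)[OF Suc.prems(1)] Ck_on_SucD(1)[OF Suc.prems(2)]]])
    fix v
    have fg: "Ck_on k S f" "Ck_on k S g" using Suc.prems by (blast intro: Ck_on_Suc_imp)+
    show "Ck_on k S (\<lambda>x. B (f x) (frechet_derivative g (at x) v) + B (frechet_derivative f (at x) v) (g x))"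
      by (rule Ck_on_add[OF assms(2) Suc.IH[OF fg(1) Ck_on_SucD(2)[OF Suc.prems(2)]] Suc.IH[OF Ck_on_SucD(2)[OF Suc.prems(1)] fg(2)]])
  qed
qed

lemmas Ck_on_mult = Ck_on_bilinear[OF bounded_bilinear_mult]
lemmas Ck_on_scaleR = Ck_on_bilinear[OF bounded_bilinear_scaleR]
lemmas Ck_on_inner = Ck_on_bilinear[OF bounded_bilinear_inner]

lemma Ck_on_minus: "open S \<Longrightarrow> Ck_on k S f \<Longrightarrow> Ck_on k S (\<lambda>x. - f x)"
  by (rule Ck_on_bounded_linear[OF bounded_linear_minus[OF bounded_linear_ident]])

lemma Ck_on_diff: "open S \<Longrightarrow> Ck_on k S f \<Longrightarrow> Ck_on k S g \<Longrightarrow> Ck_on k S (\<lambda>x. f x - g x)"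
  using Ck_on_add[OF _ _ Ck_on_minus, of S k f g] by simp

lemma Ck_on_prod:
  fixes f :: "'i \<Rightarrow> 'v::real_normed_vector \<Rightarrow> 'w::{real_normed_algebra, comm_ring_1}"
  shows "open S \<Longrightarrow> (\<And>i. i \<in> I \<Longrightarrow> Ck_on k S (f i)) \<Longrightarrow> Ck_on k S (\<lambda>x. \<Prod>i\<in>I. f i x)"
  by (induction I rule: infinite_finite_induct) (auto intro: Ck_on_const Ck_on_mult)

text \<open>The derivative involves the inverse itself besides f and f', so the induction hypothesis
  for the inverse at the lower order closes the argument.\<close>

lemma Ck_on_inverse:
  fixes f :: "'v::real_normed_vector \<Rightarrow> 'w::real_normed_field"
  assumes "open S" "Ck_on k S f" "\<And>x. x \<in> S \<Longrightarrow> f x \<noteq> 0"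
  shows "Ck_on k S (\<lambda>x. inverse (f x))"
  using assms(2)
proof (induction k)
  case 0
  then show ?case using assms(3) by (auto intro: continuous_on_inverse)
next
  case (Suc k)
  have "Ck_on k S (\<lambda>x. - (inverse (f x) * frechet_derivative f (at x) v * inverse (f x)))" for v
    by (intro Ck_on_minus Ck_on_mult assms(1) Suc.IH Ck_on_Suc_imp[OF Suc.prems] Ck_on_SucD(2)[OF Suc.prems])
  then show ?case
    by (intro Ck_on_SucI[OF assms(1) Deriv.has_derivative_inverse[OF assms(3) Ck_on_SucD(1)[OF Suc.prems]]])
qed

lemma Ck_on_divide:
  fixes f :: "'v::real_normed_vector \<Rightarrow> 'w::real_normed_field"
  shows "open S \<Longrightarrow> Ck_on k S f \<Longrightarrow> Ck_on k S g \<Longrightarrow> (\<And>x. x \<in> S \<Longrightarrow> g x \<noteq> 0) \<Longrightarrow> Ck_on k S (\<lambda>x. f x / g x)"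
  unfolding divide_inverse by (intro Ck_on_mult Ck_on_inverse) auto

lemma Ck_on_exp:
  fixes f :: "'v::real_normed_vector \<Rightarrow> real"
  assumes "open S" "Ck_on k S f"
  shows "Ck_on k S (\<lambda>x. exp (f x))"
  using assms(2)
proof (induction k)
  case 0
  then show ?case by (auto intro: continuous_on_exp)
next
  case (Suc k)
  have "Ck_on k S (\<lambda>x. frechet_derivative f (at x) v * exp (f x))" for v
    by (intro Ck_on_mult assms(1) Suc.IH Ck_on_Suc_imp[OF Suc.prems] Ck_on_SucD(2)[OF Suc.prems])
  moreover have "((\<lambda>x. exp (f x)) has_derivative (\<lambda>v. frechet_derivative f (at x) v * exp (f x))) (at x)" if "x \<in> S" for x
    using has_derivative_exp[OF Ck_on_SucD(1)[OF Suc.prems that]] by (simp add: mult.commute)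
  ultimately show ?case by (intro Ck_on_SucI[OF assms(1)])
qed

text \<open>Higher derivatives in \<open>Ck_on\<close> are taken in fixed directions, whereas the
  chain rule evaluates f' in the moving direction g'(x) v. Expanding that direction in the basis of
  the intermediate space leaves fixed directions b, to which the induction hypothesis
  applies.\<close>

lemma Ck_on_compose:
  fixes g :: "'v::real_normed_vector \<Rightarrow> 'w::euclidean_space" and f :: "'w \<Rightarrow> 'x::real_normed_vector"
  assumes S: "open S" and g: "Ck_on k S g" and T: "open T" and f: "Ck_on k T f" and sub: "g ` S \<subseteq> T"
  shows "Ck_on k S (\<lambda>x. f (g x))"
  using g f
proof (induction k arbitrary: f)
  case 0
  then show ?case using continuous_on_compose2[of T f S g] sub by auto
next
  case (Suc k)
  let ?f' = "\<lambda>y b. frechet_derivative f (at y) b" and ?g' = "\<lambda>x. frechet_derivative g (at x)"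
  have lin: "linear (?f' (g x))" if "x \<in> S" for x
    by (rule has_derivative_linear[OF Ck_on_SucD(1)[OF Suc.prems(2)]]) (use that sub in auto)
  have D: "((\<lambda>x. f (g x)) has_derivative (\<lambda>v. \<Sum>b\<in>Basis. (?g' x v \<bullet> b) *\<^sub>R ?f' (g x) b)) (at x)" if x: "x \<in> S" for x
  proof -
    have "((\<lambda>x. f (g x)) has_derivative (\<lambda>v. ?f' (g x) (?g' x v))) (at x)"
      by (rule has_derivative_compose[OF Ck_on_SucD(1)[OF Suc.prems(1) x] Ck_on_SucD(1)[OF Suc.prems(2)]]) (use sub x in auto)
    moreover have "?f' (g x) w = (\<Sum>b\<in>Basis. (w \<bullet> b) *\<^sub>R ?f' (g x) b)" for w
    proof -
      have "?f' (g x) (\<Sum>b\<in>Basis. (w \<bullet> b) *\<^sub>R b) = (\<Sum>b\<in>Basis. (w \<bullet> b) *\<^sub>R ?f' (g x) b)"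
        by (simp only: linear_sum[OF lin[OF x]] linear_scale[OF lin[OF x]])
      then show ?thesis by (simp only: euclidean_representation)
    qed
    ultimately show ?thesis by (rule has_derivative_eq_rhs[OF _ ext])
  qed
  show ?case
  proof (rule Ck_on_SucI[OF S D])
    fix v
    have "Ck_on k S (\<lambda>x. ?f' (g x) b)" for b
      by (rule Suc.IH[OF Ck_on_Suc_imp[OF Suc.prems(1)] Ck_on_SucD(2)[OF Suc.prems(2)]])
    then show "Ck_on k S (\<lambda>x. \<Sum>b\<in>Basis. (?g' x v \<bullet> b) *\<^sub>R ?f' (g x) b)"
      by (intro Ck_on_sum Ck_on_scaleR Ck_on_inner S Ck_on_const Ck_on_SucD(2)[OF Suc.prems(1)])
  qed
qed

lemma smooth_onD: "smooth_on S f \<Longrightarrow> Ck_on k S f"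
  by (simp add: smooth_on_def)

lemma Ck_on_if:
  assumes "open S" "open T" "Ck_on k S f" "\<And>x. x \<in> S \<Longrightarrow> x \<in> T \<Longrightarrow> f x = c" "S \<union> T = UNIV"
  shows "Ck_on k UNIV (\<lambda>x. if x \<in> S then f x else c)"
proof -
  have "Ck_on k S (\<lambda>x. if x \<in> S then f x else c)"
    using assms(3) Ck_on_cong[OF assms(1), of f "\<lambda>x. if x \<in> S then f x else c"] by simp
  moreover have "Ck_on k T (\<lambda>x. if x \<in> S then f x else c)"
    using Ck_on_const[of k T c] assms(4) Ck_on_cong[OF assms(2), of "\<lambda>x. if x \<in> S then f x else c" "\<lambda>_. c"] by simp
  ultimately show ?thesis using Ck_on_Un[OF assms(1,2)] assms(5) by metis
qed

section \<open>Differentiability of vector-valued maps, determinants and inverse matrices\<close>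

lemma Ck_on_componentwise:
  fixes f :: "'v::real_normed_vector \<Rightarrow> 'w::euclidean_space"
  assumes "open S" "\<And>b. b \<in> Basis \<Longrightarrow> Ck_on k S (\<lambda>x. f x \<bullet> b)"
  shows "Ck_on k S f"
proof -
  have "Ck_on k S (\<lambda>x. \<Sum>b\<in>Basis. (f x \<bullet> b) *\<^sub>R b)"
    by (intro Ck_on_sum Ck_on_scaleR assms Ck_on_const)
  then show ?thesis by (simp add: euclidean_representation)
qed

lemma Ck_on_det:
  fixes A :: "'v::real_normed_vector \<Rightarrow> complex^'n::finite^'n"
  assumes "open S" "\<And>i j. Ck_on k S (\<lambda>x. A x $ i $ j)"
  shows "Ck_on k S (\<lambda>x. det (A x))"
  unfolding det_def by (intro Ck_on_sum Ck_on_mult Ck_on_prod assms Ck_on_const)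

text \<open>Cramer's rule for the columns of the inverse. It exhibits the entries as rational
  functions of the entries of A, which is how they inherit differentiability.\<close>

lemma matrix_inv_cramer:
  fixes A :: "complex^'n::finite^'n"
  assumes "invertible A"
  shows "matrix_inv A $ l $ k = det (\<chi> i j. if j = l then axis k 1 $ i else A $ i $ j) / det A"
proof -
  have e: "A *v (matrix_inv A *v axis k 1) = axis k 1"
    using assms by (simp add: matrix_vector_mul_assoc matrix_inv_mult)
  have "det (\<chi> i j. if j = l then axis k 1 $ i else A $ i $ j) = matrix_inv A $ l $ k * det A"
    using cramer_lemma[of l A "matrix_inv A *v axis k 1"] unfolding e matrix_vector_mult_axis .
  then show ?thesis
    using assms by (simp add: invertible_det_nz)
qed

lemma Ck_on_matrix_inv:
  fixes A :: "'v::real_normed_vector \<Rightarrow> complex^'n::finite^'n"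
  assumes "open S" "\<And>i j. Ck_on k S (\<lambda>x. A x $ i $ j)" "\<And>x. x \<in> S \<Longrightarrow> invertible (A x)"
  shows "Ck_on k S (\<lambda>x. matrix_inv (A x) $ l $ m)"
proof -
  have "Ck_on k S (\<lambda>x. det (\<chi> i j. if j = l then axis m 1 $ i else A x $ i $ j) / det (A x))"
  proof (intro Ck_on_divide Ck_on_det assms)
    fix i j
    show "Ck_on k S (\<lambda>x. (\<chi> i j. if j = l then axis m 1 $ i else A x $ i $ j) $ i $ j)"
      using assms(2)[of i j] by (cases "j = l") (auto intro: Ck_on_const)
  qed (use assms(3) in \<open>auto simp: invertible_det_nz\<close>)
  then show ?thesis
    using Ck_on_cong[OF assms(1), of "\<lambda>x. matrix_inv (A x) $ l $ m"
        "\<lambda>x. det (\<chi> i j. if j = l then axis m 1 $ i else A x $ i $ j) / det (A x)"] assms(3)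
    by (simp add: matrix_inv_cramer)
qed

section \<open>Symmetry of second derivatives\<close>

lemma frechet_derivative_bounded_linear:
  assumes "bounded_linear L" "f differentiable (at x)"
  shows "frechet_derivative (\<lambda>y. L (f y)) (at x) v = L (frechet_derivative f (at x) v)"
proof -
  have "((\<lambda>y. L (f y)) has_derivative (\<lambda>v. L (frechet_derivative f (at x) v))) (at x)"
    by (rule bounded_linear.has_derivative[OF assms(1)]) (use assms(2) in \<open>simp add: frechet_derivative_works\<close>)
  from frechet_derivative_at[OF this] show ?thesis by metis
qed

text \<open>The mean value theorem is used twice: for s \<mapsto> f(x + sv + hw) - f(x + sv), and
  then for the v-derivative of f along w.\<close>

lemma second_difference_eq:
  fixes f :: "'v::real_normed_vector \<Rightarrow> real"
  assumes f: "Ck_on 2 S f" and S: "\<And>s t. 0 \<le> s \<Longrightarrow> s \<le> h \<Longrightarrow> 0 \<le> t \<Longrightarrow> t \<le> h \<Longrightarrow> x + s *\<^sub>R v + t *\<^sub>R w \<in> S"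
    and h: "0 < h"
  shows "\<exists>s t. 0 < s \<and> s < h \<and> 0 < t \<and> t < h \<and>
    f (x + h *\<^sub>R v + h *\<^sub>R w) - f (x + h *\<^sub>R v) - f (x + h *\<^sub>R w) + f x =
    h * (h * frechet_derivative (\<lambda>y. frechet_derivative f (at y) v) (at (x + s *\<^sub>R v + t *\<^sub>R w)) w)"
proof -
  let ?D = "\<lambda>y. frechet_derivative f (at y) v"
  have f: "Ck_on (Suc (Suc 0)) S f" using assms(1) by (simp add: numeral_2_eq_2)
  have d1: "((\<lambda>s. f (x + s *\<^sub>R v + t *\<^sub>R w)) has_real_derivative ?D (x + s *\<^sub>R v + t *\<^sub>R w)) (at s)"
    if "0 \<le> s" "s \<le> h" "0 \<le> t" "t \<le> h" for s t
  proof -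
    have "((\<lambda>s. x + s *\<^sub>R v + t *\<^sub>R w) has_derivative (\<lambda>r. r *\<^sub>R v)) (at s)"
      by (auto intro!: derivative_eq_intros)
    from has_derivative_compose[OF this Ck_on_SucD(1)[OF f S[OF that]]]
    have "((\<lambda>s. f (x + s *\<^sub>R v + t *\<^sub>R w)) has_derivative (\<lambda>r. frechet_derivative f (at (x + s *\<^sub>R v + t *\<^sub>R w)) (r *\<^sub>R v))) (at s)" .
    then show ?thesis
      by (rule has_derivative_imp_has_field_derivative)
        (simp add: linear_scale[OF has_derivative_linear[OF Ck_on_SucD(1)[OF f S[OF that]]]])
  qed
  have "\<exists>s>0. s < h \<and> (f (x + h *\<^sub>R v + h *\<^sub>R w) - f (x + h *\<^sub>R v + 0 *\<^sub>R w)) - (f (x + 0 *\<^sub>R v + h *\<^sub>R w) - f (x + 0 *\<^sub>R v + 0 *\<^sub>R w))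
     = (h - 0) * (?D (x + s *\<^sub>R v + h *\<^sub>R w) - ?D (x + s *\<^sub>R v + 0 *\<^sub>R w))"
    by (rule MVT2[OF h]) (use h in \<open>intro DERIV_diff d1; simp\<close>)
  then obtain s where s: "0 < s" "s < h"
    "f (x + h *\<^sub>R v + h *\<^sub>R w) - f (x + h *\<^sub>R v) - f (x + h *\<^sub>R w) + f x = h * (?D (x + s *\<^sub>R v + h *\<^sub>R w) - ?D (x + s *\<^sub>R v + 0 *\<^sub>R w))"
    by auto
  have d2: "((\<lambda>t. ?D (x + s *\<^sub>R v + t *\<^sub>R w)) has_real_derivative frechet_derivative ?D (at (x + s *\<^sub>R v + t *\<^sub>R w)) w) (at t)"
    if "0 \<le> t" "t \<le> h" for t
  proof -
    have D: "(?D has_derivative frechet_derivative ?D (at (x + s *\<^sub>R v + t *\<^sub>R w))) (at (x + s *\<^sub>R v + t *\<^sub>R w))"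
      by (rule Ck_on_SucD(1)[OF Ck_on_SucD(2)[OF f]]) (use S s that in auto)
    have "((\<lambda>t. x + s *\<^sub>R v + t *\<^sub>R w) has_derivative (\<lambda>r. r *\<^sub>R w)) (at t)"
      by (auto intro!: derivative_eq_intros)
    from has_derivative_compose[OF this D]
    have "((\<lambda>t. ?D (x + s *\<^sub>R v + t *\<^sub>R w)) has_derivative (\<lambda>r. frechet_derivative ?D (at (x + s *\<^sub>R v + t *\<^sub>R w)) (r *\<^sub>R w))) (at t)" .
    then show ?thesis
      by (rule has_derivative_imp_has_field_derivative) (simp add: linear_scale[OF has_derivative_linear[OF D]])
  qed
  obtain t where "0 < t" "t < h" "?D (x + s *\<^sub>R v + h *\<^sub>R w) - ?D (x + s *\<^sub>R v + 0 *\<^sub>R w)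
     = (h - 0) * frechet_derivative ?D (at (x + s *\<^sub>R v + t *\<^sub>R w)) w"
    using MVT2[OF h d2] by auto
  then show ?thesis using s by auto
qed

text \<open>The second difference is symmetric in v and w and equals h^2 times a mixed derivative at
  a nearby point, in either order. Continuity at x then identifies the two mixed
  derivatives.\<close>

lemma symmetric_second_derivative_real:
  fixes f :: "'v::real_normed_vector \<Rightarrow> real"
  assumes S: "open S" and f: "Ck_on 2 S f" and x: "x \<in> S"
  shows "frechet_derivative (\<lambda>y. frechet_derivative f (at y) v) (at x) w =
         frechet_derivative (\<lambda>y. frechet_derivative f (at y) w) (at x) v"
proof -
  have f': "Ck_on (Suc (Suc 0)) S f" using f by (simp add: numeral_2_eq_2)
  let ?a = "\<lambda>v w y. frechet_derivative (\<lambda>y. frechet_derivative f (at y) v) (at y) w"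
  have cont: "continuous (at x) (?a v w)" for v w
    using Ck_on_imp_continuous_on[OF Ck_on_SucD(2)[OF Ck_on_SucD(2)[OF f']]] S x
    by (simp add: continuous_on_eq_continuous_at)
  have "\<bar>?a v w x - ?a w v x\<bar> \<le> e" if e: "e > 0" for e
  proof -
    from cont[of v w] e obtain d1 where d1: "d1 > 0" "\<And>y. dist y x < d1 \<Longrightarrow> \<bar>?a v w y - ?a v w x\<bar> < e / 2"
      unfolding continuous_at_eps_delta by (metis dist_real_def half_gt_zero)
    from cont[of w v] e obtain d2 where d2: "d2 > 0" "\<And>y. dist y x < d2 \<Longrightarrow> \<bar>?a w v y - ?a w v x\<bar> < e / 2"
      unfolding continuous_at_eps_delta by (metis dist_real_def half_gt_zero)
    obtain d3 where d3: "d3 > 0" "ball x d3 \<subseteq> S" using S x open_contains_ball by blast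
    define d where "d = min d1 (min d2 d3)"
    \<comment> \<open>With this h the parallelogram spanned by hv and hw stays within distance d of
      x; the summand 1 covers v = w = 0.\<close>
    define h where "h = d / (norm v + norm w + 1)"
    have pos: "norm v + norm w + 1 > 0" by (simp add: add_nonneg_pos)
    have h: "h > 0" using d1(1) d2(1) d3(1) pos by (simp add: h_def d_def)
    have near: "dist (x + s *\<^sub>R v + t *\<^sub>R w) x < d" "dist (x + s *\<^sub>R w + t *\<^sub>R v) x < d"
      if "0 \<le> s" "s \<le> h" "0 \<le> t" "t \<le> h" for s t
    proof -
      have *: "norm (s *\<^sub>R v' + t *\<^sub>R w') < d" if "norm v' + norm w' = norm v + norm w" for v' w' :: 'v
      proof -
        have "norm (s *\<^sub>R v' + t *\<^sub>R w') \<le> s * norm v' + t * norm w'"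
          using norm_triangle_ineq[of "s *\<^sub>R v'" "t *\<^sub>R w'"] \<open>0 \<le> s\<close> \<open>0 \<le> t\<close> by simp
        also have "\<dots> \<le> h * norm v' + h * norm w'"
          using \<open>s \<le> h\<close> \<open>t \<le> h\<close> by (intro add_mono mult_right_mono) auto
        also have "\<dots> = h * (norm v + norm w)" by (simp add: that flip: distrib_left)
        also have "\<dots> < h * (norm v + norm w + 1)" using h by simp
        also have "\<dots> = d" using pos by (simp add: h_def)
        finally show ?thesis .
      qed
      show "dist (x + s *\<^sub>R v + t *\<^sub>R w) x < d" "dist (x + s *\<^sub>R w + t *\<^sub>R v) x < d"
        using *[of v w] *[of w v] by (simp_all add: dist_norm add.assoc add.commute)
    qed
    have inS: "y \<in> S" if "dist y x < d" for y
      using that d3(2) by (auto simp: d_def dist_commute)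
    obtain s t where st: "0 < s" "s < h" "0 < t" "t < h"
      "f (x + h *\<^sub>R v + h *\<^sub>R w) - f (x + h *\<^sub>R v) - f (x + h *\<^sub>R w) + f x = h * (h * ?a v w (x + s *\<^sub>R v + t *\<^sub>R w))"
      using second_difference_eq[OF f _ h, of x v w] inS near(1) by blast
    obtain s' t' where st': "0 < s'" "s' < h" "0 < t'" "t' < h"
      "f (x + h *\<^sub>R w + h *\<^sub>R v) - f (x + h *\<^sub>R w) - f (x + h *\<^sub>R v) + f x = h * (h * ?a w v (x + s' *\<^sub>R w + t' *\<^sub>R v))"
      using second_difference_eq[OF f _ h, of x w v] inS near(2) by blast
    have "x + h *\<^sub>R w + h *\<^sub>R v = x + h *\<^sub>R v + h *\<^sub>R w" by simp
    with st(5) st'(5) have "h * (h * ?a v w (x + s *\<^sub>R v + t *\<^sub>R w)) = h * (h * ?a w v (x + s' *\<^sub>R w + t' *\<^sub>R v))"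
      by (simp only:)
    then have eq: "?a v w (x + s *\<^sub>R v + t *\<^sub>R w) = ?a w v (x + s' *\<^sub>R w + t' *\<^sub>R v)"
      using h by simp
    have "dist (x + s *\<^sub>R v + t *\<^sub>R w) x < d1" "dist (x + s' *\<^sub>R w + t' *\<^sub>R v) x < d2"
      using near(1)[of s t] near(2)[of s' t'] st st' by (auto simp: d_def)
    note n = d1(2)[OF this(1)] d2(2)[OF this(2)]
    show ?thesis using n(1) n(2)[folded eq] by (simp only: abs_less_iff abs_le_iff) linarith
  qed
  then have "\<bar>?a v w x - ?a w v x\<bar> \<le> 0" by (rule field_le_epsilon[of _ 0, simplified])
  then show ?thesis by simp
qed

lemma symmetric_second_derivative:
  fixes f :: "'v::real_normed_vector \<Rightarrow> 'w::euclidean_space"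
  assumes S: "open S" and f: "Ck_on 2 S f" and x: "x \<in> S"
  shows "frechet_derivative (\<lambda>y. frechet_derivative f (at y) v) (at x) w =
         frechet_derivative (\<lambda>y. frechet_derivative f (at y) w) (at x) v"
proof (rule euclidean_eqI)
  fix b :: 'w assume "b \<in> Basis"
  have L: "bounded_linear (\<lambda>y :: 'w. y \<bullet> b)" by (rule bounded_linear_inner_left)
  have f': "Ck_on (Suc (Suc 0)) S f" using f by (simp add: numeral_2_eq_2)
  have diff: "f differentiable (at y)" "(\<lambda>y. frechet_derivative f (at y) v) differentiable (at y)" if "y \<in> S" for y v
    using f' that by auto
  have fb: "Ck_on 2 S (\<lambda>y. f y \<bullet> b)" by (rule Ck_on_bounded_linear[OF L S f])
  have D2: "frechet_derivative (\<lambda>y. frechet_derivative (\<lambda>y. f y \<bullet> b) (at y) v) (at x) w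
     = frechet_derivative (\<lambda>y. frechet_derivative f (at y) v) (at x) w \<bullet> b" for v w
  proof -
    have "((\<lambda>y. frechet_derivative f (at y) v \<bullet> b) has_derivative (\<lambda>w. frechet_derivative (\<lambda>y. frechet_derivative f (at y) v) (at x) w \<bullet> b)) (at x)"
      by (rule bounded_linear.has_derivative[OF L]) (use diff(2)[OF x] in \<open>simp add: frechet_derivative_works\<close>)
    then have "((\<lambda>y. frechet_derivative (\<lambda>y. f y \<bullet> b) (at y) v) has_derivative (\<lambda>w. frechet_derivative (\<lambda>y. frechet_derivative f (at y) v) (at x) w \<bullet> b)) (at x)"
      by (rule has_derivative_transform_within_open[OF _ S x])
        (use frechet_derivative_bounded_linear[OF L diff(1)] in auto)
    from frechet_derivative_at[OF this] show ?thesis by metis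
  qed
  show "frechet_derivative (\<lambda>y. frechet_derivative f (at y) v) (at x) w \<bullet> b =
        frechet_derivative (\<lambda>y. frechet_derivative f (at y) w) (at x) v \<bullet> b"
    using symmetric_second_derivative_real[OF S fb x, of v w] by (simp only: D2)
qed

section \<open>Bump functions\<close>

text \<open>The powers of t in the denominator make the family closed under differentiation up to
  linear combinations; m = 0 is the usual flat function exp(-1/t).\<close>

definition bump_aux :: "nat \<Rightarrow> real \<Rightarrow> real" where
  "bump_aux m t = (if 0 < t then exp (- inverse t) / t ^ m else 0)"

text \<open>At 0 the right-hand difference quotient is exp(-1/y) / y^(m+1), which tends to 0 because
  the exponential beats every power of 1/y.\<close>

lemma has_derivative_bump_aux:
  "(bump_aux m has_derivative (\<lambda>v. v * (bump_aux (m + 2) t - real m * bump_aux (m + 1) t))) (at t)"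
proof -
  have "(bump_aux m has_real_derivative (bump_aux (m + 2) t - real m * bump_aux (m + 1) t)) (at t)"
  proof (cases t "0 :: real" rule: linorder_cases)
    case less
    have "((\<lambda>_. 0) has_real_derivative 0) (at t)" by simp
    then show ?thesis
      by (rule DERIV_cong[OF DERIV_cong_ev[THEN iffD1, OF refl _ refl, rotated]])
        (use less in \<open>auto simp: bump_aux_def eventually_at intro!: exI[of _ "- t"] eventually_nhds_in_open[of "{..<0}", THEN eventually_mono]\<close>)
  next
    case greater
    have "((\<lambda>t. exp (- inverse t) / t ^ m) has_real_derivative (bump_aux (m + 2) t - real m * bump_aux (m + 1) t)) (at t)"
      using greater
      by (auto intro!: derivative_eq_intros simp: bump_aux_def field_simps power2_eq_square)
        (cases m; simp add: field_simps)
    then show ?thesis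
      by (rule DERIV_cong_ev[THEN iffD1, OF refl _ refl, rotated])
        (use greater in \<open>auto simp: bump_aux_def intro!: eventually_nhds_in_open[of "{0<..}", THEN eventually_mono]\<close>)
  next
    case equal
    have "((\<lambda>y. bump_aux m y / y) \<longlongrightarrow> 0) (at_right 0)"
    proof -
      have "((\<lambda>y :: real. inverse y ^ (m + 1) / exp (inverse y)) \<longlongrightarrow> 0) (at_right 0)"
        by (rule filterlim_compose[OF tendsto_power_div_exp_0 filterlim_inverse_at_top_right])
      then show ?thesis
        by (rule Lim_transform_eventually)
          (auto simp: eventually_at_right_field bump_aux_def exp_minus field_simps intro!: exI[of _ 1])
    qed
    moreover have "((\<lambda>y. bump_aux m y / y) \<longlongrightarrow> 0) (at_left 0)"
      by (rule tendsto_eventually) (auto simp: eventually_at_left_field bump_aux_def intro!: exI[of _ "-1"])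
    ultimately have "((\<lambda>y. bump_aux m y / y) \<longlongrightarrow> 0) (at 0)"
      using filterlim_split_at by blast
    then show ?thesis using equal by (simp add: has_field_derivative_iff bump_aux_def)
  qed
  then show ?thesis
    by (rule has_derivative_eq_rhs[OF has_field_derivative_imp_has_derivative]) (simp add: fun_eq_iff)
qed

lemma Ck_on_bump_aux: "Ck_on k UNIV (bump_aux m)"
proof (induction k arbitrary: m)
  case 0
  then show ?case
    by (simp add: continuous_on_eq_continuous_at has_derivative_continuous[OF has_derivative_bump_aux])
next
  case (Suc k)
  show ?case
    by (rule Ck_on_SucI[OF open_UNIV has_derivative_bump_aux])
      (intro Ck_on_mult Ck_on_diff Ck_on_const Suc.IH open_UNIV)
qed

text \<open>The squared distance, unlike the distance, is smooth at the centre.\<close>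

definition bump :: "'v::euclidean_space \<Rightarrow> real \<Rightarrow> 'v \<Rightarrow> real" where
  "bump a r x = bump_aux 0 (r\<^sup>2 - (x - a) \<bullet> (x - a))"

lemma Ck_on_bump: "Ck_on k UNIV (bump a r)"
proof -
  have "Ck_on k UNIV (\<lambda>x. r\<^sup>2 - (x - a) \<bullet> (x - a))"
    by (intro Ck_on_diff Ck_on_inner Ck_on_const open_UNIV Ck_on_linear bounded_linear_ident)
  from Ck_on_compose[OF open_UNIV this open_UNIV Ck_on_bump_aux[of k 0]]
  have "Ck_on k UNIV (\<lambda>x. bump_aux 0 (r\<^sup>2 - (x - a) \<bullet> (x - a)))" by simp
  then show ?thesis by (simp add: bump_def[abs_def])
qed

lemma bump_nonneg: "0 \<le> bump a r x"
  by (simp add: bump_def bump_aux_def)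

lemma bump_pos_iff: "0 \<le> r \<Longrightarrow> 0 < bump a r x \<longleftrightarrow> dist x a < r"
proof -
  assume "0 \<le> r"
  then have "(x - a) \<bullet> (x - a) < r\<^sup>2 \<longleftrightarrow> dist x a < r"
    unfolding dist_norm dot_square_norm using abs_le_square_iff[of r "norm (x - a)"] by (simp add: not_le[symmetric])
  then show ?thesis by (simp add: bump_def bump_aux_def)
qed

lemma bump_eq_0: "0 \<le> r \<Longrightarrow> x \<notin> ball a r \<Longrightarrow> bump a r x = 0"
  using bump_pos_iff[of r a x] bump_nonneg[of a r x] by (auto simp: dist_commute)

section \<open>Holomorphic maps in several variables\<close>

text \<open>The scalar counterpart of \<open>holomorphic_map_on\<close>. Continuity of the
  derivative is not part of it and has to be proved.\<close>

definition holo_fun_on :: "(complex^'n) set \<Rightarrow> (complex^'n::finite \<Rightarrow> complex) \<Rightarrow> bool" where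
  "holo_fun_on S f \<longleftrightarrow> (\<forall>z\<in>S. \<exists>D. (f has_derivative D) (at z) \<and> (\<forall>c v. D (c *s v) = c * D v))"

lemma holo_fun_onD:
  assumes "holo_fun_on S f" "z \<in> S"
  shows "(f has_derivative frechet_derivative f (at z)) (at z)"
    and "frechet_derivative f (at z) (c *s v) = c * frechet_derivative f (at z) v"
  using assms unfolding holo_fun_on_def by (metis frechet_derivative_at)+

lemma norm_smult_vec: "norm (c *s v) = norm c * norm (v :: complex^'n::finite)"
  by (simp add: norm_vec_def L2_set_def norm_mult power_mult_distrib flip: sum_distrib_left)
    (simp add: real_sqrt_mult)

lemma bounded_linear_smult_left: "bounded_linear (\<lambda>c. c *s (v :: complex^'n::finite))"
  by (rule bounded_linear_intro[where K = "norm v"])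
    (auto simp: vec_eq_iff algebra_simps norm_smult_vec)

definition unit_circle :: "real \<Rightarrow> complex" where
  "unit_circle t = exp (2 * of_real pi * \<i> * of_real t)"

lemma unit_circle_simps [simp]: "norm (unit_circle t) = 1" "unit_circle t \<noteq> 0"
  by (simp_all add: unit_circle_def norm_exp_eq_Re)

lemma continuous_on_unit_circle [continuous_intros]:
  "continuous_on A f \<Longrightarrow> continuous_on A (\<lambda>x. unit_circle (f x))"
  unfolding unit_circle_def by (intro continuous_intros)

text \<open>Cauchy's formula for the first derivative of the restriction c \<mapsto> f(z + cv) to a
  complex line. It expresses the derivative by values of f alone, which is how regularity is
  gained.\<close>

lemma holo_fun_on_derivative_integral:
  fixes f :: "complex^'n::finite \<Rightarrow> complex"
  assumes S: "open S" and f: "holo_fun_on S f" and r: "r > 0" and sub: "cball z (r * norm v) \<subseteq> S"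
  shows "frechet_derivative f (at z) v = integral {0..1} (\<lambda>t. f (z + (r * unit_circle t) *s v) / (r * unit_circle t))"
proof -
  define g where "g = (\<lambda>c. f (z + c *s v))"
  have inS: "z + c *s v \<in> S" if "norm c \<le> r" for c
    using sub that by (auto simp: subset_iff dist_norm norm_smult_vec mult_right_mono)
  have Dg: "(g has_field_derivative frechet_derivative f (at (z + c *s v)) v) (at c)" if "norm c \<le> r" for c
  proof -
    have "((\<lambda>c. z + c *s v) has_derivative (\<lambda>c. c *s v)) (at c)"
      using bounded_linear_imp_has_derivative[OF bounded_linear_smult_left[of v]]
      by (auto intro!: derivative_eq_intros)
    from has_derivative_compose[OF this holo_fun_onD(1)[OF f inS[OF that]]]
    have "(g has_derivative (\<lambda>c'. frechet_derivative f (at (z + c *s v)) (c' *s v))) (at c)"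
      by (simp add: g_def)
    then show ?thesis
      by (rule has_derivative_imp_has_field_derivative) (simp add: holo_fun_onD(2)[OF f inS[OF that]])
  qed
  have "((\<lambda>u. g u / (u - 0) ^ Suc 1) has_contour_integral ((2 * pi * \<i>) / fact 1 * (deriv ^^ 1) g 0)) (circlepath 0 r)"
  proof (rule Cauchy_has_contour_integral_higher_derivative_circlepath)
    show "continuous_on (cball 0 r) g"
      by (rule continuous_at_imp_continuous_on, rule ballI, rule DERIV_isCont[OF Dg]) simp
    show "g holomorphic_on ball 0 r"
      unfolding holomorphic_on_def field_differentiable_def
      by (rule ballI, rule exI, rule has_field_derivative_at_within, rule Dg) simp
  qed (use r in auto)
  moreover have "deriv g 0 = frechet_derivative f (at z) v"
    using DERIV_imp_deriv[OF Dg[of 0]] r by simp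
  ultimately have "((\<lambda>u. g u / u\<^sup>2) has_contour_integral (2 * pi * \<i> * frechet_derivative f (at z) v)) (circlepath 0 r)"
    by (simp add: numeral_2_eq_2)
  then have "((\<lambda>t. g (circlepath 0 r t) / (circlepath 0 r t)\<^sup>2 * vector_derivative (circlepath 0 r) (at t within {0..1}))
      has_integral (2 * pi * \<i> * frechet_derivative f (at z) v)) {0..1}"
    by (simp add: has_contour_integral_def)
  moreover have "g (circlepath 0 r t) / (circlepath 0 r t)\<^sup>2 * vector_derivative (circlepath 0 r) (at t within {0..1})
      = 2 * pi * \<i> * (g (r * unit_circle t) / (r * unit_circle t))" if "t \<in> {0..1}" for t
  proof -
    have "circlepath 0 r t = r * unit_circle t"
      by (simp add: circlepath unit_circle_def)
    moreover have "vector_derivative (circlepath 0 r) (at t within {0..1}) = 2 * pi * \<i> * (r * unit_circle t)"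
      using that by (subst vector_derivative_circlepath01) (auto simp: unit_circle_def)
    ultimately show ?thesis using r by (simp add: power2_eq_square)
  qed
  ultimately have "((\<lambda>t. 2 * pi * \<i> * (g (r * unit_circle t) / (r * unit_circle t)))
      has_integral (2 * pi * \<i> * frechet_derivative f (at z) v)) {0..1}"
    by (rule has_integral_eq[rotated])
  from has_integral_mult_right[OF this, of "1 / (2 * pi * \<i>)"]
  have "((\<lambda>t. g (r * unit_circle t) / (r * unit_circle t)) has_integral frechet_derivative f (at z) v) {0..1}"
    by simp
  then show ?thesis by (simp add: integral_unique g_def)
qed

text \<open>A single radius for all centres near z0 keeps the contour fixed, so that the integral
  formula can be differentiated in z.\<close>

lemma holo_fun_on_uniform_radius:
  fixes v :: "complex^'n::finite"
  assumes "open S" "z0 \<in> S"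
  shows "\<exists>r>0. (\<forall>z\<in>ball z0 r. cball z (r * norm v) \<subseteq> S) \<and> ball z0 r \<subseteq> S"
proof -
  obtain d where d: "d > 0" "ball z0 d \<subseteq> S" using assms open_contains_ball by blast
  \<comment> \<open>This makes r + r * norm v = d, the largest distance of the centre plus the
    radius of the circle.\<close>
  define r where "r = d / (norm v + 1)"
  have pos: "norm v + 1 > 0" by (simp add: add_nonneg_pos)
  have "r * (norm v + 1) = d" using pos by (simp add: r_def)
  then have r: "r > 0" "r + r * norm v = d" using d pos unfolding distrib_left by (simp_all add: r_def)
  show ?thesis
  proof (intro exI conjI ballI)
    show "r > 0" by fact
    show "cball z (r * norm v) \<subseteq> S" if "z \<in> ball z0 r" for z
    proof
      fix y assume "y \<in> cball z (r * norm v)"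
      then have "dist z0 y < d" using that r(2) dist_triangle[of z0 y z] by simp
      then show "y \<in> S" using d(2) by auto
    qed
    show "ball z0 r \<subseteq> S"
      using d r by (smt (verit, best) mem_ball norm_ge_zero subset_iff zero_le_mult_iff)
  qed
qed

text \<open>The integral formula is a parameter integral with jointly continuous integrand, since f
  is continuous.\<close>

lemma holo_fun_on_continuous_derivative:
  fixes f :: "complex^'n::finite \<Rightarrow> complex"
  assumes S: "open S" and f: "holo_fun_on S f"
  shows "continuous_on S (\<lambda>z. frechet_derivative f (at z) v)"
proof (rule continuous_at_imp_continuous_on, rule ballI)
  fix z0 assume "z0 \<in> S"
  then obtain r where r: "r > 0" "\<And>z. z \<in> ball z0 r \<Longrightarrow> cball z (r * norm v) \<subseteq> S" "ball z0 r \<subseteq> S"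
    using holo_fun_on_uniform_radius[OF S, of z0 v] by blast
  have contf: "continuous_on S f"
    by (rule continuous_at_imp_continuous_on, rule ballI, rule has_derivative_continuous[OF holo_fun_onD(1)[OF f]])
  have "continuous_on (ball z0 r) (\<lambda>z. integral (cbox 0 1) (\<lambda>t. f (z + (r * unit_circle t) *s v) / (r * unit_circle t)))"
  proof (rule integral_continuous_on_param, unfold case_prod_beta)
    have "continuous_on (ball z0 r \<times> cbox 0 1) (\<lambda>x. fst x + (r * unit_circle (snd x)) *s v)"
      by (intro continuous_intros bounded_linear.continuous_on[OF bounded_linear_smult_left])
    moreover have "(\<lambda>x. fst x + (r * unit_circle (snd x)) *s v) ` (ball z0 r \<times> cbox 0 1) \<subseteq> S"
      using r by (auto simp: norm_smult_vec norm_mult dist_norm subset_iff)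
    ultimately have "continuous_on (ball z0 r \<times> cbox 0 1) (\<lambda>x. f (fst x + (r * unit_circle (snd x)) *s v))"
      by (rule continuous_on_compose2[OF contf])
    then show "continuous_on (ball z0 r \<times> cbox 0 1) (\<lambda>x. f (fst x + (r * unit_circle (snd x)) *s v) / (r * unit_circle (snd x)))"
      using r(1) by (intro continuous_intros) auto
  qed
  then have "continuous_on (ball z0 r) (\<lambda>z. frechet_derivative f (at z) v)"
    by (rule continuous_on_eq) (simp add: holo_fun_on_derivative_integral[OF S f r(1) r(2)])
  then show "isCont (\<lambda>z. frechet_derivative f (at z) v) z0"
    using r(1) by (simp add: continuous_on_eq_continuous_at)
qed

text \<open>Differentiation under the integral sign in Cauchy's formula. The Leibniz rule asks for a
  jointly continuous derivative of the integrand, supplied by the continuity just shown; complex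
  linearity passes through the integral.\<close>

lemma holo_fun_on_derivative:
  fixes f :: "complex^'n::finite \<Rightarrow> complex"
  assumes S: "open S" and f: "holo_fun_on S f"
  shows "holo_fun_on S (\<lambda>z. frechet_derivative f (at z) v)"
  unfolding holo_fun_on_def
proof
  fix z0 assume z0: "z0 \<in> S"
  then obtain r where r: "r > 0" "\<And>z. z \<in> ball z0 r \<Longrightarrow> cball z (r * norm v) \<subseteq> S" "ball z0 r \<subseteq> S"
    using holo_fun_on_uniform_radius[OF S, of z0 v] by blast
  let ?p = "\<lambda>z t. z + (r * unit_circle t) *s v"
  have pS: "?p z t \<in> S" if "z \<in> ball z0 r" for z t
    using r(1) r(2)[OF that] by (auto simp: norm_smult_vec norm_mult dist_norm subset_iff)
  have contf: "continuous_on S f"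
    by (rule continuous_at_imp_continuous_on, rule ballI, rule has_derivative_continuous[OF holo_fun_onD(1)[OF f]])
  have contp: "continuous_on (ball z0 r \<times> cbox 0 1) (\<lambda>x. ?p (fst x) (snd x))"
    by (intro continuous_intros bounded_linear.continuous_on[OF bounded_linear_smult_left])
  \<comment> \<open>The derivative is packaged as a bounded linear map, since its continuity and its
    integral are taken in the space of such maps.\<close>
  define D where "D = (\<lambda>z t. Blinfun (\<lambda>w. frechet_derivative f (at (?p z t)) w / (r * unit_circle t)))"
  have D: "blinfun_apply (D z t) w = frechet_derivative f (at (?p z t)) w / (r * unit_circle t)" if "z \<in> ball z0 r" for z t w
  proof -
    have "bounded_linear (\<lambda>w. frechet_derivative f (at (?p z t)) w / (r * unit_circle t))"
      by (intro bounded_linear_divide[THEN bounded_linear_compose] has_derivative_bounded_linear[OF holo_fun_onD(1)[OF f pS[OF that]]])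
    then show ?thesis unfolding D_def by (simp add: bounded_linear_Blinfun_apply)
  qed
  have contD: "continuous_on (ball z0 r \<times> cbox 0 1) (\<lambda>(z, t). D z t)"
    unfolding case_prod_beta
  proof (rule continuous_on_blinfun_componentwise)
    fix w :: "complex^'n"
    have "continuous_on (ball z0 r \<times> cbox 0 1) (\<lambda>x. frechet_derivative f (at (?p (fst x) (snd x))) w)"
      by (rule continuous_on_compose2[OF holo_fun_on_continuous_derivative[OF S f] contp]) (use pS in auto)
    then have "continuous_on (ball z0 r \<times> cbox 0 1) (\<lambda>x. frechet_derivative f (at (?p (fst x) (snd x))) w / (r * unit_circle (snd x)))"
      using r(1) by (intro continuous_intros) auto
    then show "continuous_on (ball z0 r \<times> cbox 0 1) (\<lambda>x. blinfun_apply (D (fst x) (snd x)) w)"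
      by (rule continuous_on_eq) (auto simp: D)
  qed
  have intf: "(\<lambda>t. f (?p z t) / (r * unit_circle t)) integrable_on cbox 0 1" if "z \<in> ball z0 r" for z
  proof (rule integrable_continuous)
    have "continuous_on (cbox 0 1) (\<lambda>t. f (?p z t))"
      by (rule continuous_on_compose2[OF contf])
        (use pS[OF that] in \<open>auto intro!: continuous_intros bounded_linear.continuous_on[OF bounded_linear_smult_left]\<close>)
    then show "continuous_on (cbox 0 1) (\<lambda>t. f (?p z t) / (r * unit_circle t))"
      using r(1) by (intro continuous_intros) auto
  qed
  have z0': "z0 \<in> ball z0 r" using r(1) by simp
  have "((\<lambda>z. integral (cbox 0 1) (\<lambda>t. f (?p z t) / (r * unit_circle t))) has_derivative blinfun_apply (integral (cbox 0 1) (D z0))) (at z0 within ball z0 r)"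
  proof (rule leibniz_rule[OF _ intf contD z0' convex_ball])
    fix z t assume z: "z \<in> ball z0 r"
    have "((\<lambda>z. ?p z t) has_derivative (\<lambda>w. w)) (at z within ball z0 r)"
      by (auto intro!: derivative_eq_intros)
    from has_derivative_compose[OF this holo_fun_onD(1)[OF f pS[OF z]]]
    have "((\<lambda>z. f (?p z t) / (r * unit_circle t)) has_derivative (\<lambda>w. frechet_derivative f (at (?p z t)) w / (r * unit_circle t))) (at z within ball z0 r)"
      by (rule bounded_linear.has_derivative[OF bounded_linear_divide])
    then show "((\<lambda>z. f (?p z t) / (r * unit_circle t)) has_derivative blinfun_apply (D z t)) (at z within ball z0 r)"
      by (simp add: D[OF z, abs_def])
  qed
  then have "((\<lambda>z. integral (cbox 0 1) (\<lambda>t. f (?p z t) / (r * unit_circle t))) has_derivative blinfun_apply (integral (cbox 0 1) (D z0))) (at z0)"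
    using r(1) by (simp add: at_within_open[OF z0'])
  then have "((\<lambda>z. frechet_derivative f (at z) v) has_derivative blinfun_apply (integral (cbox 0 1) (D z0))) (at z0)"
    by (rule has_derivative_transform_within_open[OF _ open_ball z0'])
      (simp add: holo_fun_on_derivative_integral[OF S f r(1) r(2)])
  moreover have "blinfun_apply (integral (cbox 0 1) (D z0)) (c *s w) = c * blinfun_apply (integral (cbox 0 1) (D z0)) w" for c w
  proof -
    have int: "D z0 integrable_on cbox 0 1"
    proof (rule integrable_continuous)
      have c: "continuous_on (cbox 0 1) (\<lambda>t :: real. (z0, t))"
        by (intro continuous_on_Pair continuous_on_const continuous_on_id)
      have "(\<lambda>t :: real. (z0, t)) ` cbox 0 1 \<subseteq> ball z0 r \<times> cbox 0 1" using r(1) by auto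
      from continuous_on_compose2[OF contD c this] show "continuous_on (cbox 0 1) (D z0)" by simp
    qed
    have ap: "blinfun_apply (integral (cbox 0 1) (D z0)) w = integral (cbox 0 1) (\<lambda>t. blinfun_apply (D z0 t) w)" for w
      using integral_linear[OF int, of "\<lambda>d. blinfun_apply d w"] by (simp add: o_def blinfun.bounded_linear_left)
    show ?thesis
      unfolding ap D[OF z0'] by (simp add: holo_fun_onD(2)[OF f pS[OF z0']] flip: integral_mult_right)
  qed
  ultimately show "\<exists>D. ((\<lambda>z. frechet_derivative f (at z) v) has_derivative D) (at z0) \<and> (\<forall>c v. D (c *s v) = c * D v)"
    by blast
qed

text \<open>Directional derivatives of holomorphic functions are holomorphic, so the argument
  iterates.\<close>

lemma holo_fun_on_smooth:
  assumes S: "open S" and f: "holo_fun_on S f"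
  shows "smooth_on S f"
proof -
  have "Ck_on k S f" for k
    using f
  proof (induction k arbitrary: f)
    case 0
    then show ?case
      unfolding Ck_on.simps
      by (intro continuous_at_imp_continuous_on ballI has_derivative_continuous[OF holo_fun_onD(1)])
  next
    case (Suc k)
    show ?case
      by (rule Ck_on_SucI[OF S holo_fun_onD(1)[OF Suc.prems]]) (auto intro: Suc.IH holo_fun_on_derivative[OF S Suc.prems])
  qed
  then show ?thesis by (simp add: smooth_on_def)
qed

section \<open>Wirtinger calculus\<close>

lemma del_fun_eq: "(F has_derivative D) (at z) \<Longrightarrow> del_fun F z u = (D u - \<i> * D (\<i> *s u)) / 2"
  and delbar_fun_eq: "(F has_derivative D) (at z) \<Longrightarrow> delbar_fun F z u = (D u + \<i> * D (\<i> *s u)) / 2"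
  unfolding del_fun_def delbar_fun_def by (metis frechet_derivative_at)+

lemma del_fun_cong:
  assumes "open S" "z \<in> S" "\<And>w. w \<in> S \<Longrightarrow> F w = G w"
  shows "del_fun F z u = del_fun G z u" "delbar_fun F z u = delbar_fun G z u"
proof -
  have "(F has_derivative D) (at z) \<longleftrightarrow> (G has_derivative D) (at z)" for D
    using has_derivative_transform_within_open[OF _ assms(1,2), of F D UNIV G]
      has_derivative_transform_within_open[OF _ assms(1,2), of G D UNIV F] assms(3) by auto
  then have "frechet_derivative F (at z) = frechet_derivative G (at z)"
    by (simp add: frechet_derivative_def)
  then show "del_fun F z u = del_fun G z u" "delbar_fun F z u = delbar_fun G z u"
    by (simp_all add: del_fun_def delbar_fun_def)
qed

lemmas wirtinger_cong = del_fun_cong[where u = "axis i 1" for i, folded wirtinger_def wirtinger_bar_def]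

lemma del_fun_const [simp]: "del_fun (\<lambda>_. c) z u = 0" "delbar_fun (\<lambda>_. c) z u = 0"
  using del_fun_eq[OF has_derivative_const] delbar_fun_eq[OF has_derivative_const] by auto

lemma del_fun_sum:
  assumes "\<And>i. i \<in> I \<Longrightarrow> F i differentiable (at z)"
  shows "del_fun (\<lambda>w. \<Sum>i\<in>I. F i w) z u = (\<Sum>i\<in>I. del_fun (F i) z u)"
    "delbar_fun (\<lambda>w. \<Sum>i\<in>I. F i w) z u = (\<Sum>i\<in>I. delbar_fun (F i) z u)"
proof -
  have D: "((\<lambda>w. \<Sum>i\<in>I. F i w) has_derivative (\<lambda>u. \<Sum>i\<in>I. frechet_derivative (F i) (at z) u)) (at z)"
    by (rule has_derivative_sum) (use assms frechet_derivative_works in blast)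
  show "del_fun (\<lambda>w. \<Sum>i\<in>I. F i w) z u = (\<Sum>i\<in>I. del_fun (F i) z u)"
    "delbar_fun (\<lambda>w. \<Sum>i\<in>I. F i w) z u = (\<Sum>i\<in>I. delbar_fun (F i) z u)"
    unfolding del_fun_eq[OF D] delbar_fun_eq[OF D] unfolding del_fun_def delbar_fun_def
    by (simp_all add: sum_divide_distrib sum_distrib_left sum_subtractf sum.distrib diff_divide_distrib add_divide_distrib)
qed

lemma del_fun_add:
  assumes "F differentiable (at z)" "G differentiable (at z)"
  shows "del_fun (\<lambda>w. F w + G w) z u = del_fun F z u + del_fun G z u"
    "delbar_fun (\<lambda>w. F w + G w) z u = delbar_fun F z u + delbar_fun G z u"
proof -
  note D = has_derivative_add[OF assms[unfolded frechet_derivative_works]]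
  show "del_fun (\<lambda>w. F w + G w) z u = del_fun F z u + del_fun G z u"
    "delbar_fun (\<lambda>w. F w + G w) z u = delbar_fun F z u + delbar_fun G z u"
    unfolding del_fun_eq[OF D] delbar_fun_eq[OF D] unfolding del_fun_def delbar_fun_def
    by (simp_all add: field_simps)
qed

lemma del_fun_mult:
  assumes "F differentiable (at z)" "G differentiable (at z)"
  shows "del_fun (\<lambda>w. F w * G w) z u = F z * del_fun G z u + del_fun F z u * G z"
    "delbar_fun (\<lambda>w. F w * G w) z u = F z * delbar_fun G z u + delbar_fun F z u * G z"
proof -
  note D = has_derivative_mult[OF assms[unfolded frechet_derivative_works]]
  show "del_fun (\<lambda>w. F w * G w) z u = F z * del_fun G z u + del_fun F z u * G z"
    "delbar_fun (\<lambda>w. F w * G w) z u = F z * delbar_fun G z u + delbar_fun F z u * G z"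
    unfolding del_fun_eq[OF D] delbar_fun_eq[OF D] unfolding del_fun_def delbar_fun_def
    by (simp_all add: field_simps)
qed

lemma del_fun_cmult:
  assumes "F differentiable (at z)"
  shows "del_fun (\<lambda>w. c * F w) z u = c * del_fun F z u" "delbar_fun (\<lambda>w. c * F w) z u = c * delbar_fun F z u"
  using del_fun_mult[of "\<lambda>_. c" z F u] assms by simp_all

lemma del_fun_cnj:
  assumes "F differentiable (at z)"
  shows "del_fun (\<lambda>w. cnj (F w)) z u = cnj (delbar_fun F z u)"
    "delbar_fun (\<lambda>w. cnj (F w)) z u = cnj (del_fun F z u)"
proof -
  note D = bounded_linear.has_derivative[OF bounded_linear_cnj assms[unfolded frechet_derivative_works]]
  show "del_fun (\<lambda>w. cnj (F w)) z u = cnj (delbar_fun F z u)"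
    "delbar_fun (\<lambda>w. cnj (F w)) z u = cnj (del_fun F z u)"
    unfolding del_fun_eq[OF D] delbar_fun_eq[OF D] unfolding del_fun_def delbar_fun_def by simp_all
qed

lemma del_fun_smult:
  assumes "F differentiable (at z)"
  shows "del_fun F z (c *s u) = c * del_fun F z u" "delbar_fun F z (c *s u) = cnj c * delbar_fun F z u"
proof -
  let ?D = "frechet_derivative F (at z)"
  have lin: "linear ?D" using assms linear_frechet_derivative by blast
  have e: "c *s u = Re c *\<^sub>R u + Im c *\<^sub>R (\<i> *s u)" "\<i> *s (c *s u) = Re c *\<^sub>R (\<i> *s u) - Im c *\<^sub>R u"
    by (simp_all add: vec_eq_iff complex_eq_iff)
  have D: "?D (c *s u) = Re c *\<^sub>R ?D u + Im c *\<^sub>R ?D (\<i> *s u)"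
    "?D (\<i> *s (c *s u)) = Re c *\<^sub>R ?D (\<i> *s u) - Im c *\<^sub>R ?D u"
     apply (simp only: e(1) linear_add[OF lin] linear_scale[OF lin])
    apply (simp only: e(2) linear_diff[OF lin] linear_scale[OF lin])
    done
  show "del_fun F z (c *s u) = c * del_fun F z u" "delbar_fun F z (c *s u) = cnj c * delbar_fun F z u"
    unfolding del_fun_def delbar_fun_def D by (simp_all add: complex_eq_iff algebra_simps)
qed

lemma del_fun_vec_add:
  assumes "F differentiable (at z)"
  shows "del_fun F z (u + v) = del_fun F z u + del_fun F z v"
    "delbar_fun F z (u + v) = delbar_fun F z u + delbar_fun F z v"
proof -
  have lin: "linear (frechet_derivative F (at z))" using assms linear_frechet_derivative by blast
  show "del_fun F z (u + v) = del_fun F z u + del_fun F z v"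
    "delbar_fun F z (u + v) = delbar_fun F z u + delbar_fun F z v"
    unfolding del_fun_def delbar_fun_def vector_add_ldistrib by (simp_all add: linear_add[OF lin] field_simps)
qed

lemma vec_sum_axis: "u = (\<Sum>i\<in>UNIV. u $ i *s axis i (1::complex))"
  by (simp add: vec_eq_iff axis_def if_distrib cong: if_cong)

text \<open>The two parts of the differential are complex linear and antilinear in the vector, hence
  determined by their values on the coordinate vectors.\<close>

lemma del_fun_expand:
  assumes F: "F differentiable (at z)"
  shows "del_fun F z u = (\<Sum>i\<in>UNIV. u $ i * wirtinger i F z)"
    "delbar_fun F z u = (\<Sum>i\<in>UNIV. cnj (u $ i) * wirtinger_bar i F z)"
proof -
  have 0: "del_fun F z 0 = 0" "delbar_fun F z 0 = 0"
    using del_fun_smult[OF F, of 0 0] by simp_all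
  have "del_fun F z (\<Sum>i\<in>I. f i) = (\<Sum>i\<in>I. del_fun F z (f i))"
    "delbar_fun F z (\<Sum>i\<in>I. f i) = (\<Sum>i\<in>I. delbar_fun F z (f i))" for f :: "'a \<Rightarrow> complex^'a" and I :: "'a set"
    by (induction I rule: infinite_finite_induct) (simp_all add: 0 del_fun_vec_add[OF F])
  from this[of "\<lambda>i. u $ i *s axis i 1" UNIV]
  show "del_fun F z u = (\<Sum>i\<in>UNIV. u $ i * wirtinger i F z)"
    "delbar_fun F z u = (\<Sum>i\<in>UNIV. cnj (u $ i) * wirtinger_bar i F z)"
    by (simp_all add: vec_sum_axis[symmetric] del_fun_smult[OF F] wirtinger_def wirtinger_bar_def)
qed

lemma Ck_on_del_fun:
  assumes "open S" "Ck_on (Suc k) S F"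
  shows "Ck_on k S (\<lambda>z. del_fun F z u)" "Ck_on k S (\<lambda>z. delbar_fun F z u)"
  unfolding del_fun_def delbar_fun_def
  by (intro Ck_on_divide Ck_on_diff Ck_on_add Ck_on_mult Ck_on_const Ck_on_SucD(2)[OF assms(2)] assms(1); simp)+

lemma Ck_on_wirtinger:
  assumes "open S" "Ck_on (Suc k) S F"
  shows "Ck_on k S (wirtinger i F)" "Ck_on k S (wirtinger_bar i F)"
  using Ck_on_del_fun[OF assms, of "axis i 1"] by (simp_all add: wirtinger_def[abs_def] wirtinger_bar_def[abs_def])

lemma Ck_on_differentiable: "Ck_on (Suc k) S F \<Longrightarrow> z \<in> S \<Longrightarrow> F differentiable (at z)"
  by simp

lemma del_delbar_commute:
  assumes S: "open S" and F: "Ck_on 2 S F" and z: "z \<in> S"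
  shows "delbar_fun (\<lambda>w. del_fun F w u) z v = del_fun (\<lambda>w. delbar_fun F w v) z u"
proof -
  have F': "Ck_on (Suc (Suc 0)) S F" using F by (simp add: numeral_2_eq_2)
  let ?D = "\<lambda>w a. frechet_derivative F (at w) a" and ?DD = "\<lambda>a. frechet_derivative (\<lambda>w. frechet_derivative F (at w) a) (at z)"
  have D1: "((\<lambda>w. ?D w a) has_derivative ?DD a) (at z)" for a
    using Ck_on_SucD(1)[OF Ck_on_SucD(2)[OF F'] z] .
  have "((\<lambda>w. (?D w a - \<i> * ?D w b) / 2) has_derivative (\<lambda>c. (?DD a c - \<i> * ?DD b c) / 2)) (at z)" for a b
    by (intro bounded_linear.has_derivative[OF bounded_linear_divide] has_derivative_diff
        bounded_linear.has_derivative[OF bounded_linear_mult_right] D1)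
  moreover have "((\<lambda>w. (?D w a + \<i> * ?D w b) / 2) has_derivative (\<lambda>c. (?DD a c + \<i> * ?DD b c) / 2)) (at z)" for a b
    by (intro bounded_linear.has_derivative[OF bounded_linear_divide] has_derivative_add
        bounded_linear.has_derivative[OF bounded_linear_mult_right] D1)
  ultimately have "((\<lambda>w. del_fun F w u) has_derivative (\<lambda>c. (?DD u c - \<i> * ?DD (\<i> *s u) c) / 2)) (at z)"
    "((\<lambda>w. delbar_fun F w v) has_derivative (\<lambda>c. (?DD v c + \<i> * ?DD (\<i> *s v) c) / 2)) (at z)"
    by (simp_all add: del_fun_def delbar_fun_def)
  then show ?thesis
    using symmetric_second_derivative[OF S F z]
    by (simp add: del_fun_eq delbar_fun_eq field_simps)
qed

lemma wirtinger_commute: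
  assumes "open S" "Ck_on 2 S F" "z \<in> S"
  shows "wirtinger_bar j (wirtinger i F) z = wirtinger i (wirtinger_bar j F) z"
  using del_delbar_commute[OF assms] by (simp add: wirtinger_def[abs_def] wirtinger_bar_def[abs_def])

text \<open>Complex linearity makes the two terms of the (0,1)-part cancel and those of the
  (1,0)-part coincide.\<close>

lemma holo_fun_on_delbar:
  assumes "holo_fun_on S f" "z \<in> S"
  shows "delbar_fun f z u = 0" "del_fun f z u = frechet_derivative f (at z) u"
  by (simp_all add: delbar_fun_def del_fun_def holo_fun_onD(2)[OF assms] algebra_simps)

lemma holo_fun_on_cong:
  assumes "open S" "\<And>z. z \<in> S \<Longrightarrow> f z = g z" "holo_fun_on S f"
  shows "holo_fun_on S g"
  unfolding holo_fun_on_def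
proof
  fix z assume z: "z \<in> S"
  have "(g has_derivative frechet_derivative f (at z)) (at z)"
    by (rule has_derivative_transform_within_open[OF holo_fun_onD(1)[OF assms(3) z] assms(1) z assms(2)])
  then show "\<exists>D. (g has_derivative D) (at z) \<and> (\<forall>c v. D (c *s v) = c * D v)"
    using holo_fun_onD(2)[OF assms(3) z] by blast
qed

lemma holo_fun_on_wirtinger: "open S \<Longrightarrow> holo_fun_on S f \<Longrightarrow> holo_fun_on S (wirtinger i f)"
  by (rule holo_fun_on_cong[OF _ _ holo_fun_on_derivative[of S f "axis i 1"]])
    (simp_all add: wirtinger_def holo_fun_on_delbar)

lemma holo_fun_on_const: "holo_fun_on S (\<lambda>_. c)"
  unfolding holo_fun_on_def by (intro ballI exI[of _ "\<lambda>_. 0"]) simp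

lemma holo_fun_on_add: "holo_fun_on S f \<Longrightarrow> holo_fun_on S g \<Longrightarrow> holo_fun_on S (\<lambda>z. f z + g z)"
  unfolding holo_fun_on_def
proof
  fix z assume f: "\<forall>z\<in>S. \<exists>D. (f has_derivative D) (at z) \<and> (\<forall>c v. D (c *s v) = c * D v)"
    and g: "\<forall>z\<in>S. \<exists>D. (g has_derivative D) (at z) \<and> (\<forall>c v. D (c *s v) = c * D v)" and "z \<in> S"
  then obtain D E where D: "(f has_derivative D) (at z)" "\<And>c v. D (c *s v) = c * D v"
    and E: "(g has_derivative E) (at z)" "\<And>c v. E (c *s v) = c * E v" by blast
  show "\<exists>D. ((\<lambda>z. f z + g z) has_derivative D) (at z) \<and> (\<forall>c v. D (c *s v) = c * D v)"
    by (rule exI, rule conjI[OF has_derivative_add[OF D(1) E(1)]]) (simp add: D(2) E(2) algebra_simps)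
qed

lemma holo_fun_on_mult:
  assumes "holo_fun_on S f" "holo_fun_on S g"
  shows "holo_fun_on S (\<lambda>z. f z * g z)"
  unfolding holo_fun_on_def
proof
  fix z assume z: "z \<in> S"
  show "\<exists>D. ((\<lambda>z. f z * g z) has_derivative D) (at z) \<and> (\<forall>c v. D (c *s v) = c * D v)"
    by (rule exI, rule conjI[OF has_derivative_mult[OF holo_fun_onD(1)[OF assms(1) z] holo_fun_onD(1)[OF assms(2) z]]])
      (simp add: holo_fun_onD(2)[OF assms(1) z] holo_fun_onD(2)[OF assms(2) z] algebra_simps)
qed

lemma holo_fun_on_inverse:
  assumes "holo_fun_on S f" "\<And>z. z \<in> S \<Longrightarrow> f z \<noteq> 0"
  shows "holo_fun_on S (\<lambda>z. inverse (f z))"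
  unfolding holo_fun_on_def
proof
  fix z assume z: "z \<in> S"
  show "\<exists>D. ((\<lambda>z. inverse (f z)) has_derivative D) (at z) \<and> (\<forall>c v. D (c *s v) = c * D v)"
    by (rule exI, rule conjI[OF Deriv.has_derivative_inverse[OF assms(2)[OF z] holo_fun_onD(1)[OF assms(1) z]]])
      (simp add: holo_fun_onD(2)[OF assms(1) z] algebra_simps)
qed

lemma holo_fun_on_sum: "(\<And>i. i \<in> I \<Longrightarrow> holo_fun_on S (f i)) \<Longrightarrow> holo_fun_on S (\<lambda>z. \<Sum>i\<in>I. f i z)"
  by (induction I rule: infinite_finite_induct) (auto intro: holo_fun_on_const holo_fun_on_add)

lemma holo_fun_on_prod: "(\<And>i. i \<in> I \<Longrightarrow> holo_fun_on S (f i)) \<Longrightarrow> holo_fun_on S (\<lambda>z. \<Prod>i\<in>I. f i z)"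
  by (induction I rule: infinite_finite_induct) (auto intro: holo_fun_on_const holo_fun_on_mult)

lemma holo_fun_on_det: "(\<And>i j. holo_fun_on S (\<lambda>z. A z $ i $ j)) \<Longrightarrow> holo_fun_on S (\<lambda>z. det (A z))"
  unfolding det_def by (intro holo_fun_on_sum holo_fun_on_mult holo_fun_on_const holo_fun_on_prod)

section \<open>Positive Hermitian matrices\<close>

definition hermitian_pos :: "complex^'n::finite^'n \<Rightarrow> bool" where
  "hermitian_pos A \<longleftrightarrow> (\<forall>i j. cnj (A $ i $ j) = A $ j $ i) \<and> (\<forall>v. v \<noteq> 0 \<longrightarrow> 0 < Re (herm_form A v v))"

text \<open>The Hermitian form at v pairs v with the transpose of A applied to v, so a kernel vector
  of the transpose would be isotropic.\<close>

lemma hermitian_pos_invertible: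
  assumes "hermitian_pos A"
  shows "invertible A"
proof -
  have "v = 0" if "Finite_Cartesian_Product.transpose A *v v = 0" for v
  proof (rule ccontr)
    assume "v \<noteq> 0"
    have "herm_form A v v = (\<Sum>j\<in>UNIV. (Finite_Cartesian_Product.transpose A *v v) $ j * cnj (v $ j))"
      unfolding herm_form_def matrix_vector_mult_def Finite_Cartesian_Product.transpose_def
      by (subst sum.swap) (simp add: sum_distrib_right)
    then have "herm_form A v v = 0" using that by simp
    then show False using assms \<open>v \<noteq> 0\<close> by (auto simp: hermitian_pos_def)
  qed
  then have "\<exists>B. B ** Finite_Cartesian_Product.transpose A = mat 1"
    unfolding matrix_left_invertible_ker by blast
  then have "invertible (Finite_Cartesian_Product.transpose A)"
    using invertible_left_inverse by blast
  then show ?thesis by (simp add: invertible_det_nz)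
qed

lemma hermitian_pos_mat: "c > 0 \<Longrightarrow> hermitian_pos (mat (complex_of_real c))"
proof -
  assume c: "c > 0"
  have e: "herm_form (mat (complex_of_real c)) v v = of_real (c * (\<Sum>i\<in>UNIV. (norm (v $ i))\<^sup>2))" for v :: "complex^'n"
  proof -
    have "herm_form (mat (complex_of_real c)) v v = (\<Sum>i\<in>UNIV. c * (v $ i * cnj (v $ i)))"
      unfolding herm_form_def by (simp add: mat_def if_distrib if_distribR mult.assoc cong: if_cong)
    also have "\<dots> = of_real (c * (\<Sum>i\<in>UNIV. (norm (v $ i))\<^sup>2))"
      unfolding complex_norm_square[symmetric] by (simp add: sum_distrib_left)
    finally show ?thesis .
  qed
  have p: "0 < (\<Sum>i\<in>UNIV. (norm (v $ i))\<^sup>2)" if "v \<noteq> 0" for v :: "complex^'n"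
  proof -
    from that have "\<exists>i. v $ i \<noteq> 0" unfolding vec_eq_iff by simp
    then obtain i where "v $ i \<noteq> 0" by blast
    then show ?thesis by (intro sum_pos2[of UNIV i]) auto
  qed
  have "0 < Re (herm_form (mat (complex_of_real c)) v v)" if "v \<noteq> 0" for v :: "complex^'n"
    unfolding e Re_complex_of_real using c p[OF that] by simp
  then show ?thesis by (auto simp: hermitian_pos_def mat_def)
qed

lemma herm_form_add: "herm_form (A + B) v w = herm_form A v w + herm_form B v w"
  by (simp add: herm_form_def algebra_simps sum.distrib)

lemma herm_form_scaleR: "herm_form (c *\<^sub>R A) v w = c *\<^sub>R herm_form A v w"
  by (simp add: herm_form_def scaleR_sum_right)

lemma hermitian_pos_add: "hermitian_pos A \<Longrightarrow> hermitian_pos B \<Longrightarrow> hermitian_pos (A + B)"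
  unfolding hermitian_pos_def herm_form_add plus_complex.sel
  by (intro conjI allI impI add_pos_pos) auto

lemma hermitian_pos_scaleR: "hermitian_pos A \<Longrightarrow> c > 0 \<Longrightarrow> hermitian_pos (c *\<^sub>R A)"
  by (simp add: hermitian_pos_def herm_form_scaleR)

text \<open>Real, because transposing the matrix conjugates it. Positive, because the segment from
  the identity to A consists of positive matrices, whose determinants are real and nonzero, so that
  the sign cannot change along it.\<close>

lemma hermitian_pos_det:
  fixes A :: "complex^'n::finite^'n"
  assumes A: "hermitian_pos A"
  shows "det A = of_real (Re (det A))" "0 < Re (det A)"
proof -
  have real: "det B = of_real (Re (det B))" if "hermitian_pos B" for B :: "complex^'n::finite^'n"
  proof -
    have "Finite_Cartesian_Product.transpose B = (\<chi> i j. cnj (B $ i $ j))"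
      using that by (simp add: hermitian_pos_def Finite_Cartesian_Product.transpose_def vec_eq_iff)
    then have "det B = cnj (det B)" by (metis det_cnj det_transpose)
    then show ?thesis by (simp add: complex_eq_iff)
  qed
  show "det A = of_real (Re (det A))" using real[OF A] .
  define P where "P = (\<lambda>t :: real. (1 - t) *\<^sub>R mat 1 + t *\<^sub>R A)"
  have P: "hermitian_pos (P t)" if "0 \<le> t" "t \<le> 1" for t
  proof -
    have 1: "hermitian_pos (mat 1 :: complex^'n^'n)" using hermitian_pos_mat[of 1] by simp
    have "t = 0 \<or> t = 1 \<or> 0 < t \<and> t < 1" using that by linarith
    moreover have "hermitian_pos (P t)" if "0 < t" "t < 1"
      unfolding P_def by (intro hermitian_pos_add hermitian_pos_scaleR 1 A) (use that in auto)
    ultimately show ?thesis using 1 A by (auto simp: P_def)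
  qed
  have nz: "Re (det (P t)) \<noteq> 0" if "0 \<le> t" "t \<le> 1" for t
    using hermitian_pos_invertible[OF P[OF that]] real[OF P[OF that]]
    by (metis invertible_det_nz of_real_0)
  have cont: "continuous_on {0..1} (\<lambda>t. Re (det (P t)))"
    unfolding det_def P_def by (intro continuous_intros)
  show "0 < Re (det A)"
  proof (rule ccontr)
    assume "\<not> 0 < Re (det A)"
    moreover have "Re (det (P 0)) = 1" "P 1 = A" by (simp_all add: P_def)
    ultimately have "\<exists>t\<ge>0. t \<le> 1 \<and> Re (det (P t)) = 0"
      by (intro IVT2'[of "\<lambda>t. Re (det (P t))" 1 0 0]) (use cont in auto)
    then show False using nz by auto
  qed
qed

lemma matrix_inv_eqI:
  fixes A B :: "'a::field^'n::finite^'n"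
  assumes "A ** B = mat 1"
  shows "matrix_inv A = B"
proof -
  have "B ** A = mat 1" using assms matrix_left_right_inverse by blast
  then have i: "invertible A" using assms invertible_def by blast
  have "matrix_inv A = matrix_inv A ** (A ** B)" using assms by simp
  also have "\<dots> = B" by (simp add: matrix_mul_assoc matrix_inv_mult[OF i])
  finally show ?thesis .
qed

lemma matrix_mult_nth: "(A ** B) $ i $ j = (\<Sum>k\<in>UNIV. A $ i $ k * B $ k $ j)"
  by (simp add: matrix_matrix_mult_def)

lemma mat_nth: "mat c $ i $ j = (if i = j then c else 0)"
  by (simp add: mat_def)

text \<open>The conjugate transpose of the inverse is again an inverse of A.\<close>

lemma matrix_inv_hermitian:
  assumes "hermitian_pos A"
  shows "cnj (matrix_inv A $ j $ i) = matrix_inv A $ i $ j"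
proof -
  let ?B = "\<chi> i j. cnj (matrix_inv A $ j $ i)"
  note inv = matrix_inv_mult[OF hermitian_pos_invertible[OF assms]]
  have "(A ** ?B) $ i $ j = mat 1 $ i $ j" for i j
  proof -
    have "(A ** ?B) $ i $ j = cnj (\<Sum>k\<in>UNIV. matrix_inv A $ j $ k * A $ k $ i)"
      using assms by (simp add: matrix_mult_nth hermitian_pos_def mult.commute)
    also have "\<dots> = cnj ((matrix_inv A ** A) $ j $ i)" by (simp add: matrix_mult_nth)
    finally show ?thesis by (simp add: inv mat_nth)
  qed
  then have "matrix_inv A = ?B" by (intro matrix_inv_eqI) (simp add: vec_eq_iff)
  then show ?thesis by (metis vec_lambda_beta)
qed

text \<open>With \<xi> = A y the sum becomes the Hermitian form of A at the conjugate of y; the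
  conjugation reflects the index placement of the inverse.\<close>

lemma matrix_inv_pos:
  fixes \<xi> :: "'n::finite \<Rightarrow> complex"
  assumes A: "hermitian_pos A" and "\<xi> i0 \<noteq> 0"
  shows "0 < Re (\<Sum>i\<in>UNIV. \<Sum>j\<in>UNIV. matrix_inv A $ j $ i * \<xi> i * cnj (\<xi> j))"
proof -
  note inv = matrix_inv_mult[OF hermitian_pos_invertible[OF A]]
  define y where "y = matrix_inv A *v (\<chi> i. \<xi> i)"
  define x where "x = (\<chi> i. cnj (y $ i))"
  have Ay: "A *v y = (\<chi> i. \<xi> i)" by (simp add: y_def matrix_vector_mul_assoc inv)
  have "y \<noteq> 0"
  proof
    assume "y = 0"
    with Ay have "(\<chi> i. \<xi> i) $ i0 = 0" by (metis matrix_vector_mult_0_right zero_index)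
    then show False using assms(2) by simp
  qed
  then have "x \<noteq> 0" by (auto simp: x_def vec_eq_iff)
  then have "0 < Re (herm_form A x x)" using A by (simp add: hermitian_pos_def)
  moreover have "(\<Sum>i\<in>UNIV. \<Sum>j\<in>UNIV. matrix_inv A $ j $ i * \<xi> i * cnj (\<xi> j)) = (\<Sum>j\<in>UNIV. cnj ((A *v y) $ j) * y $ j)"
    unfolding Ay by (subst sum.swap) (simp add: y_def matrix_vector_mult_def sum_distrib_left algebra_simps)
  moreover have "\<dots> = herm_form A x x"
  proof -
    have "(\<Sum>j\<in>UNIV. cnj ((A *v y) $ j) * y $ j) = (\<Sum>j\<in>UNIV. \<Sum>k\<in>UNIV. A $ k $ j * (cnj (y $ k) * y $ j))"
      using A by (simp add: matrix_vector_mult_def hermitian_pos_def sum_distrib_left sum_distrib_right algebra_simps)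
    then show ?thesis by (subst (asm) sum.swap) (simp add: herm_form_def x_def algebra_simps)
  qed
  ultimately show ?thesis by simp
qed

lemma matrix_inv_scaleR:
  fixes A :: "complex^'n::finite^'n"
  assumes "invertible A" "c \<noteq> 0"
  shows "matrix_inv (c *\<^sub>R A) = inverse c *\<^sub>R matrix_inv A"
proof (rule matrix_inv_eqI)
  have "((c *\<^sub>R A) ** (inverse c *\<^sub>R matrix_inv A)) $ i $ j = (A ** matrix_inv A) $ i $ j" for i j
    using assms(2) by (simp add: matrix_mult_nth)
  then show "(c *\<^sub>R A) ** (inverse c *\<^sub>R matrix_inv A) = mat 1"
    by (simp add: vec_eq_iff matrix_inv_mult[OF assms(1)])
qed

lemma det_scaleR:
  fixes A :: "complex^'n::finite^'n"
  shows "det (c *\<^sub>R A) = c ^ CARD('n) *\<^sub>R det A"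
  by (simp add: det_def prod.distrib scaleR_conv_of_real[where 'a = complex] sum_distrib_left algebra_simps)

text \<open>In matrix form A = J^T A' conj(J). Taking determinants gives the first two claims,
  inverting gives the third.\<close>

lemma change_of_basis:
  fixes A A' J :: "complex^'n::finite^'n"
  assumes A: "\<And>i j. A $ i $ j = (\<Sum>k\<in>UNIV. \<Sum>l\<in>UNIV. A' $ k $ l * J $ k $ i * cnj (J $ l $ j))"
    and inv: "invertible A" "invertible A'"
  shows "det A = det A' * (det J * cnj (det J))" "det J \<noteq> 0"
    "matrix_inv A' $ l $ k = (\<Sum>i\<in>UNIV. \<Sum>j\<in>UNIV. J $ k $ i * cnj (J $ l $ j) * matrix_inv A $ j $ i)"
proof -
  let ?T = "Finite_Cartesian_Product.transpose J" and ?C = "\<chi> i j. cnj (J $ i $ j)"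
  have eq: "A = ?T ** A' ** ?C"
    unfolding vec_eq_iff matrix_mult_nth A Finite_Cartesian_Product.transpose_def
    by (intro allI, subst sum.swap) (simp add: sum_distrib_left sum_distrib_right algebra_simps)
  show d: "det A = det A' * (det J * cnj (det J))"
    unfolding eq det_mul det_cnj by simp
  then show J: "det J \<noteq> 0" using inv by (auto simp: invertible_det_nz)
  have T: "invertible ?T" using J by (simp add: invertible_det_nz)
  have "?T ** (A' ** (?C ** matrix_inv A ** ?T)) = A ** matrix_inv A ** ?T"
    unfolding eq by (simp add: matrix_mul_assoc)
  also have "\<dots> = ?T" by (simp add: matrix_inv_mult inv)
  finally have "matrix_inv ?T ** ?T ** (A' ** (?C ** matrix_inv A ** ?T)) = matrix_inv ?T ** ?T"
    by (simp flip: matrix_mul_assoc)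
  then have "A' ** (?C ** matrix_inv A ** ?T) = mat 1" by (simp add: matrix_inv_mult T)
  then have "matrix_inv A' = ?C ** matrix_inv A ** ?T" by (rule matrix_inv_eqI)
  then have "matrix_inv A' $ l $ k = (\<Sum>i\<in>UNIV. (\<Sum>j\<in>UNIV. cnj (J $ l $ j) * matrix_inv A $ j $ i) * J $ k $ i)"
    by (simp add: matrix_mult_nth Finite_Cartesian_Product.transpose_def)
  then show "matrix_inv A' $ l $ k = (\<Sum>i\<in>UNIV. \<Sum>j\<in>UNIV. J $ k $ i * cnj (J $ l $ j) * matrix_inv A $ j $ i)"
    by (simp add: sum_distrib_left sum_distrib_right algebra_simps)
qed

section \<open>The Chern scalar curvature in coordinates\<close>

definition local_metric :: "(complex^'n) set \<Rightarrow> (complex^'n::finite \<Rightarrow> complex^'n^'n) \<Rightarrow> bool" where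
  "local_metric S h \<longleftrightarrow> (\<forall>i j. smooth_on S (\<lambda>z. h z $ i $ j)) \<and> (\<forall>z\<in>S. hermitian_pos (h z))"

definition chern_lap :: "(complex^'n::finite \<Rightarrow> complex^'n^'n) \<Rightarrow> (complex^'n \<Rightarrow> complex) \<Rightarrow> complex^'n \<Rightarrow> complex" where
  "chern_lap h F z = (\<Sum>i\<in>UNIV. \<Sum>j\<in>UNIV. inverse_metric h z i j * wirtinger_bar j (wirtinger i F) z)"

text \<open>For a positive Hermitian matrix the determinant is a positive real number, so the real
  part loses nothing and no branch of the logarithm has to be chosen.\<close>

definition log_det :: "(complex^'n::finite \<Rightarrow> complex^'n^'n) \<Rightarrow> complex^'n \<Rightarrow> real" where
  "log_det h z = ln (Re (det (h z)))"

lemma Ck_on_ln: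
  fixes f :: "'v::real_normed_vector \<Rightarrow> real"
  assumes "open S" "Ck_on k S f" "\<And>x. x \<in> S \<Longrightarrow> 0 < f x"
  shows "Ck_on k S (\<lambda>x. ln (f x))"
proof (cases k)
  case 0
  then show ?thesis using assms(2,3) by (auto intro!: continuous_on_ln simp: less_imp_neq[symmetric])
next
  case (Suc m)
  have f: "Ck_on (Suc m) S f" using assms(2) Suc by simp
  have "Ck_on m S (\<lambda>x. frechet_derivative f (at x) v * inverse (f x))" for v
    by (intro Ck_on_mult Ck_on_inverse assms(1) Ck_on_SucD(2)[OF f] Ck_on_Suc_imp[OF f]) (use assms(3) in force)
  moreover have "((\<lambda>x. ln (f x)) has_derivative (\<lambda>v. frechet_derivative f (at x) v * inverse (f x))) (at x)" if "x \<in> S" for x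
    using has_derivative_ln[OF assms(3)[OF that] Ck_on_SucD(1)[OF f that]] .
  ultimately show ?thesis unfolding Suc by (intro Ck_on_SucI[OF assms(1)])
qed

lemma Ck_on_of_real: "open S \<Longrightarrow> Ck_on k S f \<Longrightarrow> Ck_on k S (\<lambda>x. complex_of_real (f x))"
  by (rule Ck_on_bounded_linear[OF bounded_linear_of_real])

context
  fixes S :: "(complex^'n::finite) set" and h :: "complex^'n \<Rightarrow> complex^'n^'n"
  assumes S: "open S" and h: "local_metric S h"
begin

lemma local_metric_pos: "z \<in> S \<Longrightarrow> hermitian_pos (h z)"
  using h by (simp add: local_metric_def)

lemma local_metric_invertible: "z \<in> S \<Longrightarrow> invertible (h z)"
  using local_metric_pos hermitian_pos_invertible by blast

lemma Ck_on_metric: "Ck_on k S (\<lambda>z. h z $ i $ j)"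
  using h by (simp add: local_metric_def smooth_on_def)

lemma Ck_on_inverse_metric: "Ck_on k S (\<lambda>z. inverse_metric h z i j)"
  unfolding inverse_metric_def by (intro Ck_on_matrix_inv S Ck_on_metric local_metric_invertible)

lemma Ck_on_det_metric: "Ck_on k S (\<lambda>z. det (h z))"
  by (intro Ck_on_det S Ck_on_metric)

lemma Ck_on_log_det: "Ck_on k S (log_det h)"
proof -
  have "Ck_on k S (\<lambda>z. ln (Re (det (h z))))"
    by (intro Ck_on_ln Ck_on_bounded_linear[OF bounded_linear_Re] S Ck_on_det_metric hermitian_pos_det local_metric_pos)
  then show ?thesis by (simp add: log_det_def[abs_def])
qed

lemma inverse_metric_cnj: "z \<in> S \<Longrightarrow> cnj (inverse_metric h z i j) = inverse_metric h z j i"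
  unfolding inverse_metric_def by (rule matrix_inv_hermitian[OF local_metric_pos])

lemma Ck_on_chern_lap: "Ck_on (Suc (Suc k)) S F \<Longrightarrow> Ck_on k S (chern_lap h F)"
  unfolding chern_lap_def[abs_def]
  by (intro Ck_on_sum Ck_on_mult S Ck_on_inverse_metric Ck_on_wirtinger)

lemma chern_lap_cong:
  assumes "z \<in> S" "\<And>w. w \<in> S \<Longrightarrow> F w = G w"
  shows "chern_lap h F z = chern_lap h G z"
  unfolding chern_lap_def
  using wirtinger_cong(2)[OF S assms(1), of "wirtinger i F" "wirtinger i G" for i] wirtinger_cong(1)[OF S _ assms(2)]
  by simp

lemma chern_lap_add:
  assumes F: "Ck_on 2 S F" and G: "Ck_on 2 S G" and z: "z \<in> S"
  shows "chern_lap h (\<lambda>w. F w + G w) z = chern_lap h F z + chern_lap h G z"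
proof -
  have F': "Ck_on (Suc (Suc 0)) S F" and G': "Ck_on (Suc (Suc 0)) S G"
    using F G by (simp_all add: numeral_2_eq_2)
  have "wirtinger_bar j (wirtinger i (\<lambda>w. F w + G w)) z = wirtinger_bar j (\<lambda>w. wirtinger i F w + wirtinger i G w) z" for i j
    by (rule wirtinger_cong(2)[OF S z]) (use F' G' in \<open>simp add: wirtinger_def del_fun_add(1)\<close>)
  also have "wirtinger_bar j (\<lambda>w. wirtinger i F w + wirtinger i G w) z = wirtinger_bar j (wirtinger i F) z + wirtinger_bar j (wirtinger i G) z" for i j
    unfolding wirtinger_bar_def
    by (rule del_fun_add(2)) (use Ck_on_differentiable[OF Ck_on_wirtinger(1)[OF S F'] z] Ck_on_differentiable[OF Ck_on_wirtinger(1)[OF S G'] z] in auto)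
  finally show ?thesis by (simp add: chern_lap_def sum.distrib algebra_simps)
qed

lemma chern_lap_cmult:
  assumes F: "Ck_on 2 S F" and z: "z \<in> S"
  shows "chern_lap h (\<lambda>w. c * F w) z = c * chern_lap h F z"
proof -
  have F': "Ck_on (Suc (Suc 0)) S F" using F by (simp add: numeral_2_eq_2)
  have "wirtinger_bar j (wirtinger i (\<lambda>w. c * F w)) z = wirtinger_bar j (\<lambda>w. c * wirtinger i F w) z" for i j
    by (rule wirtinger_cong(2)[OF S z]) (use F' in \<open>simp add: wirtinger_def del_fun_cmult(1)\<close>)
  also have "wirtinger_bar j (\<lambda>w. c * wirtinger i F w) z = c * wirtinger_bar j (wirtinger i F) z" for i j
    unfolding wirtinger_bar_def
    by (rule del_fun_cmult(2)) (use Ck_on_differentiable[OF Ck_on_wirtinger(1)[OF S F'] z] in auto)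
  finally show ?thesis by (simp add: chern_lap_def sum_distrib_left algebra_simps)
qed

text \<open>Conjugation exchanges the two kinds of derivatives of a real F and transposes the
  coefficients; as mixed derivatives commute, renaming the indices restores the sum.\<close>

lemma chern_lap_real:
  assumes F: "Ck_on 2 S F" and real: "\<And>w. w \<in> S \<Longrightarrow> cnj (F w) = F w" and z: "z \<in> S"
  shows "cnj (chern_lap h F z) = chern_lap h F z"
proof -
  have F': "Ck_on (Suc (Suc 0)) S F" using F by (simp add: numeral_2_eq_2)
  have *: "cnj (wirtinger_bar j (wirtinger i F) z) = wirtinger_bar i (wirtinger j F) z" for i j
  proof -
    have "cnj (wirtinger_bar j (wirtinger i F) z) = wirtinger j (\<lambda>w. cnj (wirtinger i F w)) z"
      unfolding wirtinger_def[of j] wirtinger_bar_def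
      by (rule del_fun_cnj(1)[symmetric]) (use Ck_on_differentiable[OF Ck_on_wirtinger(1)[OF S F'] z] in auto)
    also have "\<dots> = wirtinger j (wirtinger_bar i F) z"
    proof (rule wirtinger_cong(1)[OF S z])
      fix w assume w: "w \<in> S"
      have "cnj (wirtinger i F w) = wirtinger_bar i (\<lambda>w. cnj (F w)) w"
        unfolding wirtinger_def wirtinger_bar_def by (rule del_fun_cnj(2)[symmetric]) (use F' w in simp)
      also have "\<dots> = wirtinger_bar i F w" by (rule wirtinger_cong(2)[OF S w real])
      finally show "cnj (wirtinger i F w) = wirtinger_bar i F w" .
    qed
    also have "\<dots> = wirtinger_bar i (wirtinger j F) z" using wirtinger_commute[OF S F z] by simp
    finally show ?thesis .
  qed
  have "cnj (chern_lap h F z) = (\<Sum>i\<in>UNIV. \<Sum>j\<in>UNIV. inverse_metric h z j i * wirtinger_bar i (wirtinger j F) z)"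
    by (simp add: chern_lap_def inverse_metric_cnj[OF z] *)
  then show ?thesis by (subst (asm) sum.swap) (simp add: chern_lap_def)
qed

text \<open>Jacobi's formula: d log det h is the trace of h^(-1) dh. The derivative of the
  determinant is a sum over k of determinants with row k differentiated. That row is a combination
  of the rows of h, and Cramer's rule extracts the coefficient of row k.\<close>

lemma del_fun_log_det:
  assumes z: "z \<in> S"
  shows "del_fun (\<lambda>w. complex_of_real (log_det h w)) z u
    = (\<Sum>k\<in>UNIV. \<Sum>q\<in>UNIV. inverse_metric h z k q * del_fun (\<lambda>w. h w $ k $ q) z u)"
proof -
  let ?D = "\<lambda>k q. frechet_derivative (\<lambda>w. h w $ k $ q) (at z)"
  have D: "((\<lambda>w. h w $ k $ q) has_derivative ?D k q) (at z)" for k q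
    by (rule Ck_on_SucD(1)[OF Ck_on_metric[of "Suc 0"] z])
  have inv: "invertible (h z)" using local_metric_invertible[OF z] .
  have det: "((\<lambda>w. det (h w)) has_derivative (\<lambda>u. \<Sum>p | p permutes (UNIV :: 'n set). of_int (sign p) *
      (\<Sum>k\<in>UNIV. ?D k (p k) u * (\<Prod>i\<in>UNIV - {k}. h z $ i $ p i)))) (at z)"
    unfolding det_def
    by (intro has_derivative_sum bounded_linear.has_derivative[OF bounded_linear_mult_right] has_derivative_prod D)
  have "(\<Sum>p | p permutes (UNIV :: 'n set). of_int (sign p) * (\<Sum>k\<in>UNIV. ?D k (p k) u * (\<Prod>i\<in>UNIV - {k}. h z $ i $ p i)))
     = det (h z) * (\<Sum>k\<in>UNIV. \<Sum>q\<in>UNIV. inverse_metric h z k q * ?D k q u)" for u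
  proof -
    have "(\<Sum>p | p permutes (UNIV :: 'n set). of_int (sign p) * (?D k (p k) u * (\<Prod>i\<in>UNIV - {k}. h z $ i $ p i)))
       = det (h z) * (\<Sum>q\<in>UNIV. inverse_metric h z k q * ?D k q u)" for k
    proof -
      \<comment> \<open>The coefficients of the differentiated row with respect to the rows of h,
        obtained by multiplying it with the inverse from the right.\<close>
      define x where "x = (\<chi> i. \<Sum>q\<in>UNIV. ?D k q u * matrix_inv (h z) $ q $ i)"
      have row: "(\<Sum>i\<in>UNIV. x $ i *s row i (h z)) $ j = ?D k j u" for j
      proof -
        have "(\<Sum>i\<in>UNIV. x $ i *s row i (h z)) $ j = (\<Sum>q\<in>UNIV. ?D k q u * (matrix_inv (h z) ** h z) $ q $ j)"
          unfolding x_def matrix_mult_nth sum_distrib_left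
          by (subst sum.swap) (simp add: row_def sum_distrib_left sum_distrib_right algebra_simps)
        then show ?thesis by (simp add: matrix_inv_mult[OF inv] mat_nth if_distrib cong: if_cong)
      qed
      have "(\<Sum>p | p permutes (UNIV :: 'n set). of_int (sign p) * (?D k (p k) u * (\<Prod>i\<in>UNIV - {k}. h z $ i $ p i)))
         = det (\<chi> i. if i = k then (\<Sum>i\<in>UNIV. x $ i *s row i (h z)) else row i (h z))"
        unfolding det_def
      proof (rule sum.cong[OF refl])
        fix p :: "'n \<Rightarrow> 'n"
        let ?B = "\<chi> i. if i = k then (\<Sum>i\<in>UNIV. x $ i *s row i (h z)) else row i (h z)"
        have "(\<Prod>i\<in>UNIV. ?B $ i $ p i) = ?B $ k $ p k * (\<Prod>i\<in>UNIV - {k}. ?B $ i $ p i)"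
          by (rule prod.remove) auto
        also have "?B $ k $ p k = ?D k (p k) u" using row by simp
        also have "(\<Prod>i\<in>UNIV - {k}. ?B $ i $ p i) = (\<Prod>i\<in>UNIV - {k}. h z $ i $ p i)"
          by (intro prod.cong) (auto simp: row_def)
        finally show "of_int (sign p) * (?D k (p k) u * (\<Prod>i\<in>UNIV - {k}. h z $ i $ p i))
          = of_int (sign p) * (\<Prod>i\<in>UNIV. ?B $ i $ p i)" by simp
      qed
      also have "\<dots> = x $ k * det (h z)" by (rule cramer_lemma_transpose)
      finally show ?thesis by (simp add: x_def inverse_metric_def sum_distrib_left algebra_simps)
    qed
    then show ?thesis
      unfolding sum_distrib_left[of "of_int _"] by (subst sum.swap) (simp add: sum_distrib_left)
  qed
  with det have det': "((\<lambda>w. det (h w)) has_derivative (\<lambda>u. det (h z) * (\<Sum>k\<in>UNIV. \<Sum>q\<in>UNIV. inverse_metric h z k q * ?D k q u))) (at z)"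
    by simp
  let ?L = "\<lambda>u. \<Sum>k\<in>UNIV. \<Sum>q\<in>UNIV. inverse_metric h z k q * ?D k q u"
  note pos = hermitian_pos_det[OF local_metric_pos]
  have dz: "det (h z) = of_real (Re (det (h z)))" "0 < Re (det (h z))" using pos z by auto
  have "((\<lambda>w. complex_of_real (log_det h w)) has_derivative (\<lambda>u. of_real (Re (det (h z) * ?L u) * inverse (Re (det (h z)))))) (at z)"
    unfolding log_det_def
    by (intro bounded_linear.has_derivative[OF bounded_linear_of_real] has_derivative_ln dz(2)
        bounded_linear.has_derivative[OF bounded_linear_Re] det')
  \<comment> \<open>The determinant is real on all of S, so by uniqueness its derivative is real too
    and taking the real part changes nothing.\<close>
  moreover have "of_real (Re (det (h z) * ?L u) * inverse (Re (det (h z)))) = ?L u" for u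
  proof -
    have "((\<lambda>w. complex_of_real (Re (det (h w)))) has_derivative (\<lambda>u. of_real (Re (det (h z) * ?L u)))) (at z)"
      by (intro bounded_linear.has_derivative[OF bounded_linear_of_real] bounded_linear.has_derivative[OF bounded_linear_Re] det')
    then have "((\<lambda>w. det (h w)) has_derivative (\<lambda>u. of_real (Re (det (h z) * ?L u)))) (at z)"
      by (rule has_derivative_transform_within_open[OF _ S z]) (use pos(1) in simp)
    with det' have "(\<lambda>u. of_real (Re (det (h z) * ?L u))) = (\<lambda>u. det (h z) * ?L u)"
      by (rule has_derivative_unique[rotated])
    then have "of_real (Re (det (h z) * ?L u)) = det (h z) * ?L u" by (rule fun_cong)
    then have "of_real (Re (det (h z) * ?L u) * inverse (Re (det (h z)))) = det (h z) * ?L u * inverse (of_real (Re (det (h z))))"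
      by simp
    also have "\<dots> = ?L u" using dz by (metis (no_types, lifting) mult.commute mult.left_commute mult.right_neutral of_real_eq_0_iff order_less_irrefl right_inverse)
    finally show ?thesis .
  qed
  ultimately have "((\<lambda>w. complex_of_real (log_det h w)) has_derivative ?L) (at z)" by simp
  from del_fun_eq[OF this] show ?thesis
    by (simp add: del_fun_def sum_distrib_left sum_subtractf sum_divide_distrib diff_divide_distrib algebra_simps)
qed

text \<open>Contraction in k and l cancels the factor h in the curvature and leaves the trace of the
  connection, which by Jacobi's formula is the derivative of log det h.\<close>

lemma local_chern_scalar_eq:
  assumes z: "z \<in> S"
  shows "local_chern_scalar h z = - chern_lap h (\<lambda>w. of_real (log_det h w)) z"
proof -
  let ?g = "inverse_metric h z"
  let ?W = "\<lambda>p i j k. wirtinger_bar j (chern_connection h p i k) z"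
  have inv: "(\<Sum>l\<in>UNIV. ?g k l * h z $ p $ l) = (if p = k then 1 else 0)" for k p
  proof -
    have "(\<Sum>l\<in>UNIV. ?g k l * h z $ p $ l) = (h z ** matrix_inv (h z)) $ p $ k"
      by (simp add: inverse_metric_def matrix_mult_nth mult.commute)
    then show ?thesis by (simp add: matrix_inv_mult[OF local_metric_invertible[OF z]] mat_nth)
  qed
  have "(\<Sum>k\<in>UNIV. \<Sum>l\<in>UNIV. ?g i j * ?g k l * chern_curvature h z i j k l) = - (?g i j * (\<Sum>k\<in>UNIV. ?W k i j k))" for i j
  proof -
    have "(\<Sum>l\<in>UNIV. ?g i j * ?g k l * chern_curvature h z i j k l) = - (?g i j * ?W k i j k)" for k
    proof -
      have "(\<Sum>l\<in>UNIV. ?g i j * ?g k l * chern_curvature h z i j k l)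
        = - (?g i j * (\<Sum>p\<in>UNIV. ?W p i j k * (\<Sum>l\<in>UNIV. ?g k l * h z $ p $ l)))"
        unfolding chern_curvature_def sum_distrib_left sum_negf[symmetric]
        by (subst sum.swap) (simp add: sum_distrib_left sum_negf algebra_simps)
      then show ?thesis by (simp add: inv if_distrib cong: if_cong)
    qed
    then show ?thesis by (simp add: sum_negf sum_distrib_left)
  qed
  moreover have "(\<Sum>k\<in>UNIV. ?W k i j k) = wirtinger_bar j (wirtinger i (\<lambda>w. of_real (log_det h w))) z" for i j
  proof -
    have diff: "chern_connection h k i k differentiable (at z)" for k
    proof -
      have "Ck_on (Suc 0) S (chern_connection h k i k)"
        unfolding chern_connection_def[abs_def]
        by (intro Ck_on_sum Ck_on_mult S Ck_on_inverse_metric Ck_on_wirtinger Ck_on_metric)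
      then show ?thesis using z by simp
    qed
    have "wirtinger_bar j (wirtinger i (\<lambda>w. of_real (log_det h w))) z = wirtinger_bar j (\<lambda>w. \<Sum>k\<in>UNIV. chern_connection h k i k w) z"
      by (rule wirtinger_cong(2)[OF S z]) (simp add: wirtinger_def del_fun_log_det chern_connection_def)
    then show ?thesis unfolding wirtinger_bar_def using del_fun_sum(2)[of UNIV "\<lambda>k. chern_connection h k i k", OF diff] by simp
  qed
  ultimately show ?thesis by (simp add: local_chern_scalar_def chern_lap_def sum_negf)
qed

end

section \<open>Conformal changes and changes of coordinates\<close>

lemma local_metric_conformal:
  assumes "open S" "local_metric S h" "smooth_on S f"
  shows "local_metric S (\<lambda>z. exp (f z) *\<^sub>R h z)"
proof -
  have "Ck_on k S (\<lambda>z. exp (f z) *\<^sub>R h z $ i $ j)" for k i j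
    by (rule Ck_on_scaleR[OF assms(1) Ck_on_exp[OF assms(1) smooth_onD[OF assms(3)]] Ck_on_metric[OF assms(1,2)]])
  then show ?thesis
    using assms(2) by (auto simp: local_metric_def smooth_on_def intro: hermitian_pos_scaleR)
qed

lemma chern_lap_conformal:
  assumes "open S" "local_metric S h" "z \<in> S"
  shows "chern_lap (\<lambda>z. exp (f z) *\<^sub>R h z) F z = of_real (exp (- f z)) * chern_lap h F z"
  using matrix_inv_scaleR[OF local_metric_invertible[OF assms], of "exp (f z)"]
  by (simp add: chern_lap_def inverse_metric_def exp_minus scaleR_conv_of_real[where 'a = complex] sum_distrib_left algebra_simps)

lemma log_det_conformal:
  fixes h :: "complex^'n::finite \<Rightarrow> complex^'n^'n" and f :: "complex^'n \<Rightarrow> real"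
  assumes "open S" "local_metric S h" "z \<in> S"
  shows "log_det (\<lambda>z. exp (f z) *\<^sub>R h z) z = CARD('n) * f z + log_det h z"
  using hermitian_pos_det(2)[OF local_metric_pos[OF assms]]
  by (simp add: log_det_def det_scaleR ln_mult ln_realpow)

lemma local_chern_scalar_conformal:
  fixes h :: "complex^'n::finite \<Rightarrow> complex^'n^'n"
  assumes S: "open S" and h: "local_metric S h" and f: "smooth_on S f" and z: "z \<in> S"
  shows "local_chern_scalar (\<lambda>z. exp (f z) *\<^sub>R h z) z
    = of_real (exp (- f z)) * (local_chern_scalar h z - of_nat CARD('n) * chern_lap h (\<lambda>w. of_real (f w)) z)"
proof -
  let ?h = "\<lambda>z. exp (f z) *\<^sub>R h z"
  have ld: "log_det ?h w = CARD('n) * f w + log_det h w" if "w \<in> S" for w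
    by (rule log_det_conformal[OF S h that])
  have cf: "Ck_on 2 S (\<lambda>w. complex_of_real (f w))" by (intro Ck_on_of_real S smooth_onD f)
  have cl: "Ck_on 2 S (\<lambda>w. complex_of_real (log_det h w))" by (intro Ck_on_of_real S Ck_on_log_det h)
  have "chern_lap ?h (\<lambda>w. of_real (log_det ?h w)) z = of_real (exp (- f z)) * chern_lap h (\<lambda>w. of_real (log_det ?h w)) z"
    by (rule chern_lap_conformal[OF S h z])
  also have "chern_lap h (\<lambda>w. of_real (log_det ?h w)) z = chern_lap h (\<lambda>w. of_nat CARD('n) * of_real (f w) + of_real (log_det h w)) z"
    by (rule chern_lap_cong[OF S h z]) (simp add: ld)
  also have "\<dots> = of_nat CARD('n) * chern_lap h (\<lambda>w. of_real (f w)) z + chern_lap h (\<lambda>w. of_real (log_det h w)) z"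
    by (subst chern_lap_add[OF S h Ck_on_mult[OF S Ck_on_const cf] cl z]) (simp add: chern_lap_cmult[OF S h cf z])
  finally show ?thesis
    unfolding local_chern_scalar_eq[OF S h z] local_chern_scalar_eq[OF S local_metric_conformal[OF S h f] z]
    by (simp add: algebra_simps)
qed

lemma Ck_on_vec:
  fixes f :: "'v::real_normed_vector \<Rightarrow> complex^'n::finite"
  assumes "open S" "\<And>i. Ck_on k S (\<lambda>x. f x $ i)"
  shows "Ck_on k S f"
proof (rule Ck_on_componentwise[OF assms(1)])
  fix b :: "complex^'n" assume "b \<in> Basis"
  then obtain i u where b: "b = axis i u" by (auto simp: Basis_vec_def)
  show "Ck_on k S (\<lambda>x. f x \<bullet> b)"
    unfolding b inner_axis by (intro Ck_on_inner assms Ck_on_const)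
qed

locale holomorphic_change =
  fixes V W :: "(complex^'n::finite) set" and \<phi> :: "complex^'n \<Rightarrow> complex^'n"
  assumes open_V: "open V" and open_W: "open W" and holo: "holomorphic_map_on V \<phi>" and maps: "\<phi> ` V \<subseteq> W"
begin

definition jac :: "complex^'n \<Rightarrow> complex^'n^'n" where
  "jac z = (\<chi> k i. wirtinger i (\<lambda>w. \<phi> w $ k) z)"

lemma in_W: "z \<in> V \<Longrightarrow> \<phi> z \<in> W"
  using maps by auto

lemma holo_component: "holo_fun_on V (\<lambda>w. \<phi> w $ k)"
  unfolding holo_fun_on_def
proof
  fix z assume "z \<in> V"
  then obtain D where D: "(\<phi> has_derivative D) (at z)" "\<And>c v. D (c *s v) = c *s D v"
    using holo unfolding holomorphic_map_on_def by blast
  from D(1) have "((\<lambda>w. \<phi> w $ k) has_derivative (\<lambda>v. D v $ k)) (at z)"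
    by (rule bounded_linear.has_derivative[OF bounded_linear_vec_nth])
  then show "\<exists>D. ((\<lambda>w. \<phi> w $ k) has_derivative D) (at z) \<and> (\<forall>c v. D (c *s v) = c * D v)"
    using D(2) by (intro exI[of _ "\<lambda>v. D v $ k"]) auto
qed

lemma holo_jac: "holo_fun_on V (\<lambda>w. jac w $ k $ i)"
  unfolding jac_def by (simp add: holo_fun_on_wirtinger[OF open_V holo_component])

lemma has_derivative_jac:
  assumes "z \<in> V"
  shows "(\<phi> has_derivative (\<lambda>v. jac z *v v)) (at z)"
proof -
  obtain D where D: "(\<phi> has_derivative D) (at z)" "\<And>c v. D (c *s v) = c *s D v"
    using holo assms unfolding holomorphic_map_on_def by blast
  have "D v $ k = (jac z *v v) $ k" for v k
  proof -
    have Dk: "((\<lambda>w. \<phi> w $ k) has_derivative (\<lambda>v. D v $ k)) (at z)"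
      by (rule bounded_linear.has_derivative[OF bounded_linear_vec_nth D(1)])
    have "D v $ k = del_fun (\<lambda>w. \<phi> w $ k) z v"
      using holo_fun_on_delbar(2)[OF holo_component assms] frechet_derivative_at[OF Dk] by metis
    also have "\<dots> = (\<Sum>i\<in>UNIV. v $ i * wirtinger i (\<lambda>w. \<phi> w $ k) z)"
      by (rule del_fun_expand(1)) (use Dk in \<open>auto simp: differentiable_def\<close>)
    finally show ?thesis by (simp add: matrix_vector_mult_def jac_def mult.commute)
  qed
  then have "D = (\<lambda>v. jac z *v v)" by (simp add: fun_eq_iff vec_eq_iff)
  with D(1) show ?thesis by simp
qed

lemma Ck_on_phi: "Ck_on k V \<phi>"
  by (intro Ck_on_vec open_V smooth_onD holo_fun_on_smooth holo_component)

lemma Ck_on_pullback: "Ck_on k W F \<Longrightarrow> Ck_on k V (\<lambda>z. F (\<phi> z))"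
  by (rule Ck_on_compose[OF open_V Ck_on_phi open_W _ maps])

lemma wirtinger_pullback:
  assumes F: "F differentiable (at (\<phi> z))" and z: "z \<in> V"
  shows "wirtinger i (\<lambda>w. F (\<phi> w)) z = (\<Sum>k\<in>UNIV. wirtinger k F (\<phi> z) * jac z $ k $ i)"
    "wirtinger_bar i (\<lambda>w. F (\<phi> w)) z = (\<Sum>k\<in>UNIV. wirtinger_bar k F (\<phi> z) * cnj (jac z $ k $ i))"
proof -
  let ?D = "frechet_derivative F (at (\<phi> z))"
  have D: "((\<lambda>w. F (\<phi> w)) has_derivative (\<lambda>v. ?D (jac z *v v))) (at z)"
    by (rule has_derivative_compose[OF has_derivative_jac[OF z]]) (use F in \<open>simp add: frechet_derivative_works\<close>)
  have s: "jac z *v (c *s v) = c *s (jac z *v v)" for c v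
    by (simp add: vec_eq_iff matrix_vector_mult_def sum_distrib_left algebra_simps)
  have "del_fun (\<lambda>w. F (\<phi> w)) z u = del_fun F (\<phi> z) (jac z *v u)"
    "delbar_fun (\<lambda>w. F (\<phi> w)) z u = delbar_fun F (\<phi> z) (jac z *v u)" for u
    unfolding del_fun_eq[OF D] delbar_fun_eq[OF D] unfolding del_fun_def delbar_fun_def s by simp_all
  then show "wirtinger i (\<lambda>w. F (\<phi> w)) z = (\<Sum>k\<in>UNIV. wirtinger k F (\<phi> z) * jac z $ k $ i)"
    "wirtinger_bar i (\<lambda>w. F (\<phi> w)) z = (\<Sum>k\<in>UNIV. wirtinger_bar k F (\<phi> z) * cnj (jac z $ k $ i))"
    by (simp_all add: wirtinger_def[of i] wirtinger_bar_def[of i] del_fun_expand[OF F] matrix_vector_mult_axis mult.commute)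
qed

text \<open>The entries of the Jacobian are holomorphic, so the antiholomorphic derivative produces
  no second derivatives of \<phi>. This is why mixed second derivatives form a tensor and the
  Laplacian is invariant without a connection term.\<close>

lemma wirtinger_bar_pullback_jac:
  assumes \<psi>: "\<And>k. Ck_on (Suc 0) W (\<psi> k)" and z: "z \<in> V"
  shows "wirtinger_bar j (\<lambda>w. \<Sum>k\<in>UNIV. \<psi> k (\<phi> w) * jac w $ k $ i) z
    = (\<Sum>k\<in>UNIV. \<Sum>l\<in>UNIV. wirtinger_bar l (\<psi> k) (\<phi> z) * jac z $ k $ i * cnj (jac z $ l $ j))"
proof -
  have d1: "(\<lambda>w. \<psi> k (\<phi> w)) differentiable (at z)" for k
    by (rule Ck_on_differentiable[OF Ck_on_pullback[OF \<psi>] z])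
  have d2: "(\<lambda>w. jac w $ k $ i) differentiable (at z)" for k
    using holo_fun_onD(1)[OF holo_jac z] by (auto simp: differentiable_def)
  have d3: "\<psi> k differentiable (at (\<phi> z))" for k
    by (rule Ck_on_differentiable[OF \<psi> in_W[OF z]])
  have "wirtinger_bar j (\<lambda>w. \<psi> k (\<phi> w) * jac w $ k $ i) z = wirtinger_bar j (\<lambda>w. \<psi> k (\<phi> w)) z * jac z $ k $ i" for k
    unfolding wirtinger_bar_def del_fun_mult(2)[OF d1 d2] holo_fun_on_delbar(1)[OF holo_jac z] by simp
  moreover have "wirtinger_bar j (\<lambda>w. \<Sum>k\<in>UNIV. \<psi> k (\<phi> w) * jac w $ k $ i) z = (\<Sum>k\<in>UNIV. wirtinger_bar j (\<lambda>w. \<psi> k (\<phi> w) * jac w $ k $ i) z)"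
    unfolding wirtinger_bar_def by (rule del_fun_sum(2)) (intro differentiable_mult d1 d2)
  ultimately show ?thesis
    by (simp add: wirtinger_pullback(2)[OF d3 z] sum_distrib_left sum_distrib_right algebra_simps)
qed

end

locale metric_change = holomorphic_change V W \<phi>
  for V W :: "(complex^'n::finite) set" and \<phi> +
  fixes h h' :: "complex^'n \<Rightarrow> complex^'n^'n"
  assumes h: "local_metric V h" and h': "local_metric W h'"
    and trans: "\<And>z i j. z \<in> V \<Longrightarrow> h z $ i $ j =
      (\<Sum>k\<in>UNIV. \<Sum>l\<in>UNIV. h' (\<phi> z) $ k $ l * jac z $ k $ i * cnj (jac z $ l $ j))"
begin

lemma basis_change:
  assumes z: "z \<in> V"
  shows "det (h z) = det (h' (\<phi> z)) * (det (jac z) * cnj (det (jac z)))" "det (jac z) \<noteq> 0"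
    "inverse_metric h' (\<phi> z) k l = (\<Sum>i\<in>UNIV. \<Sum>j\<in>UNIV. jac z $ k $ i * cnj (jac z $ l $ j) * inverse_metric h z i j)"
  using change_of_basis[where A = "h z" and A' = "h' (\<phi> z)" and J = "jac z", OF trans[OF z]
      local_metric_invertible[OF open_V h z] local_metric_invertible[OF open_W h' in_W[OF z]]]
  by (simp_all add: inverse_metric_def)

lemma contract_pullback:
  assumes z: "z \<in> V"
  shows "(\<Sum>i\<in>UNIV. \<Sum>j\<in>UNIV. inverse_metric h z i j * (\<Sum>k\<in>UNIV. \<Sum>l\<in>UNIV. X k l * jac z $ k $ i * cnj (jac z $ l $ j)))
    = (\<Sum>k\<in>UNIV. \<Sum>l\<in>UNIV. inverse_metric h' (\<phi> z) k l * X k l)"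
proof -
  let ?t = "\<lambda>i j k l. inverse_metric h z i j * (X k l * jac z $ k $ i * cnj (jac z $ l $ j))"
  have "(\<Sum>i\<in>UNIV. \<Sum>j\<in>UNIV. \<Sum>k\<in>UNIV. \<Sum>l\<in>UNIV. ?t i j k l)
      = (\<Sum>(i, j)\<in>UNIV \<times> UNIV. \<Sum>(k, l)\<in>UNIV \<times> UNIV. ?t i j k l)"
    by (simp only: sum.cartesian_product[symmetric])
  also have "\<dots> = (\<Sum>(k, l)\<in>UNIV \<times> UNIV. \<Sum>(i, j)\<in>UNIV \<times> UNIV. ?t i j k l)"
    unfolding case_prod_beta by (rule sum.swap)
  also have "\<dots> = (\<Sum>k\<in>UNIV. \<Sum>l\<in>UNIV. \<Sum>i\<in>UNIV. \<Sum>j\<in>UNIV. ?t i j k l)"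
    by (simp only: sum.cartesian_product[symmetric])
  finally show ?thesis
    unfolding basis_change(3)[OF z] by (simp add: sum_distrib_left sum_distrib_right algebra_simps)
qed

lemma chern_lap_pullback:
  assumes F: "Ck_on 2 W F" and z: "z \<in> V"
  shows "chern_lap h (\<lambda>w. F (\<phi> w)) z = chern_lap h' F (\<phi> z)"
proof -
  have F': "Ck_on (Suc (Suc 0)) W F" using F by (simp add: numeral_2_eq_2)
  have "wirtinger_bar j (wirtinger i (\<lambda>w. F (\<phi> w))) z = wirtinger_bar j (\<lambda>w. \<Sum>k\<in>UNIV. wirtinger k F (\<phi> w) * jac w $ k $ i) z" for i j
    by (rule wirtinger_cong(2)[OF open_V z wirtinger_pullback(1)]) (use F' in_W in auto)
  then show ?thesis
    unfolding chern_lap_def using contract_pullback[OF z, of "\<lambda>k l. wirtinger_bar l (wirtinger k F) (\<phi> z)"]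
    by (simp add: wirtinger_bar_pullback_jac[OF Ck_on_wirtinger(1)[OF open_W F'] z])
qed

lemma log_det_pullback:
  assumes z: "z \<in> V"
  shows "log_det h z = log_det h' (\<phi> z) + ln ((norm (det (jac z)))\<^sup>2)"
proof -
  have "det (h z) = of_real (Re (det (h' (\<phi> z))) * (norm (det (jac z)))\<^sup>2)"
    unfolding basis_change(1)[OF z] of_real_mult complex_norm_square
    using hermitian_pos_det(1)[OF local_metric_pos[OF open_W h' in_W[OF z]]] by simp
  then have "Re (det (h z)) = Re (det (h' (\<phi> z))) * (norm (det (jac z)))\<^sup>2"
    by (metis Re_complex_of_real)
  then show ?thesis
    using hermitian_pos_det(2)[OF local_metric_pos[OF open_W h' in_W[OF z]]] basis_change(2)[OF z]
    by (simp add: log_det_def ln_mult)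
qed

text \<open>The function log |det J|^2 is pluriharmonic: its holomorphic derivatives are those of
  det J divided by det J, hence holomorphic. Therefore log det h, although not a scalar, has an
  invariant Laplacian, and the scalar curvature is well defined.\<close>

lemma chern_lap_log_norm_det:
  assumes z: "z \<in> V"
  shows "chern_lap h (\<lambda>w. of_real (ln ((norm (det (jac w)))\<^sup>2))) z = 0"
proof -
  let ?j = "\<lambda>w. det (jac w)"
  have holo: "holo_fun_on V ?j" by (intro holo_fun_on_det holo_jac)
  have "wirtinger i (\<lambda>w. of_real (ln ((norm (?j w))\<^sup>2))) w = wirtinger i ?j w * inverse (?j w)" if w: "w \<in> V" for i w
  proof -
    let ?D = "frechet_derivative ?j (at w)"
    have nz: "?j w \<noteq> 0" by (rule basis_change(2)[OF w])
    note D = holo_fun_onD(1)[OF holo w]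
    have "((\<lambda>w. Re (?j w * cnj (?j w))) has_derivative (\<lambda>u. Re (?j w * cnj (?D u) + ?D u * cnj (?j w)))) (at w)"
      by (intro bounded_linear.has_derivative[OF bounded_linear_Re] has_derivative_mult D bounded_linear.has_derivative[OF bounded_linear_cnj])
    moreover have "Re (a * cnj a) = (norm a)\<^sup>2" for a
      unfolding complex_norm_square[symmetric] by simp
    ultimately have "((\<lambda>w. (norm (?j w))\<^sup>2) has_derivative (\<lambda>u. Re (?j w * cnj (?D u) + ?D u * cnj (?j w)))) (at w)"
      by simp
    then have "((\<lambda>w. of_real (ln ((norm (?j w))\<^sup>2)) :: complex) has_derivative (\<lambda>u. of_real (Re (?j w * cnj (?D u) + ?D u * cnj (?j w)) * inverse ((norm (?j w))\<^sup>2)))) (at w)"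
      by (intro bounded_linear.has_derivative[OF bounded_linear_of_real] has_derivative_ln) (use nz in auto)
    moreover have "of_real (Re (?j w * cnj (?D u) + ?D u * cnj (?j w)) * inverse ((norm (?j w))\<^sup>2)) = ?D u * inverse (?j w) + cnj (?D u * inverse (?j w))" for u
    proof -
      have "of_real (Re (?j w * cnj (?D u) + ?D u * cnj (?j w))) = ?j w * cnj (?D u) + ?D u * cnj (?j w)"
        by (simp add: complex_eq_iff)
      then have "of_real (Re (?j w * cnj (?D u) + ?D u * cnj (?j w)) * inverse ((norm (?j w))\<^sup>2))
         = (?j w * cnj (?D u) + ?D u * cnj (?j w)) * inverse (?j w * cnj (?j w))"
        unfolding of_real_mult of_real_inverse complex_norm_square by simp
      then show ?thesis using nz by (simp add: field_simps)
    qed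
    ultimately have "((\<lambda>w. of_real (ln ((norm (?j w))\<^sup>2)) :: complex) has_derivative (\<lambda>u. ?D u * inverse (?j w) + cnj (?D u * inverse (?j w)))) (at w)"
      by simp
    from del_fun_eq[OF this] show ?thesis
      using holo_fun_onD(2)[OF holo w] holo_fun_on_delbar(2)[OF holo w]
      by (simp add: wirtinger_def field_simps)
  qed
  then have "wirtinger_bar j (wirtinger i (\<lambda>w. of_real (ln ((norm (?j w))\<^sup>2)))) z = wirtinger_bar j (\<lambda>w. wirtinger i ?j w * inverse (?j w)) z" for i j
    by (intro wirtinger_cong(2)[OF open_V z])
  moreover have "holo_fun_on V (\<lambda>w. wirtinger i ?j w * inverse (?j w))" for i
    by (intro holo_fun_on_mult holo_fun_on_wirtinger holo_fun_on_inverse holo open_V basis_change(2))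
  then have "wirtinger_bar j (\<lambda>w. wirtinger i ?j w * inverse (?j w)) z = 0" for i j
    unfolding wirtinger_bar_def by (rule holo_fun_on_delbar(1)[OF _ z])
  ultimately show ?thesis by (simp add: chern_lap_def)
qed

lemma local_chern_scalar_pullback:
  assumes z: "z \<in> V"
  shows "local_chern_scalar h z = local_chern_scalar h' (\<phi> z)"
proof -
  let ?L = "\<lambda>w. complex_of_real (log_det h' w)"
  have L: "Ck_on 2 W ?L" by (intro Ck_on_of_real open_W Ck_on_log_det h')
  have N: "Ck_on 2 V (\<lambda>w. complex_of_real (ln ((norm (det (jac w)))\<^sup>2)))"
  proof -
    have "Ck_on 2 V (\<lambda>w. complex_of_real (log_det h w - log_det h' (\<phi> w)))"
      by (intro Ck_on_of_real Ck_on_diff open_V Ck_on_log_det[OF open_V h] Ck_on_pullback[OF Ck_on_log_det[OF open_W h']])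
    then show ?thesis
      by (subst Ck_on_cong[OF open_V, where g = "\<lambda>w. complex_of_real (log_det h w - log_det h' (\<phi> w))"])
        (simp_all add: log_det_pullback)
  qed
  have "chern_lap h (\<lambda>w. of_real (log_det h w)) z = chern_lap h (\<lambda>w. ?L (\<phi> w) + of_real (ln ((norm (det (jac w)))\<^sup>2))) z"
    by (rule chern_lap_cong[OF open_V h z]) (simp add: log_det_pullback)
  also have "\<dots> = chern_lap h (\<lambda>w. ?L (\<phi> w)) z"
    by (simp add: chern_lap_add[OF open_V h Ck_on_pullback[OF L] N z] chern_lap_log_norm_det[OF z])
  also have "\<dots> = chern_lap h' ?L (\<phi> z)" by (rule chern_lap_pullback[OF L z])
  finally show ?thesis
    by (simp add: local_chern_scalar_eq[OF open_V h z] local_chern_scalar_eq[OF open_W h' in_W[OF z]])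
qed

end

section \<open>The Gauduchon condition in coordinates\<close>

definition gauduchon_fun :: "(complex^'n::finite \<Rightarrow> complex^'n^'n) \<Rightarrow> complex^'n \<Rightarrow> complex" where
  "gauduchon_fun h z = (\<Sum>k\<in>UNIV. \<Sum>l\<in>UNIV. wirtinger k (wirtinger_bar l (\<lambda>w. det (h w) * inverse_metric h w k l)) z)"

lemma alt_sum_del_fun:
  assumes "\<And>u. (\<lambda>w. B w u) differentiable (at z)"
  shows "del_fun (\<lambda>w. alt_sum m (B w) v) z x = alt_sum m (\<lambda>u. del_fun (\<lambda>w. B w u) z x) v"
    "delbar_fun (\<lambda>w. alt_sum m (B w) v) z x = alt_sum m (\<lambda>u. delbar_fun (\<lambda>w. B w u) z x) v"
  unfolding alt_sum_def using assms
  by (simp_all add: del_fun_sum del_fun_cmult)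

lemma delbar_form_alt_sum:
  assumes "\<And>u. (\<lambda>w. B w u) differentiable (at z)"
  shows "delbar_form k (\<lambda>w. alt_sum k (B w)) z v
    = alt_sum (Suc k) (\<lambda>u. delbar_fun (\<lambda>w. B w (\<lambda>i. u (Suc i))) z (u 0)) v"
  unfolding delbar_form_def alt_sum_del_fun(2)[of B z, OF assms]
  by (rule alt_sum_Suc[of k "\<lambda>x u. delbar_fun (\<lambda>w. B w u) z x"])

text \<open>The identity for \<alpha> is asked on S only: \<alpha> will be the result of
  \<open>delbar_form\<close>, which is known to be an alternating sum just where the coefficients
  are smooth.\<close>

lemma del_form_alt_sum:
  assumes S: "open S" "z \<in> S" and \<alpha>: "\<And>w v. w \<in> S \<Longrightarrow> \<alpha> w v = alt_sum k (B w) v"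
    and diff: "\<And>u. (\<lambda>w. B w u) differentiable (at z)"
  shows "del_form k \<alpha> z v = alt_sum (Suc k) (\<lambda>u. del_fun (\<lambda>w. B w (\<lambda>i. u (Suc i))) z (u 0)) v"
proof -
  have "del_fun (\<lambda>w. \<alpha> w v) z x = alt_sum k (\<lambda>u. del_fun (\<lambda>w. B w u) z x) v" for v x
    unfolding alt_sum_del_fun(1)[of B z, OF diff, symmetric]
    by (rule del_fun_cong(1)[OF S]) (simp add: \<alpha>)
  then show ?thesis
    unfolding del_form_def using alt_sum_Suc[of k "\<lambda>x u. del_fun (\<lambda>w. B w u) z x" v] by simp
qed

lemma wirtinger_alt_sum:
  assumes S: "open S" and z: "z \<in> S" and B: "\<And>u. Ck_on 2 S (\<lambda>w. B w u)"
  shows "alt_sum m (\<lambda>u. c u * wirtinger k (wirtinger_bar l (\<lambda>w. B w u)) z) v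
    = wirtinger k (wirtinger_bar l (\<lambda>w. alt_sum m (\<lambda>u. c u * B w u) v)) z"
proof -
  have B': "Ck_on (Suc (Suc 0)) S (\<lambda>w. B w u)" for u using B by (simp add: numeral_2_eq_2)
  have d1: "(\<lambda>w. B w u) differentiable (at w)" if "w \<in> S" for u w using B' that by auto
  have d2: "wirtinger_bar l (\<lambda>w. B w u) differentiable (at z)" for u
    by (rule Ck_on_differentiable[OF Ck_on_wirtinger(2)[OF S B'] z])
  have "wirtinger k (wirtinger_bar l (\<lambda>w. alt_sum m (\<lambda>u. c u * B w u) v)) z
     = wirtinger k (\<lambda>w. alt_sum m (\<lambda>u. c u * wirtinger_bar l (\<lambda>w. B w u) w) v) z"
  proof (rule wirtinger_cong(1)[OF S z])
    fix w assume w: "w \<in> S"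
    show "wirtinger_bar l (\<lambda>w. alt_sum m (\<lambda>u. c u * B w u) v) w = alt_sum m (\<lambda>u. c u * wirtinger_bar l (\<lambda>w. B w u) w) v"
      unfolding wirtinger_bar_def
      by (subst alt_sum_del_fun(2)) (auto simp: del_fun_cmult d1[OF w])
  qed
  also have "\<dots> = alt_sum m (\<lambda>u. c u * wirtinger k (wirtinger_bar l (\<lambda>w. B w u)) z) v"
    unfolding wirtinger_def
    by (subst alt_sum_del_fun(1)) (auto simp: del_fun_cmult d2)
  finally show ?thesis ..
qed

text \<open>The forms dz^k and dzbar^l are constant, so both derivatives may be taken of dz^k \<and>
  dzbar^l \<and> \<omega>^(n-1), whose coefficient is a constant times det h times the inverse
  metric. The top-degree form evaluates v through the determinant of its frame matrix.\<close>

lemma del_delbar_form_power: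
  fixes h :: "complex^'n::finite \<Rightarrow> complex^'n^'n"
  assumes S: "open S" and h: "local_metric S h" and z: "z \<in> S"
  shows "del_form (2 * CARD('n) - 1) (delbar_form (2 * CARD('n) - 2)
      (form_power (fundamental_form h) (CARD('n) - 1))) z v
    = \<i> ^ (CARD('n) - 1) * of_nat (card_fix TYPE('n)) * gauduchon_fun h z * det (frame_matrix (frame_of v))"
proof -
  define N where "N = CARD('n) - 1"
  have card: "CARD('n) = Suc N" "2 * CARD('n) - 1 = Suc (2 * N)" "2 * CARD('n) - 2 = 2 * N"
    "2 * CARD('n) = Suc (Suc (2 * N))"
    using zero_less_card_finite[where 'a = 'n] unfolding N_def by linarith+
  define B where "B = (\<lambda>w u. \<Prod>m<N. \<i> * herm_form (h w) (u (2 * m)) (u (2 * m + 1)))"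
  have smB: "Ck_on k S (\<lambda>w. B w u)" for k u
    unfolding B_def herm_form_def by (intro Ck_on_prod Ck_on_mult Ck_on_sum Ck_on_const S Ck_on_metric[OF S h])
  then have B2: "Ck_on (Suc (Suc 0)) S (\<lambda>w. B w u)" for u by blast
  have dB: "(\<lambda>w. B w u) differentiable (at w)" if "w \<in> S" for u w
    by (rule Ck_on_differentiable[OF smB that])
  let ?s = "\<lambda>u :: nat \<Rightarrow> complex^'n. \<lambda>i. u (Suc i)"
  have fp: "form_power (fundamental_form h) N = (\<lambda>w. alt_sum (2 * N) (B w))"
    by (intro ext) (simp add: form_power_eq_alt_sum B_def)
  have "del_form (Suc (2 * N)) (delbar_form (2 * N) (form_power (fundamental_form h) N)) z v
     = alt_sum (Suc (Suc (2 * N))) (\<lambda>u. del_fun (\<lambda>w. delbar_fun (\<lambda>w. B w (?s (?s u))) w (u 1)) z (u 0)) v"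
  proof (subst del_form_alt_sum[OF S z, where B = "\<lambda>w u. delbar_fun (\<lambda>w. B w (?s u)) w (u 0)"])
    show "delbar_form (2 * N) (form_power (fundamental_form h) N) w v = alt_sum (Suc (2 * N)) (\<lambda>u. delbar_fun (\<lambda>w. B w (?s u)) w (u 0)) v"
      if "w \<in> S" for w v
      unfolding fp by (rule delbar_form_alt_sum[OF dB[OF that]])
    show "(\<lambda>w. delbar_fun (\<lambda>w. B w (?s u)) w (u 0)) differentiable (at z)" for u
      by (rule Ck_on_differentiable[OF Ck_on_del_fun(2)[OF S B2] z])
  qed simp
  also have "\<dots> = alt_sum (2 * CARD('n)) (\<lambda>u. \<Sum>k\<in>UNIV. \<Sum>l\<in>UNIV. u 0 $ k * cnj (u 1 $ l) * wirtinger k (wirtinger_bar l (\<lambda>w. B w (?s (?s u)))) z) v"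
    unfolding card(4)
  proof (rule alt_sum_cong)
    fix u :: "nat \<Rightarrow> complex^'n"
    let ?F = "\<lambda>w. B w (?s (?s u))"
    have "del_fun (\<lambda>w. delbar_fun ?F w (u 1)) z (u 0) = (\<Sum>k\<in>UNIV. u 0 $ k * wirtinger k (\<lambda>w. delbar_fun ?F w (u 1)) z)"
      by (rule del_fun_expand(1)[OF Ck_on_differentiable[OF Ck_on_del_fun(2)[OF S B2] z]])
    moreover have "wirtinger k (\<lambda>w. delbar_fun ?F w (u 1)) z = (\<Sum>l\<in>UNIV. cnj (u 1 $ l) * wirtinger k (wirtinger_bar l ?F) z)" for k
    proof -
      have "wirtinger k (\<lambda>w. delbar_fun ?F w (u 1)) z = wirtinger k (\<lambda>w. \<Sum>l\<in>UNIV. cnj (u 1 $ l) * wirtinger_bar l ?F w) z"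
        by (rule wirtinger_cong(1)[OF S z del_fun_expand(2)[OF dB]])
      also have "\<dots> = (\<Sum>l\<in>UNIV. cnj (u 1 $ l) * wirtinger k (wirtinger_bar l ?F) z)"
        unfolding wirtinger_def
        using Ck_on_differentiable[OF Ck_on_wirtinger(2)[OF S B2] z]
        by (simp add: del_fun_sum(1) del_fun_cmult(1))
      finally show ?thesis .
    qed
    ultimately show "del_fun (\<lambda>w. delbar_fun ?F w (u 1)) z (u 0) = (\<Sum>k\<in>UNIV. \<Sum>l\<in>UNIV. u 0 $ k * cnj (u 1 $ l) * wirtinger k (wirtinger_bar l ?F) z)"
      by (simp add: sum_distrib_left mult.assoc)
  qed
  also have "\<dots> = (\<Sum>k\<in>UNIV. \<Sum>l\<in>UNIV. wirtinger k (wirtinger_bar l (\<lambda>w. alt_sum (2 * CARD('n)) (\<lambda>u. u 0 $ k * cnj (u 1 $ l) * B w (?s (?s u))) v)) z)"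
    unfolding alt_sum_sum
    by (intro sum.cong refl wirtinger_alt_sum[OF S z]) (rule smB)
  also have "\<dots> = (\<Sum>k\<in>UNIV. \<Sum>l\<in>UNIV. \<i> ^ N * of_nat (card_fix TYPE('n)) * det (frame_matrix (frame_of v)) * wirtinger k (wirtinger_bar l (\<lambda>w. det (h w) * inverse_metric h w k l)) z)"
  proof (intro sum.cong refl)
    fix k l
    let ?c = "\<i> ^ N * of_nat (card_fix TYPE('n)) * det (frame_matrix (frame_of v))"
    let ?A = "\<lambda>w. det (h w) * inverse_metric h w k l"
    have A: "Ck_on (Suc (Suc 0)) S ?A"
      by (intro Ck_on_mult S Ck_on_det_metric[OF S h] Ck_on_inverse_metric[OF S h])
    have e: "alt_sum (2 * CARD('n)) (\<lambda>u. u 0 $ k * cnj (u 1 $ l) * B w (?s (?s u))) v = ?c * ?A w" if "w \<in> S" for w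
      using alt_sum_wedge_form_power[OF local_metric_invertible[OF S h that], of k l v]
      by (simp add: B_def N_def inverse_metric_def)
    have "wirtinger k (wirtinger_bar l (\<lambda>w. alt_sum (2 * CARD('n)) (\<lambda>u. u 0 $ k * cnj (u 1 $ l) * B w (?s (?s u))) v)) z
      = wirtinger k (\<lambda>w. ?c * wirtinger_bar l ?A w) z"
    proof (rule wirtinger_cong(1)[OF S z])
      fix w assume w: "w \<in> S"
      have "wirtinger_bar l (\<lambda>w. alt_sum (2 * CARD('n)) (\<lambda>u. u 0 $ k * cnj (u 1 $ l) * B w (?s (?s u))) v) w = wirtinger_bar l (\<lambda>w. ?c * ?A w) w"
        by (rule wirtinger_cong(2)[OF S w e])
      also have "\<dots> = ?c * wirtinger_bar l ?A w"
        unfolding wirtinger_bar_def by (rule del_fun_cmult(2)[OF Ck_on_differentiable[OF A w]])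
      finally show "wirtinger_bar l (\<lambda>w. alt_sum (2 * CARD('n)) (\<lambda>u. u 0 $ k * cnj (u 1 $ l) * B w (?s (?s u))) v) w = ?c * wirtinger_bar l ?A w" .
    qed
    also have "\<dots> = ?c * wirtinger k (wirtinger_bar l ?A) z"
      unfolding wirtinger_def by (rule del_fun_cmult(1)[OF Ck_on_differentiable[OF Ck_on_wirtinger(2)[OF S A] z]])
    finally show "wirtinger k (wirtinger_bar l (\<lambda>w. alt_sum (2 * CARD('n)) (\<lambda>u. u 0 $ k * cnj (u 1 $ l) * B w (?s (?s u))) v)) z
      = ?c * wirtinger k (wirtinger_bar l ?A) z" .
  qed
  finally show ?thesis
    unfolding card(2,3) N_def[symmetric] by (simp add: gauduchon_fun_def sum_distrib_left algebra_simps)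
qed

text \<open>The real frame is one tuple of vectors on which a top-degree form vanishes only if its
  coefficient does.\<close>

lemma gauduchon_iff_local:
  fixes h :: "complex^'n::finite \<Rightarrow> complex^'n^'n"
  assumes S: "open S" and h: "local_metric S h" and z: "z \<in> S"
  shows "(\<forall>v. del_form (2 * CARD('n) - 1) (delbar_form (2 * CARD('n) - 2)
      (form_power (fundamental_form h) (CARD('n) - 1))) z v = 0) \<longleftrightarrow> gauduchon_fun h z = 0"
proof -
  have "det (frame_matrix (frame_of real_frame :: 'n + 'n \<Rightarrow> complex^'n)) \<noteq> 0"
    by (simp add: det_real_frame)
  then show ?thesis
    unfolding del_delbar_form_power[OF assms] using card_fix_pos[where 'n = 'n] by auto
qed

text \<open>Two integrations by parts, at the level of the integrands.\<close>

lemma det_chern_lap_eq: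
  fixes h :: "complex^'n::finite \<Rightarrow> complex^'n^'n"
  assumes S: "open S" and h: "local_metric S h" and F: "Ck_on 2 S F" and z: "z \<in> S"
  defines "A \<equiv> \<lambda>k l w. det (h w) * inverse_metric h w k l"
  shows "det (h z) * chern_lap h F z = F z * gauduchon_fun h z +
    (\<Sum>k\<in>UNIV. \<Sum>l\<in>UNIV. wirtinger_bar l (\<lambda>w. A k l w * wirtinger k F w) z - wirtinger k (\<lambda>w. F w * wirtinger_bar l (A k l) w) z)"
proof -
  have F': "Ck_on (Suc (Suc 0)) S F" using F by (simp add: numeral_2_eq_2)
  have A: "Ck_on m S (A k l)" for m k l
    unfolding A_def by (intro Ck_on_mult S Ck_on_det_metric[OF S h] Ck_on_inverse_metric[OF S h])
  have 1: "wirtinger_bar l (\<lambda>w. A k l w * wirtinger k F w) z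
      = A k l z * wirtinger_bar l (wirtinger k F) z + wirtinger_bar l (A k l) z * wirtinger k F z" for k l
    unfolding wirtinger_bar_def
    by (rule del_fun_mult(2)[OF Ck_on_differentiable[OF A z] Ck_on_differentiable[OF Ck_on_wirtinger(1)[OF S F'] z]])
  have 2: "wirtinger k (\<lambda>w. F w * wirtinger_bar l (A k l) w) z
      = F z * wirtinger k (wirtinger_bar l (A k l)) z + wirtinger k F z * wirtinger_bar l (A k l) z" for k l
    unfolding wirtinger_def[of k]
    by (rule del_fun_mult(1)[OF Ck_on_differentiable[OF F' z] Ck_on_differentiable[OF Ck_on_wirtinger(2)[OF S A] z]])
  show ?thesis
    unfolding 1 2 chern_lap_def gauduchon_fun_def A_def[symmetric]
    by (simp add: sum_distrib_left sum.distrib sum_subtractf A_def algebra_simps)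
qed

section \<open>Integration by parts\<close>

text \<open>Dominated convergence for difference quotients along sequences; after division by t the
  bound linear in \<bar>t\<bar> is the dominating function w.\<close>

lemma has_real_derivative_integral:
  fixes F :: "real \<Rightarrow> 'a \<Rightarrow> real"
  assumes int: "\<And>t. \<bar>t\<bar> < 1 \<Longrightarrow> integrable M (F t)"
    and deriv: "\<And>x. x \<in> space M \<Longrightarrow> ((\<lambda>t. F t x) has_real_derivative F' x) (at 0)"
    and F': "F' \<in> borel_measurable M"
    and w: "integrable M w"
    and bound: "\<And>t x. \<bar>t\<bar> < 1 \<Longrightarrow> x \<in> space M \<Longrightarrow> \<bar>F t x - F 0 x\<bar> \<le> \<bar>t\<bar> * w x"
  shows "((\<lambda>t. LINT x|M. F t x) has_real_derivative (LINT x|M. F' x)) (at 0)"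
proof -
  let ?I = "{-1<..<1 :: real}"
  have at: "at 0 within ?I = at (0 :: real)" by (rule at_within_open) auto
  have "((\<lambda>t. ((LINT x|M. F t x) - (LINT x|M. F 0 x)) / (t - 0)) \<longlongrightarrow> (LINT x|M. F' x)) (at 0 within ?I)"
    unfolding tendsto_at_iff_sequentially
  proof (intro allI impI)
    fix X :: "nat \<Rightarrow> real" assume X: "\<forall>i. X i \<in> ?I - {0}" and lim: "X \<longlonglongrightarrow> 0"
    have Xi: "\<bar>X i\<bar> < 1" "X i \<noteq> 0" for i using X by (auto simp: abs_less_iff)
    have "(\<lambda>i. LINT x|M. (F (X i) x - F 0 x) / X i) \<longlonglongrightarrow> (LINT x|M. F' x)"
    proof (rule integral_dominated_convergence[OF F' _ w])
      show "(\<lambda>x. (F (X i) x - F 0 x) / X i) \<in> borel_measurable M" for i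
        using int[OF Xi(1)] int[of 0] by (intro borel_measurable_divide borel_measurable_diff) auto
      show "AE x in M. (\<lambda>i. (F (X i) x - F 0 x) / X i) \<longlonglongrightarrow> F' x"
      proof (rule AE_I2)
        fix x assume "x \<in> space M"
        from deriv[OF this] have "((\<lambda>t. (F t x - F 0 x) / (t - 0)) \<longlongrightarrow> F' x) (at 0 within UNIV)"
          by (simp add: has_field_derivative_iff)
        from this[unfolded tendsto_at_iff_sequentially, rule_format, of X] lim Xi(2)
        show "(\<lambda>i. (F (X i) x - F 0 x) / X i) \<longlonglongrightarrow> F' x" by (simp add: o_def)
      qed
      show "AE x in M. norm ((F (X i) x - F 0 x) / X i) \<le> w x" for i
        using bound[OF Xi(1)] Xi(2) by (intro AE_I2) (simp add: divide_le_eq mult.commute)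
    qed
    moreover have e: "(LINT x|M. (F (X i) x - F 0 x) / X i) = ((LINT x|M. F (X i) x) - (LINT x|M. F 0 x)) / X i" for i
      using Bochner_Integration.integral_diff[OF int[OF Xi(1)] int[of 0]] by simp
    ultimately show "((\<lambda>t. ((LINT x|M. F t x) - (LINT x|M. F 0 x)) / (t - 0)) \<circ> X) \<longlonglongrightarrow> (LINT x|M. F' x)"
      by (simp only: o_def e diff_zero)
  qed
  then show ?thesis by (simp add: has_field_derivative_iff at)
qed

text \<open>By translation invariance the integral of f(z + tv) is constant in t, and its derivative
  at t = 0 is the integral of the directional derivative. Iterated integrals are avoided.\<close>

lemma integral_derivative_compact_support:
  fixes f :: "'a::euclidean_space \<Rightarrow> real"
  assumes f: "Ck_on 1 UNIV f" and supp: "\<And>z. norm z > R \<Longrightarrow> f z = 0"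
  shows "(LINT z|lborel. frechet_derivative f (at z) v) = 0"
proof -
  let ?D = "\<lambda>z. frechet_derivative f (at z)"
  have f1: "Ck_on (Suc 0) UNIV f" using f by simp
  have D: "(f has_derivative ?D z) (at z)" for z by (rule Ck_on_SucD(1)[OF f1]) simp
  have contD: "continuous_on UNIV (\<lambda>z. ?D z v)"
    by (rule Ck_on_imp_continuous_on[OF Ck_on_SucD(2)[OF f1]])
  have contf: "continuous_on UNIV f" by (rule Ck_on_imp_continuous_on[OF f])
  have "bounded ((\<lambda>z. ?D z v) ` cball 0 R)"
    by (intro compact_imp_bounded compact_continuous_image continuous_on_subset[OF contD]) auto
  then have "\<exists>C0. \<forall>z\<in>cball 0 R. \<bar>?D z v\<bar> \<le> C0" by (simp add: bounded_iff)
  then obtain C0 where C0: "\<And>z. z \<in> cball 0 R \<Longrightarrow> \<bar>?D z v\<bar> \<le> C0" by blast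
  define C where "C = max C0 0"
  have C: "\<bar>?D z v\<bar> \<le> C" if "z \<in> cball 0 R" for z using C0[OF that] by (simp add: C_def)
  have "C \<ge> 0" by (simp add: C_def)
  have D0: "?D z v = 0" if "norm z > R" for z
  proof -
    have "open {z :: 'a. norm z > R}" by (intro open_Collect_less continuous_intros)
    then have "((\<lambda>_. 0) has_derivative ?D z) (at z)"
      using has_derivative_transform_within_open[OF D, of "{z. norm z > R}" z "\<lambda>_. 0"] that supp by auto
    from has_derivative_unique[OF this has_derivative_const] show ?thesis by simp
  qed
  have Cb: "\<bar>?D z v\<bar> \<le> C" for z using C[of z] D0[of z] \<open>C \<ge> 0\<close> by (cases "norm z > R") auto
  have line: "((\<lambda>t. f (z + t *\<^sub>R v)) has_real_derivative ?D (z + t *\<^sub>R v) v) (at t)" for z t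
  proof -
    have "((\<lambda>t. z + t *\<^sub>R v) has_derivative (\<lambda>s. s *\<^sub>R v)) (at t)"
      by (auto intro!: derivative_eq_intros)
    from has_derivative_compose[OF this D]
    show ?thesis
      by (rule has_derivative_imp_has_field_derivative) (simp add: linear_scale[OF has_derivative_linear[OF D]])
  qed
  have diff: "\<bar>f (z + t *\<^sub>R v) - f z\<bar> \<le> \<bar>t\<bar> * C" for z t
  proof -
    have "norm (f (z + t *\<^sub>R v) - f (z + 0 *\<^sub>R v)) \<le> C * norm (t - 0)"
      by (rule field_differentiable_bound[of UNIV "\<lambda>t. f (z + t *\<^sub>R v)" "\<lambda>t. ?D (z + t *\<^sub>R v) v"])
        (auto intro: line[THEN has_field_derivative_at_within] Cb)
    then show ?thesis by (simp add: mult.commute)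
  qed
  \<comment> \<open>For \<bar>t\<bar> < 1 the translates of f are supported in the ball of radius R
    + norm v, and C bounds the derivative along v everywhere.\<close>
  let ?w = "\<lambda>z. C * indicator (cball 0 (R + norm v)) z :: real"
  have meas: "f \<in> borel_measurable lborel" using contf by (simp add: borel_measurable_continuous_onI)
  have int0: "integrable lborel f"
  proof -
    have "integrable lborel (\<lambda>z. indicator (cball 0 R) z *\<^sub>R f z)"
      by (rule borel_integrable_compact) (auto intro: continuous_on_subset[OF contf])
    moreover have "(\<lambda>z. indicator (cball 0 R) z *\<^sub>R f z) = f"
      using supp by (auto simp: fun_eq_iff indicator_def not_le)
    ultimately show ?thesis by simp
  qed
  have trans: "integrable lborel (\<lambda>z. f (z + t *\<^sub>R v))" "(LINT z|lborel. f (z + t *\<^sub>R v)) = (LINT z|lborel. f z)" for t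
  proof -
    have d: "distr lborel borel ((+) (t *\<^sub>R v)) = (lborel :: 'a measure)" by (rule lborel_distr_plus)
    have m: "(+) (t *\<^sub>R v) \<in> measurable lborel borel" by simp
    show "integrable lborel (\<lambda>z. f (z + t *\<^sub>R v))"
      using integrable_distr[OF m, of f] int0 unfolding d by (simp add: add.commute)
    show "(LINT z|lborel. f (z + t *\<^sub>R v)) = (LINT z|lborel. f z)"
      using integral_distr[OF m, of f] meas unfolding d by (simp add: add.commute)
  qed
  have "((\<lambda>t. LINT z|lborel. f (z + t *\<^sub>R v)) has_real_derivative (LINT z|lborel. ?D z v)) (at 0)"
  proof (rule has_real_derivative_integral[where w = ?w])
    show "integrable lborel (\<lambda>z. f (z + t *\<^sub>R v))" for t by (rule trans(1))
    show "((\<lambda>t. f (z + t *\<^sub>R v)) has_real_derivative ?D z v) (at 0)" for z using line[of z 0] by simp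
    show "(\<lambda>z. ?D z v) \<in> borel_measurable lborel" using contD by (simp add: borel_measurable_continuous_onI)
    show "integrable lborel ?w"
      by (intro integrable_mult_right integrable_real_indicator) (use emeasure_bounded_finite[OF bounded_cball] in auto)
    show "\<bar>f (z + t *\<^sub>R v) - f (z + 0 *\<^sub>R v)\<bar> \<le> \<bar>t\<bar> * ?w z" if t: "\<bar>t\<bar> < 1" for t z
    proof (cases "z \<in> cball 0 (R + norm v)")
      case False
      then have z: "norm z > R + norm v" by simp
      have "norm (t *\<^sub>R v) \<le> norm v" using t by (simp add: mult_left_le_one_le)
      moreover have "norm z \<le> norm (z + t *\<^sub>R v) + norm (t *\<^sub>R v)"
        using norm_triangle_ineq4[of "z + t *\<^sub>R v" "t *\<^sub>R v"] by simp
      ultimately have "norm (z + t *\<^sub>R v) > R" using z by linarith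
      moreover have "norm z > R" using z norm_ge_zero[of v] by linarith
      ultimately show ?thesis using supp False by simp
    qed (use diff in simp)
  qed
  then have "((\<lambda>t. LINT z|lborel. f z) has_real_derivative (LINT z|lborel. ?D z v)) (at 0)"
    by (simp add: trans(2))
  from DERIV_unique[OF this DERIV_const] show ?thesis .
qed

lemma set_integrable_compact_support:
  fixes f :: "'a::euclidean_space \<Rightarrow> 'b::euclidean_space"
  assumes "continuous_on S f" "compact K" "K \<subseteq> S" "\<And>z. z \<in> S - K \<Longrightarrow> f z = 0"
  shows "set_integrable lborel S f"
proof -
  have "integrable lborel (\<lambda>z. indicator K z *\<^sub>R f z)"
    by (rule borel_integrable_compact) (use assms in \<open>auto intro: continuous_on_subset\<close>)
  moreover have "(\<lambda>z. indicator K z *\<^sub>R f z) = (\<lambda>z. indicator S z *\<^sub>R f z)"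
    using assms(3,4) by (auto simp: fun_eq_iff indicator_def)
  ultimately show ?thesis by (simp add: set_integrable_def)
qed

text \<open>Extension by zero is continuously differentiable on the whole space, because S and the
  complement of K are open sets that cover it.\<close>

lemma set_integral_derivative_real:
  fixes f :: "'a::euclidean_space \<Rightarrow> real"
  assumes S: "open S" and f: "Ck_on 1 S f" and K: "compact K" "K \<subseteq> S" and supp: "\<And>z. z \<in> S - K \<Longrightarrow> f z = 0"
  shows "(LINT z:S|lborel. frechet_derivative f (at z) v) = 0"
proof -
  let ?g = "\<lambda>z. if z \<in> S then f z else 0"
  have g: "Ck_on 1 UNIV ?g"
    by (rule Ck_on_if[OF S, of "- K"]) (use K f supp in \<open>auto simp: compact_imp_closed open_Compl\<close>)
  then have gd: "?g differentiable (at z)" for z by simp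
  obtain R where R: "\<And>z. z \<in> K \<Longrightarrow> norm z \<le> R" using compact_imp_bounded[OF K(1)] by (auto simp: bounded_iff)
  have "(LINT z|lborel. frechet_derivative ?g (at z) v) = 0"
    by (rule integral_derivative_compact_support[OF g, of R]) (use supp R in force)
  moreover have "frechet_derivative ?g (at z) v = indicator S z *\<^sub>R frechet_derivative f (at z) v" for z
  proof (cases "z \<in> S")
    case True
    have "(?g has_derivative frechet_derivative f (at z)) (at z)"
      by (rule has_derivative_transform_within_open[OF _ S True])
        (use f True in \<open>auto simp: frechet_derivative_works[symmetric]\<close>)
    from frechet_derivative_at[OF this] show ?thesis using True by (metis indicator_simps(1) scaleR_one)
  next
    case False
    then have "z \<in> - K" using K by auto
    then have "((\<lambda>_. 0) has_derivative frechet_derivative ?g (at z)) (at z)"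
      by (rule has_derivative_transform_within_open[OF gd[unfolded frechet_derivative_works] open_Compl[OF compact_imp_closed[OF K(1)]]])
        (use supp in auto)
    from has_derivative_unique[OF this has_derivative_const] False show ?thesis by simp
  qed
  ultimately show ?thesis by (simp add: set_lebesgue_integral_def)
qed

lemma set_integral_derivative:
  fixes f :: "'a::euclidean_space \<Rightarrow> complex"
  assumes S: "open S" and f: "Ck_on 1 S f" and K: "compact K" "K \<subseteq> S" and supp: "\<And>z. z \<in> S - K \<Longrightarrow> f z = 0"
  shows "set_integrable lborel S (\<lambda>z. frechet_derivative f (at z) v)"
    "(LINT z:S|lborel. frechet_derivative f (at z) v) = 0"
proof -
  have f1: "Ck_on (Suc 0) S f" using f by simp
  have SK: "open (S - K)" using S K compact_imp_closed by blast
  have D0: "frechet_derivative f (at z) v = 0" if "z \<in> S - K" for z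
  proof -
    have "((\<lambda>_. 0) has_derivative frechet_derivative f (at z)) (at z)"
      by (rule has_derivative_transform_within_open[OF Ck_on_SucD(1)[OF f1] SK that]) (use that supp in auto)
    from has_derivative_unique[OF this has_derivative_const] show ?thesis by simp
  qed
  show int: "set_integrable lborel S (\<lambda>z. frechet_derivative f (at z) v)"
    by (rule set_integrable_compact_support[OF Ck_on_imp_continuous_on[OF Ck_on_SucD(2)[OF f1]] K D0])
  have L: "L (LINT z:S|lborel. frechet_derivative f (at z) v) = 0" if L: "bounded_linear L" for L :: "complex \<Rightarrow> real"
  proof -
    have "L (LINT z:S|lborel. frechet_derivative f (at z) v) = (LINT z|lborel. L (indicator S z *\<^sub>R frechet_derivative f (at z) v))"
      unfolding set_lebesgue_integral_def
      by (rule integral_bounded_linear[OF L int[unfolded set_integrable_def], symmetric])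
    also have "\<dots> = (LINT z:S|lborel. frechet_derivative (\<lambda>z. L (f z)) (at z) v)"
      unfolding set_lebesgue_integral_def
    proof (rule Bochner_Integration.integral_cong[OF refl])
      fix z
      show "L (indicator S z *\<^sub>R frechet_derivative f (at z) v) = indicator S z *\<^sub>R frechet_derivative (\<lambda>z. L (f z)) (at z) v"
        using f1 frechet_derivative_bounded_linear[OF L, of f z v] linear_simps(3)[OF L]
        by (cases "z \<in> S") (simp_all add: linear_simps(5)[OF L])
    qed
    also have "\<dots> = 0"
      by (rule set_integral_derivative_real[OF S Ck_on_bounded_linear[OF L S f] K]) (simp add: supp linear_simps(3)[OF L])
    finally show ?thesis .
  qed
  show "(LINT z:S|lborel. frechet_derivative f (at z) v) = 0"
    using L[OF bounded_linear_Re] L[OF bounded_linear_Im] by (simp add: complex_eq_iff)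
qed

lemma set_integral_wirtinger:
  assumes S: "open S" and f: "Ck_on 1 S f" and K: "compact K" "K \<subseteq> S" and supp: "\<And>z. z \<in> S - K \<Longrightarrow> f z = 0"
  shows "set_integrable lborel S (wirtinger k f)" "(LINT z:S|lborel. wirtinger k f z) = 0"
    "set_integrable lborel S (wirtinger_bar k f)" "(LINT z:S|lborel. wirtinger_bar k f z) = 0"
proof -
  note D = set_integral_derivative[OF S f K supp]
  have e: "wirtinger k f z = (1 / 2) * frechet_derivative f (at z) (axis k 1) - (\<i> / 2) * frechet_derivative f (at z) (\<i> *s axis k 1)"
    "wirtinger_bar k f z = (1 / 2) * frechet_derivative f (at z) (axis k 1) + (\<i> / 2) * frechet_derivative f (at z) (\<i> *s axis k 1)" for z
    by (simp_all add: wirtinger_def wirtinger_bar_def del_fun_def delbar_fun_def field_simps)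
  have m: "set_integrable lborel S (\<lambda>z. c * frechet_derivative f (at z) v)" "(LINT z:S|lborel. c * frechet_derivative f (at z) v) = 0" for c v
    using D(1)[of v] D(2)[of v] by (auto intro: set_integrable_mult_right simp: set_integral_mult_right)
  show "set_integrable lborel S (wirtinger k f)" "set_integrable lborel S (wirtinger_bar k f)"
    unfolding e[abs_def] by (rule set_integral_diff(1)[OF m(1) m(1)], rule set_integral_add(1)[OF m(1) m(1)])
  show "(LINT z:S|lborel. wirtinger k f z) = 0" "(LINT z:S|lborel. wirtinger_bar k f z) = 0"
    unfolding e set_integral_diff(2)[OF m(1) m(1)] set_integral_add(2)[OF m(1) m(1)] m(2) by simp_all
qed

lemma wirtinger_eq_0:
  assumes "open S" "\<And>z. z \<in> S \<Longrightarrow> f z = 0" "z \<in> S"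
  shows "wirtinger k f z = 0" "wirtinger_bar k f z = 0"
  using wirtinger_cong[OF assms(1,3), of f "\<lambda>_. 0"] assms(2)
  by (simp_all add: wirtinger_def wirtinger_bar_def)

lemma set_integral_sum:
  fixes f :: "'i \<Rightarrow> 'a \<Rightarrow> 'b::{banach, second_countable_topology}"
  assumes "\<And>i. i \<in> I \<Longrightarrow> set_integrable M S (f i)"
  shows "set_integrable M S (\<lambda>x. \<Sum>i\<in>I. f i x)"
    "(LINT x:S|M. (\<Sum>i\<in>I. f i x)) = (\<Sum>i\<in>I. LINT x:S|M. f i x)"
  using assms unfolding set_integrable_def set_lebesgue_integral_def scaleR_sum_right
  by (auto intro!: Bochner_Integration.integrable_sum Bochner_Integration.integral_sum)

text \<open>In the pointwise identity the divergence terms are derivatives of functions supported in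
  K and integrate to zero.\<close>

lemma set_integral_chern_lap:
  fixes h :: "complex^'n::finite \<Rightarrow> complex^'n^'n"
  assumes S: "open S" and h: "local_metric S h" and F: "Ck_on 2 S F"
    and K: "compact K" "K \<subseteq> S" and supp: "\<And>z. z \<in> S - K \<Longrightarrow> F z = 0"
  shows "(LINT z:S|lborel. det (h z) * chern_lap h F z) = (LINT z:S|lborel. F z * gauduchon_fun h z)"
proof -
  have F': "Ck_on (Suc 1) S F" using F by (simp add: numeral_2_eq_2)
  define A where "A = (\<lambda>k l w. det (h w) * inverse_metric h w k l)"
  have A: "Ck_on m S (A k l)" for m k l
    unfolding A_def by (intro Ck_on_mult S Ck_on_det_metric[OF S h] Ck_on_inverse_metric[OF S h])
  have SK: "open (S - K)" using S K compact_imp_closed by blast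
  have F1: "Ck_on 1 S (\<lambda>w. A k l w * wirtinger k F w)" for k l
    by (intro Ck_on_mult S A Ck_on_wirtinger F')
  have F2: "Ck_on 1 S (\<lambda>w. F w * wirtinger_bar l (A k l) w)" for k l
    by (intro Ck_on_mult S Ck_on_Suc_imp[OF F'] Ck_on_wirtinger A)
  have s1: "A k l z * wirtinger k F z = 0" if "z \<in> S - K" for k l z
    using wirtinger_eq_0(1)[OF SK supp that] by simp
  have s2: "F z * wirtinger_bar l (A k l) z = 0" if "z \<in> S - K" for k l z
    using supp[OF that] by simp
  have I1: "set_integrable lborel S (wirtinger_bar m (\<lambda>w. A k l w * wirtinger k F w))"
    "(LINT z:S|lborel. wirtinger_bar m (\<lambda>w. A k l w * wirtinger k F w) z) = 0" for k l m
    by (rule set_integral_wirtinger(3)[OF S F1 K], rule s1, assumption) (rule set_integral_wirtinger(4)[OF S F1 K], rule s1, assumption)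
  have I2: "set_integrable lborel S (wirtinger m (\<lambda>w. F w * wirtinger_bar l (A k l) w))"
    "(LINT z:S|lborel. wirtinger m (\<lambda>w. F w * wirtinger_bar l (A k l) w) z) = 0" for k l m
    by (rule set_integral_wirtinger(1)[OF S F2 K], rule s2, assumption) (rule set_integral_wirtinger(2)[OF S F2 K], rule s2, assumption)
  have G: "set_integrable lborel S (\<lambda>z. F z * gauduchon_fun h z)"
  proof (rule set_integrable_compact_support[OF _ K])
    have g: "gauduchon_fun h = (\<lambda>z. \<Sum>k\<in>UNIV. \<Sum>l\<in>UNIV. wirtinger k (wirtinger_bar l (A k l)) z)"
      by (simp add: gauduchon_fun_def[abs_def] A_def)
    have "Ck_on 0 S (\<lambda>z. F z * gauduchon_fun h z)"
      unfolding g
      by (intro Ck_on_mult Ck_on_sum S Ck_on_le[OF F] Ck_on_wirtinger A) auto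
    then show "continuous_on S (\<lambda>z. F z * gauduchon_fun h z)" by simp
  qed (use supp in simp)
  let ?B = "\<lambda>z. \<Sum>k\<in>UNIV. \<Sum>l\<in>UNIV. wirtinger_bar l (\<lambda>w. A k l w * wirtinger k F w) z - wirtinger k (\<lambda>w. F w * wirtinger_bar l (A k l) w) z"
  have "(LINT z:S|lborel. det (h z) * chern_lap h F z) = (LINT z:S|lborel. F z * gauduchon_fun h z + ?B z)"
    by (rule set_lebesgue_integral_cong) (use det_chern_lap_eq[OF S h F] S in \<open>auto simp: A_def\<close>)
  also have "\<dots> = (LINT z:S|lborel. F z * gauduchon_fun h z) + (LINT z:S|lborel. ?B z)"
    by (intro set_integral_add(2) G set_integral_sum(1) set_integral_diff(1) I1(1) I2(1))
  also have "(LINT z:S|lborel. ?B z) = 0"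
  proof -
    let ?b = "\<lambda>k l z. wirtinger_bar l (\<lambda>w. A k l w * wirtinger k F w) z - wirtinger k (\<lambda>w. F w * wirtinger_bar l (A k l) w) z"
    have b: "set_integrable lborel S (?b k l)" "(LINT z:S|lborel. ?b k l z) = 0" for k l
       apply (rule set_integral_diff(1)[OF I1(1) I2(1)])
      apply (simp only: set_integral_diff(2)[OF I1(1) I2(1)] I1(2) I2(2) diff_self)
      done
    have s: "set_integrable lborel S (\<lambda>z. \<Sum>l\<in>UNIV. ?b k l z)" "(LINT z:S|lborel. (\<Sum>l\<in>UNIV. ?b k l z)) = 0" for k
      using set_integral_sum[of UNIV lborel S "?b k", OF b(1)] by (simp_all only: b(2) sum.neutral_const)
    show ?thesis
      using set_integral_sum(2)[of UNIV lborel S "\<lambda>k z. \<Sum>l\<in>UNIV. ?b k l z", OF s(1)] by (simp only: s(2) sum.neutral_const)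
  qed
  finally show ?thesis by simp
qed

text \<open>If G a is nonzero, the real part of conj(G a) G is positive near a, and its integral
  against a bump supported there cannot vanish.\<close>

lemma bump_orthogonal_imp_zero:
  fixes G :: "'a::euclidean_space \<Rightarrow> complex"
  assumes S: "open S" and G: "continuous_on S G"
    and orth: "\<And>a r. 0 < r \<Longrightarrow> cball a r \<subseteq> S \<Longrightarrow> (LINT z:S|lborel. of_real (bump a r z) * G z) = 0"
    and a: "a \<in> S"
  shows "G a = 0"
proof (rule ccontr)
  assume nz: "G a \<noteq> 0"
  define p where "p = (\<lambda>z. Re (cnj (G a) * G z))"
  have contp: "continuous_on S p" unfolding p_def by (intro continuous_intros G)
  have "p a > 0" using nz by (simp add: p_def complex_neq_0 power2_eq_square)
  then have "open (S \<inter> p -` {0<..})" "a \<in> S \<inter> p -` {0<..}"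
    using continuous_open_preimage[OF contp S, of "{0<..}"] a by auto
  then obtain r where r: "r > 0" "cball a r \<subseteq> S \<inter> p -` {0<..}"
    by (meson open_contains_cball)
  let ?b = "bump a r"
  have b0: "?b z = 0" if "z \<notin> cball a r" for z using bump_eq_0[of r z a] r(1) that by auto
  have contb: "continuous_on UNIV ?b" using Ck_on_bump[of 0 a r] by simp
  have int: "set_integrable lborel S (\<lambda>z. of_real (?b z) * G z)"
    by (rule set_integrable_compact_support[of _ _ "cball a r"])
      (use r b0 in \<open>auto intro!: continuous_intros G continuous_on_subset[OF contb]\<close>)
  let ?q = "\<lambda>z. indicator S z *\<^sub>R (?b z * p z) :: real"
  have "integrable lborel (\<lambda>z. Re (cnj (G a) * (indicator S z *\<^sub>R (of_real (?b z) * G z))))"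
    by (intro integrable_Re integrable_mult_right int[unfolded set_integrable_def])
  moreover have qe: "(\<lambda>z. Re (cnj (G a) * (indicator S z *\<^sub>R (of_real (?b z) * G z)))) = ?q"
    by (auto simp: fun_eq_iff p_def algebra_simps indicator_def)
  ultimately have qi: "integrable lborel ?q" by simp
  have "(LINT z|lborel. ?q z) = Re (cnj (G a) * (LINT z:S|lborel. of_real (?b z) * G z))"
    unfolding qe[symmetric] set_lebesgue_integral_def
    by (rule integral_bounded_linear[OF _ int[unfolded set_integrable_def]])
      (rule bounded_linear_compose[OF bounded_linear_Re bounded_linear_mult_right])
  also have "\<dots> = 0" using orth[of r a] r by auto
  finally have "(LINT z|lborel. ?q z) = 0" .
  moreover have "?q z \<ge> 0" for z
    using r b0[of z] bump_nonneg[of a r z] by (cases "z \<in> cball a r") (auto simp: indicator_def subset_iff)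
  ultimately have "AE z in lborel. ?q z = 0"
    using integral_nonneg_eq_0_iff_AE[OF qi] by simp
  moreover have "?q z \<noteq> 0" if "z \<in> ball a r" for z
  proof -
    have "z \<in> cball a r" using that by simp
    then have "z \<in> S" "p z > 0" using r(2) by auto
    then show ?thesis using that r(1) bump_pos_iff[of r a z] by (simp add: dist_commute)
  qed
  ultimately have "AE z in lborel. z \<notin> ball a r" by (auto elim: eventually_mono)
  then have "ball a r \<in> null_sets lborel" by (subst AE_iff_null_sets) auto
  then have "negligible (ball a r)"
    by (simp add: negligible_iff_null_sets null_sets_completionI)
  then show False using open_not_negligible[of "ball a r"] r(1) by simp
qed

section \<open>Change of variables in complex coordinate space\<close>

text \<open>
  The change of variables theorem of the library is for \<open>real^'m\<close> with a well-ordered index type,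
  for which \<open>'n bit0\<close> serves.
\<close>

definition real_index :: "'n::finite bit0 \<Rightarrow> 'n + 'n" where
  "real_index = (SOME q. bij q)"

lemma bij_real_index: "bij (real_index :: 'n::finite bit0 \<Rightarrow> 'n + 'n)"
proof -
  have "\<exists>q :: 'n bit0 \<Rightarrow> 'n + 'n. bij q"
    by (rule finite_same_card_bij) auto
  then show ?thesis unfolding real_index_def by (rule someI_ex)
qed

definition realify :: "complex^'n::finite \<Rightarrow> real^('n bit0)" where
  "realify z = (\<chi> k. case real_index k of Inl i \<Rightarrow> Re (z $ i) | Inr i \<Rightarrow> Im (z $ i))"

definition cplxify :: "real^('n::finite bit0) \<Rightarrow> complex^'n" where
  "cplxify x = (\<chi> i. Complex (x $ inv real_index (Inl i)) (x $ inv real_index (Inr i)))"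

lemma real_index_inv [simp]: "real_index (inv real_index y) = y" "inv real_index (real_index k) = k"
  by (rule surj_f_inv_f[OF bij_is_surj[OF bij_real_index]]) (rule inv_f_f[OF bij_is_inj[OF bij_real_index]])

lemma cplxify_realify [simp]: "cplxify (realify z) = z"
  by (simp add: cplxify_def realify_def vec_eq_iff)

lemma realify_cplxify [simp]: "realify (cplxify x) = x"
  unfolding vec_eq_iff
proof
  fix k
  have "x $ k = x $ inv real_index (real_index k)" by simp
  then show "realify (cplxify x) $ k = x $ k"
    by (cases "real_index k") (simp_all add: cplxify_def realify_def)
qed

lemma inner_cplxify: "cplxify x \<bullet> cplxify y = x \<bullet> y"
proof -
  have "x \<bullet> y = (\<Sum>s\<in>UNIV. x $ inv real_index s * y $ inv real_index s)"
    unfolding inner_vec_def inner_real_def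
    by (rule sum.reindex_bij_betw[symmetric]) (rule bij_imp_bij_inv[OF bij_real_index])
  then show ?thesis
    by (simp add: sum_UNIV_Plus inner_vec_def cplxify_def inner_complex_def sum.distrib)
qed

lemma bounded_linear_cplxify: "bounded_linear (cplxify :: real^('n::finite bit0) \<Rightarrow> complex^'n)"
proof (rule bounded_linear_intro[where K = 1])
  show "norm (cplxify x) \<le> norm x * 1" for x :: "real^('n bit0)"
    by (simp add: norm_eq_sqrt_inner inner_cplxify)
  show "cplxify (x + y) = cplxify x + cplxify y" "cplxify (r *\<^sub>R x) = r *\<^sub>R cplxify x"
    for r and x y :: "real^('n bit0)"
    by (simp_all add: cplxify_def vec_eq_iff complex_eq_iff)
qed

lemma bounded_linear_realify: "bounded_linear (realify :: complex^'n::finite \<Rightarrow> real^('n bit0))"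
proof (rule bounded_linear_intro[where K = 1])
  show "norm (realify z) \<le> norm z * 1" for z :: "complex^'n"
    using inner_cplxify[of "realify z" "realify z"] by (simp add: norm_eq_sqrt_inner)
  show "realify (z + w) = realify z + realify w" for z w :: "complex^'n"
    by (auto simp: realify_def vec_eq_iff split: sum.split)
  show "realify (r *\<^sub>R z) = r *\<^sub>R realify z" for r and z :: "complex^'n"
    by (auto simp: realify_def vec_eq_iff split: sum.split)
qed

lemma cplxify_axis: "cplxify (axis l 1) = (case real_index l of Inl j \<Rightarrow> axis j 1 | Inr j \<Rightarrow> axis j \<i>)"
proof -
  have e: "inv real_index s = l \<longleftrightarrow> s = real_index l" for s by auto
  show ?thesis
    by (cases "real_index l") (auto simp: cplxify_def vec_eq_iff axis_def complex_eq_iff e)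
qed

lemma Basis_eq_cplxify: "(Basis :: (complex^'n::finite) set) = cplxify ` Basis"
proof
  show "(Basis :: (complex^'n) set) \<subseteq> cplxify ` Basis"
  proof
    fix b :: "complex^'n" assume "b \<in> Basis"
    then obtain j where "b = axis j 1 \<or> b = axis j \<i>" by (auto simp: Basis_vec_def Basis_complex_def)
    moreover have "axis j 1 = cplxify (axis (inv real_index (Inl j)) 1)" "axis j \<i> = cplxify (axis (inv real_index (Inr j)) 1)"
      by (simp_all add: cplxify_axis)
    ultimately show "b \<in> cplxify ` Basis" by auto
  qed
  show "cplxify ` Basis \<subseteq> (Basis :: (complex^'n) set)"
  proof
    fix b :: "complex^'n" assume "b \<in> cplxify ` Basis"
    then obtain l where "b = cplxify (axis l 1)" by (auto simp: Basis_vec_def)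
    then show "b \<in> Basis"
      by (cases "real_index l") (auto simp: cplxify_axis Basis_vec_def Basis_complex_def)
  qed
qed

lemmas continuous_realify = linear_continuous_on[OF bounded_linear_realify]
  and continuous_cplxify = linear_continuous_on[OF bounded_linear_cplxify]

text \<open>An isometry that matches the standard bases maps boxes to boxes of the same volume, and
  boxes determine Lebesgue measure.\<close>

lemma lborel_realify: "lborel = distr lborel borel (realify :: complex^'n::finite \<Rightarrow> real^('n bit0))"
proof (rule lborel_eqI)
  fix l u :: "real^('n bit0)" assume le: "\<And>b. b \<in> Basis \<Longrightarrow> l \<bullet> b \<le> u \<bullet> b"
  have m: "(realify :: complex^'n \<Rightarrow> real^('n bit0)) \<in> borel_measurable borel"
    by (intro borel_measurable_continuous_onI continuous_realify)
  have inj: "inj_on cplxify (Basis :: (real^('n bit0)) set)"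
    by (rule inj_onI) (metis realify_cplxify)
  have "realify -` box l u = box (cplxify l) (cplxify u)"
  proof -
    have "realify z \<in> box l u \<longleftrightarrow> z \<in> box (cplxify l) (cplxify u)" for z :: "complex^'n"
    proof -
      have "z \<bullet> cplxify b = realify z \<bullet> b" for b using inner_cplxify[of "realify z" b] by simp
      then show ?thesis by (auto simp: mem_box Basis_eq_cplxify inner_cplxify)
    qed
    then show ?thesis by auto
  qed
  then have "emeasure (distr lborel borel realify) (box l u) = emeasure lborel (box (cplxify l) (cplxify u) :: (complex^'n) set)"
    using m by (subst emeasure_distr) auto
  also have "\<dots> = (\<Prod>b\<in>Basis. (cplxify u - cplxify l :: complex^'n) \<bullet> b)"
    by (rule emeasure_lborel_box) (use le in \<open>auto simp: Basis_eq_cplxify inner_cplxify\<close>)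
  also have "(\<Prod>b\<in>Basis. (cplxify u - cplxify l :: complex^'n) \<bullet> b) = (\<Prod>b\<in>Basis. (u - l) \<bullet> b)"
    unfolding Basis_eq_cplxify
    by (subst prod.reindex[OF inj]) (simp add: inner_diff_left inner_cplxify)
  finally show "emeasure (distr lborel borel (realify :: complex^'n \<Rightarrow> _)) (box l u) = (\<Prod>b\<in>Basis. (u - l) \<bullet> b)" .
qed simp

lemma realify_image: "realify ` B = cplxify -` B"
  by (auto simp: image_iff) (metis realify_cplxify)

lemma sets_realify_image: "B \<in> sets borel \<Longrightarrow> realify ` B \<in> sets borel"
  unfolding realify_image
  using measurable_sets[OF borel_measurable_continuous_onI[OF continuous_cplxify], of B] by simp

lemma emeasure_realify_image:
  fixes B :: "(complex^'n::finite) set"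
  assumes "B \<in> sets borel"
  shows "emeasure lborel (realify ` B) = emeasure lborel B"
proof -
  have m: "(realify :: complex^'n \<Rightarrow> real^('n bit0)) \<in> measurable lborel borel"
    using borel_measurable_continuous_onI[OF continuous_realify] by simp
  have "realify -` (realify ` B) = B" by (auto simp: image_iff) (metis cplxify_realify)
  then show ?thesis
    by (subst lborel_realify, subst emeasure_distr[OF m]) (use sets_realify_image[OF assms] in auto)
qed

lemma nn_integral_realify:
  fixes f :: "complex^'n::finite \<Rightarrow> ennreal"
  assumes "f \<in> borel_measurable borel"
  shows "(\<integral>\<^sup>+x. f (cplxify x) \<partial>lborel) = (\<integral>\<^sup>+z. f z \<partial>lborel)"
proof -
  have m: "(realify :: complex^'n \<Rightarrow> real^('n bit0)) \<in> measurable lborel borel"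
    using borel_measurable_continuous_onI[OF continuous_realify] by simp
  have c: "(cplxify :: real^('n bit0) \<Rightarrow> complex^'n) \<in> measurable borel borel"
    by (rule borel_measurable_continuous_onI[OF continuous_cplxify])
  show ?thesis
    by (subst lborel_realify, subst nn_integral_distr[OF m]) (use measurable_compose[OF c assms] in simp_all)
qed

lemma borel_measurable_indicator_ennreal:
  assumes "continuous_on A f" "A \<in> sets borel"
  shows "(\<lambda>z. indicator A z * ennreal (f z)) \<in> borel_measurable borel"
proof -
  have "(\<lambda>z. ennreal (indicator A z *\<^sub>R f z)) \<in> borel_measurable borel"
    using borel_measurable_continuous_on_indicator[OF assms(2,1)] by simp
  moreover have "(\<lambda>z. ennreal (indicator A z *\<^sub>R f z)) = (\<lambda>z. indicator A z * ennreal (f z))"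
    by (auto simp: fun_eq_iff indicator_def)
  ultimately show ?thesis by (simp only:)
qed

text \<open>Compactness of K makes the density integrable on B, so the change of variables for
  images of finite measure applies. The image is asked to be Borel in order to return from the
  completed measure.\<close>

lemma emeasure_differentiable_image_compact:
  fixes \<Phi> :: "real^'m::{finite,wellorder} \<Rightarrow> real^'m::_"
  assumes B: "B \<in> sets borel" "B \<subseteq> K" and K: "compact K"
    and deriv: "\<And>x. x \<in> K \<Longrightarrow> (\<Phi> has_derivative \<Phi>' x) (at x)" and inj: "inj_on \<Phi> K"
    and cont: "continuous_on K d" and d: "\<And>x. x \<in> K \<Longrightarrow> \<bar>det (matrix (\<Phi>' x))\<bar> = d x"
    and im: "\<Phi> ` B \<in> sets borel"
  shows "emeasure lborel (\<Phi> ` B) = (\<integral>\<^sup>+x. indicator B x * ennreal (d x) \<partial>lborel)"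
proof -
  have "integrable lborel (\<lambda>x. indicator K x *\<^sub>R d x)"
    by (rule borel_integrable_compact[OF K cont])
  then have "integrable lborel (\<lambda>x. indicator B x *\<^sub>R (indicator K x *\<^sub>R d x))"
    by (rule integrable_mult_indicator[rotated]) (use B in simp)
  moreover have "(\<lambda>x. indicator B x *\<^sub>R (indicator K x *\<^sub>R d x)) = (\<lambda>x. indicator B x *\<^sub>R d x)"
    using B(2) by (auto simp: fun_eq_iff indicator_def)
  ultimately have "integrable lborel (\<lambda>x. indicator B x *\<^sub>R d x)" by simp
  from has_integral_integral_lborel[OF this]
  have "((\<lambda>x. if x \<in> B then d x else 0) has_integral (LINT x|lborel. indicator B x *\<^sub>R d x)) UNIV"
    by (rule has_integral_eq[rotated]) (simp add: indicator_def)
  then obtain m where m: "(d has_integral m) B" by (auto simp: has_integral_restrict_UNIV)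
  then have "((\<lambda>x. \<bar>det (matrix (\<Phi>' x))\<bar>) has_integral m) B"
    by (rule has_integral_eq[rotated]) (use d B in auto)
  moreover have "B \<in> sets lebesgue" using B(1) by simp
  ultimately have "\<Phi> ` B \<in> lmeasurable \<and> measure lebesgue (\<Phi> ` B) = m"
    using has_measure_differentiable_image[of B \<Phi> \<Phi>' m] deriv[THEN has_derivative_at_withinI] B(2) inj_on_subset[OF inj B(2)]
    by blast
  then have "emeasure lborel (\<Phi> ` B) = ennreal m"
    using emeasure_eq_measure2[of "\<Phi> ` B" lebesgue] im by (simp add: emeasure_completion main_part_sets)
  moreover have "(\<integral>\<^sup>+x. ennreal (indicator B x * d x) \<partial>lborel) = ennreal m"
    by (rule nn_integral_has_integral_lebesgue[OF _ m]) (use d[symmetric] B(2) in auto)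
  moreover have "(\<integral>\<^sup>+x. ennreal (indicator B x * d x) \<partial>lborel) = (\<integral>\<^sup>+x. indicator B x * ennreal (d x) \<partial>lborel)"
    by (rule nn_integral_cong) (auto simp: indicator_def)
  ultimately show ?thesis by simp
qed

text \<open>In the order given by \<open>real_index\<close> the real matrix is the block
  realification with rows and columns reindexed simultaneously, so the arbitrary choice of that
  order does not affect the determinant.\<close>

lemma det_matrix_realify:
  fixes L :: "complex^'n::finite^'n"
  shows "det (matrix (\<lambda>x. realify (L *v cplxify x))) = (norm (det L))\<^sup>2"
proof -
  let ?R = "block_matrix (\<chi> i j. Re (L $ i $ j)) (\<chi> i j. - Im (L $ i $ j)) (\<chi> i j. Im (L $ i $ j)) (\<chi> i j. Re (L $ i $ j))"
  have col: "(L *v axis j \<i>) $ i = \<i> * L $ i $ j" for i j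
    by (simp add: matrix_vector_mult_def axis_def if_distrib if_distribR mult.commute cong: if_cong)
  have "matrix (\<lambda>x. realify (L *v cplxify x)) = (\<chi> k l. ?R $ real_index k $ real_index l)"
  proof -
    have "realify (L *v cplxify (axis l 1)) $ k = ?R $ real_index k $ real_index l" for k l
      by (cases "real_index l"; cases "real_index k")
        (simp_all add: cplxify_axis realify_def matrix_vector_mult_axis col)
    then show ?thesis by (simp add: matrix_def vec_eq_iff)
  qed
  then have "det (matrix (\<lambda>x. realify (L *v cplxify x))) = det ?R"
    using det_reindex[OF bij_real_index, of ?R] by simp
  moreover have "complex_of_real (det ?R) = of_real ((norm (det L))\<^sup>2)"
    unfolding det_realification complex_norm_square ..
  ultimately show ?thesis by (simp only: of_real_eq_iff)
qed

context holomorphic_change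
begin

text \<open>Inside a compact set the claim follows in real coordinates. In general V is exhausted by
  compact sets, and both sides are continuous along increasing unions.\<close>

lemma emeasure_image:
  assumes inj: "inj_on \<phi> V" and im: "\<And>B. B \<in> sets borel \<Longrightarrow> B \<subseteq> V \<Longrightarrow> \<phi> ` B \<in> sets borel"
    and B: "B \<in> sets borel" "B \<subseteq> V"
  shows "emeasure lborel (\<phi> ` B) = (\<integral>\<^sup>+z. indicator B z * ennreal ((norm (det (jac z)))\<^sup>2) \<partial>lborel)"
proof -
  let ?d = "\<lambda>z. (norm (det (jac z)))\<^sup>2"
  have contd: "continuous_on V ?d"
    by (intro continuous_intros Ck_on_imp_continuous_on[of 0] smooth_onD holo_fun_on_smooth open_V holo_fun_on_det holo_jac)
  have dm: "(\<lambda>z. indicator V z * ennreal (?d z)) \<in> borel_measurable lborel"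
    using borel_measurable_indicator_ennreal[OF contd] open_V by simp
  have compact_case: "emeasure lborel (\<phi> ` C) = (\<integral>\<^sup>+z. indicator C z * ennreal (?d z) \<partial>lborel)"
    if C: "C \<in> sets borel" "C \<subseteq> K" and K: "compact K" "K \<subseteq> V" for C K
  proof -
    let ?\<Phi> = "\<lambda>x. realify (\<phi> (cplxify x))" and ?K = "realify ` K" and ?C = "realify ` C"
    have imC: "?\<Phi> ` ?C = realify ` (\<phi> ` C)" by (simp add: image_image)
    have CV: "C \<subseteq> V" using C(2) K(2) by blast
    have "emeasure lborel (?\<Phi> ` ?C) = (\<integral>\<^sup>+x. indicator ?C x * ennreal (?d (cplxify x)) \<partial>lborel)"
    proof (rule emeasure_differentiable_image_compact[where K = ?K and \<Phi>' = "\<lambda>x v. realify (jac (cplxify x) *v cplxify v)"])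
      show "?C \<in> sets borel" by (rule sets_realify_image[OF C(1)])
      show "?C \<subseteq> ?K" using C(2) by auto
      show "compact ?K" by (rule compact_continuous_image[OF continuous_realify K(1)])
      show "((\<lambda>x. realify (\<phi> (cplxify x))) has_derivative (\<lambda>v. realify (jac (cplxify x) *v cplxify v))) (at x)" if "x \<in> ?K" for x
      proof -
        have "cplxify x \<in> V" using that K(2) by auto
        then show ?thesis
          by (intro bounded_linear.has_derivative[OF bounded_linear_realify]
              has_derivative_compose[OF bounded_linear_imp_has_derivative[OF bounded_linear_cplxify] has_derivative_jac])
      qed
      show "inj_on ?\<Phi> ?K"
      proof (rule inj_onI)
        fix x y assume "x \<in> ?K" "y \<in> ?K" and eq: "?\<Phi> x = ?\<Phi> y"
        then have xy: "cplxify x \<in> V" "cplxify y \<in> V" using K(2) by auto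
        have "\<phi> (cplxify x) = \<phi> (cplxify y)" using arg_cong[OF eq, of cplxify] by simp
        then have "cplxify x = cplxify y" using inj_onD[OF inj _ xy] by blast
        then show "x = y" using realify_cplxify by metis
      qed
      show "continuous_on ?K (\<lambda>x. ?d (cplxify x))"
        by (rule continuous_on_compose2[OF contd continuous_cplxify]) (use K(2) in auto)
      show "\<bar>det (matrix (\<lambda>v. realify (jac (cplxify x) *v cplxify v)))\<bar> = ?d (cplxify x)" for x
        by (simp add: det_matrix_realify)
      show "?\<Phi> ` ?C \<in> sets borel"
        unfolding imC by (rule sets_realify_image[OF im[OF C(1) CV]])
    qed
    also have "\<dots> = (\<integral>\<^sup>+x. indicator C (cplxify x) * ennreal (?d (cplxify x)) \<partial>lborel)"
      by (rule nn_integral_cong) (auto simp: indicator_def realify_image)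
    also have "\<dots> = (\<integral>\<^sup>+z. indicator C z * ennreal (?d z) \<partial>lborel)"
    proof (rule nn_integral_realify)
      have "(\<lambda>z. indicator C z * (indicator V z * ennreal (?d z))) \<in> borel_measurable borel"
        using dm C(1) by simp
      moreover have "(\<lambda>z. indicator C z * (indicator V z * ennreal (?d z))) = (\<lambda>z. indicator C z * ennreal (?d z))"
        using CV by (auto simp: fun_eq_iff indicator_def)
      ultimately show "(\<lambda>z. indicator C z * ennreal (?d z)) \<in> borel_measurable borel" by simp
    qed
    finally show ?thesis
      unfolding imC emeasure_realify_image[OF im[OF C(1) CV]] .
  qed
  obtain C :: "nat \<Rightarrow> (complex^'n) set" where C: "\<And>k. compact (C k)" "\<And>k. C k \<subseteq> V"
    and Ci: "\<And>k. C k \<subseteq> interior (C (Suc k))" and CU: "\<Union>(range C) = V"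
    and "\<And>K. compact K \<Longrightarrow> K \<subseteq> V \<Longrightarrow> \<exists>N. \<forall>n\<ge>N. K \<subseteq> C n"
    apply (rule open_Union_compact_subsets[OF open_V])
    apply (rule that)
        apply assumption+
    done
  let ?B = "\<lambda>k. B \<inter> C k"
  have Bk: "?B k \<in> sets borel" for k using sets.Int[OF B(1) borel_compact[OF C(1)]] .
  have inc: "incseq C" by (rule incseq_SucI) (use Ci interior_subset in blast)
  \<comment> \<open>The right-hand side as a measure, so that continuity from below applies to it as
    well.\<close>
  let ?N = "density lborel (\<lambda>z. indicator V z * ennreal (?d z))"
  have N: "emeasure ?N X = (\<integral>\<^sup>+z. indicator X z * ennreal (?d z) \<partial>lborel)" if "X \<in> sets borel" "X \<subseteq> V" for X
    using that by (subst emeasure_density[OF dm]) (auto intro!: nn_integral_cong simp: indicator_def)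
  have UB: "(\<Union>k. ?B k) = B" using CU B(2) by blast
  have "emeasure lborel (\<phi> ` B) = (SUP k. emeasure lborel (\<phi> ` ?B k))"
  proof -
    have "(SUP k. emeasure lborel (\<phi> ` ?B k)) = emeasure lborel (\<Union>k. \<phi> ` ?B k)"
    proof (rule SUP_emeasure_incseq)
      show "range (\<lambda>k. \<phi> ` ?B k) \<subseteq> sets lborel" using im[OF Bk] B(2) by auto
      show "incseq (\<lambda>k. \<phi> ` ?B k)" using inc unfolding incseq_def by blast
    qed
    moreover have "(\<Union>k. \<phi> ` ?B k) = \<phi> ` B" using UB by blast
    ultimately show ?thesis by simp
  qed
  also have "\<dots> = (SUP k. emeasure ?N (?B k))"
  proof (rule SUP_cong[OF refl])
    fix k
    have "emeasure lborel (\<phi> ` ?B k) = (\<integral>\<^sup>+z. indicator (?B k) z * ennreal (?d z) \<partial>lborel)"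
      by (rule compact_case[OF Bk _ C(1,2)]) auto
    also have "\<dots> = emeasure ?N (?B k)" by (rule N[symmetric]) (use Bk B(2) in auto)
    finally show "emeasure lborel (\<phi> ` ?B k) = emeasure ?N (?B k)" .
  qed
  also have "\<dots> = emeasure ?N (\<Union>k. ?B k)"
  proof (rule SUP_emeasure_incseq)
    show "range ?B \<subseteq> sets ?N" using Bk by auto
    show "incseq ?B" using inc unfolding incseq_def by blast
  qed
  finally show ?thesis unfolding UB N[OF B] .
qed

text \<open>The formula for sets says that Lebesgue measure on the image is the push-forward of a
  density; integrating f against both measures gives the formula for functions.\<close>

lemma nn_integral_image:
  assumes inj: "inj_on \<phi> V" and im: "\<And>B. B \<in> sets borel \<Longrightarrow> B \<subseteq> V \<Longrightarrow> \<phi> ` B \<in> sets borel"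
    and B: "B \<in> sets borel" "B \<subseteq> V" and f: "(\<lambda>w. indicator (\<phi> ` V) w * f w) \<in> borel_measurable borel"
  shows "(\<integral>\<^sup>+w. indicator (\<phi> ` B) w * f w \<partial>lborel)
    = (\<integral>\<^sup>+z. indicator B z * (ennreal ((norm (det (jac z)))\<^sup>2) * f (\<phi> z)) \<partial>lborel)"
proof -
  let ?d = "\<lambda>z. ennreal ((norm (det (jac z)))\<^sup>2)" and ?g = "\<lambda>w. indicator (\<phi> ` V) w * f w"
  have contd: "continuous_on V (\<lambda>z. (norm (det (jac z)))\<^sup>2)"
    by (intro continuous_intros Ck_on_imp_continuous_on[of 0] smooth_onD holo_fun_on_smooth open_V holo_fun_on_det holo_jac)
  have d: "(\<lambda>z. indicator B z * ?d z) \<in> borel_measurable borel"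
    by (rule borel_measurable_indicator_ennreal[OF continuous_on_subset[OF contd B(2)] B(1)])
  \<comment> \<open>An extension of \<phi> by zero that is Borel on the whole space, so that it can
    be pushed forward along.\<close>
  define \<psi> where "\<psi> = (\<lambda>z. indicator V z *\<^sub>R \<phi> z)"
  have \<psi>: "\<psi> \<in> borel_measurable borel"
    unfolding \<psi>_def
    by (rule borel_measurable_continuous_on_indicator[OF _ Ck_on_imp_continuous_on[OF Ck_on_phi[of 0]]]) (use open_V in auto)
  let ?M = "density lborel (\<lambda>z. indicator B z * ?d z)"
  have eq: "density lborel (indicator (\<phi> ` B)) = distr ?M borel \<psi>"
  proof (rule measure_eqI)
    fix X assume "X \<in> sets (density lborel (indicator (\<phi> ` B)))"
    then have X: "X \<in> sets borel" by simp
    let ?Y = "B \<inter> \<psi> -` X"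
    have Y: "?Y \<in> sets borel" "?Y \<subseteq> V" using B measurable_sets[OF \<psi> X] by auto
    have "\<phi> ` B \<inter> X = \<phi> ` ?Y" using B(2) by (auto simp: \<psi>_def)
    then have "emeasure (density lborel (indicator (\<phi> ` B))) X = emeasure lborel (\<phi> ` ?Y)"
      using X im[OF B] im[OF Y] by (simp add: emeasure_density nn_integral_indicator indicator_inter_arith[symmetric])
    also have "\<dots> = (\<integral>\<^sup>+z. indicator ?Y z * ?d z \<partial>lborel)" by (rule emeasure_image[OF inj im Y])
    also have "\<dots> = emeasure ?M (\<psi> -` X)"
      using d measurable_sets[OF \<psi> X]
      by (subst emeasure_density) (auto intro!: nn_integral_cong simp: indicator_def)
    also have "\<dots> = emeasure (distr ?M borel \<psi>) X"
      using \<psi> X by (subst emeasure_distr) auto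
    finally show "emeasure (density lborel (indicator (\<phi> ` B))) X = emeasure (distr ?M borel \<psi>) X" .
  qed simp
  have "(\<integral>\<^sup>+w. indicator (\<phi> ` B) w * f w \<partial>lborel) = (\<integral>\<^sup>+w. indicator (\<phi> ` B) w * ?g w \<partial>lborel)"
    using B(2) by (intro nn_integral_cong) (auto simp: indicator_def)
  also have "\<dots> = (\<integral>\<^sup>+w. ?g w \<partial>density lborel (indicator (\<phi> ` B)))"
    by (rule nn_integral_density[symmetric]) (use f im[OF B] in auto)
  also have "\<dots> = (\<integral>\<^sup>+z. ?g (\<psi> z) \<partial>?M)"
    unfolding eq by (rule nn_integral_distr) (use \<psi> f in auto)
  also have "\<dots> = (\<integral>\<^sup>+z. indicator B z * ?d z * ?g (\<psi> z) \<partial>lborel)"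
    by (rule nn_integral_density) (use d measurable_compose[OF \<psi> f] in auto)
  also have "\<dots> = (\<integral>\<^sup>+z. indicator B z * (?d z * f (\<phi> z)) \<partial>lborel)"
    using B(2) by (intro nn_integral_cong) (auto simp: indicator_def \<psi>_def)
  finally show ?thesis .
qed

end

section \<open>Charts\<close>

lemma local_metric_subset: "local_metric S h \<Longrightarrow> T \<subseteq> S \<Longrightarrow> local_metric T h"
  unfolding local_metric_def smooth_on_def by (blast intro: Ck_on_subset)

locale complex_manifold =
  fixes \<A> :: "('a::t2_space, 'n::finite) chart set"
  assumes atlas: "complex_atlas \<A>"
begin

lemma chart_cover: "\<exists>c\<in>\<A>. x \<in> fst c"
  using atlas unfolding complex_atlas_def by blast

lemma open_chart: "c \<in> \<A> \<Longrightarrow> open (fst c)" and open_chart_image: "c \<in> \<A> \<Longrightarrow> open (chart_image c)"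
  and chart_homeo: "c \<in> \<A> \<Longrightarrow> homeomorphism (fst c) (chart_image c) (snd c) (inv_chart c)"
  using atlas unfolding complex_atlas_def by blast+

lemma inv_chart_chart: "c \<in> \<A> \<Longrightarrow> x \<in> fst c \<Longrightarrow> inv_chart c (snd c x) = x"
  and chart_inv_chart: "c \<in> \<A> \<Longrightarrow> z \<in> chart_image c \<Longrightarrow> snd c (inv_chart c z) = z"
  using chart_homeo[of c] unfolding homeomorphism_def by blast+

lemma chart_in: "c \<in> \<A> \<Longrightarrow> x \<in> fst c \<Longrightarrow> snd c x \<in> chart_image c"
  and inv_chart_in: "c \<in> \<A> \<Longrightarrow> z \<in> chart_image c \<Longrightarrow> inv_chart c z \<in> fst c"
  using chart_homeo[of c] unfolding homeomorphism_def by blast+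

lemma continuous_chart: "c \<in> \<A> \<Longrightarrow> continuous_on (fst c) (snd c)"
  and continuous_inv_chart: "c \<in> \<A> \<Longrightarrow> continuous_on (chart_image c) (inv_chart c)"
  using chart_homeo[of c] unfolding homeomorphism_def by blast+

definition overlap :: "('a, 'n) chart \<Rightarrow> ('a, 'n) chart \<Rightarrow> (complex^'n) set" where
  "overlap c c' = snd c ` (fst c \<inter> fst c')"

lemma overlap_eq: "c \<in> \<A> \<Longrightarrow> overlap c c' = {z \<in> chart_image c. inv_chart c z \<in> fst c'}"
proof (intro set_eqI iffI)
  fix z assume "c \<in> \<A>" "z \<in> {z \<in> chart_image c. inv_chart c z \<in> fst c'}"
  then show "z \<in> overlap c c'"
    unfolding overlap_def by (intro image_eqI[of _ _ "inv_chart c z"]) (simp_all add: chart_inv_chart inv_chart_in)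
qed (auto simp: overlap_def inv_chart_chart chart_in)

lemma open_overlap: "c \<in> \<A> \<Longrightarrow> c' \<in> \<A> \<Longrightarrow> open (overlap c c')"
  using continuous_open_preimage[OF continuous_inv_chart[of c] open_chart_image[of c] open_chart[of c']]
  by (simp add: overlap_eq vimage_def Int_def)

lemma transition_eq: "transition c c' z = snd c' (inv_chart c z)"
  by (simp add: transition_def)

lemma inv_chart_transition: "c \<in> \<A> \<Longrightarrow> c' \<in> \<A> \<Longrightarrow> z \<in> overlap c c' \<Longrightarrow> inv_chart c' (transition c c' z) = inv_chart c z"
  by (simp add: transition_eq overlap_eq inv_chart_chart)

lemma holomorphic_change_transition:
  assumes "c \<in> \<A>" "c' \<in> \<A>"
  shows "holomorphic_change (overlap c c') (chart_image c') (transition c c')"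
proof
  show "open (overlap c c')" "open (chart_image c')" using assms by (auto intro: open_overlap open_chart_image)
  show "holomorphic_map_on (overlap c c') (transition c c')"
    using atlas assms unfolding complex_atlas_def overlap_def by blast
  show "transition c c' ` overlap c c' \<subseteq> chart_image c'"
    using assms by (auto simp: transition_eq overlap_eq chart_in)
qed

lemma overlap_subset: "c \<in> \<A> \<Longrightarrow> overlap c c' \<subseteq> chart_image c"
  by (auto simp: overlap_eq)

section \<open>Functions on the manifold\<close>

definition Ck_fun :: "nat \<Rightarrow> ('a \<Rightarrow> real) \<Rightarrow> bool" where
  "Ck_fun k f \<longleftrightarrow> (\<forall>c\<in>\<A>. Ck_on k (chart_image c) (\<lambda>z. f (inv_chart c z)))"

lemma smooth_function_iff: "smooth_function \<A> f \<longleftrightarrow> (\<forall>k. Ck_fun k f)"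
  by (auto simp: smooth_function_def Ck_fun_def smooth_on_def o_def)

lemma continuous_on_charts:
  fixes f :: "'a \<Rightarrow> 'b::topological_space"
  assumes "\<And>c. c \<in> \<A> \<Longrightarrow> continuous_on (chart_image c) (\<lambda>z. f (inv_chart c z))"
  shows "continuous_on UNIV f"
proof -
  have "continuous_on (fst c) f" if c: "c \<in> \<A>" for c
  proof -
    have "continuous_on (fst c) (\<lambda>x. f (inv_chart c (snd c x)))"
      by (rule continuous_on_compose2[OF assms[OF c] continuous_chart[OF c]]) (use chart_in[OF c] in auto)
    then show ?thesis by (rule continuous_on_eq) (simp add: inv_chart_chart[OF c])
  qed
  then have "continuous_on (\<Union>c\<in>\<A>. fst c) f"
    by (intro continuous_on_open_UN) (auto intro: open_chart)
  moreover have "(\<Union>c\<in>\<A>. fst c) = UNIV" using chart_cover by blast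
  ultimately show ?thesis by simp
qed

lemma Ck_fun_continuous: "Ck_fun k f \<Longrightarrow> continuous_on UNIV f"
  by (rule continuous_on_charts) (auto simp: Ck_fun_def intro: Ck_on_imp_continuous_on)

lemma Ck_fun_const: "Ck_fun k (\<lambda>x. c)"
  by (simp add: Ck_fun_def Ck_on_const)

lemma Ck_fun_mult: "Ck_fun k f \<Longrightarrow> Ck_fun k g \<Longrightarrow> Ck_fun k (\<lambda>x. f x * g x)"
  by (auto simp: Ck_fun_def intro: Ck_on_mult open_chart_image)

lemma Ck_fun_divide: "Ck_fun k f \<Longrightarrow> Ck_fun k g \<Longrightarrow> (\<And>x. g x \<noteq> 0) \<Longrightarrow> Ck_fun k (\<lambda>x. f x / g x)"
  by (auto simp: Ck_fun_def intro: Ck_on_divide open_chart_image)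

lemma Ck_fun_sum: "(\<And>i. i \<in> I \<Longrightarrow> Ck_fun k (f i)) \<Longrightarrow> Ck_fun k (\<lambda>x. \<Sum>i\<in>I. f i x)"
  by (auto simp: Ck_fun_def intro: Ck_on_sum open_chart_image)

lemma Ck_fun_compose:
  assumes "Ck_on k UNIV P" "Ck_fun k f"
  shows "Ck_fun k (\<lambda>x. P (f x))"
  unfolding Ck_fun_def
  using Ck_on_compose[OF open_chart_image _ open_UNIV assms(1)] assms(2) by (auto simp: Ck_fun_def)

definition extend_chart :: "('a, 'n) chart \<Rightarrow> (complex^'n \<Rightarrow> real) \<Rightarrow> 'a \<Rightarrow> real" where
  "extend_chart c u x = (if x \<in> fst c then u (snd c x) else 0)"

text \<open>In another chart the function is a pullback of u on the overlap and zero off the image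
  of K. The latter region is open because compact sets are closed in a Hausdorff space, and the two
  regions cover the chart.\<close>

lemma Ck_fun_extend_chart:
  assumes c: "c \<in> \<A>" and u: "Ck_on k (chart_image c) u" and K: "compact K" "K \<subseteq> chart_image c"
    and supp: "\<And>z. z \<in> chart_image c - K \<Longrightarrow> u z = 0"
  shows "Ck_fun k (extend_chart c u)"
  unfolding Ck_fun_def
proof
  fix c' assume c': "c' \<in> \<A>"
  interpret holomorphic_change "overlap c' c" "chart_image c" "transition c' c"
    by (rule holomorphic_change_transition[OF c' c])
  let ?f = "\<lambda>z. extend_chart c u (inv_chart c' z)"
  have "compact (inv_chart c ` K)"
    by (rule compact_continuous_image[OF continuous_on_subset[OF continuous_inv_chart[OF c] K(2)] K(1)])
  then have "open (- (inv_chart c ` K))" by (simp add: compact_imp_closed open_Compl)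
  define N where "N = {z \<in> chart_image c'. inv_chart c' z \<notin> inv_chart c ` K}"
  have N: "open N"
    using continuous_open_preimage[OF continuous_inv_chart[OF c'] open_chart_image[OF c'] \<open>open (- (inv_chart c ` K))\<close>]
    by (simp add: N_def vimage_def Int_def)
  have "Ck_on k (overlap c' c) ?f \<longleftrightarrow> Ck_on k (overlap c' c) (\<lambda>z. u (transition c' c z))"
    by (rule Ck_on_cong[OF open_V]) (simp add: extend_chart_def overlap_eq[OF c'] transition_eq)
  then have 1: "Ck_on k (overlap c' c) ?f" using Ck_on_pullback[OF u] by simp
  have 0: "?f z = 0" if "z \<in> N" for z
  proof (cases "inv_chart c' z \<in> fst c")
    case True
    have "snd c (inv_chart c' z) \<notin> K"
      using that inv_chart_chart[OF c True] by (force simp: N_def)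
    then show ?thesis using True supp chart_in[OF c True] by (simp add: extend_chart_def)
  qed (simp add: extend_chart_def)
  have "Ck_on k N ?f \<longleftrightarrow> Ck_on k N (\<lambda>z. 0 :: real)" by (rule Ck_on_cong[OF N 0])
  then have 2: "Ck_on k N ?f" by (simp add: Ck_on_const)
  have "chart_image c' = overlap c' c \<union> N"
    using K(2) inv_chart_in[OF c] by (auto simp: N_def overlap_eq[OF c'])
  then show "Ck_on k (chart_image c') ?f" using Ck_on_Un[OF open_V N 1 2] by simp
qed

lemma smooth_extend_bump:
  assumes "c \<in> \<A>" "0 < r" "cball a r \<subseteq> chart_image c"
  shows "Ck_fun k (extend_chart c (bump a r))"
  by (rule Ck_fun_extend_chart[OF assms(1) Ck_on_subset[OF Ck_on_bump] compact_cball assms(3)])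
    (use assms(2) bump_eq_0[of r _ a] in \<open>auto\<close>)

end

section \<open>Finite covers by coordinate balls\<close>

locale compact_complex_manifold = complex_manifold \<A>
  for \<A> :: "('a::t2_space, 'n::finite) chart set" +
  assumes compact_M: "compact (UNIV :: 'a set)"
begin

definition good_ball :: "('a, 'n) chart \<times> (complex^'n) \<times> real \<Rightarrow> bool" where
  "good_ball p = (case p of (c, a, r) \<Rightarrow> c \<in> \<A> \<and> 0 < r \<and> cball a r \<subseteq> chart_image c)"

definition ball_bump :: "('a, 'n) chart \<times> (complex^'n) \<times> real \<Rightarrow> 'a \<Rightarrow> real" where
  "ball_bump p = (case p of (c, a, r) \<Rightarrow> extend_chart c (bump a r))"

text \<open>The bumps serve twice: the sets where they are positive form the open cover, and after
  normalisation they give the partition of unity.\<close>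

lemma finite_ball_cover:
  obtains P where "finite P" "\<And>p. p \<in> P \<Longrightarrow> good_ball p" "\<And>x. \<exists>p\<in>P. 0 < ball_bump p x"
proof -
  let ?U = "\<lambda>p. {x. 0 < ball_bump p x}"
  have op: "open (?U p)" if "good_ball p" for p
  proof -
    obtain c a r where p: "p = (c, a, r)" by (cases p)
    have "continuous_on UNIV (ball_bump p)"
      using that Ck_fun_continuous[OF smooth_extend_bump[of c r a 0]] by (simp add: p good_ball_def ball_bump_def)
    then show ?thesis by (intro open_Collect_less continuous_on_const)
  qed
  have cov: "\<exists>p. good_ball p \<and> x \<in> ?U p" for x
  proof -
    obtain c where c: "c \<in> \<A>" "x \<in> fst c" using chart_cover by blast
    obtain r where r: "r > 0" "cball (snd c x) r \<subseteq> chart_image c"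
      using open_chart_image[OF c(1)] chart_in[OF c] open_contains_cball by blast
    then show ?thesis
      using c by (intro exI[of _ "(c, snd c x, r)"]) (auto simp: good_ball_def ball_bump_def extend_chart_def bump_pos_iff)
  qed
  have "UNIV \<subseteq> (\<Union>p\<in>Collect good_ball. ?U p)" using cov by blast
  with compact_M op obtain P where P: "P \<subseteq> Collect good_ball" "finite P" "UNIV \<subseteq> (\<Union>p\<in>P. ?U p)"
    by (rule compactE_image[of UNIV "Collect good_ball" ?U]) auto
  show ?thesis
  proof
    show "finite P" by fact
    show "good_ball p" if "p \<in> P" for p using P(1) that by auto
    show "\<exists>p\<in>P. 0 < ball_bump p x" for x
    proof -
      have "x \<in> (\<Union>p\<in>P. ?U p)" using P(3) by (rule subsetD) simp
      then show ?thesis by simp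
    qed
  qed
qed

end

section \<open>The volume measure\<close>

locale hermitian_manifold = compact_complex_manifold \<A>
  for \<A> :: "('a::t2_space, 'n::finite) chart set" +
  fixes g :: "('a, 'n) metric_components"
  assumes herm: "hermitian_metric \<A> g"
begin

lemma local_metric_chart: "c \<in> \<A> \<Longrightarrow> local_metric (chart_image c) (g c)"
proof -
  assume c: "c \<in> \<A>"
  have "smooth_on (chart_image c) (\<lambda>z. g c z $ i $ j)" for i j
    using herm c unfolding hermitian_metric_def by blast
  moreover have "hermitian_pos (g c z)" if z: "z \<in> chart_image c" for z
  proof -
    have "g c z $ j $ i = cnj (g c z $ i $ j)" for i j
      using herm c z unfolding hermitian_metric_def by blast
    moreover have "0 < Re (herm_form (g c z) v v)" if "v \<noteq> 0" for v
      using herm c z that unfolding hermitian_metric_def herm_form_def by blast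
    ultimately show ?thesis unfolding hermitian_pos_def by metis
  qed
  ultimately show ?thesis by (simp add: local_metric_def)
qed

lemma metric_change_transition:
  assumes c: "c \<in> \<A>" "c' \<in> \<A>"
  shows "metric_change (overlap c c') (chart_image c') (transition c c') (g c) (g c')"
proof -
  interpret H: holomorphic_change "overlap c c'" "chart_image c'" "transition c c'"
    by (rule holomorphic_change_transition[OF c])
  show ?thesis
  proof
    show "local_metric (overlap c c') (g c)"
      by (rule local_metric_subset[OF local_metric_chart[OF c(1)] overlap_subset[OF c(1)]])
    show "local_metric (chart_image c') (g c')" by (rule local_metric_chart[OF c(2)])
    fix z i j assume "z \<in> overlap c c'"
    then have "g c z $ i $ j = (\<Sum>k\<in>UNIV. \<Sum>l\<in>UNIV. g c' (transition c c' z) $ k $ l *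
             wirtinger i (\<lambda>w. transition c c' w $ k) z *
             cnj (wirtinger j (\<lambda>w. transition c c' w $ l) z))"
      using herm c unfolding hermitian_metric_def overlap_def by blast
    then show "g c z $ i $ j = (\<Sum>k\<in>UNIV. \<Sum>l\<in>UNIV. g c' (transition c c' z) $ k $ l * H.jac z $ k $ i * cnj (H.jac z $ l $ j))"
      by (simp add: H.jac_def)
  qed
qed

definition vol :: "('a, 'n) chart \<Rightarrow> complex^'n \<Rightarrow> real" where
  "vol c z = volume_density (g c) z"

lemma vol_eq: "vol c z = 2 ^ CARD('n) * Re (det (g c z))"
  by (simp add: vol_def volume_density_eq)

lemma vol_pos: "c \<in> \<A> \<Longrightarrow> z \<in> chart_image c \<Longrightarrow> 0 < vol c z"
  using hermitian_pos_det(2)[OF local_metric_pos[OF open_chart_image local_metric_chart]]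
  by (simp add: vol_eq)

lemma of_real_vol: "c \<in> \<A> \<Longrightarrow> z \<in> chart_image c \<Longrightarrow> complex_of_real (vol c z) = 2 ^ CARD('n) * det (g c z)"
  using hermitian_pos_det(1)[OF local_metric_pos[OF open_chart_image local_metric_chart], of c z]
  by (simp add: vol_eq)

lemma continuous_vol: "c \<in> \<A> \<Longrightarrow> continuous_on (chart_image c) (vol c)"
proof -
  assume c: "c \<in> \<A>"
  have "continuous_on (chart_image c) (\<lambda>z. det (g c z))"
    by (rule Ck_on_imp_continuous_on[OF Ck_on_det_metric[OF open_chart_image[OF c] local_metric_chart[OF c], of 0]])
  then show ?thesis unfolding vol_eq by (intro continuous_intros)
qed

text \<open>The squared modulus is the real Jacobian determinant of a holomorphic map, so this is
  the transformation law of a measure.\<close>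

lemma vol_transition:
  assumes c: "c \<in> \<A>" "c' \<in> \<A>" and z: "z \<in> overlap c c'"
  shows "vol c z = vol c' (transition c c' z) * (norm (det (holomorphic_change.jac (transition c c') z)))\<^sup>2"
proof -
  interpret metric_change "overlap c c'" "chart_image c'" "transition c c'" "g c" "g c'"
    by (rule metric_change_transition[OF c])
  have "complex_of_real (vol c z) = of_real (vol c' (transition c c' z) * (norm (det (jac z)))\<^sup>2)"
    unfolding of_real_vol[OF c(1) subsetD[OF overlap_subset[OF c(1)] z]] of_real_mult of_real_vol[OF c(2) in_W[OF z]]
      complex_norm_square basis_change(1)[OF z] by simp
  then show ?thesis by (simp only: of_real_eq_iff)
qed

text \<open>A total version of \<open>inv_chart\<close>, constant off the chart image, and therefore
  Borel measurable on the whole coordinate space.\<close>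

definition chart_inv :: "('a, 'n) chart \<Rightarrow> complex^'n \<Rightarrow> 'a" where
  "chart_inv c z = (if z \<in> chart_image c then inv_chart c z else undefined)"

lemma chart_image_borel: "c \<in> \<A> \<Longrightarrow> chart_image c \<in> sets borel" and chart_borel: "c \<in> \<A> \<Longrightarrow> fst c \<in> sets borel"
  using open_chart_image open_chart by auto

lemma measurable_chart_inv: "c \<in> \<A> \<Longrightarrow> chart_inv c \<in> borel_measurable borel"
proof -
  assume c: "c \<in> \<A>"
  have "inv_chart c \<in> borel_measurable (restrict_space borel (chart_image c))"
    by (rule borel_measurable_continuous_on_restrict[OF continuous_inv_chart[OF c]])
  then have "(\<lambda>z. if z \<in> chart_image c then inv_chart c z else undefined) \<in> borel_measurable borel"
    by (subst measurable_If_restrict_space_iff) (use chart_image_borel[OF c] in auto)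
  then show ?thesis by (simp add: chart_inv_def[abs_def])
qed

lemma sets_chart_image: "c \<in> \<A> \<Longrightarrow> B \<in> sets borel \<Longrightarrow> B \<subseteq> fst c \<Longrightarrow> snd c ` B \<in> sets borel"
proof -
  assume c: "c \<in> \<A>" and B: "B \<in> sets borel" "B \<subseteq> fst c"
  have "snd c ` B = chart_image c \<inter> chart_inv c -` B"
  proof (intro set_eqI iffI)
    fix z assume "z \<in> chart_image c \<inter> chart_inv c -` B"
    then show "z \<in> snd c ` B"
      using chart_inv_chart[OF c, of z] by (intro image_eqI[of _ _ "inv_chart c z"]) (auto simp: chart_inv_def)
  qed (use B(2) in \<open>auto simp: chart_inv_def chart_in[OF c] inv_chart_chart[OF c] subset_iff\<close>)
  moreover have "chart_inv c -` B \<in> sets borel" using measurable_sets[OF measurable_chart_inv[OF c] B(1)] by simp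
  ultimately show ?thesis using chart_image_borel[OF c] by auto
qed

lemma sets_inv_chart_image:
  assumes c: "c \<in> \<A>" and B: "B \<in> sets borel" "B \<subseteq> chart_image c"
  shows "inv_chart c ` B \<in> sets borel"
proof -
  have "snd c \<in> borel_measurable (restrict_space borel (fst c))"
    by (rule borel_measurable_continuous_on_restrict[OF continuous_chart[OF c]])
  from measurable_sets[OF this B(1)] have "snd c -` B \<inter> fst c \<in> sets (restrict_space borel (fst c))"
    by (simp add: space_restrict_space)
  then have "snd c -` B \<inter> fst c \<in> sets borel"
    using chart_borel[OF c] by (simp add: sets_restrict_space_iff)
  moreover have "snd c -` B \<inter> fst c = inv_chart c ` B"
  proof (intro set_eqI iffI)
    fix x assume "x \<in> snd c -` B \<inter> fst c"
    then show "x \<in> inv_chart c ` B"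
      using inv_chart_chart[OF c, of x] by (intro image_eqI[of _ _ "snd c x"]) auto
  qed (use B(2) in \<open>auto simp: chart_inv_chart[OF c] inv_chart_in[OF c] subset_iff\<close>)
  ultimately show ?thesis by simp
qed

text \<open>The part of the volume that lives in one chart, as a measure on the whole
  manifold.\<close>

definition chart_measure :: "('a, 'n) chart \<Rightarrow> 'a measure" where
  "chart_measure c = distr (density lborel (\<lambda>z. ennreal (indicator (chart_image c) z * vol c z))) borel (chart_inv c)"

lemma density_measurable: "c \<in> \<A> \<Longrightarrow> (\<lambda>z. indicator (chart_image c) z * vol c z) \<in> borel_measurable borel"
  using borel_measurable_continuous_on_indicator[OF chart_image_borel continuous_vol] by simp

lemma sets_chart_measure [simp]: "sets (chart_measure c) = sets borel"
  by (simp add: chart_measure_def)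

definition chart_volume :: "('a, 'n) chart \<Rightarrow> 'a set \<Rightarrow> ennreal" where
  "chart_volume c B = (\<integral>\<^sup>+z\<in>snd c ` B. ennreal (vol c z) \<partial>lborel)"

lemma emeasure_chart_measure:
  assumes c: "c \<in> \<A>" and B: "B \<in> sets borel"
  shows "emeasure (chart_measure c) B = chart_volume c (B \<inter> fst c)"
proof -
  have m: "chart_inv c \<in> measurable (density lborel (\<lambda>z. ennreal (indicator (chart_image c) z * vol c z))) borel"
    using measurable_chart_inv[OF c] by simp
  have pre: "chart_inv c -` B \<in> sets borel" using measurable_sets[OF measurable_chart_inv[OF c] B] by simp
  have "emeasure (chart_measure c) B = emeasure (density lborel (\<lambda>z. ennreal (indicator (chart_image c) z * vol c z))) (chart_inv c -` B)"
    unfolding chart_measure_def using emeasure_distr[OF m] B by simp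
  also have "\<dots> = (\<integral>\<^sup>+z. ennreal (indicator (chart_image c) z * vol c z) * indicator (chart_inv c -` B) z \<partial>lborel)"
    by (rule emeasure_density) (use density_measurable[OF c] pre in auto)
  also have "\<dots> = chart_volume c (B \<inter> fst c)"
    unfolding chart_volume_def
  proof (rule nn_integral_cong)
    fix z
    have "z \<in> snd c ` (B \<inter> fst c) \<longleftrightarrow> z \<in> chart_image c \<and> chart_inv c z \<in> B"
      using chart_inv_chart[OF c, of z] inv_chart_in[OF c, of z] inv_chart_chart[OF c] chart_in[OF c]
      by (force simp: chart_inv_def image_iff)
    then show "ennreal (indicator (chart_image c) z * vol c z) * indicator (chart_inv c -` B) z = ennreal (vol c z) * indicator (snd c ` (B \<inter> fst c)) z"
      by (simp add: indicator_def)
  qed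
  finally show ?thesis .
qed

text \<open>This is the change of variables formula for the transition map, whose real Jacobian is
  exactly the factor relating the two densities.\<close>

lemma chart_volume_eq:
  assumes c: "c \<in> \<A>" "c' \<in> \<A>" and B: "B \<in> sets borel" "B \<subseteq> fst c" "B \<subseteq> fst c'"
  shows "chart_volume c B = chart_volume c' B"
proof -
  interpret holomorphic_change "overlap c c'" "chart_image c'" "transition c c'"
    by (rule holomorphic_change_transition[OF c])
  have ov: "snd c ` B \<subseteq> overlap c c'" using B by (auto simp: overlap_def)
  have tr: "transition c c' (snd c x) = snd c' x" if "x \<in> fst c" for x
    by (simp add: transition_eq inv_chart_chart[OF c(1) that])
  have im: "transition c c' ` snd c ` B = snd c' ` B"
    unfolding image_image by (rule image_cong[OF refl]) (use tr B(2) in auto)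
  have inj: "inj_on (transition c c') (overlap c c')"
  proof (rule inj_onI)
    fix z w assume "z \<in> overlap c c'" "w \<in> overlap c c'" "transition c c' z = transition c c' w"
    then have "inv_chart c z = inv_chart c w" using inv_chart_transition[OF c] by metis
    then show "z = w" using \<open>z \<in> overlap c c'\<close> \<open>w \<in> overlap c c'\<close> overlap_subset[OF c(1)] chart_inv_chart[OF c(1)]
      by (metis subsetD)
  qed
  have sets_im: "transition c c' ` D \<in> sets borel" if D: "D \<in> sets borel" "D \<subseteq> overlap c c'" for D
  proof -
    have Dc: "D \<subseteq> chart_image c" using D(2) overlap_subset[OF c(1)] by blast
    have "transition c c' ` D = snd c' ` (inv_chart c ` D)" by (auto simp: transition_eq image_image)
    moreover have "inv_chart c ` D \<subseteq> fst c'" using D(2) overlap_eq[OF c(1)] by auto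
    ultimately show ?thesis using sets_chart_image[OF c(2) sets_inv_chart_image[OF c(1) D(1) Dc]] by simp
  qed
  have tV: "transition c c' ` overlap c c' = overlap c' c"
    unfolding overlap_def image_image by (subst Int_commute, rule image_cong[OF refl]) (use tr in auto)
  have meas: "(\<lambda>w. indicator (transition c c' ` overlap c c') w * ennreal (vol c' w)) \<in> borel_measurable borel"
    unfolding tV
    by (rule borel_measurable_indicator_ennreal[OF continuous_on_subset[OF continuous_vol[OF c(2)] overlap_subset[OF c(2)]]])
      (use open_overlap[OF c(2,1)] in simp)
  have "chart_volume c' B = (\<integral>\<^sup>+w. indicator (transition c c' ` snd c ` B) w * ennreal (vol c' w) \<partial>lborel)"
    by (simp add: chart_volume_def im mult.commute)
  also have "\<dots> = (\<integral>\<^sup>+z. indicator (snd c ` B) z * (ennreal ((norm (det (jac z)))\<^sup>2) * ennreal (vol c' (transition c c' z))) \<partial>lborel)"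
    by (rule nn_integral_image[OF inj sets_im sets_chart_image[OF c(1) B(1,2)] ov meas])
  also have "\<dots> = chart_volume c B"
    unfolding chart_volume_def
  proof (rule nn_integral_cong)
    fix z
    show "indicator (snd c ` B) z * (ennreal ((norm (det (jac z)))\<^sup>2) * ennreal (vol c' (transition c c' z))) = ennreal (vol c z) * indicator (snd c ` B) z"
    proof (cases "z \<in> snd c ` B")
      case True
      then have z: "z \<in> overlap c c'" using ov by auto
      then have "0 \<le> vol c' (transition c c' z)" using vol_pos[OF c(2) in_W[OF z]] by simp
      then show ?thesis
        using vol_transition[OF c z] True by (simp add: ennreal_mult mult.commute)
    qed simp
  qed
  finally show ?thesis ..
qed

section \<open>Existence and uniqueness of the volume measure\<close>

definition is_volume :: "'a measure \<Rightarrow> bool" where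
  "is_volume \<mu> \<longleftrightarrow> sets \<mu> = sets borel \<and>
     (\<forall>c\<in>\<A>. \<forall>B\<in>sets borel. B \<subseteq> fst c \<longrightarrow> emeasure \<mu> B = chart_volume c B)"

text \<open>Each chart of a finite subcover is taken without the earlier ones. Such a Borel
  partition allows a measure to be compared, and constructed, chart by chart.\<close>

lemma finite_disjoint_cover:
  obtains I :: "nat set" and c W where "finite I" "\<And>i. i \<in> I \<Longrightarrow> c i \<in> \<A>" "\<And>i. i \<in> I \<Longrightarrow> W i \<in> sets borel"
    "\<And>i. i \<in> I \<Longrightarrow> W i \<subseteq> fst (c i)" "disjoint_family_on W I" "(\<Union>i\<in>I. W i) = UNIV"
proof -
  obtain P where P: "finite P" "\<And>p. p \<in> P \<Longrightarrow> good_ball p" "\<And>x. \<exists>p\<in>P. 0 < ball_bump p x"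
    by (rule finite_ball_cover) blast
  obtain e :: "nat \<Rightarrow> _" and N where e: "P = e ` {..<N}"
    using finite_imp_nat_seg_image_inj_on[OF P(1)] by (metis lessThan_def)
  define c where "c = (\<lambda>i. fst (e i))"
  define W where "W = (\<lambda>i. fst (c i) - (\<Union>j<i. fst (c j)))"
  have cA: "c i \<in> \<A>" if "i < N" for i
    using P(2)[of "e i"] that e by (auto simp: c_def good_ball_def split: prod.splits)
  have cov: "\<exists>i<N. x \<in> fst (c i)" for x
  proof -
    obtain p where p: "p \<in> P" "0 < ball_bump p x" using P(3) by blast
    then have "x \<in> fst (fst p)" by (auto simp: ball_bump_def extend_chart_def split: prod.splits if_splits)
    then show ?thesis using p(1) e by (auto simp: c_def)
  qed
  show ?thesis
  proof (rule that)
    show "finite {..<N}" by simp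
    show "c i \<in> \<A>" if "i \<in> {..<N}" for i using cA that by simp
    show "W i \<subseteq> fst (c i)" for i by (auto simp: W_def)
    show "W i \<in> sets borel" if "i \<in> {..<N}" for i
    proof -
      have "open (\<Union>j<i. fst (c j))" using that cA open_chart by (intro open_UN) auto
      then show ?thesis using cA[of i] that chart_borel unfolding W_def by (intro sets.Diff) auto
    qed
    show "disjoint_family_on W {..<N}"
    proof -
      have "W i \<inter> W j = {}" if "i < j" for i j using that by (auto simp: W_def)
      then show ?thesis unfolding disjoint_family_on_def by (metis Int_commute linorder_neqE_nat)
    qed
    show "(\<Union>i\<in>{..<N}. W i) = UNIV"
    proof -
      have "\<exists>i<N. x \<in> W i" for x
      proof -
        define i where "i = (LEAST i. x \<in> fst (c i))"
        obtain k where k: "k < N" "x \<in> fst (c k)" using cov by blast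
        have "x \<in> fst (c i)" unfolding i_def by (rule LeastI) (rule k(2))
        moreover have "i < N" using Least_le[of "\<lambda>i. x \<in> fst (c i)" k] k unfolding i_def by simp
        moreover have "x \<notin> fst (c j)" if "j < i" for j using not_less_Least that unfolding i_def by blast
        ultimately show ?thesis by (auto simp: W_def)
      qed
      then show ?thesis by auto
    qed
  qed
qed

lemma is_volume_unique:
  assumes "is_volume \<mu>" "is_volume \<nu>"
  shows "\<mu> = \<nu>"
proof (rule measure_eqI)
  show "sets \<mu> = sets \<nu>" using assms by (simp add: is_volume_def)
  fix B assume "B \<in> sets \<mu>"
  then have B: "B \<in> sets borel" using assms by (simp add: is_volume_def)
  obtain I :: "nat set" and c W where I: "finite I" "\<And>i. i \<in> I \<Longrightarrow> c i \<in> \<A>" "\<And>i. i \<in> I \<Longrightarrow> W i \<in> sets borel"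
    "\<And>i. i \<in> I \<Longrightarrow> W i \<subseteq> fst (c i)" "disjoint_family_on W I" "(\<Union>i\<in>I. W i) = UNIV"
    by (rule finite_disjoint_cover) blast
  have "emeasure \<mu> B = (\<Sum>i\<in>I. chart_volume (c i) (B \<inter> W i))" if "is_volume \<mu>" for \<mu>
  proof -
    have B': "B = (\<Union>i\<in>I. B \<inter> W i)" using I(6) by blast
    have "emeasure \<mu> (\<Union>i\<in>I. B \<inter> W i) = (\<Sum>i\<in>I. emeasure \<mu> (B \<inter> W i))"
      by (rule sum_emeasure[symmetric])
        (use that B I(1,3,5) in \<open>auto simp: is_volume_def disjoint_family_on_def\<close>)
    also have "\<dots> = (\<Sum>i\<in>I. chart_volume (c i) (B \<inter> W i))"
    proof (rule sum.cong[OF refl])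
      fix i assume i: "i \<in> I"
      have "B \<inter> W i \<in> sets borel" "B \<inter> W i \<subseteq> fst (c i)" using B I(3,4)[OF i] by auto
      then show "emeasure \<mu> (B \<inter> W i) = chart_volume (c i) (B \<inter> W i)"
        using that I(2)[OF i] by (simp add: is_volume_def)
    qed
    finally show ?thesis using B' by simp
  qed
  then show "emeasure \<mu> B = emeasure \<nu> B" using assms by simp
qed

text \<open>Chart measures are summed over a finite Borel partition subordinate to charts. The value
  on a set in any other chart is correct because the volumes computed in two charts agree on common
  subsets.\<close>

lemma is_volume_exists: "\<exists>\<mu>. is_volume \<mu>"
proof -
  obtain I :: "nat set" and c W where I: "finite I" "\<And>i. i \<in> I \<Longrightarrow> c i \<in> \<A>" "\<And>i. i \<in> I \<Longrightarrow> W i \<in> sets borel"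
    "\<And>i. i \<in> I \<Longrightarrow> W i \<subseteq> fst (c i)" "disjoint_family_on W I" "(\<Union>i\<in>I. W i) = UNIV"
    by (rule finite_disjoint_cover) blast
  define m where "m = (\<lambda>B. \<Sum>i\<in>I. emeasure (chart_measure (c i)) (B \<inter> W i))"
  define \<mu> where "\<mu> = measure_of (UNIV :: 'a set) (sets borel) m"
  have sets: "sets \<mu> = sets borel"
    unfolding \<mu>_def by (metis sets.sets_measure_of_eq space_borel)
  have em: "emeasure \<mu> B = m B" if "B \<in> sets borel" for B
    unfolding \<mu>_def
  proof (rule emeasure_measure_of_sigma)
    show "sigma_algebra UNIV (sets borel :: 'a set set)" by (metis sets.sigma_algebra_axioms space_borel)
    show "positive (sets borel) m" by (simp add: positive_def m_def)
    show "countably_additive (sets borel) m"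
    proof (rule countably_additiveI)
      fix A :: "nat \<Rightarrow> 'a set" assume A: "range A \<subseteq> sets borel" "disjoint_family A"
      have "(\<lambda>n. emeasure (chart_measure (c i)) (A n \<inter> W i)) sums emeasure (chart_measure (c i)) (\<Union>n. A n \<inter> W i)" if "i \<in> I" for i
      proof -
        have "(\<Sum>n. emeasure (chart_measure (c i)) (A n \<inter> W i)) = emeasure (chart_measure (c i)) (\<Union>n. A n \<inter> W i)"
        proof (rule suminf_emeasure)
          show "range (\<lambda>n. A n \<inter> W i) \<subseteq> sets (chart_measure (c i))" using A(1) I(3)[OF that] by auto
          show "disjoint_family (\<lambda>n. A n \<inter> W i)" using A(2) unfolding disjoint_family_on_def by blast
        qed
        then show ?thesis using summable_sums[OF summableI, of "\<lambda>n. emeasure (chart_measure (c i)) (A n \<inter> W i)"] by simp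
      qed
      then have "(\<lambda>n. m (A n)) sums (\<Sum>i\<in>I. emeasure (chart_measure (c i)) (\<Union>n. A n \<inter> W i))"
        unfolding m_def by (rule sums_sum)
      moreover have "m (\<Union>n. A n) = (\<Sum>i\<in>I. emeasure (chart_measure (c i)) (\<Union>n. A n \<inter> W i))"
        by (simp only: m_def UN_simps(4))
      ultimately show "(\<Sum>n. m (A n)) = m (\<Union>n. A n)"
        using sums_unique by metis
    qed
  qed (use that in simp)
  have "emeasure \<mu> B = chart_volume c' B" if c': "c' \<in> \<A>" and B: "B \<in> sets borel" "B \<subseteq> fst c'" for c' B
  proof -
    have "emeasure \<mu> B = (\<Sum>i\<in>I. emeasure (chart_measure c') (B \<inter> W i))"
      unfolding em[OF B(1)] m_def
    proof (rule sum.cong[OF refl])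
      fix i assume i: "i \<in> I"
      have s: "B \<inter> W i \<in> sets borel" "B \<inter> W i \<subseteq> fst (c i)" "B \<inter> W i \<subseteq> fst c'" using B I(3,4)[OF i] by auto
      then have e: "B \<inter> W i \<inter> fst (c i) = B \<inter> W i" "B \<inter> W i \<inter> fst c' = B \<inter> W i" by auto
      show "emeasure (chart_measure (c i)) (B \<inter> W i) = emeasure (chart_measure c') (B \<inter> W i)"
        unfolding emeasure_chart_measure[OF I(2)[OF i] s(1)] emeasure_chart_measure[OF c' s(1)] e
        by (rule chart_volume_eq[OF I(2)[OF i] c' s])
    qed
    also have "\<dots> = emeasure (chart_measure c') (\<Union>i\<in>I. B \<inter> W i)"
    proof (rule sum_emeasure[OF _ _ I(1)])
      show "(\<lambda>i. B \<inter> W i) ` I \<subseteq> sets (chart_measure c')" using B(1) I(3) by auto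
      show "disjoint_family_on (\<lambda>i. B \<inter> W i) I" using I(5) unfolding disjoint_family_on_def by blast
    qed
    also have "(\<Union>i\<in>I. B \<inter> W i) = B" using I(6) by blast
    also have "emeasure (chart_measure c') B = chart_volume c' B"
      using emeasure_chart_measure[OF c' B(1)] B(2) by (simp add: Int_absorb2)
    finally show ?thesis .
  qed
  then show ?thesis using sets by (auto simp: is_volume_def)
qed

lemma is_volume_volume_measure: "is_volume (volume_measure \<A> g)"
proof -
  have "volume_measure \<A> g = (THE \<mu>. is_volume \<mu>)"
    by (simp add: volume_measure_def is_volume_def chart_volume_def vol_def)
  then show ?thesis
    using theI'[of is_volume] is_volume_exists is_volume_unique by metis
qed

section \<open>Integration against the volume measure\<close>

abbreviation \<mu> :: "'a measure" where "\<mu> \<equiv> volume_measure \<A> g"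

lemma sets_\<mu> [simp]: "sets \<mu> = sets borel" and space_\<mu> [simp]: "space \<mu> = UNIV"
  using is_volume_volume_measure sets_eq_imp_space_eq[of \<mu> borel] by (auto simp: is_volume_def)

lemma emeasure_\<mu>: "c \<in> \<A> \<Longrightarrow> B \<in> sets borel \<Longrightarrow> B \<subseteq> fst c \<Longrightarrow> emeasure \<mu> B = chart_volume c B"
  using is_volume_volume_measure by (simp add: is_volume_def)

text \<open>Finitely many closed coordinate balls cover the manifold, and on each of them the
  continuous density has a finite integral.\<close>

lemma finite_measure_\<mu>: "finite_measure \<mu>"
proof
  obtain P where P: "finite P" "\<And>p. p \<in> P \<Longrightarrow> good_ball p" "\<And>x. \<exists>p\<in>P. 0 < ball_bump p x"
    by (rule finite_ball_cover) blast
  define E :: "('a, 'n) chart \<times> (complex^'n) \<times> real \<Rightarrow> 'a set"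
    where "E = (\<lambda>(c, a, r). inv_chart c ` cball a r)"
  have E: "E p \<in> sets borel" "emeasure \<mu> (E p) < \<infinity>" if p: "p \<in> P" for p
  proof -
    obtain c a r where pe: "p = (c, a, r)" by (cases p)
    then have c: "c \<in> \<A>" "cball a r \<subseteq> chart_image c" using P(2)[OF p] by (auto simp: good_ball_def)
    have Ee: "E p = inv_chart c ` cball a r" by (simp add: E_def pe)
    show 1: "E p \<in> sets borel"
      unfolding Ee by (intro sets_inv_chart_image c) auto
    have sub: "E p \<subseteq> fst c" unfolding Ee using c(2) inv_chart_in[OF c(1)] by auto
    have im: "snd c ` E p = cball a r"
      unfolding Ee image_image using chart_inv_chart[OF c(1)] c(2) by (force simp: image_iff)
    have "integrable lborel (\<lambda>z. indicator (cball a r) z *\<^sub>R vol c z)"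
      by (rule borel_integrable_compact[OF compact_cball continuous_on_subset[OF continuous_vol[OF c(1)] c(2)]])
    then have "(\<integral>\<^sup>+z. ennreal (norm (indicator (cball a r) z *\<^sub>R vol c z)) \<partial>lborel) < \<infinity>"
      by (simp add: integrable_iff_bounded)
    moreover have "ennreal (norm (indicator (cball a r) z *\<^sub>R vol c z)) = ennreal (vol c z) * indicator (cball a r) z" for z
      using vol_pos[OF c(1), of z] c(2) by (auto simp: indicator_def)
    ultimately show "emeasure \<mu> (E p) < \<infinity>"
      unfolding emeasure_\<mu>[OF c(1) 1 sub] chart_volume_def im by simp
  qed
  have "UNIV \<subseteq> (\<Union>p\<in>P. E p)"
  proof
    fix x
    obtain p where p: "p \<in> P" "0 < ball_bump p x" using P(3) by blast
    obtain c a r where pe: "p = (c, a, r)" by (cases p)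
    then have c: "c \<in> \<A>" "0 < r" using P(2)[OF p(1)] by (auto simp: good_ball_def)
    have x: "x \<in> fst c" "0 < bump a r (snd c x)" using p(2) by (auto simp: pe ball_bump_def extend_chart_def split: if_splits)
    then have "snd c x \<in> cball a r" using bump_pos_iff[of r a "snd c x"] c(2) by (simp add: dist_commute)
    then have "x \<in> E p" using inv_chart_chart[OF c(1) x(1)] by (auto simp: E_def pe intro!: image_eqI[of _ _ "snd c x"])
    then show "x \<in> (\<Union>p\<in>P. E p)" using p(1) by blast
  qed
  then have "emeasure \<mu> UNIV \<le> emeasure \<mu> (\<Union>p\<in>P. E p)"
    using E(1) P(1) by (intro emeasure_mono) auto
  also have "\<dots> \<le> (\<Sum>p\<in>P. emeasure \<mu> (E p))"
    by (rule emeasure_subadditive_finite[OF P(1)]) (use E(1) in auto)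
  also have "\<dots> < \<infinity>" using E(2) P(1) by (simp add: ennreal_sum_less_top)
  finally show "emeasure \<mu> (space \<mu>) \<noteq> \<infinity>" by simp
qed

lemma integrable_continuous_\<mu>:
  fixes f :: "'a \<Rightarrow> 'b::{banach, second_countable_topology}"
  assumes "continuous_on UNIV f"
  shows "integrable \<mu> f"
proof -
  interpret finite_measure \<mu> by (rule finite_measure_\<mu>)
  have "compact (range f)" by (rule compact_continuous_image[OF assms compact_M])
  then have "bounded (range f)" by (rule compact_imp_bounded)
  then obtain C where "\<And>x. norm (f x) \<le> C" unfolding bounded_iff by blast
  then show ?thesis
    by (intro integrable_const_bound[of _ C]) (use assms in \<open>auto simp: measurable_cong_sets[OF sets_\<mu> refl] borel_measurable_continuous_onI\<close>)
qed

lemma density_chart: "c \<in> \<A> \<Longrightarrow> density \<mu> (\<lambda>x. ennreal (indicator (fst c) x)) = chart_measure c"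
proof (rule measure_eqI)
  assume c: "c \<in> \<A>"
  fix B assume "B \<in> sets (density \<mu> (\<lambda>x. ennreal (indicator (fst c) x)))"
  then have B: "B \<in> sets borel" by simp
  have m: "(\<lambda>x. ennreal (indicator (fst c) x)) \<in> borel_measurable \<mu>"
    using chart_borel[OF c] by (simp add: measurable_cong_sets[OF sets_\<mu> refl])
  have "emeasure (density \<mu> (\<lambda>x. ennreal (indicator (fst c) x))) B = (\<integral>\<^sup>+x. ennreal (indicator (fst c) x) * indicator B x \<partial>\<mu>)"
    by (rule emeasure_density[OF m]) (use B in simp)
  also have "\<dots> = (\<integral>\<^sup>+x. indicator (B \<inter> fst c) x \<partial>\<mu>)"
    by (rule nn_integral_cong) (auto simp: indicator_def)
  also have "\<dots> = emeasure \<mu> (B \<inter> fst c)" using B chart_borel[OF c] by simp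
  also have "\<dots> = emeasure (chart_measure c) B"
    unfolding emeasure_chart_measure[OF c B] by (rule emeasure_\<mu>[OF c]) (use B chart_borel[OF c] in auto)
  finally show "emeasure (density \<mu> (\<lambda>x. ennreal (indicator (fst c) x))) B = emeasure (chart_measure c) B" .
qed simp

lemma integral_chart:
  fixes f :: "'a \<Rightarrow> 'b::{banach, second_countable_topology}"
  assumes c: "c \<in> \<A>" and f: "f \<in> borel_measurable borel" and supp: "\<And>x. x \<notin> fst c \<Longrightarrow> f x = 0"
  shows "(LINT x|\<mu>. f x) = (LINT z:chart_image c|lborel. vol c z *\<^sub>R f (inv_chart c z))"
proof -
  have f\<mu>: "f \<in> borel_measurable \<mu>" using f by (simp add: measurable_cong_sets[OF sets_\<mu> refl])
  have "(LINT x|\<mu>. f x) = (LINT x|\<mu>. indicator (fst c) x *\<^sub>R f x)"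
    by (rule Bochner_Integration.integral_cong) (use supp in \<open>auto simp: indicator_def\<close>)
  also have "\<dots> = (LINT x|density \<mu> (\<lambda>x. ennreal (indicator (fst c) x)). f x)"
    by (rule integral_density[symmetric])
      (use f\<mu> chart_borel[OF c] in \<open>auto simp: measurable_cong_sets[OF sets_\<mu> refl]\<close>)
  also have "\<dots> = (LINT x|chart_measure c. f x)" by (simp only: density_chart[OF c])
  also have "\<dots> = (LINT z|density lborel (\<lambda>z. ennreal (indicator (chart_image c) z * vol c z)). f (chart_inv c z))"
    unfolding chart_measure_def by (rule integral_distr[OF _ f]) (use measurable_chart_inv[OF c] in simp)
  also have "\<dots> = (LINT z|lborel. (indicator (chart_image c) z * vol c z) *\<^sub>R f (chart_inv c z))"
  proof (rule integral_density)
    show "(\<lambda>z. f (chart_inv c z)) \<in> borel_measurable lborel"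
      using measurable_compose[OF measurable_chart_inv[OF c] f] by simp
    show "(\<lambda>z. indicator (chart_image c) z * vol c z) \<in> borel_measurable lborel"
      using density_measurable[OF c] by simp
    show "AE z in lborel. 0 \<le> indicator (chart_image c) z * vol c z"
      using vol_pos[OF c] by (intro AE_I2) (auto simp: indicator_def intro: less_imp_le)
  qed
  also have "\<dots> = (LINT z:chart_image c|lborel. vol c z *\<^sub>R f (inv_chart c z))"
    unfolding set_lebesgue_integral_def
    by (rule Bochner_Integration.integral_cong) (auto simp: indicator_def chart_inv_def)
  finally show ?thesis .
qed

text \<open>A point where f is positive has a coordinate neighbourhood of such points, which has
  positive volume because the density is positive and nonempty open sets have positive Lebesgue
  measure.\<close>

lemma continuous_integral_eq_0:
  fixes f :: "'a \<Rightarrow> real"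
  assumes f: "continuous_on UNIV f" "\<And>x. 0 \<le> f x" and int: "(LINT x|\<mu>. f x) = 0"
  shows "f x = 0"
proof (rule ccontr)
  assume "f x \<noteq> 0"
  then have pos: "0 < f x" using f(2)[of x] by simp
  obtain c where c: "c \<in> \<A>" "x \<in> fst c" using chart_cover by blast
  define U where "U = {z \<in> chart_image c. 0 < f (inv_chart c z)}"
  have "continuous_on (chart_image c) (\<lambda>z. f (inv_chart c z))"
    by (rule continuous_on_compose2[OF f(1) continuous_inv_chart[OF c(1)]]) auto
  from continuous_open_preimage[OF this open_chart_image[OF c(1)] open_greaterThan[of 0]]
  have U: "open U" by (simp add: U_def vimage_def Int_def)
  have "snd c x \<in> U" using chart_in[OF c] inv_chart_chart[OF c] pos by (simp add: U_def)
  have AE0: "AE x in \<mu>. f x = 0"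
    using integral_nonneg_eq_0_iff_AE[OF integrable_continuous_\<mu>[OF f(1)]] f(2) int by simp
  have B: "inv_chart c ` U \<in> sets borel" "inv_chart c ` U \<subseteq> fst c"
    using sets_inv_chart_image[OF c(1), of U] U inv_chart_in[OF c(1)] by (auto simp: U_def)
  have "AE x in \<mu>. x \<notin> inv_chart c ` U" using AE0 by (rule eventually_mono) (auto simp: U_def)
  then have "emeasure \<mu> (inv_chart c ` U) = 0"
    using B(1) by (subst (asm) AE_iff_null_sets[symmetric]) auto
  moreover have im: "snd c ` inv_chart c ` U = U"
    unfolding image_image using chart_inv_chart[OF c(1)] by (force simp: U_def image_iff)
  ultimately have "(\<integral>\<^sup>+z. ennreal (vol c z) * indicator U z \<partial>lborel) = 0"
    unfolding emeasure_\<mu>[OF c(1) B] chart_volume_def im by simp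
  moreover have "(\<lambda>z. ennreal (vol c z) * indicator U z) \<in> borel_measurable lborel"
  proof -
    have "U \<subseteq> chart_image c" by (auto simp: U_def)
    from borel_measurable_indicator_ennreal[OF continuous_on_subset[OF continuous_vol[OF c(1)] this] borel_open[OF U]]
    show ?thesis by (simp add: mult.commute)
  qed
  ultimately have "AE z in lborel. ennreal (vol c z) * indicator U z = 0"
    by (simp add: nn_integral_0_iff_AE)
  then have "AE z in lborel. z \<notin> U"
  proof (rule eventually_mono)
    fix z assume "ennreal (vol c z) * indicator U z = 0"
    then show "z \<notin> U" using vol_pos[OF c(1), of z] by (auto simp: U_def indicator_def split: if_splits)
  qed
  then have "U \<in> null_sets lborel" using U by (subst AE_iff_null_sets) auto
  then have "negligible U" by (simp add: negligible_iff_null_sets null_sets_completionI)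
  then show False using open_not_negligible[OF U] \<open>snd c x \<in> U\<close> by auto
qed

section \<open>Global curvature and Laplacian\<close>

definition some_chart :: "'a \<Rightarrow> ('a, 'n) chart" where
  "some_chart x = (SOME c. c \<in> \<A> \<and> x \<in> fst c)"

lemma some_chart: "some_chart x \<in> \<A>" "x \<in> fst (some_chart x)"
  using someI_ex[of "\<lambda>c. c \<in> \<A> \<and> x \<in> fst c"] chart_cover unfolding some_chart_def by blast+

lemma chern_scalar_eq: "chern_scalar \<A> h x = local_chern_scalar (h (some_chart x)) (snd (some_chart x) x)"
  by (simp add: chern_scalar_def some_chart_def Let_def)

text \<open>The values are complex because the definition goes through Wirtinger derivatives; on C^2
  functions they are real and do not depend on the chosen chart.\<close>

definition lap :: "('a \<Rightarrow> real) \<Rightarrow> 'a \<Rightarrow> complex" where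
  "lap f x = chern_lap (g (some_chart x)) (\<lambda>w. of_real (f (inv_chart (some_chart x) w))) (snd (some_chart x) x)"

lemma chern_scalar_chart:
  assumes c: "c \<in> \<A>" and z: "z \<in> chart_image c"
  shows "chern_scalar \<A> g (inv_chart c z) = local_chern_scalar (g c) z"
proof -
  let ?x = "inv_chart c z" let ?c = "some_chart ?x"
  interpret metric_change "overlap c ?c" "chart_image ?c" "transition c ?c" "g c" "g ?c"
    by (rule metric_change_transition[OF c some_chart(1)])
  have "z \<in> overlap c ?c" using z some_chart(2)[of ?x] by (simp add: overlap_eq[OF c])
  from local_chern_scalar_pullback[OF this] show ?thesis by (simp add: chern_scalar_eq transition_eq)
qed

lemma Ck_on_of_real_chart: "Ck_fun k f \<Longrightarrow> c \<in> \<A> \<Longrightarrow> Ck_on k (chart_image c) (\<lambda>w. complex_of_real (f (inv_chart c w)))"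
  by (intro Ck_on_of_real open_chart_image) (auto simp: Ck_fun_def)

lemma lap_chart:
  assumes f: "Ck_fun 2 f" and c: "c \<in> \<A>" and z: "z \<in> chart_image c"
  shows "lap f (inv_chart c z) = chern_lap (g c) (\<lambda>w. of_real (f (inv_chart c w))) z"
proof -
  let ?x = "inv_chart c z" let ?c = "some_chart ?x"
  interpret metric_change "overlap c ?c" "chart_image ?c" "transition c ?c" "g c" "g ?c"
    by (rule metric_change_transition[OF c some_chart(1)])
  have zo: "z \<in> overlap c ?c" using z some_chart(2)[of ?x] by (simp add: overlap_eq[OF c])
  have "chern_lap (g c) (\<lambda>w. of_real (f (inv_chart c w))) z = chern_lap (g c) (\<lambda>w. of_real (f (inv_chart ?c (transition c ?c w)))) z"
    by (rule chern_lap_cong[OF open_V h zo]) (simp add: inv_chart_transition[OF c some_chart(1)])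
  also have "\<dots> = chern_lap (g ?c) (\<lambda>w. of_real (f (inv_chart ?c w))) (transition c ?c z)"
    by (rule chern_lap_pullback[OF Ck_on_of_real_chart[OF f some_chart(1)] zo])
  finally show ?thesis by (simp add: lap_def transition_eq)
qed

lemma continuous_lap: "Ck_fun 2 f \<Longrightarrow> continuous_on UNIV (lap f)"
proof (rule continuous_on_charts)
  fix c assume f: "Ck_fun 2 f" and c: "c \<in> \<A>"
  have "Ck_on 0 (chart_image c) (chern_lap (g c) (\<lambda>w. of_real (f (inv_chart c w))))"
    by (rule Ck_on_chern_lap[OF open_chart_image[OF c] local_metric_chart[OF c]])
      (use Ck_on_of_real_chart[OF f c] in \<open>simp add: numeral_2_eq_2\<close>)
  then have "continuous_on (chart_image c) (chern_lap (g c) (\<lambda>w. of_real (f (inv_chart c w))))" by simp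
  then show "continuous_on (chart_image c) (\<lambda>z. lap f (inv_chart c z))"
    by (rule continuous_on_eq) (simp add: lap_chart[OF f c])
qed

lemma lap_real: "Ck_fun 2 f \<Longrightarrow> lap f x = of_real (Re (lap f x))"
proof -
  assume f: "Ck_fun 2 f"
  let ?c = "some_chart x"
  note c = some_chart[of x]
  have "cnj (lap f x) = lap f x"
    unfolding lap_def
    by (rule chern_lap_real[OF open_chart_image[OF c(1)] local_metric_chart[OF c(1)] Ck_on_of_real_chart[OF f c(1)] _ chart_in[OF c]]) simp
  then show ?thesis by (simp add: complex_eq_iff)
qed

lemma lap_add: "Ck_fun 2 f \<Longrightarrow> Ck_fun 2 f' \<Longrightarrow> lap (\<lambda>x. f x + f' x) x = lap f x + lap f' x"
  unfolding lap_def of_real_add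
  by (rule chern_lap_add[OF open_chart_image local_metric_chart Ck_on_of_real_chart Ck_on_of_real_chart chart_in])
    (auto simp: some_chart)

section \<open>Integrals of the Laplacian\<close>

lemma lap_local_zero:
  assumes U: "open U" "\<And>y. y \<in> U \<Longrightarrow> f y = 0" and x: "x \<in> U"
  shows "lap f x = 0"
proof -
  let ?c = "some_chart x"
  note c = some_chart[of x]
  define V where "V = {z \<in> chart_image ?c. inv_chart ?c z \<in> U}"
  have V: "open V"
    using continuous_open_preimage[OF continuous_inv_chart[OF c(1)] open_chart_image[OF c(1)] U(1)]
    by (simp add: V_def vimage_def Int_def)
  have lm: "local_metric V (g ?c)"
    by (rule local_metric_subset[OF local_metric_chart[OF c(1)]]) (auto simp: V_def)
  have z: "snd ?c x \<in> V" using x chart_in[OF c] inv_chart_chart[OF c] by (simp add: V_def)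
  have "lap f x = chern_lap (g ?c) (\<lambda>_. 0) (snd ?c x)"
    unfolding lap_def by (rule chern_lap_cong[OF V lm z]) (simp add: V_def U(2))
  also have "\<dots> = 0"
  proof -
    have "wirtinger i (\<lambda>_ :: complex^'n. 0) = (\<lambda>_. 0)" for i by (simp add: wirtinger_def[abs_def])
    then show ?thesis by (simp add: chern_lap_def wirtinger_bar_def)
  qed
  finally show ?thesis .
qed

lemma lap_sum: "finite I \<Longrightarrow> (\<And>i. i \<in> I \<Longrightarrow> Ck_fun 2 (f i)) \<Longrightarrow> lap (\<lambda>x. \<Sum>i\<in>I. f i x) x = (\<Sum>i\<in>I. lap (f i) x)"
proof (induction I rule: finite_induct)
  case empty
  then show ?case using lap_local_zero[of UNIV "\<lambda>_. 0"] by simp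
next
  case (insert i I)
  then show ?case by (simp add: lap_add Ck_fun_sum)
qed

text \<open>Both f and its Laplacian vanish off the image of K, so the integral lives in one chart.
  The weight there is 2^n det h, which yields the constant and the integrand to which the two
  integrations by parts apply.\<close>

lemma integral_lap_supported:
  assumes f: "Ck_fun 2 f" and c: "c \<in> \<A>" and K: "compact K" "K \<subseteq> chart_image c"
    and supp: "\<And>z. z \<in> chart_image c - K \<Longrightarrow> f (inv_chart c z) = 0" and out: "\<And>x. x \<notin> fst c \<Longrightarrow> f x = 0"
  shows "(LINT x|\<mu>. lap f x) = 2 ^ CARD('n) * (LINT z:chart_image c|lborel. of_real (f (inv_chart c z)) * gauduchon_fun (g c) z)"
proof -
  note S = open_chart_image[OF c] and h = local_metric_chart[OF c]
  let ?F = "\<lambda>w. complex_of_real (f (inv_chart c w))"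
  have "compact (inv_chart c ` K)"
    by (rule compact_continuous_image[OF continuous_on_subset[OF continuous_inv_chart[OF c] K(2)] K(1)])
  then have U: "open (- (inv_chart c ` K))" by (simp add: compact_imp_closed open_Compl)
  have f0: "f y = 0" if "y \<in> - (inv_chart c ` K)" for y
  proof (cases "y \<in> fst c")
    case True
    have "snd c y \<notin> K" using that inv_chart_chart[OF c True] by force
    then show ?thesis using supp[of "snd c y"] chart_in[OF c True] inv_chart_chart[OF c True] by simp
  qed (rule out)
  have "lap f x = 0" if "x \<notin> fst c" for x
    by (rule lap_local_zero[OF U f0]) (use that K(2) inv_chart_in[OF c] in auto)
  then have "(LINT x|\<mu>. lap f x) = (LINT z:chart_image c|lborel. vol c z *\<^sub>R lap f (inv_chart c z))"
    by (rule integral_chart[OF c borel_measurable_continuous_onI[OF continuous_lap[OF f]]])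
  also have "\<dots> = (LINT z:chart_image c|lborel. 2 ^ CARD('n) * (det (g c z) * chern_lap (g c) ?F z))"
    by (rule set_lebesgue_integral_cong)
      (use S in \<open>auto simp: lap_chart[OF f c] of_real_vol[OF c] scaleR_conv_of_real mult.assoc\<close>)
  also have "\<dots> = 2 ^ CARD('n) * (LINT z:chart_image c|lborel. det (g c z) * chern_lap (g c) ?F z)"
    by simp
  also have "(LINT z:chart_image c|lborel. det (g c z) * chern_lap (g c) ?F z) = (LINT z:chart_image c|lborel. ?F z * gauduchon_fun (g c) z)"
    by (rule set_integral_chern_lap[OF S h Ck_on_of_real_chart[OF f c] K]) (simp add: supp)
  finally show ?thesis .
qed

lemma gauduchon_iff: "gauduchon \<A> g \<longleftrightarrow> (\<forall>c\<in>\<A>. \<forall>z\<in>chart_image c. gauduchon_fun (g c) z = 0)"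
  unfolding gauduchon_def
  using gauduchon_iff_local[OF open_chart_image local_metric_chart] by blast

lemma integral_lap_gauduchon:
  assumes G: "gauduchon \<A> g" and f: "Ck_fun 2 f"
  shows "(LINT x|\<mu>. lap f x) = 0"
proof -
  obtain P where P: "finite P" "\<And>p. p \<in> P \<Longrightarrow> good_ball p" "\<And>x. \<exists>p\<in>P. 0 < ball_bump p x"
    by (rule finite_ball_cover) blast
  have nn: "0 \<le> ball_bump p x" for p x
    by (auto simp: ball_bump_def extend_chart_def bump_nonneg split: prod.splits)
  define \<Sigma> where "\<Sigma> = (\<lambda>x. \<Sum>p\<in>P. ball_bump p x)"
  have pos: "\<Sigma> x > 0" for x
  proof -
    obtain p where "p \<in> P" "0 < ball_bump p x" using P(3) by blast
    then show ?thesis unfolding \<Sigma>_def by (intro sum_pos2[OF P(1)]) (auto simp: nn)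
  qed
  have sm: "Ck_fun 2 (ball_bump p)" if "p \<in> P" for p
    using P(2)[OF that] smooth_extend_bump by (auto simp: good_ball_def ball_bump_def split: prod.splits)
  \<comment> \<open>Dividing by the positive sum \<Sigma> turns the bumps into weights that add up
    to 1.\<close>
  define F where "F = (\<lambda>p x. f x * ball_bump p x / \<Sigma> x)"
  have F: "Ck_fun 2 (F p)" if "p \<in> P" for p
    unfolding F_def \<Sigma>_def
    by (intro Ck_fun_divide Ck_fun_mult Ck_fun_sum f sm that) (use pos in \<open>auto simp: \<Sigma>_def less_imp_neq[symmetric]\<close>)
  have fe: "f = (\<lambda>x. \<Sum>p\<in>P. F p x)"
  proof
    fix x
    have "(\<Sum>p\<in>P. F p x) = f x * \<Sigma> x / \<Sigma> x"
      by (simp add: F_def \<Sigma>_def sum_distrib_left sum_divide_distrib)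
    then show "f x = (\<Sum>p\<in>P. F p x)" using pos[of x] by simp
  qed
  have "lap f x = (\<Sum>p\<in>P. lap (F p) x)" for x
    using lap_sum[OF P(1) F, where x = x] arg_cong[OF fe, of lap] by simp
  then have "(LINT x|\<mu>. lap f x) = (LINT x|\<mu>. (\<Sum>p\<in>P. lap (F p) x))" by presburger
  also have "\<dots> = (\<Sum>p\<in>P. LINT x|\<mu>. lap (F p) x)"
    by (rule Bochner_Integration.integral_sum) (rule integrable_continuous_\<mu>[OF continuous_lap[OF F]])
  also have "(\<Sum>p\<in>P. LINT x|\<mu>. lap (F p) x) = 0"
  proof (rule sum.neutral, rule ballI)
    fix p assume p: "p \<in> P"
    obtain c a r where pe: "p = (c, a, r)" by (cases p)
    then have c: "c \<in> \<A>" "0 < r" "cball a r \<subseteq> chart_image c" using P(2)[OF p] by (auto simp: good_ball_def)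
    have "(LINT x|\<mu>. lap (F p) x) = 2 ^ CARD('n) * (LINT z:chart_image c|lborel. of_real (F p (inv_chart c z)) * gauduchon_fun (g c) z)"
    proof (rule integral_lap_supported[OF F[OF p] c(1) compact_cball c(3)])
      show "F p (inv_chart c z) = 0" if "z \<in> chart_image c - cball a r" for z
        using that bump_eq_0[of r z a] c(2) by (simp add: F_def pe ball_bump_def extend_chart_def chart_inv_chart[OF c(1)])
      show "F p x = 0" if "x \<notin> fst c" for x
        using that by (simp add: F_def pe ball_bump_def extend_chart_def)
    qed
    also have "(LINT z:chart_image c|lborel. of_real (F p (inv_chart c z)) * gauduchon_fun (g c) z) = (LINT z:chart_image c|lborel. 0)"
      by (rule set_lebesgue_integral_cong) (use G c(1) open_chart_image in \<open>auto simp: gauduchon_iff\<close>)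
    finally show "(LINT x|\<mu>. lap (F p) x) = 0" by simp
  qed
  finally show ?thesis .
qed

lemma gauduchon_if_integral_lap:
  assumes lap0: "\<And>f. smooth_function \<A> f \<Longrightarrow> (LINT x|\<mu>. lap f x) = 0"
  shows "gauduchon \<A> g"
  unfolding gauduchon_iff
proof (intro ballI)
  fix c z assume c: "c \<in> \<A>" and z: "z \<in> chart_image c"
  show "gauduchon_fun (g c) z = 0"
  proof (rule bump_orthogonal_imp_zero[OF open_chart_image[OF c] _ _ z])
    have A: "Ck_on m (chart_image c) (\<lambda>w. det (g c w) * inverse_metric (g c) w k l)" for m k l
      by (intro Ck_on_mult open_chart_image[OF c] Ck_on_det_metric[OF open_chart_image[OF c] local_metric_chart[OF c]]
          Ck_on_inverse_metric[OF open_chart_image[OF c] local_metric_chart[OF c]])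
    have "Ck_on 0 (chart_image c) (gauduchon_fun (g c))"
      unfolding gauduchon_fun_def[abs_def]
      by (intro Ck_on_sum open_chart_image[OF c] Ck_on_wirtinger A)
    then show "continuous_on (chart_image c) (gauduchon_fun (g c))" by simp
    fix a r assume r: "0 < r" "cball a r \<subseteq> chart_image c"
    let ?f = "extend_chart c (bump a r)"
    have sm: "Ck_fun k ?f" for k by (rule smooth_extend_bump[OF c r])
    have "0 = (LINT x|\<mu>. lap ?f x)" using lap0 sm by (simp add: smooth_function_iff)
    also have "\<dots> = 2 ^ CARD('n) * (LINT z:chart_image c|lborel. of_real (?f (inv_chart c z)) * gauduchon_fun (g c) z)"
    proof (rule integral_lap_supported[OF sm c compact_cball r(2)])
      show "?f (inv_chart c z) = 0" if "z \<in> chart_image c - cball a r" for z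
        using that bump_eq_0[of r z a] r(1) by (simp add: extend_chart_def chart_inv_chart[OF c])
    qed (simp add: extend_chart_def)
    also have "(LINT z:chart_image c|lborel. of_real (?f (inv_chart c z)) * gauduchon_fun (g c) z)
       = (LINT z:chart_image c|lborel. of_real (bump a r z) * gauduchon_fun (g c) z)"
      by (rule set_lebesgue_integral_cong)
        (use open_chart_image[OF c] in \<open>auto simp: extend_chart_def chart_inv_chart[OF c] inv_chart_in[OF c]\<close>)
    finally show "(LINT z:chart_image c|lborel. of_real (bump a r z) * gauduchon_fun (g c) z) = 0" by simp
  qed
qed

end

section \<open>Powers of absolute values\<close>

text \<open>At 0 the difference quotient is \<bar>h\<bar>^m, whose limit is 1 for m = 0 and 0
  otherwise, in accordance with (m + 1) \<bar>0\<bar>^m.\<close>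

lemma DERIV_mult_abs_power: "((\<lambda>y :: real. y * \<bar>y\<bar> ^ m) has_real_derivative real (m + 1) * \<bar>y\<bar> ^ m) (at y)"
proof (cases y "0 :: real" rule: linorder_cases)
  case less
  have "((\<lambda>y :: real. - ((- y) ^ Suc m)) has_real_derivative real (m + 1) * \<bar>y\<bar> ^ m) (at y)"
    using less by (auto intro!: derivative_eq_intros simp del: power_Suc)
  then show ?thesis
    by (rule has_field_derivative_transform_within_open[of _ _ _ "{..<0}"]) (use less in auto)
next
  case greater
  have "((\<lambda>y :: real. y ^ Suc m) has_real_derivative real (m + 1) * \<bar>y\<bar> ^ m) (at y)"
    using greater by (auto intro!: derivative_eq_intros simp del: power_Suc)
  then show ?thesis
    by (rule has_field_derivative_transform_within_open[of _ _ _ "{0<..}"]) (use greater in auto)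
next
  case equal
  have "isCont (\<lambda>h :: real. \<bar>h\<bar> ^ m) 0" by (intro continuous_intros)
  then have "((\<lambda>h :: real. \<bar>h\<bar> ^ m) \<longlongrightarrow> \<bar>0\<bar> ^ m) (at 0)" by (simp only: isCont_def)
  moreover have "\<forall>\<^sub>F h :: real in at 0. \<bar>h\<bar> ^ m = (h * \<bar>h\<bar> ^ m - 0 * \<bar>0\<bar> ^ m) / (h - 0)"
    by (auto simp: eventually_at intro!: exI[of _ 1])
  ultimately have "((\<lambda>h :: real. (h * \<bar>h\<bar> ^ m - 0 * \<bar>0\<bar> ^ m) / (h - 0)) \<longlongrightarrow> \<bar>0\<bar> ^ m) (at 0)"
    by (rule Lim_transform_eventually)
  moreover have "\<bar>0\<bar> ^ m = real (m + 1) * \<bar>0 :: real\<bar> ^ m" by (cases m) auto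
  ultimately show ?thesis using equal unfolding has_field_derivative_iff by metis
qed

lemma abs_power_Suc_Suc: "\<bar>y :: real\<bar> ^ (m + 2) = y * \<bar>y\<bar> ^ m * y"
  by (cases "y \<ge> 0") (simp_all add: power_add power2_eq_square)

lemma DERIV_abs_power: "((\<lambda>y :: real. \<bar>y\<bar> ^ (m + 2)) has_real_derivative real (m + 2) * (y * \<bar>y\<bar> ^ m)) (at y)"
  unfolding abs_power_Suc_Suc
  by (rule DERIV_cong[OF DERIV_mult[OF DERIV_mult_abs_power DERIV_ident]]) (simp add: algebra_simps)

text \<open>The second derivative is a multiple of \<bar>y\<bar>^m, which for m = 1 is continuous
  but not differentiable at 0; order 2 is what holds uniformly in m.\<close>

lemma Ck_on_abs_power: "Ck_on 2 UNIV (\<lambda>y :: real. \<bar>y\<bar> ^ (m + 2))"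
proof -
  have M: "Ck_on (Suc 0) UNIV (\<lambda>y :: real. y * \<bar>y\<bar> ^ m)"
  proof (rule Ck_on_SucI[OF open_UNIV])
    show "((\<lambda>y :: real. y * \<bar>y\<bar> ^ m) has_derivative (\<lambda>v. v * (real (m + 1) * \<bar>y\<bar> ^ m))) (at y)" for y
      by (rule has_derivative_eq_rhs[OF has_field_derivative_imp_has_derivative[OF DERIV_mult_abs_power]]) (simp add: fun_eq_iff)
    show "Ck_on 0 UNIV (\<lambda>y. v * (real (m + 1) * \<bar>y\<bar> ^ m))" for v
      by (auto intro!: continuous_intros)
  qed
  have C: "Ck_on (Suc 0) UNIV (\<lambda>y :: real. v * (real (m + 2) * (y * \<bar>y\<bar> ^ m)))" for v
    by (rule Ck_on_mult[OF open_UNIV Ck_on_const Ck_on_mult[OF open_UNIV Ck_on_const M]])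
  have D: "((\<lambda>y :: real. \<bar>y\<bar> ^ (m + 2)) has_derivative (\<lambda>v. v * (real (m + 2) * (y * \<bar>y\<bar> ^ m)))) (at y)" for y
    by (rule has_derivative_eq_rhs[OF has_field_derivative_imp_has_derivative[OF DERIV_abs_power]]) (simp add: fun_eq_iff)
  have "Ck_on (Suc (Suc 0)) UNIV (\<lambda>y :: real. \<bar>y\<bar> ^ (m + 2))"
    by (rule Ck_on_SucI[OF open_UNIV D C])
  then show ?thesis by (simp only: numeral_2_eq_2)
qed

text \<open>The mean value bound on the interval from -R to R. It supplies the uniform domination in
  the variation of the functional.\<close>

lemma abs_power_diff_le:
  fixes a b R :: real
  assumes "\<bar>a\<bar> \<le> R" "\<bar>b\<bar> \<le> R"
  shows "\<bar>\<bar>a\<bar> ^ (m + 2) - \<bar>b\<bar> ^ (m + 2)\<bar> \<le> real (m + 2) * R ^ (m + 1) * \<bar>a - b\<bar>"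
proof -
  have "norm (\<bar>a\<bar> ^ (m + 2) - \<bar>b\<bar> ^ (m + 2)) \<le> real (m + 2) * R ^ (m + 1) * norm (a - b)"
  proof (rule field_differentiable_bound[of "{-R..R}" "\<lambda>y. \<bar>y\<bar> ^ (m + 2)" "\<lambda>y. real (m + 2) * (y * \<bar>y\<bar> ^ m)"])
    show "((\<lambda>y. \<bar>y\<bar> ^ (m + 2)) has_field_derivative real (m + 2) * (y * \<bar>y\<bar> ^ m)) (at y within {-R..R})" for y
      by (rule has_field_derivative_at_within[OF DERIV_abs_power])
    show "norm (real (m + 2) * (y * \<bar>y\<bar> ^ m)) \<le> real (m + 2) * R ^ (m + 1)" if "y \<in> {-R..R}" for y
    proof -
      have "\<bar>y\<bar> ^ (m + 1) \<le> R ^ (m + 1)" using that by (intro power_mono) auto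
      then show ?thesis by (simp add: abs_mult power_abs mult_left_mono)
    qed
  qed (use assms in \<open>auto simp: abs_le_iff\<close>)
  then show ?thesis by simp
qed

section \<open>The Laplacian of a composite function\<close>

text \<open>The squared length of \<partial>u with respect to h.\<close>

definition grad_norm :: "(complex^'n::finite \<Rightarrow> complex^'n^'n) \<Rightarrow> (complex^'n \<Rightarrow> real) \<Rightarrow> complex^'n \<Rightarrow> complex" where
  "grad_norm h u z = (\<Sum>i\<in>UNIV. \<Sum>j\<in>UNIV. inverse_metric h z i j *
     wirtinger i (\<lambda>w. of_real (u w)) z * cnj (wirtinger j (\<lambda>w. of_real (u w)) z))"

lemma del_fun_compose_real:
  assumes u: "u differentiable (at z)" and P: "(P has_real_derivative p) (at (u z))"
  shows "del_fun (\<lambda>w. of_real (P (u w))) z v = of_real p * del_fun (\<lambda>w. of_real (u w)) z v"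
    "delbar_fun (\<lambda>w. of_real (P (u w))) z v = of_real p * delbar_fun (\<lambda>w. of_real (u w)) z v"
proof -
  note D = u[unfolded frechet_derivative_works]
  have 1: "((\<lambda>w. complex_of_real (u w)) has_derivative (\<lambda>v. of_real (frechet_derivative u (at z) v))) (at z)"
    by (rule bounded_linear.has_derivative[OF bounded_linear_of_real D])
  have "((\<lambda>w. P (u w)) has_derivative (\<lambda>v. p * frechet_derivative u (at z) v)) (at z)"
    by (rule has_derivative_compose[OF D P[unfolded has_field_derivative_def]])
  then have 2: "((\<lambda>w. complex_of_real (P (u w))) has_derivative (\<lambda>v. of_real (p * frechet_derivative u (at z) v))) (at z)"
    by (rule bounded_linear.has_derivative[OF bounded_linear_of_real])
  show "del_fun (\<lambda>w. of_real (P (u w))) z v = of_real p * del_fun (\<lambda>w. of_real (u w)) z v"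
    "delbar_fun (\<lambda>w. of_real (P (u w))) z v = of_real p * delbar_fun (\<lambda>w. of_real (u w)) z v"
    unfolding del_fun_eq[OF 1] del_fun_eq[OF 2] delbar_fun_eq[OF 1] delbar_fun_eq[OF 2] by (simp_all add: algebra_simps)
qed

text \<open>The first derivative of P(u) is P'(u) \<partial>u; differentiating the factor P'(u) once
  more produces the gradient term.\<close>

lemma chern_lap_compose:
  assumes S: "open S" and h: "local_metric S h" and u: "Ck_on 2 S u" and z: "z \<in> S"
    and P: "\<And>y. (P has_real_derivative P' y) (at y)" "\<And>y. (P' has_real_derivative P'' y) (at y)"
  shows "chern_lap h (\<lambda>w. of_real (P (u w))) z = of_real (P' (u z)) * chern_lap h (\<lambda>w. of_real (u w)) z + of_real (P'' (u z)) * grad_norm h u z"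
proof -
  let ?U = "\<lambda>w. complex_of_real (u w)"
  have u': "Ck_on (Suc (Suc 0)) S u" using u by (simp add: numeral_2_eq_2)
  have U': "Ck_on (Suc (Suc 0)) S ?U" by (rule Ck_on_of_real[OF S u'])
  have du: "u differentiable (at w)" if "w \<in> S" for w using u' that by simp
  have dP': "(\<lambda>w. complex_of_real (P' (u w))) differentiable (at z)"
  proof -
    have "((\<lambda>w. P' (u w)) has_derivative (\<lambda>v. P'' (u z) * frechet_derivative u (at z) v)) (at z)"
      by (rule has_derivative_compose[OF du[OF z, unfolded frechet_derivative_works] P(2)[unfolded has_field_derivative_def]])
    from bounded_linear.has_derivative[OF bounded_linear_of_real this] show ?thesis by (auto simp: differentiable_def)
  qed
  have cnj: "wirtinger_bar j ?U z = cnj (wirtinger j ?U z)" for j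
    using del_fun_cnj(2)[OF Ck_on_differentiable[OF U' z], of "axis j 1"] by (simp add: wirtinger_def wirtinger_bar_def)
  have "wirtinger_bar j (wirtinger i (\<lambda>w. of_real (P (u w)))) z
     = of_real (P' (u z)) * wirtinger_bar j (wirtinger i ?U) z + of_real (P'' (u z)) * cnj (wirtinger j ?U z) * wirtinger i ?U z" for i j
  proof -
    have "wirtinger_bar j (wirtinger i (\<lambda>w. of_real (P (u w)))) z = wirtinger_bar j (\<lambda>w. of_real (P' (u w)) * wirtinger i ?U w) z"
      by (rule wirtinger_cong(2)[OF S z]) (simp add: wirtinger_def del_fun_compose_real(1)[OF du P(1)])
    also have "\<dots> = of_real (P' (u z)) * wirtinger_bar j (wirtinger i ?U) z + wirtinger_bar j (\<lambda>w. of_real (P' (u w))) z * wirtinger i ?U z"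
      unfolding wirtinger_bar_def
      by (rule del_fun_mult(2)[OF dP' Ck_on_differentiable[OF Ck_on_wirtinger(1)[OF S U'] z]])
    also have "wirtinger_bar j (\<lambda>w. of_real (P' (u w))) z = of_real (P'' (u z)) * cnj (wirtinger j ?U z)"
      unfolding cnj[symmetric] by (simp add: wirtinger_bar_def del_fun_compose_real(2)[OF du[OF z] P(2)])
    finally show ?thesis .
  qed
  then show ?thesis
    by (simp add: chern_lap_def grad_norm_def sum_distrib_left sum.distrib algebra_simps)
qed

lemma grad_norm_nonneg:
  assumes "hermitian_pos (h z)"
  shows "0 \<le> Re (grad_norm h u z)" "Re (grad_norm h u z) = 0 \<Longrightarrow> wirtinger i (\<lambda>w. of_real (u w)) z = 0"
proof -
  let ?\<xi> = "\<lambda>i. wirtinger i (\<lambda>w. of_real (u w)) z"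
  have pos: "0 < Re (grad_norm h u z)" if "?\<xi> i \<noteq> 0" for i
    using matrix_inv_pos[OF assms, of ?\<xi> i] that by (simp add: grad_norm_def inverse_metric_def)
  show "Re (grad_norm h u z) = 0 \<Longrightarrow> ?\<xi> i = 0" using pos by force
  show "0 \<le> Re (grad_norm h u z)"
  proof (cases "\<exists>i. ?\<xi> i \<noteq> 0")
    case True
    then show ?thesis using pos by (blast intro: less_imp_le)
  next
    case False
    then show ?thesis by (simp add: grad_norm_def)
  qed
qed

text \<open>For real u the (1,0)-part determines the differential, since du(v) is twice the real
  part of \<partial>u(v).\<close>

lemma derivative_zero_if_wirtinger_zero:
  fixes u :: "complex^'n::finite \<Rightarrow> real"
  assumes u: "u differentiable (at z)" and W: "\<And>i. wirtinger i (\<lambda>w. complex_of_real (u w)) z = 0"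
  shows "(u has_derivative (\<lambda>_. 0)) (at z)"
proof -
  note D = u[unfolded frechet_derivative_works]
  have U: "((\<lambda>w. complex_of_real (u w)) has_derivative (\<lambda>v. of_real (frechet_derivative u (at z) v))) (at z)"
    by (rule bounded_linear.has_derivative[OF bounded_linear_of_real D])
  have "frechet_derivative u (at z) v = 0" for v
  proof -
    have "del_fun (\<lambda>w. complex_of_real (u w)) z v = 0"
      by (subst del_fun_expand(1)) (use U in \<open>auto simp: differentiable_def W\<close>)
    then show ?thesis unfolding del_fun_eq[OF U] by (simp add: complex_eq_iff)
  qed
  then show ?thesis using D by (simp add: has_derivative_def bounded_linear_def)
qed

context hermitian_manifold
begin

section \<open>Conformal changes of the metric\<close>

lemma conformal_change_eq: "conformal_change f h c = (\<lambda>z. exp (f (inv_chart c z)) *\<^sub>R h c z)"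
  by (simp add: conformal_change_def)

lemma hermitian_metric_conformal:
  assumes f: "smooth_function \<A> f"
  shows "hermitian_metric \<A> (conformal_change f g)"
proof -
  have lm: "local_metric (chart_image c) (conformal_change f g c)" if c: "c \<in> \<A>" for c
    unfolding conformal_change_eq
    by (rule local_metric_conformal[OF open_chart_image[OF c] local_metric_chart[OF c]])
      (use f c in \<open>simp add: smooth_function_def o_def\<close>)
  have hp: "hermitian_pos (conformal_change f g c z)" if "c \<in> \<A>" "z \<in> chart_image c" for c z
    using lm[OF that(1)] that(2) by (simp add: local_metric_def)
  show ?thesis
    unfolding hermitian_metric_def
  proof (intro conjI ballI allI impI)
    fix c assume c: "c \<in> \<A>"
    show "smooth_on (chart_image c) (\<lambda>z. conformal_change f g c z $ i $ j)" for i j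
      using lm[OF c] by (simp add: local_metric_def)
    fix z assume z: "z \<in> chart_image c"
    show "conformal_change f g c z $ j $ i = cnj (conformal_change f g c z $ i $ j)" for i j
      using hp[OF c z] by (simp only: hermitian_pos_def)
    show "0 < Re (\<Sum>i\<in>UNIV. \<Sum>j\<in>UNIV. conformal_change f g c z $ i $ j * v $ i * cnj (v $ j))" if "v \<noteq> 0" for v
      using hp[OF c z] that unfolding hermitian_pos_def herm_form_def by blast
  next
    fix c c' z i j assume c: "c \<in> \<A>" "c' \<in> \<A>" and z: "z \<in> snd c ` (fst c \<inter> fst c')"
    have "g c z $ i $ j = (\<Sum>k\<in>UNIV. \<Sum>l\<in>UNIV. g c' (transition c c' z) $ k $ l *
             wirtinger i (\<lambda>w. transition c c' w $ k) z * cnj (wirtinger j (\<lambda>w. transition c c' w $ l) z))"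
      using herm c z unfolding hermitian_metric_def by blast
    moreover have "inv_chart c' (transition c c' z) = inv_chart c z"
      using inv_chart_transition[OF c] z by (simp add: overlap_def)
    ultimately show "conformal_change f g c z $ i $ j = (\<Sum>k\<in>UNIV. \<Sum>l\<in>UNIV. conformal_change f g c' (transition c c' z) $ k $ l *
             wirtinger i (\<lambda>w. transition c c' w $ k) z * cnj (wirtinger j (\<lambda>w. transition c c' w $ l) z))"
      by (simp add: conformal_change_def scaleR_sum_right)
  qed
qed

lemma hermitian_manifold_conformal: "smooth_function \<A> f \<Longrightarrow> hermitian_manifold \<A> (conformal_change f g)"
  by unfold_locales (rule hermitian_metric_conformal)

lemma nn_integral_chart:
  assumes c: "c \<in> \<A>" and F: "F \<in> borel_measurable borel" and supp: "\<And>x. x \<notin> fst c \<Longrightarrow> F x = 0"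
  shows "(\<integral>\<^sup>+x. F x \<partial>\<mu>) = (\<integral>\<^sup>+z. ennreal (indicator (chart_image c) z * vol c z) * F (chart_inv c z) \<partial>lborel)"
proof -
  have "(\<integral>\<^sup>+x. F x \<partial>\<mu>) = (\<integral>\<^sup>+x. ennreal (indicator (fst c) x) * F x \<partial>\<mu>)"
    by (rule nn_integral_cong) (use supp in \<open>auto simp: indicator_def\<close>)
  also have "\<dots> = (\<integral>\<^sup>+x. F x \<partial>density \<mu> (\<lambda>x. ennreal (indicator (fst c) x)))"
    by (rule nn_integral_density[symmetric])
      (use F chart_borel[OF c] in \<open>auto simp: measurable_cong_sets[OF sets_\<mu> refl]\<close>)
  also have "\<dots> = (\<integral>\<^sup>+z. F (chart_inv c z) \<partial>density lborel (\<lambda>z. ennreal (indicator (chart_image c) z * vol c z)))"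
    unfolding density_chart[OF c] chart_measure_def
    by (rule nn_integral_distr) (use measurable_chart_inv[OF c] F in auto)
  also have "\<dots> = (\<integral>\<^sup>+z. ennreal (indicator (chart_image c) z * vol c z) * F (chart_inv c z) \<partial>lborel)"
    by (rule nn_integral_density) (use density_measurable[OF c] measurable_compose[OF measurable_chart_inv[OF c] F] in auto)
  finally show ?thesis .
qed

text \<open>The determinant scales by exp(n f), so the density has the chart values prescribed for
  the new metric; uniqueness of the volume measure does the rest.\<close>

lemma volume_measure_conformal:
  fixes f :: "'a \<Rightarrow> real"
  assumes f: "smooth_function \<A> f"
  shows "volume_measure \<A> (conformal_change f g) = density \<mu> (\<lambda>x. ennreal (exp (CARD('n) * f x)))"
proof -
  interpret G: hermitian_manifold \<A> "conformal_change f g" by (rule hermitian_manifold_conformal[OF f])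
  let ?w = "\<lambda>x. ennreal (exp (CARD('n) * f x))"
  have cf: "continuous_on UNIV f" using f Ck_fun_continuous[of 0 f] by (simp add: smooth_function_iff)
  have w: "?w \<in> borel_measurable borel"
    by (intro measurable_compose[OF _ measurable_ennreal] borel_measurable_continuous_onI continuous_intros cf)
  have "G.is_volume (density \<mu> ?w)"
    unfolding G.is_volume_def
  proof (intro conjI ballI impI)
    show "sets (density \<mu> ?w) = sets borel" by simp
    fix c B assume c: "c \<in> \<A>" and B: "B \<in> sets borel" "B \<subseteq> fst c"
    have "emeasure (density \<mu> ?w) B = (\<integral>\<^sup>+x. ?w x * indicator B x \<partial>\<mu>)"
      by (rule emeasure_density) (use w B in \<open>auto simp: measurable_cong_sets[OF sets_\<mu> refl]\<close>)
    also have "\<dots> = (\<integral>\<^sup>+z. ennreal (indicator (chart_image c) z * vol c z) * (?w (chart_inv c z) * indicator B (chart_inv c z)) \<partial>lborel)"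
      by (rule nn_integral_chart[OF c]) (use w B in \<open>auto simp: indicator_def\<close>)
    also have "\<dots> = G.chart_volume c B"
      unfolding G.chart_volume_def
    proof (rule nn_integral_cong)
      fix z
      show "ennreal (indicator (chart_image c) z * vol c z) * (?w (chart_inv c z) * indicator B (chart_inv c z)) = ennreal (G.vol c z) * indicator (snd c ` B) z"
      proof (cases "z \<in> chart_image c")
        case True
        have "z \<in> snd c ` B \<longleftrightarrow> inv_chart c z \<in> B"
          using B(2) chart_inv_chart[OF c True] inv_chart_chart[OF c] by (force simp: image_iff subset_iff)
        moreover have "G.vol c z = vol c z * exp (CARD('n) * f (inv_chart c z))"
          by (simp add: G.vol_eq vol_eq conformal_change_eq det_scaleR exp_of_nat_mult algebra_simps)
        ultimately show ?thesis
          using True vol_pos[OF c True] by (simp add: chart_inv_def ennreal_mult indicator_def)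
      next
        case False
        then have "z \<notin> snd c ` B" using B(2) chart_in[OF c] by auto
        then show ?thesis using False by simp
      qed
    qed
    finally show "emeasure (density \<mu> ?w) B = G.chart_volume c B" .
  qed
  from G.is_volume_unique[OF G.is_volume_volume_measure this] show ?thesis .
qed

lemma lap_cmult: "Ck_fun 2 f \<Longrightarrow> lap (\<lambda>x. t * f x) x = of_real t * lap f x"
  unfolding lap_def of_real_mult
  by (rule chern_lap_cmult[OF open_chart_image local_metric_chart Ck_on_of_real_chart chart_in])
    (auto simp: some_chart)

lemma chern_scalar_conformal:
  assumes f: "smooth_function \<A> f"
  shows "chern_scalar \<A> (conformal_change f g) x = of_real (exp (- f x)) * (chern_scalar \<A> g x - of_nat CARD('n) * lap f x)"
proof -
  let ?c = "some_chart x"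
  note c = some_chart[of x]
  have "local_chern_scalar (conformal_change f g ?c) (snd ?c x)
     = of_real (exp (- f (inv_chart ?c (snd ?c x)))) * (local_chern_scalar (g ?c) (snd ?c x) - of_nat CARD('n) * chern_lap (g ?c) (\<lambda>w. of_real (f (inv_chart ?c w))) (snd ?c x))"
    unfolding conformal_change_eq
    by (rule local_chern_scalar_conformal[OF open_chart_image[OF c(1)] local_metric_chart[OF c(1)] _ chart_in[OF c]])
      (use f c in \<open>simp add: smooth_function_def o_def\<close>)
  then show ?thesis by (simp add: chern_scalar_eq lap_def inv_chart_chart[OF c])
qed

section \<open>The functional along conformal changes\<close>

definition scal :: "'a \<Rightarrow> real" where
  "scal x = Re (chern_scalar \<A> g x)"

lemma chern_scalar_real: "chern_scalar \<A> g x = of_real (scal x)"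
proof -
  let ?c = "some_chart x"
  note c = some_chart[of x]
  note S = open_chart_image[OF c(1)] and h = local_metric_chart[OF c(1)] and z = chart_in[OF c]
  have "cnj (chern_scalar \<A> g x) = chern_scalar \<A> g x"
    unfolding chern_scalar_eq local_chern_scalar_eq[OF S h z] complex_cnj_minus
    by (rule arg_cong[where f = uminus], rule chern_lap_real[OF S h _ _ z])
      (auto intro: Ck_on_of_real[OF S Ck_on_log_det[OF S h]])
  then show ?thesis by (simp add: scal_def complex_eq_iff)
qed

lemma Ck_fun_scal: "Ck_fun k scal"
  unfolding Ck_fun_def
proof
  fix c assume c: "c \<in> \<A>"
  note S = open_chart_image[OF c] and h = local_metric_chart[OF c]
  have "Ck_on k (chart_image c) (\<lambda>z. Re (- chern_lap (g c) (\<lambda>w. of_real (log_det (g c) w)) z))"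
    by (intro Ck_on_bounded_linear[OF bounded_linear_Re S] Ck_on_minus S Ck_on_chern_lap[OF S h] Ck_on_of_real Ck_on_log_det[OF S h])
  then show "Ck_on k (chart_image c) (\<lambda>z. scal (inv_chart c z))"
    by (subst Ck_on_cong[OF S, where g = "\<lambda>z. Re (- chern_lap (g c) (\<lambda>w. of_real (log_det (g c) w)) z)"])
      (simp_all add: scal_def chern_scalar_chart[OF c] local_chern_scalar_eq[OF S h])
qed

text \<open>The factor exp(-t f)^n from the curvature cancels exp(n t f) from the volume, so that
  the integral is taken against the fixed measure \<mu> and t enters only through the
  integrand.\<close>

lemma calabi_functional_conformal:
  assumes f: "smooth_function \<A> f"
  shows "calabi_functional \<A> (conformal_change (\<lambda>x. t * f x) g) = (LINT x|\<mu>. \<bar>scal x - CARD('n) * (t * Re (lap f x))\<bar> ^ CARD('n))"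
proof -
  have f2: "Ck_fun 2 f" using f by (simp add: smooth_function_iff)
  have tf: "smooth_function \<A> (\<lambda>x. t * f x)"
    using f unfolding smooth_function_iff by (auto intro: Ck_fun_mult Ck_fun_const)
  let ?y = "\<lambda>x. scal x - CARD('n) * (t * Re (lap f x))"
  have "chern_scalar \<A> (conformal_change (\<lambda>x. t * f x) g) x = of_real (exp (- (t * f x)) * ?y x)" for x
    unfolding chern_scalar_conformal[OF tf] chern_scalar_real lap_cmult[OF f2]
    by (subst lap_real[OF f2]) simp
  then have n: "norm (chern_scalar \<A> (conformal_change (\<lambda>x. t * f x) g) x) ^ CARD('n) = exp (- (t * f x)) ^ CARD('n) * \<bar>?y x\<bar> ^ CARD('n)" for x
    by (simp only: norm_of_real abs_mult power_mult_distrib abs_exp_cancel)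
  have cf: "continuous_on UNIV f" by (rule Ck_fun_continuous[OF f2])
  have cy: "continuous_on UNIV ?y"
    by (intro continuous_intros Ck_fun_continuous[OF Ck_fun_scal[of 0]] continuous_lap[OF f2])
  have "calabi_functional \<A> (conformal_change (\<lambda>x. t * f x) g)
     = (LINT x|density \<mu> (\<lambda>x. ennreal (exp (CARD('n) * (t * f x)))). exp (- (t * f x)) ^ CARD('n) * \<bar>?y x\<bar> ^ CARD('n))"
    unfolding calabi_functional_def volume_measure_conformal[OF tf] n ..
  also have "\<dots> = (LINT x|\<mu>. exp (CARD('n) * (t * f x)) *\<^sub>R (exp (- (t * f x)) ^ CARD('n) * \<bar>?y x\<bar> ^ CARD('n)))"
    by (rule integral_density)
      (auto simp: measurable_cong_sets[OF sets_\<mu> refl] intro!: borel_measurable_continuous_onI continuous_intros cf cy)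
  also have "\<dots> = (LINT x|\<mu>. \<bar>?y x\<bar> ^ CARD('n))"
  proof (rule Bochner_Integration.integral_cong[OF refl])
    fix x
    have "exp (CARD('n) * (t * f x)) * exp (- (t * f x)) ^ CARD('n) = 1"
      by (simp add: exp_of_nat_mult[symmetric] flip: exp_add)
    then show "exp (CARD('n) * (t * f x)) *\<^sub>R (exp (- (t * f x)) ^ CARD('n) * \<bar>?y x\<bar> ^ CARD('n)) = \<bar>?y x\<bar> ^ CARD('n)"
      by (simp flip: mult.assoc)
  qed
  finally show ?thesis .
qed

text \<open>Differentiation under the integral. On the compact manifold s and \<box>f are bounded,
  so a constant dominates, and it is integrable because the volume is finite. One factor n comes
  from the power, the other from the change of curvature.\<close>

lemma calabi_functional_derivative:
  assumes f: "smooth_function \<A> f" and n: "CARD('n) = m + 2"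
  shows "((\<lambda>t. calabi_functional \<A> (conformal_change (\<lambda>x. t * f x) g)) has_real_derivative
    - (CARD('n) * CARD('n)) * (LINT x|\<mu>. scal x * \<bar>scal x\<bar> ^ m * Re (lap f x))) (at 0)"
proof -
  interpret finite_measure \<mu> by (rule finite_measure_\<mu>)
  have f2: "Ck_fun 2 f" using f by (simp add: smooth_function_iff)
  let ?n = "real CARD('n)" and ?b = "\<lambda>x. Re (lap f x)"
  let ?F = "\<lambda>t x. \<bar>scal x - ?n * (t * ?b x)\<bar> ^ CARD('n)"
  have cs: "continuous_on UNIV scal" by (rule Ck_fun_continuous[OF Ck_fun_scal[of 0]])
  have cb: "continuous_on UNIV ?b" by (intro continuous_intros continuous_lap[OF f2])
  have "bounded (range scal)" "bounded (range ?b)"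
    by (intro compact_imp_bounded compact_continuous_image compact_M cs cb)+
  then obtain A B where "\<forall>y\<in>range scal. norm y \<le> A" "\<forall>y\<in>range ?b. norm y \<le> B"
    unfolding bounded_iff by blast
  then have A: "\<bar>scal x\<bar> \<le> A" and B: "\<bar>?b x\<bar> \<le> B" for x by auto
  have B0: "0 \<le> B" using B[of undefined] by linarith
  \<comment> \<open>A bound for \<bar>s - n t \<box>f\<bar> that is uniform in \<bar>t\<bar> <
    1.\<close>
  define R where "R = A + ?n * B"
  have D: "((\<lambda>t. ?F t x) has_real_derivative ?n * (scal x * \<bar>scal x\<bar> ^ m) * (- (?n * ?b x))) (at 0)" for x
  proof -
    have "((\<lambda>t. scal x - ?n * (t * ?b x)) has_real_derivative - (?n * ?b x)) (at 0)"
      by (auto intro!: derivative_eq_intros)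
    from DERIV_chain2[OF DERIV_abs_power[of m "scal x - ?n * (0 * ?b x)"] this]
    show ?thesis by (simp add: n)
  qed
  have "((\<lambda>t. LINT x|\<mu>. ?F t x) has_real_derivative (LINT x|\<mu>. ?n * (scal x * \<bar>scal x\<bar> ^ m) * (- (?n * ?b x)))) (at 0)"
  proof (rule has_real_derivative_integral[OF _ D, where w = "\<lambda>_. ?n * R ^ (m + 1) * (?n * B)"])
    show "integrable \<mu> (?F t)" for t
      by (intro integrable_continuous_\<mu> continuous_intros cs cb)
    show "(\<lambda>x. ?n * (scal x * \<bar>scal x\<bar> ^ m) * (- (?n * ?b x))) \<in> borel_measurable \<mu>"
      by (auto simp: measurable_cong_sets[OF sets_\<mu> refl] intro!: borel_measurable_continuous_onI continuous_intros cs cb)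
    show "integrable \<mu> (\<lambda>_. ?n * R ^ (m + 1) * (?n * B))" by simp
    fix t :: real and x assume t: "\<bar>t\<bar> < 1"
    have tb: "\<bar>?n * (t * ?b x)\<bar> \<le> \<bar>t\<bar> * (?n * B)"
      using B[of x] by (simp add: abs_mult mult_left_mono)
    also have "\<dots> \<le> ?n * B" using t B0 by (simp add: mult_left_le_one_le)
    finally have tb': "\<bar>?n * (t * ?b x)\<bar> \<le> ?n * B" .
    have "\<bar>?F t x - ?F 0 x\<bar> \<le> ?n * R ^ (m + 1) * \<bar>(scal x - ?n * (t * ?b x)) - (scal x - ?n * (0 * ?b x))\<bar>"
      unfolding n
      by (rule abs_power_diff_le) (use A[of x] tb' B0 in \<open>auto simp: R_def n\<close>)
    also have "\<dots> \<le> ?n * R ^ (m + 1) * (\<bar>t\<bar> * (?n * B))"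
      by (rule mult_left_mono) (use tb A[of x] B0 in \<open>auto simp: R_def\<close>)
    finally show "\<bar>?F t x - ?F 0 x\<bar> \<le> \<bar>t\<bar> * (?n * R ^ (m + 1) * (?n * B))" by (simp add: algebra_simps)
  qed
  moreover have "(LINT x|\<mu>. ?n * (scal x * \<bar>scal x\<bar> ^ m) * (- (?n * ?b x))) = - (?n * ?n) * (LINT x|\<mu>. scal x * \<bar>scal x\<bar> ^ m * ?b x)"
    by (simp add: mult.assoc mult.left_commute flip: integral_mult_right_zero)
  ultimately show ?thesis
    unfolding calabi_functional_conformal[OF f] by simp
qed

lemma extremal_weak_equation:
  assumes E: "n_conformal_extremal \<A> g" and n: "CARD('n) = m + 2" and f: "smooth_function \<A> f"
  shows "(LINT x|\<mu>. scal x * \<bar>scal x\<bar> ^ m * Re (lap f x)) = 0"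
proof -
  have "((\<lambda>t. calabi_functional \<A> (conformal_change (\<lambda>x. t * f x) g)) has_real_derivative 0) (at 0)"
    using E f by (simp add: n_conformal_extremal_def)
  from DERIV_unique[OF this calabi_functional_derivative[OF f n]] show ?thesis by simp
qed

lemma extremal_constant_imp_gauduchon:
  assumes E: "n_conformal_extremal \<A> g" and n: "CARD('n) = m + 2"
    and s0: "s0 \<noteq> 0" "\<And>x. chern_scalar \<A> g x = of_real s0"
  shows "gauduchon \<A> g"
proof (rule gauduchon_if_integral_lap)
  fix f assume f: "smooth_function \<A> f"
  have f2: "Ck_fun 2 f" using f by (simp add: smooth_function_iff)
  have "scal x = s0" for x using s0(2) by (simp add: scal_def)
  then have "(LINT x|\<mu>. Re (lap f x)) = 0"
    using extremal_weak_equation[OF E n f] s0(1) by simp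
  moreover have "(LINT x|\<mu>. lap f x) = (LINT x|\<mu>. complex_of_real (Re (lap f x)))"
    using lap_real[OF f2] by presburger
  ultimately show "(LINT x|\<mu>. lap f x) = 0" by simp
qed

section \<open>Constancy of the curvature of a Gauduchon extremal metric\<close>

lemma clopen_UNIV:
  assumes "connected (UNIV :: 'a set)" "open S" "closed S" "x \<in> S"
  shows "S = (UNIV :: 'a set)"
  using assms connected_clopen[of "UNIV :: 'a set"] by auto

lemma extremal_gauduchon_imp_constant:
  assumes E: "n_conformal_extremal \<A> g" and n: "CARD('n) = m + 2" and G: "gauduchon \<A> g"
    and conn: "connected (UNIV :: 'a set)"
  shows "\<exists>s0. \<forall>x. chern_scalar \<A> g x = of_real s0"
proof -
  let ?P = "\<lambda>y :: real. \<bar>y\<bar> ^ (m + 2)" and ?P' = "\<lambda>y :: real. real (m + 2) * (y * \<bar>y\<bar> ^ m)"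
  let ?P'' = "\<lambda>y :: real. real (m + 2) * (real (m + 1) * \<bar>y\<bar> ^ m)"
  have dP: "(?P has_real_derivative ?P' y) (at y)" "(?P' has_real_derivative ?P'' y) (at y)" for y
    by (rule DERIV_abs_power) (rule DERIV_cmult[OF DERIV_mult_abs_power])
  define H where "H = (\<lambda>x. ?P (scal x))"
  have s2: "Ck_fun 2 scal" by (rule Ck_fun_scal)
  have H: "Ck_fun 2 H" unfolding H_def by (rule Ck_fun_compose[OF Ck_on_abs_power s2])
  have cs: "continuous_on UNIV scal" by (rule Ck_fun_continuous[OF s2])
  \<comment> \<open>By the composition formula this is n (n - 1) \<bar>s\<bar>^(n-2)
    \<bar>\<partial>s\<bar>^2. Expressed through global Laplacians it is a continuous function on
    the manifold without further argument.\<close>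
  define D where "D = (\<lambda>x. Re (lap H x) - ?P' (scal x) * Re (lap scal x))"
  have Dloc: "D (inv_chart c z) = ?P'' (scal (inv_chart c z)) * Re (grad_norm (g c) (\<lambda>w. scal (inv_chart c w)) z)"
    if c: "c \<in> \<A>" and z: "z \<in> chart_image c" for c z
  proof -
    have "Ck_on 2 (chart_image c) (\<lambda>w. scal (inv_chart c w))" using s2 c by (simp add: Ck_fun_def)
    from chern_lap_compose[OF open_chart_image[OF c] local_metric_chart[OF c] this z dP]
    show ?thesis
      unfolding D_def lap_chart[OF H c z] lap_chart[OF s2 c z] by (simp add: H_def)
  qed
  have hp: "hermitian_pos (g c z)" if "c \<in> \<A>" "z \<in> chart_image c" for c z
    by (rule local_metric_pos[OF open_chart_image[OF that(1)] local_metric_chart[OF that(1)] that(2)])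
  have Dnn: "0 \<le> D x" for x
  proof -
    obtain c where c: "c \<in> \<A>" "x \<in> fst c" using chart_cover by blast
    have "0 \<le> D (inv_chart c (snd c x))"
      unfolding Dloc[OF c(1) chart_in[OF c]]
      by (intro mult_nonneg_nonneg grad_norm_nonneg(1) hp chart_in c) auto
    then show ?thesis by (simp add: inv_chart_chart[OF c])
  qed
  have cD: "continuous_on UNIV D"
    unfolding D_def by (intro continuous_intros continuous_lap H s2 cs)
  have "(LINT x|\<mu>. D x) = (LINT x|\<mu>. Re (lap H x)) - (LINT x|\<mu>. ?P' (scal x) * Re (lap scal x))"
    unfolding D_def
    by (rule Bochner_Integration.integral_diff; intro integrable_continuous_\<mu> continuous_intros continuous_lap H s2 cs)
  also have "(LINT x|\<mu>. Re (lap H x)) = 0"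
    using integral_lap_gauduchon[OF G H] integrable_continuous_\<mu>[OF continuous_lap[OF H]] by simp
  also have "(LINT x|\<mu>. ?P' (scal x) * Re (lap scal x)) = real (m + 2) * (LINT x|\<mu>. scal x * \<bar>scal x\<bar> ^ m * Re (lap scal x))"
    by (simp add: mult.assoc flip: integral_mult_right_zero)
  \<comment> \<open>The extremal equation, tested on the smooth function s itself.\<close>
  also have "\<dots> = 0"
    using extremal_weak_equation[OF E n, of scal] Ck_fun_scal by (simp add: smooth_function_iff)
  finally have "(LINT x|\<mu>. D x) = 0" by simp
  then have D0: "D x = 0" for x by (rule continuous_integral_eq_0[OF cD Dnn])
  have Hd: "((\<lambda>w. H (inv_chart c w)) has_derivative (\<lambda>_. 0)) (at z)" if c: "c \<in> \<A>" and z: "z \<in> chart_image c" for c z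
  proof (rule derivative_zero_if_wirtinger_zero)
    let ?u = "\<lambda>w. scal (inv_chart c w)"
    have u: "?u differentiable (at z)"
      using Ck_fun_scal[of "Suc 0"] c z by (auto simp: Ck_fun_def)
    show "(\<lambda>w. H (inv_chart c w)) differentiable (at z)"
      using H c z by (auto simp: Ck_fun_def numeral_2_eq_2)
    fix i
    have "wirtinger i (\<lambda>w. complex_of_real (H (inv_chart c w))) z = of_real (?P' (?u z)) * wirtinger i (\<lambda>w. of_real (?u w)) z"
      unfolding H_def wirtinger_def by (rule del_fun_compose_real(1)[OF u dP(1)])
    also have "\<dots> = 0"
    \<comment> \<open>Where this power vanishes, so does P'(s), which contains it as a factor.
      Elsewhere P''(s) is nonzero and the vanishing of D kills the gradient of s. For m = 0 only the
      second case occurs.\<close>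
    proof (cases "\<bar>?u z\<bar> ^ m = 0")
      case False
      then have "?P'' (?u z) \<noteq> 0" by (intro no_zero_divisors) auto
      moreover have "?P'' (?u z) * Re (grad_norm (g c) ?u z) = 0"
        by (rule Dloc[OF c z, unfolded D0, symmetric])
      ultimately have "Re (grad_norm (g c) ?u z) = 0" by (rule mult_left_cancel[THEN iffD1, OF _ trans[OF _ mult_zero_right[symmetric]]])
      from grad_norm_nonneg(2)[OF hp[OF c z] this] show ?thesis by simp
    qed simp
    finally show "wirtinger i (\<lambda>w. complex_of_real (H (inv_chart c w))) z = 0" .
  qed
  obtain x0 :: 'a where True by blast
  have "{x. H x = H x0} = UNIV"
  proof (rule clopen_UNIV[OF conn])
    show "closed {x. H x = H x0}"
      by (intro closed_Collect_eq Ck_fun_continuous[OF H] continuous_on_const)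
    show "open {x. H x = H x0}"
      unfolding open_subopen[of "{x. H x = H x0}"]
    proof
      fix x assume x: "x \<in> {x. H x = H x0}"
      obtain c where c: "c \<in> \<A>" "x \<in> fst c" using chart_cover by blast
      obtain r where r: "r > 0" "ball (snd c x) r \<subseteq> chart_image c"
        by (rule openE[OF open_chart_image[OF c(1)] chart_in[OF c]])
      \<comment> \<open>The derivative of H vanishes on a coordinate ball, which is convex, so H is
        locally constant.\<close>
      have "\<exists>k. \<forall>w\<in>ball (snd c x) r. H (inv_chart c w) = k"
        by (rule has_derivative_zero_constant[OF convex_ball]) (rule has_derivative_at_withinI[OF Hd[OF c(1) subsetD[OF r(2)]]])
      then obtain k where k: "\<And>w. w \<in> ball (snd c x) r \<Longrightarrow> H (inv_chart c w) = k" by blast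
      have xk: "H x = k" using k[of "snd c x"] r(1) inv_chart_chart[OF c] by simp
      define U where "U = fst c \<inter> snd c -` ball (snd c x) r"
      have "open U" unfolding U_def
        by (rule continuous_open_preimage[OF continuous_chart[OF c(1)] open_chart[OF c(1)] open_ball])
      moreover have "x \<in> U" using c r by (simp add: U_def)
      moreover have "U \<subseteq> {x. H x = H x0}"
      proof
        fix y assume "y \<in> U"
        then have "H y = k" using k[of "snd c y"] inv_chart_chart[OF c(1), of y] by (simp add: U_def)
        then show "y \<in> {x. H x = H x0}" using xk x by simp
      qed
      ultimately show "\<exists>T. open T \<and> x \<in> T \<and> T \<subseteq> {x. H x = H x0}" by blast
    qed
  qed simp
  then have Hc: "H x = H x0" for x by blast
  have abs: "\<bar>scal x\<bar> = \<bar>scal x0\<bar>" for x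
    using Hc[of x] power_eq_iff_eq_base[of "m + 2" "\<bar>scal x\<bar>" "\<bar>scal x0\<bar>"] by (simp add: H_def)
  have "scal x = scal x0" for x
  proof (cases "scal x0 = 0")
    case True
    then show ?thesis using abs[of x] by simp
  next
    case False
    \<comment> \<open>As \<bar>s\<bar> is constant and nonzero, s takes at most two opposite values,
      and the closed condition of equality becomes an open condition on signs.\<close>
    have "scal x = scal x0 \<longleftrightarrow> 0 < scal x * scal x0" for x
    proof (cases "scal x = scal x0")
      case True
      then show ?thesis using False by (auto simp: zero_less_mult_iff linorder_neq_iff)
    next
      case ne: False
      then have "scal x = - scal x0" using abs[of x] by (simp add: abs_eq_iff)
      then show ?thesis using ne by (simp add: not_less)
    qed
    then have eq: "{x. scal x = scal x0} = {x. 0 < scal x * scal x0}" by blast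
    have "{x. scal x = scal x0} = UNIV"
    proof (rule clopen_UNIV[OF conn])
      show "closed {x. scal x = scal x0}" by (intro closed_Collect_eq cs continuous_on_const)
      show "open {x. scal x = scal x0}" unfolding eq by (intro open_Collect_less continuous_intros cs)
    qed simp
    then show ?thesis by blast
  qed
  then show ?thesis using chern_scalar_real by metis
qed

end

theorem theorem1p4:
  fixes \<A> :: "('a::t2_space, 'n::finite) chart set"
    and g g\<^sub>E :: "('a, 'n) metric_components"
  assumes "complex_atlas \<A>"
    and "compact (UNIV :: 'a set)"
    and "connected (UNIV :: 'a set)"
    and "CARD('n) \<ge> 2"
    and "hermitian_metric \<A> g"
    and "g\<^sub>E \<in> conformal_class \<A> g"
    and "n_conformal_extremal \<A> g\<^sub>E"
  shows "(gauduchon \<A> g\<^sub>E \<longrightarrow> (\<exists>s\<^sub>0::real. \<forall>x. chern_scalar \<A> g\<^sub>E x = of_real s\<^sub>0)) \<and>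
    ((\<exists>s\<^sub>0::real. s\<^sub>0 \<noteq> 0 \<and> (\<forall>x. chern_scalar \<A> g\<^sub>E x = of_real s\<^sub>0)) \<longrightarrow> gauduchon \<A> g\<^sub>E)"
proof -
  interpret G: hermitian_manifold \<A> g
    using assms(1,2,5) by unfold_locales
  obtain f where f: "smooth_function \<A> f" "g\<^sub>E = conformal_change f g"
    using assms(6) by (auto simp: conformal_class_def)
  \<comment> \<open>The extremal metric is a conformal change of a Hermitian metric and hence itself
    Hermitian, so the results apply to it as the base point of the variations.\<close>
  interpret E: hermitian_manifold \<A> g\<^sub>E
    unfolding f(2) by (rule G.hermitian_manifold_conformal[OF f(1)])
  obtain m where m: "CARD('n) = m + 2"
    using assms(4) by (metis add.commute le_Suc_ex)
  show ?thesis
    using E.extremal_gauduchon_imp_constant[OF assms(7) m _ assms(3)]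
      E.extremal_constant_imp_gauduchon[OF assms(7) m] by blast
qed

end
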